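(* Let $f:\mathbb{R}\to\mathbb{C}$ be a non-degenerate complex Gaussian stationary process with covariance kernel $r$ normalized by $r(0)=1$, whose spectral measure $\rho$ satisfies $\int_{\mathbb{R}}\lambda^2\log^{1+\alpha}(1+|\lambda|)\,d\rho(\lambda)<\infty$ for some $\alpha>0$. Let $\Delta(T)$ be the winding of $f$ in $[0,T]$. Then for any $T>0$ the following hold. (1) $\mathbb{E}[\Delta(T)] = T\,\mathrm{Im}\, r'(0)$. (2) Denote $R(x)=\frac{r'(x)}{r(x)}$ for $x$ such that $r(x)\neq 0$, and define $K:\mathbb{R}\to\mathbb{R}$ by $$K(x)=\begin{cases}\frac12 |r'(x)|^2, & \text{if } |r(x)|=0 \text{ or } 1,\\[4pt] \dfrac{|r(x)|^2}{1-|r(x)|^2}\,\big(\mathrm{Im}\{R(x)-R(0)\}\big)^2-\dfrac12\log\left(\dfrac{1}{1-|r(x)|^2}\right)\mathrm{Re}\{R'(x)\}, & \text{if } 0<|r(x)|<1.\end{cases}$$ Then $K$ is integrable on any compact subset of $\mathbb{R}$, and $$\mathrm{var}[\Delta(T)] = T\int_{-T}^{T}\left(1-\frac{|x|}{T}\right)K(x)\,dx.$$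
   Context: A standard complex Gaussian $\mathcal{N}_{\mathbb{C}}(0,1)$ is a $\mathbb{C}$-valued random variable with density $\frac1\pi e^{-|z|^2}$ with respect to Lebesgue measure. A complex Gaussian vector is a random vector in $\mathbb{C}^n$ equal in distribution to $A\mathbf{v}$, with $A$ a (deterministic) complex $n\times m$ matrix and $\mathbf{v}\in\mathbb{C}^m$ having i.i.d. $\mathcal{N}_{\mathbb{C}}(0,1)$ components (everything is centred). A complex Gaussian process $f:\mathbb{R}\to\mathbb{C}$ is one all of whose finite marginals are complex Gaussian vectors; it is stationary if its finite-dimensional distributions are invariant under all real shifts. Its covariance kernel is $r(t)=\mathbb{E}[f(t)\overline{f(0)}]$, assumed continuous and normalized by $r(0)=1$. Its spectral measure is the probability measure $\rho$ on $\mathbb{R}$ with $r(t)=\int_{\mathbb{R}}e^{-it\lambda}\,d\rho(\lambda)$. The process is degenerate if $\rho$ consists of exactly one atom. The logarithmic moment condition on $\rho$ ensures that $f$ is a.s. continuously differentiable and that $r$ is twice continuously differentiable. The winding of $f$ in $[0,T]$ is $$\Delta(T)=\frac{1}{2i}\int_0^T\left[\frac{f'(t)}{f(t)}-\overline{\left(\frac{f'(t)}{f(t)}\right)}\right]dt$$ (almost surely $f$ does not vanish on $[0,T]$). *)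

theory Defs
  imports "HOL-Probability.Probability"
begin

definition std_complex_gaussian :: "complex measure" where
  "std_complex_gaussian = density lborel (\<lambda>z. ennreal (1 / pi * exp (- (cmod z)\<^sup>2)))"

(* The law on C^n of (X 0, ..., X (n - 1)). *)
definition joint_law :: "'a measure \<Rightarrow> nat \<Rightarrow> (nat \<Rightarrow> 'a \<Rightarrow> complex) \<Rightarrow> (nat \<Rightarrow> complex) measure" where
  "joint_law M n X = distr M (\<Pi>\<^sub>M i\<in>{..<n}. borel) (\<lambda>\<omega>. \<lambda>i\<in>{..<n}. X i \<omega>)"

(* The vector has the law of A v, where A is an n x m matrix and the law of v is the m-fold
   product of N_C(0,1), i.e. v has i.i.d. standard complex Gaussian components. *)
definition complex_gaussian_vector :: "'a measure \<Rightarrow> nat \<Rightarrow> (nat \<Rightarrow> 'a \<Rightarrow> complex) \<Rightarrow> bool" where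
  "complex_gaussian_vector M n X \<longleftrightarrow>
     (\<forall>i<n. X i \<in> borel_measurable M) \<and>
     (\<exists>(m::nat) (A :: nat \<Rightarrow> nat \<Rightarrow> complex).
        joint_law M n X =
        joint_law (\<Pi>\<^sub>M j\<in>{..<m}. std_complex_gaussian) n (\<lambda>i v. \<Sum>j<m. A i j * v j))"

definition complex_gaussian_process :: "'a measure \<Rightarrow> (real \<Rightarrow> 'a \<Rightarrow> complex) \<Rightarrow> bool" where
  "complex_gaussian_process M f \<longleftrightarrow>
     (\<forall>n (t :: nat \<Rightarrow> real). complex_gaussian_vector M n (\<lambda>i. f (t i)))"

definition stationary_process :: "'a measure \<Rightarrow> (real \<Rightarrow> 'a \<Rightarrow> complex) \<Rightarrow> bool" where
  "stationary_process M f \<longleftrightarrow>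
     (\<forall>n (t :: nat \<Rightarrow> real) s. joint_law M n (\<lambda>i. f (t i + s)) = joint_law M n (\<lambda>i. f (t i)))"

definition covariance_kernel :: "'a measure \<Rightarrow> (real \<Rightarrow> 'a \<Rightarrow> complex) \<Rightarrow> real \<Rightarrow> complex" where
  "covariance_kernel M f t = (LINT \<omega>|M. f t \<omega> * cnj (f 0 \<omega>))"

definition spectral_measure :: "(real \<Rightarrow> complex) \<Rightarrow> real measure \<Rightarrow> bool" where
  "spectral_measure r \<rho> \<longleftrightarrow>
     real_distribution \<rho> \<and> (\<forall>t. r t = (LINT l|\<rho>. exp (- (\<i> * of_real t * of_real l))))"

definition degenerate :: "real measure \<Rightarrow> bool" where
  "degenerate \<rho> \<longleftrightarrow> (\<exists>a. \<rho> = return borel a)"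

definition log_derivative :: "(real \<Rightarrow> complex) \<Rightarrow> real \<Rightarrow> complex" where
  "log_derivative g t = vector_derivative g (at t) / g t"

(* The integral is purely imaginary, so Re only changes the type, see of_real_winding.
   Off the almost sure event where the path is continuously differentiable and does not vanish
   on [0,T], the value is arbitrary, and its measurability is not guaranteed there if null sets
   are missing from M. As a random variable the winding is therefore taken on completion M. *)
definition winding :: "(real \<Rightarrow> 'a \<Rightarrow> complex) \<Rightarrow> real \<Rightarrow> 'a \<Rightarrow> real" where
  "winding f T \<omega> =
     (let L = log_derivative (\<lambda>t. f t \<omega>)
      in Re (1 / (2 * \<i>) * (LINT t:{0..T}|lborel. L t - cnj (L t))))"

lemma of_real_winding:
  fixes f :: "real \<Rightarrow> 'a \<Rightarrow> complex" and T :: real and \<omega> :: 'a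
  defines "L \<equiv> log_derivative (\<lambda>t. f t \<omega>)"
  shows "complex_of_real (winding f T \<omega>) =
           1 / (2 * \<i>) * (LINT t:{0..T}|lborel. L t - cnj (L t))"
proof -
  define I where "I = (LINT t:{0..T}|lborel. L t - cnj (L t))"
  have "cnj I = (LINT t|lborel. cnj (indicator {0..T} t *\<^sub>R (L t - cnj (L t))))"
    unfolding I_def set_lebesgue_integral_def
    by (rule integral_bounded_linear' [OF bounded_linear_cnj bounded_linear_cnj, symmetric]) simp
  also have "\<dots> = (LINT t|lborel. - (indicator {0..T} t *\<^sub>R (L t - cnj (L t))))"
    by (intro Bochner_Integration.integral_cong) (auto simp: algebra_simps)
  also have "\<dots> = - I"
    unfolding I_def set_lebesgue_integral_def by simp
  finally have "Re I = 0" by (simp add: complex_eq_iff)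
  moreover have "winding f T \<omega> = Re (1 / (2 * \<i>) * I)"
    by (simp add: winding_def Let_def I_def L_def)
  ultimately show ?thesis
    unfolding I_def [symmetric] by (simp add: complex_eq_iff Re_divide Im_divide)
qed

(* For a covariance kernel normalized by r 0 = 1 one has cmod (r x) <= 1, so the else branch is
   exactly the case 0 < cmod (r x) < 1. *)
definition winding_kernel :: "(real \<Rightarrow> complex) \<Rightarrow> real \<Rightarrow> real" where
  "winding_kernel r x =
     (let R = log_derivative r in
      if cmod (r x) = 0 \<or> cmod (r x) = 1 then 1 / 2 * (cmod (vector_derivative r (at x)))\<^sup>2
      else (cmod (r x))\<^sup>2 / (1 - (cmod (r x))\<^sup>2) * (Im (R x - R 0))\<^sup>2
           - 1 / 2 * ln (1 / (1 - (cmod (r x))\<^sup>2)) * Re (vector_derivative R (at x)))"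

end

theory Submission
  imports Defs "HOL-Complex_Analysis.Complex_Analysis"
begin

text \<open>
  By stationarity the variance of the winding is the integral over \<open>[0,T]\<^sup>2\<close> of the covariance, at \<open>s\<close> and
  \<open>t\<close>, of \<open>Im (f' / f) = Im r'(0) + Im (u / f)\<close>, where \<open>u = f' - r'(0) f\<close> is pointwise independent of \<open>f\<close>.
  For fixed \<open>s\<close>, \<open>t\<close> the vector \<open>(f s, f t, u s, u t)\<close> is circular Gaussian; conditioning on \<open>f s\<close>, \<open>f t\<close>
  reduces the covariance to two integrals over a pair of independent Gaussians, which are computed by
  averaging over circles and give the kernel \<open>K (s - t)\<close>. The interchange of expectation and integration rests on
  \<open>E |u s u t / (f s f t)| \<le> C (1 + (1 - |r|\<^sup>2) powr (-3/8))\<close>, which is locally integrable because \<open>1 - |r|\<^sup>2\<close>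
  vanishes only to second order for a non-degenerate spectral measure.

  The derivative \<open>f'\<close> is an almost sure limit \<open>G\<close> of difference quotients that converge fast in mean square. The
  logarithmic moment makes the dyadic mean square oscillations of \<open>G\<close> at a fixed time summable, so that the path is
  almost surely differentiable at almost every time, which suffices for the winding integral.
\<close>

section \<open>Characteristic functions determine finite measures\<close>

text \<open>The joint law of \<open>(f s, f t, u s, u t)\<close> is never written down. Instead a
  space of random variables is kept whose members all have circular Gaussian laws. Closure under
  complex combinations yields joint characteristic functions, and uniqueness on
  \<open>C^2 x C^2\<close> turns vanishing covariance into independence; hence the detour through
  characteristic functions on products. Circular laws also survive mean square limits, which is how
  the derivative joins the space.

  The obstacle is that \<open>E |f|^(-2)\<close> is infinite, so Cauchy-Schwarz cannot control
  \<open>1 / (f s f t)\<close>. Young's inequality asks for an exponent p > 1, and the 2p inverse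
  powers are split as a + b: a < 2 falls on one value of the process, b on the independent residual,
  of size \<open>sqrt (1 - |r|^2)\<close>. This is bounded below linearly near its zeros, so b < 1
  makes it integrable over the lag. Thus 1 < p < 3/2; the choice is p = 5/4, a = 7/4, b = 3/4.

  The logarithm counts dyadic scales: a frequency l contributes fully at about log |l| of
  them.\<close>

definition char_determines :: "'a::{real_inner, second_countable_topology} itself \<Rightarrow> bool" where
  "char_determines _ \<longleftrightarrow>
     (\<forall>\<mu> \<nu> :: 'a measure. finite_measure \<mu> \<longrightarrow> finite_measure \<nu> \<longrightarrow> sets \<mu> = sets borel \<longrightarrow>
        sets \<nu> = sets borel \<longrightarrow>
        (\<forall>\<xi>. (LINT x|\<mu>. iexp (\<xi> \<bullet> x)) = (LINT x|\<nu>. iexp (\<xi> \<bullet> x))) \<longrightarrow> \<mu> = \<nu>)"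

lemma char_determinesD:
  fixes \<mu> \<nu> :: "'a::{real_inner, second_countable_topology} measure"
  assumes "char_determines TYPE('a)" "finite_measure \<mu>" "finite_measure \<nu>"
    "sets \<mu> = sets borel" "sets \<nu> = sets borel"
    "\<And>\<xi>. (LINT x|\<mu>. iexp (\<xi> \<bullet> x)) = (LINT x|\<nu>. iexp (\<xi> \<bullet> x))"
  shows "\<mu> = \<nu>"
  using assms unfolding char_determines_def by blast

text \<open>\<open>Levy_uniqueness\<close> speaks of probability laws, so both measures are divided
  by their common mass, read off at \<xi> = 0. Finite measures are allowed from the start because
  the product step applies uniqueness to weighted, unnormalized marginals.\<close>

lemma char_determines_real: "char_determines TYPE(real)"
  unfolding char_determines_def
proof (intro allI impI)
  fix \<mu> \<nu> :: "real measure"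
  assume fin: "finite_measure \<mu>" "finite_measure \<nu>"
    and sets: "sets \<mu> = sets borel" "sets \<nu> = sets borel"
    and eq: "\<forall>\<xi>. (LINT x|\<mu>. iexp (\<xi> \<bullet> x)) = (LINT x|\<nu>. iexp (\<xi> \<bullet> x))"
  have sp: "space \<mu> = UNIV" "space \<nu> = UNIV"
    using sets[THEN sets_eq_imp_space_eq] by simp_all
  have mass: "measure \<mu> UNIV = measure \<nu> UNIV"
    using eq[rule_format, of 0] by (simp add: sp)
  define m where "m = measure \<mu> UNIV"
  have em: "emeasure \<mu> UNIV = ennreal m" "emeasure \<nu> UNIV = ennreal m"
    using fin mass by (simp_all add: m_def finite_measure.emeasure_eq_measure)
  show "\<mu> = \<nu>"
  proof (cases "m = 0")
    case True
    have null: "emeasure \<kappa> A = 0" if "emeasure \<kappa> UNIV = ennreal m" "sets \<kappa> = sets borel"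
      for \<kappa> :: "real measure" and A
      using emeasure_mono[of A UNIV \<kappa>] that True by simp
    show ?thesis
      by (rule measure_eqI) (simp_all add: sets null em)
  next
    case False
    then have m: "m > 0" by (simp add: m_def less_le)
    define s where "s \<kappa> = density \<kappa> (\<lambda>_. ennreal (1 / m))" for \<kappa> :: "real measure"
    have em_s: "emeasure (s \<kappa>) A = ennreal (1 / m) * emeasure \<kappa> A"
      if "sets \<kappa> = sets borel" "A \<in> sets borel" for \<kappa> A
      using that by (simp add: s_def emeasure_density_const)
    have rd: "real_distribution (s \<kappa>)"
      if "emeasure \<kappa> UNIV = ennreal m" "sets \<kappa> = sets borel" for \<kappa>
    proof (intro real_distribution.intro real_distribution_axioms.intro prob_spaceI)
      have "space (s \<kappa>) = UNIV"
        using sets_eq_imp_space_eq[OF that(2)] by (simp add: s_def)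
      then show "emeasure (s \<kappa>) (space (s \<kappa>)) = 1"
        using that m by (simp add: em_s ennreal_mult'[symmetric])
      show "sets (s \<kappa>) = sets borel" by (simp add: s_def that)
    qed
    have "char (s \<mu>) = char (s \<nu>)"
    proof
      fix t
      have "char (s \<kappa>) t = (1 / m) *\<^sub>R (LINT x|\<kappa>. iexp (t * x))" if "sets \<kappa> = sets borel" for \<kappa>
      proof -
        have "(\<lambda>x. iexp (t * x)) \<in> borel_measurable \<kappa>"
          by (subst measurable_cong_sets[OF that refl]) simp
        then show ?thesis
          unfolding char_def s_def using m
          by (subst integral_density) (simp_all)
      qed
      with eq show "char (s \<mu>) t = char (s \<nu>) t"
        by (simp add: sets)
    qed
    then have s: "s \<mu> = s \<nu>"
      by (intro Levy_uniqueness rd em sets)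
    show ?thesis
    proof (rule measure_eqI)
      fix A assume "A \<in> sets \<mu>"
      then have A: "A \<in> sets borel" by (simp add: sets)
      have "ennreal m * emeasure (s \<kappa>) A = emeasure \<kappa> A" if "sets \<kappa> = sets borel" for \<kappa>
      proof -
        have "ennreal m * (ennreal (1 / m) * emeasure \<kappa> A) = emeasure \<kappa> A"
          using m by (simp add: mult.assoc[symmetric] ennreal_mult'[symmetric])
        then show ?thesis by (simp add: em_s that A)
      qed
      then show "emeasure \<mu> A = emeasure \<nu> A"
        using s sets by metis
    qed (simp add: sets)
  qed
qed

text \<open>The weight \<open>1 + Re (c * iexp (\<xi> \<bullet> y))\<close> with \<open>cmod c = 1\<close> is nonnegative, so the
  marginal on the first factor of a weighted measure is again covered by uniqueness on that factor;
  then disintegrate along a set of the first factor and use uniqueness on the second.\<close>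

lemma char_determines_prod:
  assumes A: "char_determines TYPE('a::{real_inner, second_countable_topology})"
    and B: "char_determines TYPE('b::{real_inner, second_countable_topology})"
  shows "char_determines TYPE('a \<times> 'b)"
  unfolding char_determines_def
proof (intro allI impI)
  fix \<mu> \<nu> :: "('a \<times> 'b) measure"
  assume fin: "finite_measure \<mu>" "finite_measure \<nu>"
    and sets: "sets \<mu> = sets borel" "sets \<nu> = sets borel"
    and eq0: "\<forall>\<xi>. (LINT x|\<mu>. iexp (\<xi> \<bullet> x)) = (LINT x|\<nu>. iexp (\<xi> \<bullet> x))"
  have ms: "borel_measurable \<mu> = borel_measurable borel" "borel_measurable \<nu> = borel_measurable borel"
    using sets by (auto intro!: measurable_cong_sets)
  have sp: "space \<mu> = UNIV" "space \<nu> = UNIV"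
    using sets[THEN sets_eq_imp_space_eq] by simp_all
  have fst_m: "fst \<in> borel_measurable (borel :: ('a \<times> 'b) measure)"
    and snd_m: "snd \<in> borel_measurable (borel :: ('a \<times> 'b) measure)"
    by (auto intro!: borel_measurable_continuous_onI continuous_intros)
  note [measurable] = fst_m snd_m
  have bdd_int: "integrable \<kappa> h" if "finite_measure \<kappa>" "sets \<kappa> = sets borel" "h \<in> borel_measurable borel"
      "\<And>p. norm (h p) \<le> bd" for \<kappa> :: "('a \<times> 'b) measure" and h :: "'a \<times> 'b \<Rightarrow> complex" and bd
  proof -
    interpret finite_measure \<kappa> by fact
    have "h \<in> borel_measurable \<kappa>" using that by (simp add: measurable_cong_sets[OF that(2) refl])
    then show ?thesis using that(4) by (intro integrable_const_bound[where B=bd]) auto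
  qed
  define w where "w c \<xi> p = 1 + Re (c * iexp (\<xi> \<bullet> snd p))" for c and \<xi> :: 'b and p :: "'a \<times> 'b"
  have w_m [measurable]: "w c \<xi> \<in> borel_measurable borel" for c \<xi>
    unfolding w_def by measurable
  have Re_le: "\<bar>Re (c * iexp x)\<bar> \<le> 1" if "cmod c = 1" for c x
    using abs_Re_le_cmod[of "c * iexp x"] that by (simp add: norm_mult)
  have w_nonneg: "0 \<le> w c \<xi> p" if "cmod c = 1" for c \<xi> p
    using Re_le[OF that, of "\<xi> \<bullet> snd p"] by (simp add: w_def abs_le_iff)
  \<comment> \<open>The cosine in the weight is half the sum of two conjugate exponentials, so
    weight times character of the first factor is a combination of three characters of the product;
    on these the two measures agree.\<close>
  have w_split: "w c \<xi>2 p *\<^sub>R iexp (\<xi>1 \<bullet> fst p) =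
      iexp ((\<xi>1, 0) \<bullet> p) + (c / 2) * iexp ((\<xi>1, \<xi>2) \<bullet> p) + (cnj c / 2) * iexp ((\<xi>1, - \<xi>2) \<bullet> p)"
    for c \<xi>1 \<xi>2 p
  proof -
    obtain x y where p: "p = (x, y)" by force
    have "complex_of_real (Re (c * iexp (\<xi>2 \<bullet> y))) =
        (c * iexp (\<xi>2 \<bullet> y) + cnj c * iexp (- (\<xi>2 \<bullet> y))) / 2"
      unfolding complex_add_cnj[symmetric, of "c * iexp (\<xi>2 \<bullet> y)"]
      by (simp add: exp_cnj complex_eq_iff Re_exp Im_exp)
    then have "w c \<xi>2 p *\<^sub>R iexp (\<xi>1 \<bullet> x) =
       (1 + (c * iexp (\<xi>2 \<bullet> y) + cnj c * iexp (- (\<xi>2 \<bullet> y))) / 2) * iexp (\<xi>1 \<bullet> x)"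
      by (simp add: w_def p scaleR_conv_of_real)
    then show ?thesis
      by (simp add: p inner_prod_def algebra_simps exp_add exp_diff add_divide_distrib)
        (simp add: exp_minus field_simps)
  qed
  have w_fourier: "(LINT p|\<mu>. w c \<xi>2 p *\<^sub>R iexp (\<xi>1 \<bullet> fst p)) = (LINT p|\<nu>. w c \<xi>2 p *\<^sub>R iexp (\<xi>1 \<bullet> fst p))"
    for c \<xi>1 \<xi>2
  proof -
    have i: "integrable \<mu> (\<lambda>p. iexp (\<xi> \<bullet> p))" "integrable \<nu> (\<lambda>p. iexp (\<xi> \<bullet> p))" for \<xi>
      using fin sets by (auto intro!: bdd_int[of _ _ 1])
    show ?thesis
      unfolding w_split using eq0 i by simp
  qed
  have marg1: "distr (density \<mu> (w c \<xi>2)) borel fst = distr (density \<nu> (w c \<xi>2)) borel fst"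
    if c: "cmod c = 1" for c \<xi>2
  proof (rule char_determinesD[OF A])
    have f: "finite_measure (distr (density \<kappa> (w c \<xi>2)) borel fst)"
      if "finite_measure \<kappa>" "sets \<kappa> = sets borel" for \<kappa> :: "('a \<times> 'b) measure"
    proof -
      interpret finite_measure \<kappa> by fact
      have m1: "w c \<xi>2 \<in> borel_measurable \<kappa>" "fst \<in> borel_measurable \<kappa>"
        using w_m fst_m by (simp_all add: measurable_cong_sets[OF that(2) refl])
      have "(\<integral>\<^sup>+ x. ennreal (w c \<xi>2 x) \<partial>\<kappa>) \<le> (\<integral>\<^sup>+ x. 2 \<partial>\<kappa>)"
        using Re_le[OF c] by (intro nn_integral_mono) (auto simp: w_def abs_le_iff simp flip: ennreal_numeral intro!: ennreal_leI)
      also have "\<dots> < \<infinity>" by (simp add: emeasure_eq_measure ennreal_mult_less_top)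
      finally have "finite_measure (density \<kappa> (w c \<xi>2))"
        using m1 by (intro finite_measureI) (auto simp: emeasure_density cong: nn_integral_cong)
      then show ?thesis
        using m1 by (intro finite_measure.finite_measure_distr) auto
    qed
    show "finite_measure (distr (density \<mu> (w c \<xi>2)) borel fst)"
      "finite_measure (distr (density \<nu> (w c \<xi>2)) borel fst)"
      using fin sets by (auto intro: f)
    fix \<xi>1 :: 'a
    have "(LINT x|distr (density \<kappa> (w c \<xi>2)) borel fst. iexp (\<xi>1 \<bullet> x)) =
        (LINT p|\<kappa>. w c \<xi>2 p *\<^sub>R iexp (\<xi>1 \<bullet> fst p))"
      if s: "sets \<kappa> = sets borel" for \<kappa> :: "('a \<times> 'b) measure"
    proof -
      have m1: "w c \<xi>2 \<in> borel_measurable \<kappa>" "fst \<in> borel_measurable \<kappa>"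
        "(\<lambda>p. iexp (\<xi>1 \<bullet> fst p)) \<in> borel_measurable \<kappa>"
        using w_m fst_m by (simp_all add: measurable_cong_sets[OF s refl])
      show ?thesis using m1 w_nonneg[OF c]
        by (subst integral_distr) (auto simp: integral_density)
    qed
    then show "(LINT x|distr (density \<mu> (w c \<xi>2)) borel fst. iexp (\<xi>1 \<bullet> x)) =
        (LINT x|distr (density \<nu> (w c \<xi>2)) borel fst. iexp (\<xi>1 \<bullet> x))"
      using w_fourier sets by simp
  qed simp_all
  have ind1_m: "(\<lambda>p :: 'a \<times> 'b. indicator U (fst p) :: real) \<in> borel_measurable borel"
    if "U \<in> sets borel" for U :: "'a set"
    using that by (intro measurable_compose[OF fst_m, of "indicator U"]) auto
  have ind_w: "(LINT p|\<mu>. w c \<xi>2 p * indicator U (fst p)) = (LINT p|\<nu>. w c \<xi>2 p * indicator U (fst p))"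
    if c: "cmod c = 1" and U: "U \<in> sets borel" for c \<xi>2 and U :: "'a set"
  proof -
    have "(LINT x|distr (density \<kappa> (w c \<xi>2)) borel fst. indicator U x) =
        (LINT p|\<kappa>. w c \<xi>2 p * indicator U (fst p))"
      if s: "sets \<kappa> = sets borel" for \<kappa> :: "('a \<times> 'b) measure"
    proof -
      have m1: "w c \<xi>2 \<in> borel_measurable \<kappa>" "fst \<in> borel_measurable \<kappa>"
        "(\<lambda>p. indicator U (fst p) :: real) \<in> borel_measurable \<kappa>"
        using w_m fst_m ind1_m[OF U] by (simp_all add: measurable_cong_sets[OF s refl])
      show ?thesis using m1 w_nonneg[OF c] U
        by (subst integral_distr) (auto simp: integral_density)
    qed
    then show ?thesis using marg1[OF c] sets by metis
  qed
  have ind_m: "(\<lambda>p :: 'a \<times> 'b. indicator U (fst p) *\<^sub>R iexp (\<xi> \<bullet> snd p)) \<in> borel_measurable borel"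
    if "U \<in> sets borel" for U :: "'a set" and \<xi> :: 'b
  proof (rule borel_measurable_scaleR)
    show "(\<lambda>p :: 'a \<times> 'b. indicator U (fst p) :: real) \<in> borel_measurable borel"
      using that by (rule ind1_m)
    show "(\<lambda>p :: 'a \<times> 'b. iexp (\<xi> \<bullet> snd p)) \<in> borel_measurable borel"
      by (intro measurable_compose[OF snd_m, of "\<lambda>y. iexp (\<xi> \<bullet> y)"]) auto
  qed
  have ind_fourier: "(LINT p|\<mu>. indicator U (fst p) *\<^sub>R iexp (\<xi> \<bullet> snd p)) =
      (LINT p|\<nu>. indicator U (fst p) *\<^sub>R iexp (\<xi> \<bullet> snd p))"
    if U: "U \<in> sets borel" for U \<xi>
  proof -
    let ?g = "\<lambda>p. indicator U (fst p) *\<^sub>R iexp (\<xi> \<bullet> snd p)"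
    have ig: "integrable \<kappa> ?g" if "finite_measure \<kappa>" "sets \<kappa> = sets borel" for \<kappa>
      using that ind_m[OF U] by (intro bdd_int[of _ _ 1]) (auto simp: indicator_def)
    have i1: "integrable \<kappa> (\<lambda>p. indicator U (fst p) :: real)"
      if "finite_measure \<kappa>" "sets \<kappa> = sets borel" for \<kappa> :: "('a \<times> 'b) measure"
    proof -
      interpret finite_measure \<kappa> by fact
      have "(\<lambda>p. indicator U (fst p) :: real) \<in> borel_measurable \<kappa>"
        using ind1_m[OF U] by (simp add: measurable_cong_sets[OF that(2) refl])
      then show ?thesis by (intro integrable_const_bound[where B=1]) (auto simp: indicator_def)
    qed
    have wexp: "(LINT p|\<kappa>. w c \<xi> p * indicator U (fst p)) =
        (LINT p|\<kappa>. indicator U (fst p)) + Re (c * (LINT p|\<kappa>. ?g p))"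
      if k: "finite_measure \<kappa>" "sets \<kappa> = sets borel" for \<kappa> c
    proof -
      have *: "w c \<xi> p * indicator U (fst p) = indicator U (fst p) + Re (c * ?g p)" for p
        by (auto simp: w_def indicator_def)
      have "integrable \<kappa> (\<lambda>p. Re (c * ?g p))"
        using ig[OF k] by (intro integrable_Re integrable_mult_right)
      moreover have "(LINT p|\<kappa>. Re (c * ?g p)) = Re (c * (LINT p|\<kappa>. ?g p))"
        using integral_Re[OF integrable_mult_right[OF ig[OF k], of c]]
        by (simp only: integral_mult_right_zero)
      ultimately show ?thesis unfolding * using i1[OF k] by simp
    qed
    \<comment> \<open>Here the weight is constant, so the strips over \<open>U\<close> have equal
      mass. Subtracting that mass from \<open>ind_w\<close> leaves the real part of \<open>c\<close>
      times the Fourier integral over the strip; \<open>c = 1\<close> and \<open>c = - \<i>\<close>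
      then give its real and imaginary parts.\<close>
    have "w 1 0 p = 2" for p
      by (simp add: w_def)
    then have "(LINT p|\<mu>. indicator U (fst p)) = (LINT p|\<nu>. indicator U (fst p) :: real)"
      using ind_w[OF _ U, of 1 0] by simp
    then have "Re (c * (LINT p|\<mu>. ?g p)) = Re (c * (LINT p|\<nu>. ?g p))" if "cmod c = 1" for c
      using ind_w[OF that U, of \<xi>] wexp[OF fin(1) sets(1)] wexp[OF fin(2) sets(2)] by simp
    from this[of 1] this[of "- \<i>"] show ?thesis by (simp add: complex_eq_iff)
  qed
  have rect: "emeasure \<mu> (U \<times> V) = emeasure \<nu> (U \<times> V)"
    if U: "U \<in> sets borel" and V: "V \<in> sets borel" for U V
  proof -
    let ?d = "\<lambda>\<kappa>. distr (density \<kappa> (\<lambda>p. ennreal (indicator U (fst p)))) borel snd"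
    have m1: "(\<lambda>p. indicator U (fst p) :: real) \<in> borel_measurable \<kappa>" "snd \<in> borel_measurable \<kappa>"
        "(\<lambda>p. iexp (\<xi> \<bullet> snd p)) \<in> borel_measurable \<kappa>"
      if s: "sets \<kappa> = sets borel" for \<kappa> :: "('a \<times> 'b) measure" and \<xi>
      using snd_m ind1_m[OF U] by (simp_all add: measurable_cong_sets[OF s refl])
    have val: "emeasure (?d \<kappa>) V' = emeasure \<kappa> (U \<times> V')"
      if s: "sets \<kappa> = sets borel" and V': "V' \<in> sets borel" for \<kappa> :: "('a \<times> 'b) measure" and V' :: "'b set"
    proof -
      have "snd -` V' \<inter> space \<kappa> \<in> sets \<kappa>"
        using m1(2)[OF s] V' by (rule measurable_sets)
      then have "emeasure (?d \<kappa>) V' = (\<integral>\<^sup>+ p. indicator (U \<times> V') p \<partial>\<kappa>)"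
        using m1[OF s] V'
        by (subst emeasure_distr) (auto simp: emeasure_density indicator_def intro!: nn_integral_cong)
      also have "\<dots> = emeasure \<kappa> (U \<times> V')"
        using s U V' by (intro nn_integral_indicator) (auto simp: borel_prod[symmetric])
      finally show ?thesis .
    qed
    have "?d \<mu> = ?d \<nu>"
    proof (rule char_determinesD[OF B])
      have "finite_measure (?d \<kappa>)" if "finite_measure \<kappa>" "sets \<kappa> = sets borel" for \<kappa> :: "('a \<times> 'b) measure"
        by (rule finite_measureI)
          (use val[OF that(2), of UNIV] that(1) in \<open>simp add: finite_measure.emeasure_eq_measure\<close>)
      then show "finite_measure (?d \<mu>)" "finite_measure (?d \<nu>)" using fin sets by auto
      fix \<xi>
      have "(LINT y|?d \<kappa>. iexp (\<xi> \<bullet> y)) = (LINT p|\<kappa>. indicator U (fst p) *\<^sub>R iexp (\<xi> \<bullet> snd p))"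
        if s: "sets \<kappa> = sets borel" for \<kappa> :: "('a \<times> 'b) measure"
        using m1[OF s] by (subst integral_distr) (auto simp: integral_density)
      then show "(LINT y|?d \<mu>. iexp (\<xi> \<bullet> y)) = (LINT y|?d \<nu>. iexp (\<xi> \<bullet> y))"
        using ind_fourier[OF U] sets by simp
    qed simp_all
    then show ?thesis using val[OF sets(1) V] val[OF sets(2) V] by simp
  qed
  let ?E = "{a \<times> b | a b. a \<in> sets (borel :: 'a measure) \<and> b \<in> sets (borel :: 'b measure)}"
  show "\<mu> = \<nu>"
  proof (rule measure_eqI_generator_eq[OF Int_stable_pair_measure_generator[of borel borel],
        where \<Omega>=UNIV and A="\<lambda>_. UNIV"])
    have gen: "sets (borel :: ('a \<times> 'b) measure) = sigma_sets UNIV ?E"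
      by (simp add: borel_prod[symmetric] sets_pair_measure)
    show "sets \<mu> = sigma_sets UNIV ?E" "sets \<nu> = sigma_sets UNIV ?E"
      using gen sets by simp_all
    show "range (\<lambda>_. UNIV) \<subseteq> ?E" by (auto intro!: exI[of _ UNIV])
    show "emeasure \<mu> UNIV \<noteq> \<infinity>" using fin by (simp add: finite_measure.emeasure_eq_measure)
  qed (auto simp: rect)
qed

lemma char_determines_complex: "char_determines TYPE(complex)"
  unfolding char_determines_def
proof (intro allI impI)
  fix \<mu> \<nu> :: "complex measure"
  assume fin: "finite_measure \<mu>" "finite_measure \<nu>"
    and sets: "sets \<mu> = sets borel" "sets \<nu> = sets borel"
    and eq: "\<forall>\<xi>. (LINT x|\<mu>. iexp (\<xi> \<bullet> x)) = (LINT x|\<nu>. iexp (\<xi> \<bullet> x))"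
  let ?S = "\<lambda>z. (Re z, Im z)" and ?T = "\<lambda>p. Complex (fst p) (snd p)"
  have S: "?S \<in> borel_measurable borel"
    by (auto intro!: borel_measurable_continuous_onI continuous_intros)
  have T: "?T \<in> borel_measurable borel"
    unfolding Complex_eq by (auto intro!: borel_measurable_continuous_onI continuous_intros)
  have Sm: "?S \<in> borel_measurable \<kappa>" if "sets \<kappa> = sets borel" for \<kappa>
    using S by (simp add: measurable_cong_sets[OF that refl])
  have inverse: "distr (distr \<kappa> borel ?S) borel ?T = \<kappa>" if s: "sets \<kappa> = sets borel" for \<kappa> :: "complex measure"
    using Sm[OF s] T s by (subst distr_distr) (auto simp: comp_def intro: distr_id2)
  have "distr \<mu> borel ?S = distr \<nu> borel ?S"
  proof (rule char_determinesD[OF char_determines_prod[OF char_determines_real char_determines_real]])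
    show "finite_measure (distr \<mu> borel ?S)" "finite_measure (distr \<nu> borel ?S)"
      using fin sets Sm by (auto intro!: finite_measure.finite_measure_distr)
    fix \<xi> :: "real \<times> real"
    have "(LINT p|distr \<kappa> borel ?S. iexp (\<xi> \<bullet> p)) = (LINT z|\<kappa>. iexp (?T \<xi> \<bullet> z))"
      if "sets \<kappa> = sets borel" for \<kappa>
    proof -
      have "(\<lambda>p. iexp (\<xi> \<bullet> p)) \<in> borel_measurable borel" by measurable
      from integral_distr[OF Sm[OF that] this] show ?thesis
        by (simp add: inner_prod_def inner_complex_def)
    qed
    then show "(LINT p|distr \<mu> borel ?S. iexp (\<xi> \<bullet> p)) = (LINT p|distr \<nu> borel ?S. iexp (\<xi> \<bullet> p))"
      using eq sets by simp
  qed simp_all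
  then show "\<mu> = \<nu>" using inverse[OF sets(1)] inverse[OF sets(2)] by metis
qed

lemma distr_eqI_char:
  fixes X :: "'a \<Rightarrow> 'c::{real_inner, second_countable_topology}" and Y :: "'b \<Rightarrow> 'c"
  assumes "char_determines TYPE('c)" "prob_space M" "prob_space N"
    and X: "X \<in> borel_measurable M" and Y: "Y \<in> borel_measurable N"
    and eq: "\<And>\<xi>. (LINT \<omega>|M. iexp (\<xi> \<bullet> X \<omega>)) = (LINT \<omega>|N. iexp (\<xi> \<bullet> Y \<omega>))"
  shows "distr M borel X = distr N borel Y"
proof (rule char_determinesD[OF assms(1)])
  show "finite_measure (distr M borel X)" "finite_measure (distr N borel Y)"
    using assms prob_space.finite_measure by (auto intro!: finite_measure.finite_measure_distr)
  fix \<xi>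
  show "(LINT x|distr M borel X. iexp (\<xi> \<bullet> x)) = (LINT x|distr N borel Y. iexp (\<xi> \<bullet> x))"
    using X Y eq by (simp add: integral_distr)
qed simp_all

section \<open>The standard complex Gaussian distribution\<close>

text \<open>Boxes determine Lebesgue measure. The product form is what lets the Gaussian density on
  the plane factor into two real ones.\<close>

lemma lborel_complex: "lborel = distr (lborel \<Otimes>\<^sub>M lborel) borel (\<lambda>(x, y). Complex x y)"
proof (rule lborel_eqI)
  have m [measurable]: "(\<lambda>(x, y). Complex x y) \<in> borel_measurable (lborel \<Otimes>\<^sub>M lborel)"
    unfolding Complex_eq by measurable
  fix l u :: complex
  assume le: "\<And>b. b \<in> Basis \<Longrightarrow> l \<bullet> b \<le> u \<bullet> b"
  have le': "Re l \<le> Re u" "Im l \<le> Im u"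
    using le[of 1] le[of \<i>] by (auto simp: Basis_complex_def inner_complex_def)
  have "(\<lambda>(x, y). Complex x y) -` box l u \<inter> space (lborel \<Otimes>\<^sub>M lborel) = {Re l<..<Re u} \<times> {Im l<..<Im u}"
    by (auto simp: box_def Basis_complex_def inner_complex_def space_pair_measure)
  then have "emeasure (distr (lborel \<Otimes>\<^sub>M lborel) borel (\<lambda>(x, y). Complex x y)) (box l u) =
      emeasure (lborel \<Otimes>\<^sub>M lborel) ({Re l<..<Re u} \<times> {Im l<..<Im u})"
    by (subst emeasure_distr) auto
  also have "\<dots> = ennreal (Re u - Re l) * ennreal (Im u - Im l)"
    using le' by (subst lborel.emeasure_pair_measure_Times) auto
  also have "\<dots> = (\<Prod>b\<in>Basis. (u - l) \<bullet> b)"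
    using le' by (simp add: Basis_complex_def inner_complex_def ennreal_mult')
  finally show "emeasure (distr (lborel \<Otimes>\<^sub>M lborel) borel (\<lambda>(x, y). Complex x y)) (box l u) =
      ennreal (\<Prod>b\<in>Basis. (u - l) \<bullet> b)" .
qed simp

lemma sets_std_complex_gaussian [simp, measurable_cong]: "sets std_complex_gaussian = sets borel"
  by (simp add: std_complex_gaussian_def)

text \<open>Variance 1/2 per coordinate: the product of two such densities is
  \<open>exp (- |z|^2) / pi\<close>, so that \<open>E |z|^2 = 1\<close>.\<close>

lemma normal_density_half: "normal_density 0 (sqrt (1 / 2)) x = 1 / sqrt pi * exp (- x\<^sup>2)"
  by (simp add: normal_density_def)

lemma std_complex_gaussian_eq_distr:
  "std_complex_gaussian =
     distr (density lborel (normal_density 0 (sqrt (1 / 2))) \<Otimes>\<^sub>M density lborel (normal_density 0 (sqrt (1 / 2))))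
       borel (\<lambda>(x, y). Complex x y)"
proof -
  let ?n = "normal_density 0 (sqrt (1 / 2))"
  have [measurable]: "(\<lambda>(x, y). Complex x y) \<in> borel_measurable (lborel \<Otimes>\<^sub>M lborel)"
    unfolding Complex_eq by measurable
  have eq: "1 / pi * exp (- (cmod (Complex x y))\<^sup>2) = ?n x * ?n y" for x y
  proof -
    have "sqrt pi * sqrt pi = pi" by simp
    then show ?thesis
      unfolding normal_density_half by (simp add: cmod_power2 exp_add[symmetric] exp_diff field_simps)
  qed
  have "std_complex_gaussian = distr (density (lborel \<Otimes>\<^sub>M lborel)
      (\<lambda>p. ennreal (1 / pi * exp (- (cmod (case p of (x, y) \<Rightarrow> Complex x y))\<^sup>2)))) borel (\<lambda>(x, y). Complex x y)"
    unfolding std_complex_gaussian_def by (subst lborel_complex, subst density_distr) auto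
  also have "density (lborel \<Otimes>\<^sub>M lborel) (\<lambda>p. ennreal (1 / pi * exp (- (cmod (case p of (x, y) \<Rightarrow> Complex x y))\<^sup>2)))
      = density (lborel \<Otimes>\<^sub>M lborel) (\<lambda>(x, y). ennreal (?n x) * ennreal (?n y))"
    by (intro arg_cong[where f="density _"] ext)
      (auto simp: eq[simplified] ennreal_mult' simp del: normal_density_def)
  also have "\<dots> = density lborel ?n \<Otimes>\<^sub>M density lborel ?n"
    by (intro pair_measure_density[symmetric] prob_space_imp_sigma_finite lborel.sigma_finite_measure_axioms prob_space_normal_density) auto
  finally show ?thesis .
qed

lemma integral_iexp_normal_half:
  "(LINT x|density lborel (normal_density 0 (sqrt (1 / 2))). iexp (t * x)) = exp (- t\<^sup>2 / 4)"
proof -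
  let ?N = "density lborel (normal_density 0 (sqrt (1 / 2)))"
  interpret prob_space ?N by (rule prob_space_normal_density) simp
  have "distributed ?N lborel (\<lambda>x. x) (normal_density 0 (sqrt (1 / 2)))"
    by (auto simp: distributed_def distr_id2 cong: distr_cong)
  then have "distributed ?N lborel (\<lambda>x. (x - 0) / sqrt (1 / 2)) std_normal_density"
    by (subst (asm) normal_standard_normal_convert) auto
  then have d: "distr ?N lborel (\<lambda>x. x / sqrt (1 / 2)) = std_normal_distribution"
    by (simp add: distributed_distr_eq_density)
  have "(LINT x|?N. iexp (t * x)) = (LINT x|?N. iexp ((t * sqrt (1 / 2)) * (x / sqrt (1 / 2))))"
    by simp
  also have "\<dots> = char (distr ?N lborel (\<lambda>x. x / sqrt (1 / 2))) (t * sqrt (1 / 2))"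
    unfolding char_def by (subst integral_distr) auto
  also have "\<dots> = exp (- t\<^sup>2 / 4)"
    unfolding d char_std_normal_distribution by (simp add: power_mult_distrib exp_of_real)
  finally show ?thesis .
qed

lemma prob_space_std_complex_gaussian: "prob_space std_complex_gaussian"
proof -
  let ?N = "density lborel (normal_density 0 (sqrt (1 / 2)))"
  interpret N: prob_space ?N by (rule prob_space_normal_density) simp
  interpret NN: pair_prob_space ?N ?N ..
  have [measurable]: "(\<lambda>(x, y). Complex x y) \<in> borel_measurable (?N \<Otimes>\<^sub>M ?N)"
    unfolding Complex_eq by measurable
  show ?thesis
    unfolding std_complex_gaussian_eq_distr by (rule NN.prob_space_distr) simp
qed

interpretation std_complex_gaussian: prob_space std_complex_gaussian
  by (rule prob_space_std_complex_gaussian)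

lemma char_std_complex_gaussian:
  "(LINT z|std_complex_gaussian. iexp (\<xi> \<bullet> z)) = exp (- (cmod \<xi>)\<^sup>2 / 4)"
proof -
  let ?N = "density lborel (normal_density 0 (sqrt (1 / 2)))"
  interpret N: prob_space ?N by (rule prob_space_normal_density) simp
  interpret NN: pair_prob_space ?N ?N ..
  have [measurable]: "(\<lambda>(x, y). Complex x y) \<in> borel_measurable (?N \<Otimes>\<^sub>M ?N)"
    unfolding Complex_eq by measurable
  have "(LINT z|std_complex_gaussian. iexp (\<xi> \<bullet> z)) =
      (LINT p|(?N \<Otimes>\<^sub>M ?N). iexp (\<xi> \<bullet> (case p of (x, y) \<Rightarrow> Complex x y)))"
    unfolding std_complex_gaussian_eq_distr by (subst integral_distr) auto
  also have "\<dots> = (LINT p|(?N \<Otimes>\<^sub>M ?N). iexp (Re \<xi> * fst p) * iexp (Im \<xi> * snd p))"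
    by (intro Bochner_Integration.integral_cong)
      (auto simp: inner_complex_def distrib_left exp_add)
  also have "\<dots> = (LINT x|?N. LINT y|?N. iexp (Re \<xi> * x) * iexp (Im \<xi> * y))"
    by (subst NN.integral_fst'[symmetric])
      (auto intro!: NN.P.integrable_const_bound[where B=1] simp: norm_mult)
  also have "\<dots> = exp (- (Re \<xi>)\<^sup>2 / 4) * exp (- (Im \<xi>)\<^sup>2 / 4)"
    using integral_iexp_normal_half[of "Re \<xi>"] integral_iexp_normal_half[of "Im \<xi>"] by simp
  also have "\<dots> = exp (- (cmod \<xi>)\<^sup>2 / 4)"
    by (simp add: cmod_power2 exp_add[symmetric] add_divide_distrib)
  finally show ?thesis .
qed

lemma inner_mult_complex: "\<xi> \<bullet> (c * z) = (cnj c * \<xi>) \<bullet> z"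
  by (simp add: inner_complex_def algebra_simps)

text \<open>The characteristic function depends on the frequency through its modulus only.\<close>

lemma std_complex_gaussian_rotate:
  assumes "cmod c = 1"
  shows "distr std_complex_gaussian borel (\<lambda>z. c * z) = std_complex_gaussian"
proof -
  have "distr std_complex_gaussian borel (\<lambda>z. c * z) = distr std_complex_gaussian borel (\<lambda>z. z)"
    by (rule distr_eqI_char[OF char_determines_complex])
      (simp_all add: std_complex_gaussian.prob_space_axioms inner_mult_complex char_std_complex_gaussian
        norm_mult assms)
  then show ?thesis by (simp add: distr_id2)
qed

lemma borel_measurable_cnj [measurable (raw)]:
  "f \<in> borel_measurable M \<Longrightarrow> (\<lambda>x. cnj (f x)) \<in> borel_measurable M"
  by (rule measurable_compose[of f M borel cnj])
    (auto intro!: borel_measurable_continuous_onI continuous_intros)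

text \<open>The disc \<open>|z|^2 \<le> a\<close> has area \<open>pi * a\<close>, so the squared
  modulus carries the constant density pi. Working with this push-forward takes the place of polar
  coordinates.\<close>

lemma distr_norm_square_lborel:
  "distr lborel borel (\<lambda>z::complex. (cmod z)\<^sup>2) = density lborel (\<lambda>u. ennreal (pi * indicator {0..} u))"
    (is "?L = ?R")
proof (rule measure_eqI_generator_eq[where E="range (\<lambda>a::real. {..a})" and \<Omega>=UNIV and A="\<lambda>i. {..real i}"])
  show "Int_stable (range (\<lambda>a::real. {..a}))"
    by (auto simp: Int_stable_def)
  have "sets (borel :: real measure) = sigma_sets UNIV (range (\<lambda>a. {..a}))"
    by (subst borel_eq_atMost) simp
  then show "sets ?L = sigma_sets UNIV (range (\<lambda>a::real. {..a}))"
    and "sets ?R = sigma_sets UNIV (range (\<lambda>a::real. {..a}))" by simp_all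
  have L: "emeasure ?L {..a} = ennreal (pi * max 0 a)" for a
  proof (cases "a < 0")
    case True
    then have "(\<lambda>z::complex. (cmod z)\<^sup>2) -` {..a} = {}"
      by auto (smt (verit) zero_le_power2)
    with True show ?thesis by (simp add: emeasure_distr)
  next
    case False
    then have "(\<lambda>z::complex. (cmod z)\<^sup>2) -` {..a} = cball 0 (sqrt a)"
      by (auto simp: real_le_rsqrt dest: real_sqrt_le_mono simp flip: real_sqrt_le_iff[of "_\<^sup>2"])
    with False show ?thesis
      by (simp add: emeasure_distr emeasure_cball unit_ball_vol_2 max_def)
  qed
  have R: "emeasure ?R {..a} = ennreal (pi * max 0 a)" for a
  proof -
    have "emeasure ?R {..a} = (\<integral>\<^sup>+ u. ennreal pi * indicator {0..a} u \<partial>lborel)"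
      by (subst emeasure_density) (auto intro!: nn_integral_cong simp: indicator_def)
    also have "\<dots> = ennreal pi * emeasure lborel {0..a}"
      by (simp add: nn_integral_cmult_indicator)
    also have "\<dots> = ennreal (pi * max 0 a)"
      by (cases "0 \<le> a") (auto simp: ennreal_mult' max_def)
    finally show ?thesis .
  qed
  show "emeasure ?L X = emeasure ?R X" if "X \<in> range (\<lambda>a. {..a})" for X
    using that L R by auto
  show "(\<Union>i. {..real i}) = UNIV"
    by (auto intro: real_arch_simple)
  show "emeasure ?L {..real i} \<noteq> \<infinity>" for i
    by (simp only: L ennreal_neq_top infinity_ennreal_def not_False_eq_True)
qed auto

text \<open>The Gaussian density is a function of the squared modulus, so it only reweights the
  constant density pi; the two factors pi cancel.\<close>

lemma distr_norm_square_std_complex_gaussian: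
  "distr std_complex_gaussian borel (\<lambda>z. (cmod z)\<^sup>2) = density lborel (exponential_density 1)"
proof -
  let ?h = "\<lambda>u. ennreal (1 / pi * exp (- u))"
  have "distr std_complex_gaussian borel (\<lambda>z. (cmod z)\<^sup>2) =
      density (distr lborel borel (\<lambda>z::complex. (cmod z)\<^sup>2)) ?h"
    unfolding std_complex_gaussian_def by (subst density_distr) auto
  also have "\<dots> = density lborel (\<lambda>u. ennreal (pi * indicator {0..} u) * ?h u)"
    unfolding distr_norm_square_lborel by (subst density_density_eq) auto
  also have "\<dots> = density lborel (exponential_density 1)"
    by (intro arg_cong[where f="density _"] ext)
      (auto simp: exponential_density_def indicator_def ennreal_mult'[symmetric])
  finally show ?thesis .
qed

lemma nn_integral_std_complex_gaussian_radial:
  assumes [measurable]: "F \<in> borel_measurable borel"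
  shows "(\<integral>\<^sup>+ z. F ((cmod z)\<^sup>2) \<partial>std_complex_gaussian) =
    (\<integral>\<^sup>+ u. ennreal (exp (- u)) * indicator {0<..} u * F u \<partial>lborel)"
proof -
  have "(\<integral>\<^sup>+ z. F ((cmod z)\<^sup>2) \<partial>std_complex_gaussian) =
      (\<integral>\<^sup>+ u. F u \<partial>distr std_complex_gaussian borel (\<lambda>z. (cmod z)\<^sup>2))"
    by (subst nn_integral_distr) auto
  also have "\<dots> = (\<integral>\<^sup>+ u. ennreal (exponential_density 1 u) * F u \<partial>lborel)"
    unfolding distr_norm_square_std_complex_gaussian by (subst nn_integral_density) auto
  also have "\<dots> = (\<integral>\<^sup>+ u. ennreal (exp (- u)) * indicator {0<..} u * F u \<partial>lborel)"
    using AE_lborel_singleton[of "0::real"]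
    by (intro nn_integral_cong_AE) (auto simp: exponential_density_def indicator_def)
  finally show ?thesis .
qed

lemma nn_integral_power_exp:
  assumes l: "l > 0"
  shows "(\<integral>\<^sup>+ u. ennreal (u ^ k * exp (- (l * u))) * indicator {0<..} u \<partial>lborel) = ennreal (fact k / l ^ (Suc k))"
proof -
  have scale: "ennreal (((1 / l) * x) ^ k * exp (- x)) * indicator {0..} x =
      ennreal ((1 / l) ^ k) * (ennreal (x ^ k * exp (- x)) * indicator {0..} x)" for x :: real
  proof -
    have "((1 / l) * x) ^ k * exp (- x) = (1 / l) ^ k * (x ^ k * exp (- x))"
      by (simp only: power_mult_distrib mult.assoc)
    then show ?thesis
      using l by (simp only: ennreal_mult' zero_le_power zero_le_divide_1_iff less_imp_le mult.assoc)
  qed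
  have "(\<integral>\<^sup>+ u. ennreal (u ^ k * exp (- (l * u))) * indicator {0<..} u \<partial>lborel) =
      (\<integral>\<^sup>+ u. ennreal (u ^ k * exp (- (l * u))) * indicator {0..} u \<partial>lborel)"
    using AE_lborel_singleton[of "0::real"] by (intro nn_integral_cong_AE) (auto simp: indicator_def)
  also have "\<dots> = ennreal (1 / l) * (\<integral>\<^sup>+ x. ennreal (((1 / l) * x) ^ k * exp (- x)) * indicator {0..} x \<partial>lborel)"
    using l by (subst nn_integral_real_affine[where c="1 / l" and t=0])
      (auto intro!: arg_cong2[where f="(*)"] nn_integral_cong simp: indicator_def zero_le_divide_iff)
  also have "\<dots> = ennreal (1 / l) * (\<integral>\<^sup>+ x. ennreal ((1 / l) ^ k) * (ennreal (x ^ k * exp (- x)) * indicator {0..} x) \<partial>lborel)"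
    by (simp only: scale)
  also have "\<dots> = ennreal (1 / l) * (ennreal ((1 / l) ^ k) * ennreal (fact k))"
    by (subst nn_integral_cmult) (auto simp: nn_intergal_power_times_exp_Ici)
  also have "\<dots> = ennreal (fact k / l ^ (Suc k))"
    using l by (simp add: ennreal_mult'[symmetric] field_simps power_divide)
  finally show ?thesis .
qed

text \<open>Substituting \<open>v = y * u\<close> turns the integral over two exponential variables into
  \<open>\<integral>\<^sub>0\<^sup>c fact k * y ^ k / (1 + y) ^ (k + 1) dy\<close>.\<close>

lemma nn_integral_two_gaussians_ratio:
  assumes c: "c > 0"
  shows "(\<integral>\<^sup>+ w. \<integral>\<^sup>+ z. ennreal (indicator {..<c * (cmod w)\<^sup>2} ((cmod z)\<^sup>2) * (cmod z) ^ (2 * k) / (cmod w)\<^sup>2)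
      \<partial>std_complex_gaussian \<partial>std_complex_gaussian) =
    (\<integral>\<^sup>+ y. ennreal (fact k * y ^ k / (1 + y) ^ Suc k) * indicator {0..c} y \<partial>lborel)" (is "?L = ?R")
proof -
  let ?in = "\<lambda>u. \<integral>\<^sup>+ v. ennreal (exp (- v)) * indicator {0<..} v * ennreal (if v < c * u then v ^ k / u else 0) \<partial>lborel"
  have "?L = (\<integral>\<^sup>+ w. ?in ((cmod w)\<^sup>2) \<partial>std_complex_gaussian)"
    by (intro nn_integral_cong, subst nn_integral_std_complex_gaussian_radial[symmetric])
      (auto simp: power_mult indicator_def intro!: nn_integral_cong)
  also have "\<dots> = (\<integral>\<^sup>+ u. ennreal (exp (- u)) * indicator {0<..} u * ?in u \<partial>lborel)"
    by (subst nn_integral_std_complex_gaussian_radial) auto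
  also have "\<dots> = (\<integral>\<^sup>+ u. \<integral>\<^sup>+ y. ennreal (u ^ k * exp (- ((1 + y) * u))) * indicator {0<..} u *
      (ennreal (y ^ k) * indicator {0<..<c} y) \<partial>lborel \<partial>lborel)"
  proof (intro nn_integral_cong)
    fix u :: real
    show "ennreal (exp (- u)) * indicator {0<..} u * ?in u =
      (\<integral>\<^sup>+ y. ennreal (u ^ k * exp (- ((1 + y) * u))) * indicator {0<..} u * (ennreal (y ^ k) * indicator {0<..<c} y) \<partial>lborel)"
    proof (cases "u > 0")
      case u: True
      have in_u: "?in u = ennreal u * (\<integral>\<^sup>+ y. ennreal (exp (- (u * y))) * indicator {0<..} (u * y) *
          ennreal (if u * y < c * u then (u * y) ^ k / u else 0) \<partial>lborel)"
      proof -
        have "?in u = ennreal \<bar>u\<bar> * (\<integral>\<^sup>+ y. ennreal (exp (- (0 + u * y))) * indicator {0<..} (0 + u * y) *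
            ennreal (if 0 + u * y < c * u then (0 + u * y) ^ k / u else 0) \<partial>lborel)"
          using u by (intro nn_integral_real_affine) auto
        then show ?thesis
          using u by (simp only: add_0_left abs_of_pos)
      qed
      have "ennreal (exp (- u)) * indicator {0<..} u * ?in u =
          (\<integral>\<^sup>+ y. ennreal (exp (- u)) * ennreal u * (ennreal (exp (- (u * y))) * indicator {0<..} (u * y) *
          ennreal (if u * y < c * u then (u * y) ^ k / u else 0)) \<partial>lborel)"
        unfolding in_u using u by (simp add: nn_integral_cmult mult.assoc)
      also have "\<dots> = (\<integral>\<^sup>+ y. ennreal (u ^ k * exp (- ((1 + y) * u))) * indicator {0<..} u *
          (ennreal (y ^ k) * indicator {0<..<c} y) \<partial>lborel)"
      proof (intro nn_integral_cong)
        fix y :: real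
        have e: "exp (- ((1 + y) * u)) = exp (- u) * exp (- (u * y))"
          unfolding mult_exp_exp by (rule arg_cong[where f=exp]) (simp add: algebra_simps)
        have iff: "0 < u * y \<longleftrightarrow> 0 < y" "u * y < c * u \<longleftrightarrow> y < c"
          using u by (auto simp: zero_less_mult_iff mult.commute)
        show "ennreal (exp (- u)) * ennreal u * (ennreal (exp (- (u * y))) * indicator {0<..} (u * y) *
            ennreal (if u * y < c * u then (u * y) ^ k / u else 0)) =
            ennreal (u ^ k * exp (- ((1 + y) * u))) * indicator {0<..} u * (ennreal (y ^ k) * indicator {0<..<c} y)"
        proof (cases "0 < y \<and> y < c")
          case y: True
          have "ennreal (exp (- u)) * ennreal u * (ennreal (exp (- (u * y))) * ennreal ((u * y) ^ k / u)) =
              ennreal (exp (- u) * u * (exp (- (u * y)) * ((u * y) ^ k / u)))"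
          proof -
            have "ennreal a * ennreal b * (ennreal d * ennreal e) = ennreal (a * b * (d * e))"
              if "0 \<le> a" "0 \<le> b" "0 \<le> d" "0 \<le> e" for a b d e
              using that by (simp add: ennreal_mult)
            then show ?thesis using u y by simp
          qed
          also have "exp (- u) * u * (exp (- (u * y)) * ((u * y) ^ k / u)) = u ^ k * exp (- ((1 + y) * u)) * y ^ k"
            using u unfolding e power_mult_distrib by simp
          also have "ennreal \<dots> = ennreal (u ^ k * exp (- ((1 + y) * u))) * ennreal (y ^ k)"
            using u y by (intro ennreal_mult) auto
          finally show ?thesis using u y iff by simp
        next
          case False
          then show ?thesis using iff by (auto simp: indicator_def)
        qed
      qed
      finally show ?thesis .
    qed simp
  qed
  also have "\<dots> = (\<integral>\<^sup>+ y. \<integral>\<^sup>+ u. ennreal (u ^ k * exp (- ((1 + y) * u))) * indicator {0<..} u *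
      (ennreal (y ^ k) * indicator {0<..<c} y) \<partial>lborel \<partial>lborel)"
    by (rule lborel_pair.Fubini') auto
  also have "\<dots> = (\<integral>\<^sup>+ y. ennreal (fact k / (1 + y) ^ Suc k) * (ennreal (y ^ k) * indicator {0<..<c} y) \<partial>lborel)"
  proof (intro nn_integral_cong)
    fix y :: real
    show "(\<integral>\<^sup>+ u. ennreal (u ^ k * exp (- ((1 + y) * u))) * indicator {0<..} u * (ennreal (y ^ k) * indicator {0<..<c} y) \<partial>lborel) =
      ennreal (fact k / (1 + y) ^ Suc k) * (ennreal (y ^ k) * indicator {0<..<c} y)"
    proof (cases "y \<in> {0<..<c}")
      case True
      then show ?thesis
        by (subst nn_integral_multc) (auto simp: nn_integral_power_exp)
    qed simp
  qed
  also have "\<dots> = ?R"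
    using AE_lborel_singleton[of "0::real"] AE_lborel_singleton[of c]
    by (intro nn_integral_cong_AE) (auto simp: indicator_def ennreal_mult'[symmetric] elim!: eventually_rev_mp)
  finally show ?thesis .
qed

lemma nn_integral_two_gaussians_ratio_0:
  assumes c: "c > 0"
  shows "(\<integral>\<^sup>+ w. \<integral>\<^sup>+ z. ennreal (indicator {..<c * (cmod w)\<^sup>2} ((cmod z)\<^sup>2) / (cmod w)\<^sup>2)
      \<partial>std_complex_gaussian \<partial>std_complex_gaussian) = ennreal (ln (1 + c))"
proof -
  have "(\<integral>\<^sup>+ y. ennreal (1 / (1 + y)) * indicator {0..c} y \<partial>lborel) = ennreal (ln (1 + c) - ln (1 + 0))"
    using c by (intro nn_integral_FTC_Icc) (auto intro!: derivative_eq_intros)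
  then show ?thesis
    using nn_integral_two_gaussians_ratio[OF c, of 0] by simp
qed

lemma nn_integral_two_gaussians_ratio_1:
  assumes c: "c > 0"
  shows "(\<integral>\<^sup>+ w. \<integral>\<^sup>+ z. ennreal (indicator {..<c * (cmod w)\<^sup>2} ((cmod z)\<^sup>2) * (cmod z)\<^sup>2 / (cmod w)\<^sup>2)
      \<partial>std_complex_gaussian \<partial>std_complex_gaussian) = ennreal (ln (1 + c) - c / (1 + c))"
proof -
  have "(\<integral>\<^sup>+ y. ennreal (y / (1 + y)\<^sup>2) * indicator {0..c} y \<partial>lborel) =
      ennreal ((ln (1 + c) + 1 / (1 + c)) - (ln (1 + 0) + 1 / (1 + 0)))"
  proof (rule nn_integral_FTC_Icc)
    fix y :: real assume "y \<in> {0..c}"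
    then have y: "0 \<le> y" "y \<le> c" by auto
    have "y / (1 + y)\<^sup>2 = 1 / (1 + y) + - (1 / (1 + y)\<^sup>2)"
      using y by (simp add: divide_simps) (simp add: power2_eq_square algebra_simps)
    then show "((\<lambda>y. ln (1 + y) + 1 / (1 + y)) has_real_derivative y / (1 + y)\<^sup>2) (at y)"
      using y by (auto intro!: derivative_eq_intros simp: power2_eq_square)
    show "0 \<le> y / (1 + y)\<^sup>2" using y by simp
  qed (use c in auto)
  also have "(ln (1 + c) + 1 / (1 + c)) - (ln (1 + 0) + 1 / (1 + 0)) = ln (1 + c) - c / (1 + c)"
    using c by (simp add: field_simps)
  finally show ?thesis
    using nn_integral_two_gaussians_ratio[OF c, of 1] by (simp add: power2_eq_square)
qed

section \<open>Circle averages\<close>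

text \<open>The unit circle encloses the pole \<open>- w / z\<close> exactly when
  \<open>|w| < |z|\<close>. With the pole outside, Cauchy's formula gives the value
  \<open>1 / w\<close> at the centre. With the pole inside,
  \<open>1 / (w + z * e) = (1 / w) * (1 - e / (e + w / z))\<close>, and the last fraction has mean
  1.\<close>

lemma has_integral_circle_inverse:
  fixes w z :: complex
  assumes w: "w \<noteq> 0" and wz: "cmod w \<noteq> cmod z"
  shows "((\<lambda>x. 1 / (w + z * exp (2 * of_real pi * \<i> * of_real x))) has_integral
      (if cmod z < cmod w then 1 / w else 0)) {0..1}"
proof -
  \<comment> \<open>On the unit circle \<open>d\<zeta> = 2 * pi * \<i> * \<zeta> dx\<close>, so the
    contour integral is \<open>2 * pi * \<i>\<close> times the mean of
    \<open>f \<zeta> * \<zeta>\<close>.\<close>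
  have circ: "((\<lambda>x. f (exp (2 * of_real pi * \<i> * of_real x)) * exp (2 * of_real pi * \<i> * of_real x))
      has_integral I) {0..1}"
    if "(f has_contour_integral (2 * of_real pi * \<i> * I)) (circlepath 0 1)" for f I
  proof -
    have "((\<lambda>x. f (circlepath 0 1 x) * vector_derivative (circlepath 0 1) (at x within {0..1}))
        has_integral (2 * of_real pi * \<i> * I)) {0..1}"
      using that by (simp add: has_contour_integral_def)
    moreover have "f (circlepath 0 1 x) * vector_derivative (circlepath 0 1) (at x within {0..1}) =
        f (exp (2 * of_real pi * \<i> * of_real x)) * (2 * pi * \<i> * exp (2 * of_real pi * \<i> * of_real x))"
      if "x \<in> {0..1}" for x
      using that by (subst vector_derivative_circlepath01) (auto simp: circlepath)
    ultimately have "((\<lambda>x. f (exp (2 * of_real pi * \<i> * of_real x)) * (2 * pi * \<i> * exp (2 * of_real pi * \<i> * of_real x)))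
        has_integral (2 * of_real pi * \<i> * I)) {0..1}"
      by (metis (no_types, lifting) has_integral_cong)
    from has_integral_mult_right[OF this, of "1 / (2 * pi * \<i>)"] show ?thesis
      by (simp add: mult.left_commute)
  qed
  have norm_e: "cmod (exp (2 * of_real pi * \<i> * of_real x)) = 1" for x :: real
    by simp
  show ?thesis
  proof (cases "cmod z < cmod w")
    case True
    have nz: "w + z * \<zeta> \<noteq> 0" if "\<zeta> \<in> cball 0 1" for \<zeta>
    proof
      assume "w + z * \<zeta> = 0"
      then have "cmod w = cmod (z * \<zeta>)" by (metis add.inverse_unique norm_minus_cancel)
      also have "\<dots> \<le> cmod z" using that by (simp add: norm_mult mult_left_le)
      finally show False using True by simp
    qed
    have "(\<lambda>\<zeta>. 1 / (w + z * \<zeta>)) holomorphic_on cball 0 1"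
      using nz by (intro holomorphic_intros) auto
    from Cauchy_integral_circlepath_simple[OF this, of 0]
    have "((\<lambda>u. 1 / (w + z * u) / (u - 0)) has_contour_integral (2 * of_real pi * \<i> * (1 / (w + z * 0)))) (circlepath 0 1)"
      by simp
    from circ[OF this] show ?thesis using True by simp
  next
    case False
    with wz have zw: "cmod w < cmod z" by simp
    then have z: "z \<noteq> 0" by auto
    have "((\<lambda>u. 1 / (u - (- w / z))) has_contour_integral (2 * of_real pi * \<i> * 1)) (circlepath 0 1)"
      using zw z by (intro Cauchy_integral_circlepath_simple) (auto simp: norm_divide)
    from circ[OF this]
    have "((\<lambda>x. exp (2 * of_real pi * \<i> * of_real x) / (exp (2 * of_real pi * \<i> * of_real x) + w / z)) has_integral 1) {0..1}"
      by simp
    from has_integral_diff[OF has_integral_const_real[of 1 0 1] this]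
    have "((\<lambda>x. 1 - exp (2 * of_real pi * \<i> * of_real x) / (exp (2 * of_real pi * \<i> * of_real x) + w / z)) has_integral 0) {0..1}"
      by simp
    from has_integral_mult_right[OF this, of "1 / w"]
    have i: "((\<lambda>x. 1 / w * (1 - exp (2 * of_real pi * \<i> * of_real x) / (exp (2 * of_real pi * \<i> * of_real x) + w / z))) has_integral 0) {0..1}"
      by simp
    have "1 / w * (1 - exp (2 * of_real pi * \<i> * of_real x) / (exp (2 * of_real pi * \<i> * of_real x) + w / z)) =
        1 / (w + z * exp (2 * of_real pi * \<i> * of_real x))" for x :: real
    proof -
      define e where "e = exp (2 * of_real pi * \<i> * of_real x)"
      have "w + z * e \<noteq> 0"
      proof
        assume "w + z * e = 0"
        then have "cmod w = cmod (z * e)" by (metis add.inverse_unique norm_minus_cancel)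
        then show False using zw norm_e[of x] by (simp add: norm_mult e_def)
      qed
      moreover from this have "e + w / z \<noteq> 0" using z by (auto simp: field_simps)
      ultimately show ?thesis unfolding e_def[symmetric] using w z by (simp add: field_simps)
    qed
    then show ?thesis using i False by simp
  qed
qed

lemma continuous_circle_inverse:
  fixes w z :: complex
  assumes wz: "cmod w \<noteq> cmod z"
  shows "continuous_on S (\<lambda>x. 1 / (w + z * exp (2 * of_real pi * \<i> * of_real x)))"
proof -
  have "w + z * exp (2 * of_real pi * \<i> * of_real x) \<noteq> 0" for x :: real
  proof
    assume "w + z * exp (2 * of_real pi * \<i> * of_real x) = 0"
    then have "cmod w = cmod (z * exp (2 * of_real pi * \<i> * of_real x))"
      by (metis add.inverse_unique norm_minus_cancel)
    then show False using wz by (simp add: norm_mult)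
  qed
  then show ?thesis by (intro continuous_intros) auto
qed

lemma LINT_circle_inverse:
  fixes w z :: complex
  assumes w: "w \<noteq> 0" and wz: "cmod w \<noteq> cmod z"
  shows "(LINT x:{0..1}|lborel. 1 / (w + z * exp (2 * of_real pi * \<i> * of_real x))) =
      (if cmod z < cmod w then 1 / w else 0)"
  using set_borel_integral_eq_integral(2)[OF borel_integrable_atLeastAtMost'[OF continuous_circle_inverse[OF wz]]]
    has_integral_circle_inverse[OF w wz] by (simp add: integral_unique)

text \<open>Circles centred at 0 are null because the squared modulus has a density. This discards
  the one radius at which the pole lies on the path of integration.\<close>

lemma AE_std_complex_gaussian_norm_neq: "AE z in std_complex_gaussian. cmod z \<noteq> a"
proof -
  have "AE u in density lborel (exponential_density 1). u \<noteq> a\<^sup>2"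
    using AE_lborel_singleton[of "a\<^sup>2"] by (subst AE_density) (auto elim: eventually_mono)
  then have "AE z in std_complex_gaussian. (cmod z)\<^sup>2 \<noteq> a\<^sup>2"
    unfolding distr_norm_square_std_complex_gaussian[symmetric]
    by (subst (asm) AE_distr_iff) auto
  then show ?thesis by (auto elim: eventually_mono)
qed

lemma integral_std_complex_gaussian_rotate:
  fixes h :: "complex \<Rightarrow> 'b::{banach, second_countable_topology}"
  assumes [measurable]: "h \<in> borel_measurable borel" and c: "cmod c = 1"
  shows "(LINT z|std_complex_gaussian. h (c * z)) = (LINT z|std_complex_gaussian. h z)"
proof -
  have "(LINT z|distr std_complex_gaussian borel (\<lambda>z. c * z). h z) = (LINT z|std_complex_gaussian. h (c * z))"
    by (subst integral_distr) auto
  then show ?thesis by (simp add: std_complex_gaussian_rotate[OF c])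
qed

lemma integrable_std_complex_gaussian_rotate:
  fixes h :: "complex \<Rightarrow> 'b::{banach, second_countable_topology}"
  assumes [measurable]: "h \<in> borel_measurable borel" and c: "cmod c = 1"
  shows "integrable std_complex_gaussian (\<lambda>z. h (c * z)) \<longleftrightarrow> integrable std_complex_gaussian h"
proof -
  have "integrable (distr std_complex_gaussian borel (\<lambda>z. c * z)) h \<longleftrightarrow> integrable std_complex_gaussian (\<lambda>z. h (c * z))"
    by (subst integrable_distr_eq) auto
  then show ?thesis by (simp add: std_complex_gaussian_rotate[OF c])
qed

text \<open>Used with \<open>c = -1\<close> for odd functions and with \<open>c = \<i>\<close> for
  functions of angular degree two or minus two.\<close>

lemma integral_std_complex_gaussian_odd:
  fixes h :: "complex \<Rightarrow> complex"
  assumes "h \<in> borel_measurable borel" "cmod c = 1" "\<And>z. h (c * z) = - h z"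
  shows "(LINT z|std_complex_gaussian. h z) = 0"
  using integral_std_complex_gaussian_rotate[OF assms(1,2)] assms(3) by simp

text \<open>By rotation invariance the integrand may be averaged over circles centred at \<open>0\<close>.\<close>

lemma integral_std_complex_gaussian_radial_inverse:
  fixes w :: complex and \<psi> :: "real \<Rightarrow> real"
  assumes w: "w \<noteq> 0" and s: "s > 0" and [measurable]: "\<psi> \<in> borel_measurable borel"
    and int: "integrable std_complex_gaussian (\<lambda>z. of_real (\<psi> (cmod z)) / (w + of_real s * z))"
  shows "(LINT z|std_complex_gaussian. of_real (\<psi> (cmod z)) / (w + of_real s * z)) =
    (1 / w) * of_real (LINT z|std_complex_gaussian. \<psi> (cmod z) * indicator {..<cmod w} (s * cmod z))"
proof -
  define \<Theta> where "\<Theta> = density lborel (\<lambda>x::real. ennreal (indicator {0..1} x))"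
  define e where "e x = exp (2 * of_real pi * \<i> * of_real x)" for x :: real
  have [measurable]: "e \<in> borel_measurable borel"
    unfolding e_def by (intro borel_measurable_continuous_onI continuous_intros)
  have norm_e: "cmod (e x) = 1" for x by (simp add: e_def)
  interpret \<Theta>: prob_space \<Theta>
  proof
    have "emeasure \<Theta> (space \<Theta>) = (\<integral>\<^sup>+ x. indicator {0..1::real} x \<partial>lborel)"
      unfolding \<Theta>_def by (subst emeasure_density) (simp_all add: ennreal_indicator)
    also have "\<dots> = emeasure lborel {0..1::real}" by (rule nn_integral_indicator) simp
    also have "\<dots> = 1" by simp
    finally show "emeasure \<Theta> (space \<Theta>) = 1" .
  qed
  have [measurable_cong]: "sets \<Theta> = sets borel" by (simp add: \<Theta>_def)
  interpret P: pair_prob_space \<Theta> std_complex_gaussian ..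
  define h where "h z = of_real (\<psi> (cmod z)) / (w + of_real s * z)" for z
  have [measurable]: "h \<in> borel_measurable borel" unfolding h_def by measurable
  have inth: "integrable std_complex_gaussian h" using int unfolding h_def[abs_def] .
  have rot: "(LINT z|std_complex_gaussian. h (e x * z)) = (LINT z|std_complex_gaussian. h z)" for x
    by (rule integral_std_complex_gaussian_rotate) (auto simp: norm_e)
  have rotn: "(LINT z|std_complex_gaussian. norm (h (e x * z))) = (LINT z|std_complex_gaussian. norm (h z))" for x
    by (rule integral_std_complex_gaussian_rotate) (auto simp: norm_e)
  have roti: "integrable std_complex_gaussian (\<lambda>z. h (e x * z))" for x
    using inth by (subst integrable_std_complex_gaussian_rotate) (auto simp: norm_e)
  \<comment> \<open>Rotation invariance makes the inner integrals of the norm independent of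
    \<open>x\<close>, so joint integrability in the angle and \<open>z\<close> follows from the
    single integrability assumed.\<close>
  have ip: "integrable (\<Theta> \<Otimes>\<^sub>M std_complex_gaussian) (\<lambda>(x, z). h (e x * z))"
    by (rule P.Fubini_integrable) (auto simp: rotn roti)
  have "(LINT z|std_complex_gaussian. h z) = (LINT x|\<Theta>. LINT z|std_complex_gaussian. h (e x * z))"
    by (simp add: rot \<Theta>.prob_space)
  also have "\<dots> = (LINT z|std_complex_gaussian. LINT x|\<Theta>. h (e x * z))"
    using P.Fubini_integral[OF ip] by simp
  also have "\<dots> = (LINT z|std_complex_gaussian. (1 / w) * of_real (\<psi> (cmod z) * indicator {..<cmod w} (s * cmod z)))"
  proof (rule integral_cong_AE)
    \<comment> \<open>The circle average is applied to \<open>w\<close> and \<open>s * z\<close>,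
      off the null radius \<open>|w| / s\<close>.\<close>
    show "AE z in std_complex_gaussian. (LINT x|\<Theta>. h (e x * z)) =
        (1 / w) * of_real (\<psi> (cmod z) * indicator {..<cmod w} (s * cmod z))"
      using AE_std_complex_gaussian_norm_neq[of "cmod w / s"]
    proof eventually_elim
      fix z assume "cmod z \<noteq> cmod w / s"
      then have ne: "cmod w \<noteq> cmod (of_real s * z)"
        using s by (auto simp: norm_mult field_simps)
      have "(LINT x|\<Theta>. h (e x * z)) = (LINT x:{0..1}|lborel. h (e x * z))"
        unfolding \<Theta>_def set_lebesgue_integral_def by (subst integral_density) auto
      also have "\<dots> = (LINT x:{0..1}|lborel. of_real (\<psi> (cmod z)) * (1 / (w + (of_real s * z) * e x)))"
        unfolding set_lebesgue_integral_def by (simp add: h_def norm_mult norm_e mult_ac)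
      also have "\<dots> = of_real (\<psi> (cmod z)) * (if cmod (of_real s * z) < cmod w then 1 / w else 0)"
        unfolding LINT_circle_inverse[OF w ne, symmetric]
        by (simp only: e_def set_lebesgue_integral_def mult_scaleR_right[symmetric] integral_mult_right_zero)
      also have "\<dots> = (1 / w) * of_real (\<psi> (cmod z) * indicator {..<cmod w} (s * cmod z))"
        using s by (simp add: norm_mult indicator_def)
      finally show "(LINT x|\<Theta>. h (e x * z)) = (1 / w) * of_real (\<psi> (cmod z) * indicator {..<cmod w} (s * cmod z))" .
    qed
  qed measurable
  also have "\<dots> = (1 / w) * of_real (LINT z|std_complex_gaussian. \<psi> (cmod z) * indicator {..<cmod w} (s * cmod z))"
    by (simp only: integral_mult_right_zero integral_complex_of_real)
  finally show ?thesis by (simp add: h_def)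
qed


section \<open>Moments, and radial integrals over two independent Gaussians\<close>

lemma nn_integral_std_complex_gaussian_power:
  "(\<integral>\<^sup>+ z. ennreal (cmod z ^ (2 * n)) \<partial>std_complex_gaussian) = ennreal (fact n)"
proof -
  have "(\<integral>\<^sup>+ z. ennreal (((cmod z)\<^sup>2) ^ n) \<partial>std_complex_gaussian) =
      (\<integral>\<^sup>+ u. ennreal (exp (- u)) * indicator {0<..} u * ennreal (u ^ n) \<partial>lborel)"
    by (subst nn_integral_std_complex_gaussian_radial) auto
  also have "\<dots> = (\<integral>\<^sup>+ u. ennreal (u ^ n * exp (- (1 * u))) * indicator {0<..} u \<partial>lborel)"
    by (intro nn_integral_cong) (auto simp: indicator_def ennreal_mult'[symmetric] mult_ac)
  also have "\<dots> = ennreal (fact n)"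
    by (subst nn_integral_power_exp) auto
  finally show ?thesis by (simp add: power_mult)
qed

lemma integrable_std_complex_gaussian_power:
  "integrable std_complex_gaussian (\<lambda>z. cmod z ^ (2 * n))"
  using nn_integral_std_complex_gaussian_power[of n] by (intro integrableI_nonneg) auto

lemma integral_std_complex_gaussian_power:
  "(LINT z|std_complex_gaussian. cmod z ^ (2 * n)) = fact n"
  using nn_integral_std_complex_gaussian_power[of n] by (subst integral_eq_nn_integral) auto

lemma integrable_std_complex_gaussian_id: "integrable std_complex_gaussian (\<lambda>z. z)"
proof (rule Bochner_Integration.integrable_bound)
  show "integrable std_complex_gaussian (\<lambda>z. 1 + cmod z ^ (2 * 1))"
    using integrable_std_complex_gaussian_power[of 1] by simp
  have "cmod z \<le> 1 + (cmod z)\<^sup>2" for z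
    using zero_le_power2[of "cmod z - 1"] norm_ge_zero[of z] unfolding power2_diff by (simp del: norm_ge_zero)
  then show "AE z in std_complex_gaussian. norm z \<le> norm (1 + cmod z ^ (2 * 1))"
    by simp
qed auto

lemma integral_two_gaussians_radial:
  assumes k: "k \<noteq> (0::complex)" and s: "s > 0"
  shows "(LINT w|std_complex_gaussian. (LINT z|std_complex_gaussian.
      cmod z ^ (2 * n) * indicator {..<cmod (k * w)} (s * cmod z)) / (cmod w)\<^sup>2) =
    enn2real (\<integral>\<^sup>+ y. ennreal (fact n * y ^ n / (1 + y) ^ Suc n) * indicator {0..(cmod k / s)\<^sup>2} y \<partial>lborel)"
proof -
  let ?g = "\<lambda>w. (LINT z|std_complex_gaussian. cmod z ^ (2 * n) * indicator {..<cmod (k * w)} (s * cmod z)) / (cmod w)\<^sup>2"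
  have "integral\<^sup>L std_complex_gaussian ?g = enn2real (\<integral>\<^sup>+ w. ennreal (?g w) \<partial>std_complex_gaussian)"
  proof (rule integral_eq_nn_integral)
    have "(\<lambda>w. LINT z|std_complex_gaussian. cmod z ^ (2 * n) * of_bool (s * cmod z < cmod (k * w))) \<in> borel_measurable borel"
      by measurable
    moreover have "(indicator {..<cmod (k * w)} (s * cmod z) :: real) = of_bool (s * cmod z < cmod (k * w))" for w z
      by (auto simp: indicator_def)
    ultimately show "?g \<in> borel_measurable std_complex_gaussian"
      by simp
  qed (auto intro!: divide_nonneg_nonneg integral_nonneg)
  also have "(\<integral>\<^sup>+ w. ennreal (?g w) \<partial>std_complex_gaussian) =
      (\<integral>\<^sup>+ w. \<integral>\<^sup>+ z. ennreal (indicator {..<(cmod k / s)\<^sup>2 * (cmod w)\<^sup>2} ((cmod z)\<^sup>2) * (cmod z) ^ (2 * n) / (cmod w)\<^sup>2)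
        \<partial>std_complex_gaussian \<partial>std_complex_gaussian)"
  proof (intro nn_integral_cong)
    fix w :: complex
    \<comment> \<open>The event compares \<open>|z|^2\<close> with \<open>c * |w|^2\<close> for
      \<open>c = (|k| / s)^2\<close>, which is the cut-off of the ratio lemma.\<close>
    have iff: "s * cmod z < cmod (k * w) \<longleftrightarrow> (cmod z)\<^sup>2 < (cmod k / s)\<^sup>2 * (cmod w)\<^sup>2" for z
    proof -
      have "s * cmod z < cmod (k * w) \<longleftrightarrow> cmod z < cmod k / s * cmod w"
        using s by (simp add: norm_mult field_simps)
      also have "\<dots> \<longleftrightarrow> (cmod z)\<^sup>2 < (cmod k / s * cmod w)\<^sup>2"
        using s by (auto intro: power_strict_mono power2_less_imp_less)
      finally show ?thesis by (simp add: power_mult_distrib power_divide)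
    qed
    have int: "integrable std_complex_gaussian (\<lambda>z. cmod z ^ (2 * n) * indicator {..<cmod (k * w)} (s * cmod z) / (cmod w)\<^sup>2)"
      by (intro integrable_divide Bochner_Integration.integrable_bound[OF integrable_std_complex_gaussian_power[of n]])
        (auto simp: indicator_def)
    have "?g w = (LINT z|std_complex_gaussian. cmod z ^ (2 * n) * indicator {..<cmod (k * w)} (s * cmod z) / (cmod w)\<^sup>2)"
      by simp
    then have "ennreal (?g w) = (\<integral>\<^sup>+ z. ennreal (cmod z ^ (2 * n) * indicator {..<cmod (k * w)} (s * cmod z) / (cmod w)\<^sup>2) \<partial>std_complex_gaussian)"
      using int by (subst nn_integral_eq_integral) auto
    also have "\<dots> = (\<integral>\<^sup>+ z. ennreal (indicator {..<(cmod k / s)\<^sup>2 * (cmod w)\<^sup>2} ((cmod z)\<^sup>2) * (cmod z) ^ (2 * n) / (cmod w)\<^sup>2) \<partial>std_complex_gaussian)"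
      by (intro nn_integral_cong) (simp add: indicator_def iff mult.commute)
    finally show "ennreal (?g w) = (\<integral>\<^sup>+ z. ennreal (indicator {..<(cmod k / s)\<^sup>2 * (cmod w)\<^sup>2} ((cmod z)\<^sup>2) * (cmod z) ^ (2 * n) / (cmod w)\<^sup>2) \<partial>std_complex_gaussian)" .
  qed
  also have "\<dots> = (\<integral>\<^sup>+ y. ennreal (fact n * y ^ n / (1 + y) ^ Suc n) * indicator {0..(cmod k / s)\<^sup>2} y \<partial>lborel)"
    using k s by (intro nn_integral_two_gaussians_ratio) auto
  finally show ?thesis .
qed

text \<open>Since \<open>|k|^2 + s^2 = 1\<close>, the cut-off \<open>c = (|k| / s)^2\<close>
  satisfies \<open>1 + c = 1 / s^2\<close>: the logarithm of the kernel is the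
  \<open>ln (1 + c)\<close> of the ratio lemma.\<close>

lemma integral_two_gaussians_radial_0:
  assumes k: "k \<noteq> (0::complex)" and s: "s > 0" and ks: "(cmod k)\<^sup>2 + s\<^sup>2 = 1"
  shows "(LINT w|std_complex_gaussian. (LINT z|std_complex_gaussian.
      indicator {..<cmod (k * w)} (s * cmod z)) / (cmod w)\<^sup>2) = ln (1 / s\<^sup>2)"
proof -
  let ?c = "(cmod k / s)\<^sup>2"
  have c: "?c > 0" "1 + ?c = 1 / s\<^sup>2"
    using k s ks by (auto simp: power_divide field_simps)
  have "(\<integral>\<^sup>+ y. ennreal (1 / (1 + y)) * indicator {0..?c} y \<partial>lborel) = ennreal (ln (1 / s\<^sup>2))"
    using nn_integral_two_gaussians_ratio[OF c(1), of 0] nn_integral_two_gaussians_ratio_0[OF c(1)]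
    unfolding c(2) by simp
  moreover have "ln (1 / s\<^sup>2) \<ge> 0" unfolding c(2)[symmetric] using c(1) by simp
  ultimately show ?thesis
    using integral_two_gaussians_radial[OF k s, of 0] by simp
qed

lemma integral_two_gaussians_radial_1:
  assumes k: "k \<noteq> (0::complex)" and s: "s > 0" and ks: "(cmod k)\<^sup>2 + s\<^sup>2 = 1"
  shows "(LINT w|std_complex_gaussian. (LINT z|std_complex_gaussian.
      (cmod z)\<^sup>2 * indicator {..<cmod (k * w)} (s * cmod z)) / (cmod w)\<^sup>2) = ln (1 / s\<^sup>2) - (cmod k)\<^sup>2"
proof -
  let ?c = "(cmod k / s)\<^sup>2"
  have c: "?c > 0" "1 + ?c = 1 / s\<^sup>2"
    using k s ks by (auto simp: power_divide field_simps)
  have cc: "?c / (1 + ?c) = (cmod k)\<^sup>2"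
    unfolding c(2) using s by (simp add: power_divide)
  have "(\<integral>\<^sup>+ y. ennreal (y / (1 + y)\<^sup>2) * indicator {0..?c} y \<partial>lborel) = ennreal (ln (1 / s\<^sup>2) - (cmod k)\<^sup>2)"
    using nn_integral_two_gaussians_ratio[OF c(1), of 1] nn_integral_two_gaussians_ratio_1[OF c(1)]
    unfolding cc unfolding c(2) by (simp add: power2_eq_square)
  moreover have "ln (1 / s\<^sup>2) - (cmod k)\<^sup>2 \<ge> 0"
    using ln_le_minus_one[of "s\<^sup>2"] s ks by (simp add: ln_div)
  ultimately show ?thesis
    using integral_two_gaussians_radial[OF k s, of 1] by (simp add: power2_eq_square)
qed

lemma AE_std_complex_gaussian_neq_0: "AE z in std_complex_gaussian. z \<noteq> 0"
  using AE_std_complex_gaussian_norm_neq[of 0] by simp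

interpretation std_pair: pair_prob_space std_complex_gaussian std_complex_gaussian ..

text \<open>\<open>k * w + s * z\<close> models the second value of the process given the first
  value \<open>w\<close>, with \<open>z\<close> the normalized residual. Averaging over
  \<open>z\<close> leaves \<open>1 / (k * w)\<close> on the event \<open>s * |z| < |k * w|\<close>;
  together with \<open>1 / cnj w\<close> this makes the remaining integral radial. For
  \<open>k = 0\<close> both sides vanish, the left one by symmetry and the right one as a division
  by zero.\<close>

lemma integral_two_gaussians_inverse:
  assumes ks: "(cmod k)\<^sup>2 + s\<^sup>2 = 1" and s: "s > 0"
    and int: "integrable (std_complex_gaussian \<Otimes>\<^sub>M std_complex_gaussian)
      (\<lambda>(w, z). 1 / (cnj w * (k * w + of_real s * z)))"
  shows "(LINT p|(std_complex_gaussian \<Otimes>\<^sub>M std_complex_gaussian).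
      (case p of (w, z) \<Rightarrow> 1 / (cnj w * (k * w + of_real s * z)))) = of_real (ln (1 / s\<^sup>2)) / k"
proof (cases "k = 0")
  case True
  have "(LINT z|std_complex_gaussian. 1 / (cnj w * (of_real s * z))) = 0" for w
    by (rule integral_std_complex_gaussian_odd[where c="-1"]) auto
  then show ?thesis
    using std_pair.integral_fst'[OF int] True by simp
next
  case k: False
  let ?I = "\<lambda>w. LINT z|std_complex_gaussian. indicator {..<cmod (k * w)} (s * cmod z)"
  have "(LINT z|std_complex_gaussian. 1 / (cnj w * (k * w + of_real s * z))) = 1 / k * of_real (?I w / (cmod w)\<^sup>2)"
    if i: "integrable std_complex_gaussian (\<lambda>z. 1 / (cnj w * (k * w + of_real s * z)))" and w: "w \<noteq> 0" for w
  proof -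
    have "integrable std_complex_gaussian (\<lambda>z. of_real 1 / (k * w + of_real s * z))"
      using integrable_mult_right[OF i, of "cnj w"] w by simp
    from integral_std_complex_gaussian_radial_inverse[OF _ s _ this]
    have "(LINT z|std_complex_gaussian. 1 / (k * w + of_real s * z)) = 1 / (k * w) * of_real (?I w)"
      using k w by simp
    moreover have "(LINT z|std_complex_gaussian. 1 / (cnj w * (k * w + of_real s * z))) =
        (LINT z|std_complex_gaussian. (1 / cnj w) * (1 / (k * w + of_real s * z)))"
      by simp
    ultimately have "(LINT z|std_complex_gaussian. 1 / (cnj w * (k * w + of_real s * z))) =
        (1 / cnj w) * (1 / (k * w) * of_real (?I w))"
      by (simp only: integral_mult_right_zero)
    also have "\<dots> = 1 / k * (of_real (?I w) / (w * cnj w))"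
      by simp
    finally show ?thesis unfolding complex_norm_square[symmetric] by simp
  qed
  then have "(LINT w|std_complex_gaussian. LINT z|std_complex_gaussian. 1 / (cnj w * (k * w + of_real s * z))) =
      (LINT w|std_complex_gaussian. 1 / k * of_real (?I w / (cmod w)\<^sup>2))"
    using std_pair.AE_integrable_fst'[OF int] AE_std_complex_gaussian_neq_0
    by (intro Bochner_Integration.integral_cong_AE) (auto elim!: eventually_elim2 simp: indicator_def)
  also have "\<dots> = of_real (ln (1 / s\<^sup>2)) / k"
    using integral_two_gaussians_radial_0[OF k s ks]
    by (simp only: integral_mult_right_zero integral_complex_of_real) simp
  finally show ?thesis
    using std_pair.integral_fst'[OF int] by simp
qed

text \<open>The circle average handles only radial numerators, so \<open>cnj z\<close> is traded for
  \<open>|z|^2\<close> through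
  \<open>s * |z|^2 / (W + s * z) = cnj z - W * cnj z / (W + s * z)\<close> with
  \<open>W = k * w\<close>, where \<open>cnj z\<close> has mean 0.\<close>

lemma integral_two_gaussians_cnj_ratio:
  assumes ks: "(cmod k)\<^sup>2 + s\<^sup>2 = 1" and s: "s > 0"
    and int: "integrable (std_complex_gaussian \<Otimes>\<^sub>M std_complex_gaussian)
      (\<lambda>(w, z). cnj z * w / (cnj w * (k * w + of_real s * z)))"
  shows "(LINT p|(std_complex_gaussian \<Otimes>\<^sub>M std_complex_gaussian).
      (case p of (w, z) \<Rightarrow> cnj z * w / (cnj w * (k * w + of_real s * z)))) =
      - (of_real s / k\<^sup>2) * of_real (ln (1 / s\<^sup>2) - (cmod k)\<^sup>2)"
proof (cases "k = 0")
  case True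
  have "(LINT z|std_complex_gaussian. cnj z * w / (cnj w * (of_real s * z))) = 0" for w
  \<comment> \<open>\<open>cnj z / z\<close> has angular degree -2, so a quarter turn changes its
    sign.\<close>
  proof (rule integral_std_complex_gaussian_odd[where c=\<i>])
    fix z
    have "cnj (\<i> * z) = - \<i> * cnj z" by simp
    then show "cnj (\<i> * z) * w / (cnj w * (of_real s * (\<i> * z))) = - (cnj z * w / (cnj w * (of_real s * z)))"
      by (simp only:) simp
  qed auto
  then show ?thesis
    using std_pair.integral_fst'[OF int] True by simp
next
  case k: False
  let ?I = "\<lambda>w. LINT z|std_complex_gaussian. (cmod z)\<^sup>2 * indicator {..<cmod (k * w)} (s * cmod z)"
  have cnj0: "(LINT z|std_complex_gaussian. cnj z) = 0"
    by (rule integral_std_complex_gaussian_odd[where c="-1"]) auto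
  have icnj: "integrable std_complex_gaussian cnj"
    using integrable_std_complex_gaussian_id by (simp add: complex_integrable_cnj)
  have "(LINT z|std_complex_gaussian. cnj z * w / (cnj w * (k * w + of_real s * z))) =
      - (of_real s / k\<^sup>2) * of_real (?I w / (cmod w)\<^sup>2)"
    if i: "integrable std_complex_gaussian (\<lambda>z. cnj z * w / (cnj w * (k * w + of_real s * z)))" and w: "w \<noteq> 0" for w
  proof -
    define W where "W = k * w"
    have W: "W \<noteq> 0" using k w by (simp add: W_def)
    define J where "J = (LINT z|std_complex_gaussian. cnj z / (W + of_real s * z))"
    have i': "integrable std_complex_gaussian (\<lambda>z. cnj z / (W + of_real s * z))"
    proof -
      have "(cnj w / w) * (cnj z * w / (cnj w * (k * w + of_real s * z))) = cnj z / (W + of_real s * z)" for z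
        using w by (simp add: W_def)
      then show ?thesis using integrable_mult_right[OF i, of "cnj w / w"] by (simp only:)
    qed
    have ae: "AE z in std_complex_gaussian. of_real ((cmod z)\<^sup>2) / (W + of_real s * z) =
        (1 / of_real s) * cnj z - (W / of_real s) * (cnj z / (W + of_real s * z))"
      using AE_std_complex_gaussian_norm_neq[of "cmod W / s"]
    proof eventually_elim
      fix z assume z: "cmod z \<noteq> cmod W / s"
      have "W + of_real s * z \<noteq> 0"
      proof
        assume "W + of_real s * z = 0"
        then have "cmod W = cmod (of_real s * z)" by (metis add.inverse_unique norm_minus_cancel)
        then show False using z s by (simp add: norm_mult)
      qed
      then show "of_real ((cmod z)\<^sup>2) / (W + of_real s * z) =
        (1 / of_real s) * cnj z - (W / of_real s) * (cnj z / (W + of_real s * z))"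
        using s unfolding complex_norm_square by (simp add: divide_simps) (simp add: algebra_simps)
    qed
    have i2: "integrable std_complex_gaussian (\<lambda>z. (1 / of_real s) * cnj z - (W / of_real s) * (cnj z / (W + of_real s * z)))"
      by (intro Bochner_Integration.integrable_diff integrable_mult_right icnj i')
    have i3: "integrable std_complex_gaussian (\<lambda>z. of_real ((cmod z)\<^sup>2) / (W + of_real s * z))"
      using i2 by (rule integrable_cong_AE_imp) (use ae in \<open>auto elim: eventually_mono\<close>)
    have "1 / W * of_real (?I w) = (LINT z|std_complex_gaussian. of_real ((cmod z)\<^sup>2) / (W + of_real s * z))"
      using integral_std_complex_gaussian_radial_inverse[OF W s _ i3] by (simp add: W_def)
    also have "\<dots> = (LINT z|std_complex_gaussian. (1 / of_real s) * cnj z - (W / of_real s) * (cnj z / (W + of_real s * z)))"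
      by (rule integral_cong_AE) (use ae in auto)
    also have "\<dots> = - (W / of_real s) * J"
      using Bochner_Integration.integral_diff[OF integrable_mult_right[OF icnj, of "1 / of_real s"]
          integrable_mult_right[OF i', of "W / of_real s"]]
      by (simp only: integral_mult_right_zero cnj0) (simp add: J_def)
    finally have "J = - (of_real s / W\<^sup>2) * of_real (?I w)"
      using W s by (simp add: field_simps power2_eq_square)
    moreover have "(LINT z|std_complex_gaussian. cnj z * w / (cnj w * (k * w + of_real s * z))) = (w / cnj w) * J"
    proof -
      have "cnj z * w / (cnj w * (k * w + of_real s * z)) = (w / cnj w) * (cnj z / (W + of_real s * z))" for z
        by (simp add: W_def)
      then show ?thesis unfolding J_def by (simp only: integral_mult_right_zero)
    qed
    ultimately have "(LINT z|std_complex_gaussian. cnj z * w / (cnj w * (k * w + of_real s * z))) =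
        - (of_real s / k\<^sup>2) * (of_real (?I w) / (w * cnj w))"
      using w k by (simp add: W_def field_simps power2_eq_square)
    then show ?thesis unfolding complex_norm_square[symmetric] by simp
  qed
  then have "(LINT w|std_complex_gaussian. LINT z|std_complex_gaussian. cnj z * w / (cnj w * (k * w + of_real s * z))) =
      (LINT w|std_complex_gaussian. - (of_real s / k\<^sup>2) * of_real (?I w / (cmod w)\<^sup>2))"
    using std_pair.AE_integrable_fst'[OF int] AE_std_complex_gaussian_neq_0
    by (intro Bochner_Integration.integral_cong_AE) (auto elim!: eventually_elim2 simp: indicator_def)
  also have "\<dots> = - (of_real s / k\<^sup>2) * of_real (ln (1 / s\<^sup>2) - (cmod k)\<^sup>2)"
    using integral_two_gaussians_radial_1[OF k s ks]
    by (simp only: integral_mult_right_zero integral_complex_of_real)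
  finally show ?thesis
    using std_pair.integral_fst'[OF int] by simp
qed

section \<open>Gaussian spaces\<close>

text \<open>\<open>q\<close> is the second moment \<open>E |Z|^2\<close>. Since the law is an image
  of the standard one, \<open>q = 0\<close> is included and a variable that vanishes almost surely
  counts as circular Gaussian.\<close>

definition circular_gaussian :: "'a measure \<Rightarrow> ('a \<Rightarrow> complex) \<Rightarrow> real \<Rightarrow> bool" where
  "circular_gaussian M Z q \<longleftrightarrow> Z \<in> borel_measurable M \<and> 0 \<le> q \<and>
     distr M borel Z = distr std_complex_gaussian borel (\<lambda>z. of_real (sqrt q) * z)"

lemma circular_gaussian_measurable:
  "circular_gaussian M Z q \<Longrightarrow> Z \<in> borel_measurable M"
  by (simp add: circular_gaussian_def)

lemma circular_gaussian_integral:
  fixes h :: "complex \<Rightarrow> 'b::{banach, second_countable_topology}"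
  assumes "circular_gaussian M Z q" and [measurable]: "h \<in> borel_measurable borel"
  shows "(LINT \<omega>|M. h (Z \<omega>)) = (LINT z|std_complex_gaussian. h (of_real (sqrt q) * z))"
proof -
  have [measurable]: "Z \<in> borel_measurable M" using assms by (simp add: circular_gaussian_def)
  have "(LINT \<omega>|M. h (Z \<omega>)) = (LINT z|distr M borel Z. h z)" by (simp add: integral_distr)
  also have "\<dots> = (LINT z|std_complex_gaussian. h (of_real (sqrt q) * z))"
    using assms unfolding circular_gaussian_def by (simp add: integral_distr)
  finally show ?thesis .
qed

lemma circular_gaussian_integrable:
  fixes h :: "complex \<Rightarrow> 'b::{banach, second_countable_topology}"
  assumes "circular_gaussian M Z q" and [measurable]: "h \<in> borel_measurable borel"
  shows "integrable M (\<lambda>\<omega>. h (Z \<omega>)) \<longleftrightarrow> integrable std_complex_gaussian (\<lambda>z. h (of_real (sqrt q) * z))"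
proof -
  have [measurable]: "Z \<in> borel_measurable M" using assms by (simp add: circular_gaussian_def)
  have "integrable M (\<lambda>\<omega>. h (Z \<omega>)) \<longleftrightarrow> integrable (distr M borel Z) h"
    by (subst integrable_distr_eq) auto
  also have "\<dots> \<longleftrightarrow> integrable std_complex_gaussian (\<lambda>z. h (of_real (sqrt q) * z))"
    using assms unfolding circular_gaussian_def by (simp add: integrable_distr_eq)
  finally show ?thesis .
qed

lemma circular_gaussian_AE:
  assumes "circular_gaussian M Z q" and [measurable]: "Measurable.pred borel P"
  shows "(AE \<omega> in M. P (Z \<omega>)) \<longleftrightarrow> (AE z in std_complex_gaussian. P (of_real (sqrt q) * z))"
proof -
  have [measurable]: "Z \<in> borel_measurable M" using assms by (simp add: circular_gaussian_def)
  have "(AE \<omega> in M. P (Z \<omega>)) \<longleftrightarrow> (AE z in distr M borel Z. P z)"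
    by (subst AE_distr_iff) auto
  also have "\<dots> \<longleftrightarrow> (AE z in std_complex_gaussian. P (of_real (sqrt q) * z))"
  proof -
    have "distr M borel Z = distr std_complex_gaussian borel (\<lambda>z. of_real (sqrt q) * z)"
      using assms unfolding circular_gaussian_def by blast
    then show ?thesis by (simp only:) (subst AE_distr_iff, auto)
  qed
  finally show ?thesis .
qed

lemma circular_gaussian_char:
  assumes "circular_gaussian M Z q"
  shows "(LINT \<omega>|M. iexp (\<xi> \<bullet> Z \<omega>)) = exp (- q * (cmod \<xi>)\<^sup>2 / 4)"
proof -
  have q: "q \<ge> 0" using assms by (simp add: circular_gaussian_def)
  have "(LINT \<omega>|M. iexp (\<xi> \<bullet> Z \<omega>)) = (LINT z|std_complex_gaussian. iexp (\<xi> \<bullet> (of_real (sqrt q) * z)))"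
    by (rule circular_gaussian_integral[OF assms]) measurable
  also have "\<dots> = exp (- q * (cmod \<xi>)\<^sup>2 / 4)"
    unfolding inner_mult_complex char_std_complex_gaussian using q
    by (simp add: norm_mult power_mult_distrib)
  finally show ?thesis .
qed

lemma circular_gaussianI:
  assumes M: "prob_space M" and [measurable]: "Z \<in> borel_measurable M" and q: "q \<ge> 0"
    and char: "\<And>\<xi>. (LINT \<omega>|M. iexp (\<xi> \<bullet> Z \<omega>)) = exp (- q * (cmod \<xi>)\<^sup>2 / 4)"
  shows "circular_gaussian M Z q"
  unfolding circular_gaussian_def
proof (intro conjI)
  show "distr M borel Z = distr std_complex_gaussian borel (\<lambda>z. of_real (sqrt q) * z)"
  proof (rule distr_eqI_char[OF char_determines_complex M std_complex_gaussian.prob_space_axioms])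
    fix \<xi>
    show "(LINT \<omega>|M. iexp (\<xi> \<bullet> Z \<omega>)) = (LINT z|std_complex_gaussian. iexp (\<xi> \<bullet> (of_real (sqrt q) * z)))"
      unfolding inner_mult_complex char_std_complex_gaussian char using q
      by (simp add: norm_mult power_mult_distrib)
  qed auto
qed (use assms in auto)

lemma circular_gaussian_power:
  assumes "circular_gaussian M Z q"
  shows "integrable M (\<lambda>\<omega>. cmod (Z \<omega>) ^ (2 * n))" "(LINT \<omega>|M. cmod (Z \<omega>) ^ (2 * n)) = q ^ n * fact n"
proof -
  have q: "q \<ge> 0" using assms by (simp add: circular_gaussian_def)
  have eq: "cmod (of_real (sqrt q) * z) ^ (2 * n) = q ^ n * cmod z ^ (2 * n)" for z
  proof -
    have "sqrt q ^ (2 * n) = q ^ n" using q by (simp add: power_mult)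
    then show ?thesis using q by (simp add: norm_mult power_mult_distrib)
  qed
  show "integrable M (\<lambda>\<omega>. cmod (Z \<omega>) ^ (2 * n))"
    by (subst circular_gaussian_integrable[OF assms]) (auto simp: eq integrable_std_complex_gaussian_power)
  show "(LINT \<omega>|M. cmod (Z \<omega>) ^ (2 * n)) = q ^ n * fact n"
    by (subst circular_gaussian_integral[OF assms]) (auto simp: eq integral_std_complex_gaussian_power)
qed

text \<open>\<open>|z|^2\<close> is exponential, so the integral is
  \<open>Gamma (1 - p / 2)\<close>. The critical inverse power 2 corresponds to the pole of Gamma at
  0.\<close>

lemma integrable_std_complex_gaussian_powr:
  assumes p: "0 \<le> p" "p < 2"
  shows "integrable std_complex_gaussian (\<lambda>z. cmod z powr (- p))"
proof (rule integrableI_nonneg)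
  have "(\<integral>\<^sup>+ z. ennreal (cmod z powr (- p)) \<partial>std_complex_gaussian) =
      (\<integral>\<^sup>+ z. ennreal (((cmod z)\<^sup>2) powr (- p / 2)) \<partial>std_complex_gaussian)"
  proof (intro nn_integral_cong)
    fix z :: complex
    have "((cmod z)\<^sup>2) powr (- p / 2) = cmod z powr (- p)"
    proof (cases "z = 0")
      case False
      then have "((cmod z)\<^sup>2) powr (- p / 2) = (cmod z powr 2) powr (- p / 2)" by simp
      also have "\<dots> = cmod z powr (2 * (- p / 2))" by (rule powr_powr)
      finally show ?thesis by simp
    qed simp
    then show "ennreal (cmod z powr (- p)) = ennreal (((cmod z)\<^sup>2) powr (- p / 2))" by simp
  qed
  also have "\<dots> = (\<integral>\<^sup>+ u. ennreal (exp (- u)) * indicator {0<..} u * ennreal (u powr (- p / 2)) \<partial>lborel)"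
    by (subst nn_integral_std_complex_gaussian_radial) auto
  also have "\<dots> = (\<integral>\<^sup>+ u. ennreal (indicator {0..} u * (u powr ((1 - p / 2) - 1) / exp u)) \<partial>lborel)"
    using AE_lborel_singleton[of "0::real"]
    by (intro nn_integral_cong_AE)
      (auto elim!: eventually_mono simp: indicator_def ennreal_mult'[symmetric] exp_minus field_simps)
  also have "\<dots> = ennreal (Gamma (1 - p / 2))"
  proof (rule nn_integral_has_integral_lborel)
    have "((\<lambda>u. u powr ((1 - p / 2) - 1) / exp u) has_integral Gamma (1 - p / 2)) {0..}"
      using p by (intro Gamma_integral_real) simp
    then show "((\<lambda>u. indicator {0..} u * (u powr ((1 - p / 2) - 1) / exp u)) has_integral Gamma (1 - p / 2)) UNIV"
      by (subst (asm) has_integral_restrict_UNIV[symmetric])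
        (auto simp: indicator_def if_distrib cong: if_cong elim!: has_integral_eq[rotated])
  qed auto
  finally show "(\<integral>\<^sup>+ z. ennreal (cmod z powr (- p)) \<partial>std_complex_gaussian) < \<infinity>" by simp
qed auto

lemma circular_gaussian_powr:
  assumes Z: "circular_gaussian M Z q" and p: "0 \<le> p" "p < 2"
  shows "integrable M (\<lambda>\<omega>. cmod (Z \<omega>) powr (- p))"
    "(LINT \<omega>|M. cmod (Z \<omega>) powr (- p)) = sqrt q powr (- p) * (LINT z|std_complex_gaussian. cmod z powr (- p))"
proof -
  have q: "q \<ge> 0" using assms by (simp add: circular_gaussian_def)
  have eq: "cmod (of_real (sqrt q) * z) powr (- p) = sqrt q powr (- p) * cmod z powr (- p)" for z
    using q by (simp add: norm_mult powr_mult)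
  show "integrable M (\<lambda>\<omega>. cmod (Z \<omega>) powr (- p))"
    by (subst circular_gaussian_integrable[OF Z]) (auto simp: eq intro!: integrable_mult_right integrable_std_complex_gaussian_powr p)
  show "(LINT \<omega>|M. cmod (Z \<omega>) powr (- p)) = sqrt q powr (- p) * (LINT z|std_complex_gaussian. cmod z powr (- p))"
    by (subst circular_gaussian_integral[OF Z]) (auto simp: eq)
qed

lemma circular_gaussian_AE_neq_0:
  assumes "circular_gaussian M Z q" "q > 0"
  shows "AE \<omega> in M. Z \<omega> \<noteq> 0"
  using AE_std_complex_gaussian_neq_0 assms(2)
  by (subst circular_gaussian_AE[OF assms(1)]) auto

text \<open>Only one-dimensional laws are assumed. Closure under complex combinations makes every
  joint characteristic function that of a single member, and the joint Gaussian structure follows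
  from this.\<close>

locale gaussian_space = prob_space M for M :: "'a measure" +
  fixes H :: "('a \<Rightarrow> complex) set"
  assumes gaussian: "Z \<in> H \<Longrightarrow> \<exists>q. circular_gaussian M Z q"
    and add_mem: "X \<in> H \<Longrightarrow> Y \<in> H \<Longrightarrow> (\<lambda>\<omega>. X \<omega> + Y \<omega>) \<in> H"
    and scale_mem: "X \<in> H \<Longrightarrow> (\<lambda>\<omega>. c * X \<omega>) \<in> H"
begin

abbreviation cov :: "('a \<Rightarrow> complex) \<Rightarrow> ('a \<Rightarrow> complex) \<Rightarrow> complex" where
  "cov X Y \<equiv> LINT \<omega>|M. X \<omega> * cnj (Y \<omega>)"

lemma mem_measurable: "Z \<in> H \<Longrightarrow> Z \<in> borel_measurable M"
  using gaussian circular_gaussian_measurable by blast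

lemma diff_mem: "X \<in> H \<Longrightarrow> Y \<in> H \<Longrightarrow> (\<lambda>\<omega>. X \<omega> - Y \<omega>) \<in> H"
  using add_mem[of X "\<lambda>\<omega>. (-1) * Y \<omega>"] scale_mem[of Y "-1"] by simp

lemma mem_circular: "Z \<in> H \<Longrightarrow> circular_gaussian M Z (LINT \<omega>|M. (cmod (Z \<omega>))\<^sup>2)"
  using gaussian[of Z] circular_gaussian_power(2)[of M Z _ 1] by auto

lemma mem_power_integrable: "Z \<in> H \<Longrightarrow> integrable M (\<lambda>\<omega>. cmod (Z \<omega>) ^ (2 * n))"
  by (intro circular_gaussian_power(1)[OF mem_circular])

lemma cov_self: "cov Z Z = of_real (LINT \<omega>|M. (cmod (Z \<omega>))\<^sup>2)"
  unfolding complex_norm_square[symmetric] by (rule integral_complex_of_real)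

lemma mem_mult_integrable:
  assumes "X \<in> H" "Y \<in> H"
  shows "integrable M (\<lambda>\<omega>. X \<omega> * Y \<omega>)" "integrable M (\<lambda>\<omega>. X \<omega> * cnj (Y \<omega>))"
proof -
  note [measurable] = assms[THEN mem_measurable]
  have int: "integrable M (\<lambda>\<omega>. (cmod (X \<omega>))\<^sup>2 + (cmod (Y \<omega>))\<^sup>2)"
    using mem_power_integrable[OF assms(1), of 1] mem_power_integrable[OF assms(2), of 1] by simp
  have le: "cmod a * cmod b \<le> (cmod a)\<^sup>2 + (cmod b)\<^sup>2" for a b
    using sum_squares_bound[of "cmod a" "cmod b"] mult_nonneg_nonneg[OF norm_ge_zero norm_ge_zero, of a b]
    by linarith
  show "integrable M (\<lambda>\<omega>. X \<omega> * Y \<omega>)" "integrable M (\<lambda>\<omega>. X \<omega> * cnj (Y \<omega>))"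
    by (rule Bochner_Integration.integrable_bound[OF int]; auto simp: norm_mult intro!: le)+
qed

lemma mem_mean:
  assumes "Z \<in> H"
  shows "(LINT \<omega>|M. Z \<omega>) = 0"
proof -
  have "(LINT z|std_complex_gaussian. of_real a * z) = 0" for a
    by (rule integral_std_complex_gaussian_odd[where c="-1"]) auto
  then show ?thesis
    by (simp only: circular_gaussian_integral[OF mem_circular[OF assms], of "\<lambda>z. z", OF measurable_ident_sets[OF refl]])
qed

lemma mem_integrable:
  assumes "Z \<in> H"
  shows "integrable M Z"
  using circular_gaussian_integrable[OF mem_circular[OF assms], of "\<lambda>z. z", OF measurable_ident_sets[OF refl]]
    integrable_mult_right[OF integrable_std_complex_gaussian_id] by blast

lemma mem_square:
  assumes "Z \<in> H"
  shows "(LINT \<omega>|M. Z \<omega> * Z \<omega>) = 0"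
proof -
  have "(LINT z|std_complex_gaussian. (of_real a * z) * (of_real a * z)) = 0" for a
  proof (rule integral_std_complex_gaussian_odd[where c=\<i>])
    fix z
    have "(of_real a * (\<i> * z)) * (of_real a * (\<i> * z)) = (\<i> * \<i>) * ((of_real a * z) * (of_real a * z))"
      by (simp only: mult_ac)
    then show "(of_real a * (\<i> * z)) * (of_real a * (\<i> * z)) = - ((of_real a * z) * (of_real a * z))"
      by simp
  qed auto
  moreover have "(\<lambda>z::complex. z * z) \<in> borel_measurable borel" by simp
  ultimately show ?thesis
    using circular_gaussian_integral[OF mem_circular[OF assms], of "\<lambda>z. z * z"] by (simp only:)
qed

text \<open>Polarization of \<open>E Z^2 = 0\<close>, which is circularity: products without a
  conjugate drop out, and only covariances with one conjugate remain.\<close>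

lemma mem_mult_mean:
  assumes X: "X \<in> H" and Y: "Y \<in> H"
  shows "(LINT \<omega>|M. X \<omega> * Y \<omega>) = 0"
proof -
  note i = mem_mult_integrable(1)
  have "0 = (LINT \<omega>|M. (X \<omega> + Y \<omega>) * (X \<omega> + Y \<omega>))"
    using mem_square[OF add_mem[OF X Y]] by simp
  also have "\<dots> = (LINT \<omega>|M. X \<omega> * X \<omega> + 2 * (X \<omega> * Y \<omega>) + Y \<omega> * Y \<omega>)"
    by (simp add: algebra_simps)
  also have "\<dots> = (LINT \<omega>|M. X \<omega> * X \<omega>) + 2 * (LINT \<omega>|M. X \<omega> * Y \<omega>) + (LINT \<omega>|M. Y \<omega> * Y \<omega>)"
    using i[OF X X] i[OF X Y] i[OF Y Y] by simp
  finally show ?thesis using mem_square[OF X] mem_square[OF Y] by simp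
qed

lemma cov_cnj: "cov X Y = cnj (cov Y X)"
proof -
  have "cnj (cov Y X) = (LINT \<omega>|M. cnj (Y \<omega> * cnj (X \<omega>)))"
    by (rule integral_bounded_linear'[OF bounded_linear_cnj bounded_linear_cnj, symmetric]) simp
  then show ?thesis by (simp add: mult.commute)
qed

lemma cov_lincomb:
  assumes "X \<in> H" "Y \<in> H" "Z \<in> H"
  shows "cov (\<lambda>\<omega>. X \<omega> + Y \<omega>) Z = cov X Z + cov Y Z" "cov (\<lambda>\<omega>. X \<omega> - Y \<omega>) Z = cov X Z - cov Y Z"
    "cov (\<lambda>\<omega>. c * X \<omega>) Z = c * cov X Z"
    "cov Z (\<lambda>\<omega>. X \<omega> + Y \<omega>) = cov Z X + cov Z Y" "cov Z (\<lambda>\<omega>. X \<omega> - Y \<omega>) = cov Z X - cov Z Y"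
    "cov Z (\<lambda>\<omega>. c * X \<omega>) = cnj c * cov Z X"
proof -
  have a: "c * X \<omega> * cnj (Z \<omega>) = c * (X \<omega> * cnj (Z \<omega>))" "Z \<omega> * cnj (c * X \<omega>) = cnj c * (Z \<omega> * cnj (X \<omega>))" for \<omega>
    by simp_all
  show "cov (\<lambda>\<omega>. c * X \<omega>) Z = c * cov X Z" "cov Z (\<lambda>\<omega>. c * X \<omega>) = cnj c * cov Z X"
    unfolding a by (simp_all only: integral_mult_right_zero)
  note i = mem_mult_integrable(2)
  show "cov (\<lambda>\<omega>. X \<omega> + Y \<omega>) Z = cov X Z + cov Y Z"
    unfolding distrib_right by (intro Bochner_Integration.integral_add i assms)
  show "cov (\<lambda>\<omega>. X \<omega> - Y \<omega>) Z = cov X Z - cov Y Z"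
    unfolding left_diff_distrib by (intro Bochner_Integration.integral_diff i assms)
  show "cov Z (\<lambda>\<omega>. X \<omega> + Y \<omega>) = cov Z X + cov Z Y"
    unfolding complex_cnj_add distrib_left by (intro Bochner_Integration.integral_add i assms)
  show "cov Z (\<lambda>\<omega>. X \<omega> - Y \<omega>) = cov Z X - cov Z Y"
    unfolding complex_cnj_diff right_diff_distrib by (intro Bochner_Integration.integral_diff i assms)
qed

lemma mem_char:
  assumes "Z \<in> H"
  shows "(LINT \<omega>|M. iexp (Re (Z \<omega>))) = exp (- (LINT \<omega>|M. (cmod (Z \<omega>))\<^sup>2) / 4)"
  using circular_gaussian_char[OF mem_circular[OF assms], of 1] by (simp add: inner_complex_def)

lemma second_moment_add:
  assumes X: "X \<in> H" and Y: "Y \<in> H" and XY: "cov X Y = 0"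
  shows "(LINT \<omega>|M. (cmod (X \<omega> + Y \<omega>))\<^sup>2) = (LINT \<omega>|M. (cmod (X \<omega>))\<^sup>2) + (LINT \<omega>|M. (cmod (Y \<omega>))\<^sup>2)"
proof -
  have "cov Y X = 0" using XY cov_cnj[of Y X] by simp
  then have "cov (\<lambda>\<omega>. X \<omega> + Y \<omega>) (\<lambda>\<omega>. X \<omega> + Y \<omega>) = cov X X + cov Y Y"
    using X Y XY add_mem[OF X Y] by (simp only: cov_lincomb)  simp
  then show ?thesis unfolding cov_self of_real_add[symmetric] of_real_eq_iff .
qed

text \<open>\<open>E |U + V|^2\<close> splits for uncorrelated members, so the characteristic
  function of the pair factors, and uniqueness on the product type identifies the joint law with the
  product law. It is enough that the real linear forms of \<open>X\<close> and \<open>Y\<close> are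
  real parts of members of the space.\<close>

lemma indep_varI_cov:
  fixes X :: "'a \<Rightarrow> 'c::{real_inner, second_countable_topology}" and Y :: "'a \<Rightarrow> 'c"
  assumes det: "char_determines TYPE('c)"
    and [measurable]: "X \<in> borel_measurable M" "Y \<in> borel_measurable M"
    and UV: "\<And>\<xi> \<eta>. \<exists>U\<in>H. \<exists>V\<in>H. (\<forall>\<omega>. \<xi> \<bullet> X \<omega> = Re (U \<omega>)) \<and> (\<forall>\<omega>. \<eta> \<bullet> Y \<omega> = Re (V \<omega>)) \<and> cov U V = 0"
  shows "indep_var borel X borel Y"
proof -
  let ?N = "distr M borel X \<Otimes>\<^sub>M distr M borel Y"
  interpret X: prob_space "distr M borel X" by (rule prob_space_distr) simp
  interpret Y: prob_space "distr M borel Y" by (rule prob_space_distr) simp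
  interpret XY: pair_prob_space "distr M borel X" "distr M borel Y" ..
  have sets: "sets ?N = sets (borel \<Otimes>\<^sub>M borel)" by (intro sets_pair_measure_cong) auto
  have id: "(\<lambda>p. p) \<in> borel_measurable ?N"
    by (rule measurable_ident_sets) (simp only: sets borel_prod)
  have "distr M borel (\<lambda>\<omega>. (X \<omega>, Y \<omega>)) = distr ?N borel (\<lambda>p. p)"
  proof (rule distr_eqI_char[OF char_determines_prod[OF det det] prob_space_axioms XY.prob_space_axioms _ id])
    show "(\<lambda>\<omega>. (X \<omega>, Y \<omega>)) \<in> borel_measurable M" by (simp add: borel_prod[symmetric])
    fix \<xi> :: "'c \<times> 'c"
    obtain U V where U: "U \<in> H" and V: "V \<in> H" and eU: "\<And>\<omega>. fst \<xi> \<bullet> X \<omega> = Re (U \<omega>)"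
      and eV: "\<And>\<omega>. snd \<xi> \<bullet> Y \<omega> = Re (V \<omega>)" and c: "cov U V = 0"
      using UV[of "fst \<xi>" "snd \<xi>"] by blast
    have "(LINT \<omega>|M. iexp (\<xi> \<bullet> (X \<omega>, Y \<omega>))) = (LINT \<omega>|M. iexp (Re (U \<omega> + V \<omega>)))"
      by (simp add: inner_prod_def eU eV)
    also have "\<dots> = (LINT \<omega>|M. iexp (Re (U \<omega>))) * (LINT \<omega>|M. iexp (Re (V \<omega>)))"
      unfolding mem_char[OF add_mem[OF U V]] mem_char[OF U] mem_char[OF V] second_moment_add[OF U V c]
        of_real_mult[symmetric] mult_exp_exp
      by (rule arg_cong[where f="\<lambda>x. of_real (exp x)"]) (simp add: field_simps)
    also have "\<dots> = (LINT x|distr M borel X. iexp (fst \<xi> \<bullet> x)) * (LINT y|distr M borel Y. iexp (snd \<xi> \<bullet> y))"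
      by (simp add: integral_distr eU eV)
    also have "\<dots> = (LINT x|distr M borel X. LINT y|distr M borel Y. iexp (\<xi> \<bullet> (x, y)))"
      by (simp add: inner_prod_def distrib_left exp_add)
    also have "\<dots> = (LINT p|?N. iexp (\<xi> \<bullet> p))"
    proof (rule XY.integral_fst')
      have "(\<lambda>p. iexp (\<xi> \<bullet> p)) \<in> borel_measurable ?N"
        by (rule measurable_compose[OF id, of "\<lambda>p. iexp (\<xi> \<bullet> p)"]) auto
      then show "integrable ?N (\<lambda>p. iexp (\<xi> \<bullet> p))"
        by (intro XY.P.integrable_const_bound[where B=1]) auto
    qed
    finally show "(LINT \<omega>|M. iexp (\<xi> \<bullet> (X \<omega>, Y \<omega>))) = (LINT p|?N. iexp (\<xi> \<bullet> p))" .
  qed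
  moreover have "distr ?N borel (\<lambda>p. p) = ?N"
    by (rule distr_id2) (simp only: sets borel_prod)
  ultimately have "?N = distr M borel (\<lambda>\<omega>. (X \<omega>, Y \<omega>))"
    by simp
  then show ?thesis
    unfolding indep_var_distribution_eq borel_prod by (intro conjI) simp_all
qed

lemma indep_pairs:
  assumes X: "X1 \<in> H" "X2 \<in> H" and Y: "Y1 \<in> H" "Y2 \<in> H"
    and cov: "cov X1 Y1 = 0" "cov X1 Y2 = 0" "cov X2 Y1 = 0" "cov X2 Y2 = 0"
  shows "indep_var borel (\<lambda>\<omega>. (X1 \<omega>, X2 \<omega>)) borel (\<lambda>\<omega>. (Y1 \<omega>, Y2 \<omega>))"
proof (rule indep_varI_cov)
  note [measurable] = X[THEN mem_measurable] Y[THEN mem_measurable]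
  show "char_determines TYPE(complex \<times> complex)"
    by (intro char_determines_prod char_determines_complex)+
  show "(\<lambda>\<omega>. (X1 \<omega>, X2 \<omega>)) \<in> borel_measurable M" "(\<lambda>\<omega>. (Y1 \<omega>, Y2 \<omega>)) \<in> borel_measurable M"
    by (simp_all add: borel_prod[symmetric])
  fix \<xi> \<eta> :: "complex \<times> complex"
  let ?U = "\<lambda>\<omega>. cnj (fst \<xi>) * X1 \<omega> + cnj (snd \<xi>) * X2 \<omega>"
  let ?V = "\<lambda>\<omega>. cnj (fst \<eta>) * Y1 \<omega> + cnj (snd \<eta>) * Y2 \<omega>"
  have UV: "?U \<in> H" "?V \<in> H" using X Y by (auto intro!: add_mem scale_mem)
  note m = scale_mem[OF X(1), of "cnj (fst \<xi>)"] scale_mem[OF X(2), of "cnj (snd \<xi>)"]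
    scale_mem[OF Y(1), of "cnj (fst \<eta>)"] scale_mem[OF Y(2), of "cnj (snd \<eta>)"]
  have 1: "cov (\<lambda>\<omega>. c * X \<omega>) (\<lambda>\<omega>. d * Y \<omega>) = c * cnj d * cov X Y" for X Y c d
  proof -
    have "c * X \<omega> * cnj (d * Y \<omega>) = (c * cnj d) * (X \<omega> * cnj (Y \<omega>))" for \<omega> by simp
    then show ?thesis by (simp only: integral_mult_right_zero)
  qed
  have "cov ?U ?V = 0"
    unfolding cov_lincomb(1)[OF m(1,2) UV(2)] cov_lincomb(4)[OF m(3,4) m(1)] cov_lincomb(4)[OF m(3,4) m(2)] 1
    using cov by simp
  then show "\<exists>U\<in>H. \<exists>V\<in>H. (\<forall>\<omega>. \<xi> \<bullet> (X1 \<omega>, X2 \<omega>) = Re (U \<omega>)) \<and>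
      (\<forall>\<omega>. \<eta> \<bullet> (Y1 \<omega>, Y2 \<omega>) = Re (V \<omega>)) \<and> cov U V = 0"
    using UV by (intro bexI[of _ ?U] bexI[of _ ?V] conjI allI) (simp_all only:, simp_all add: inner_prod_def inner_complex_def)
qed

lemma indep_singles:
  assumes "X \<in> H" "Y \<in> H" "cov X Y = 0"
  shows "indep_var borel X borel Y"
proof -
  have "indep_var borel (fst \<circ> (\<lambda>\<omega>. (X \<omega>, X \<omega>))) borel (fst \<circ> (\<lambda>\<omega>. (Y \<omega>, Y \<omega>)))"
    using assms by (intro indep_var_compose[OF indep_pairs])
      (auto intro!: borel_measurable_continuous_onI continuous_intros)
  then show ?thesis by (simp add: comp_def)
qed

lemma inverse_integrable:
  assumes V: "V \<in> H" and q: "(LINT \<omega>|M. (cmod (V \<omega>))\<^sup>2) > 0"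
  shows "integrable M (\<lambda>\<omega>. 1 / V \<omega>)"
proof (rule Bochner_Integration.integrable_bound)
  note [measurable] = mem_measurable[OF V]
  show "integrable M (\<lambda>\<omega>. cmod (V \<omega>) powr (- 1))"
    using circular_gaussian_powr(1)[OF mem_circular[OF V], of 1] by simp
  show "AE \<omega> in M. norm (1 / V \<omega>) \<le> norm (cmod (V \<omega>) powr (- 1))"
    by (auto simp: powr_minus_divide norm_divide)
  show "(\<lambda>\<omega>. 1 / V \<omega>) \<in> borel_measurable M" by measurable
qed

text \<open>The residual \<open>W = U - c * V\<close> is uncorrelated with \<open>V\<close>, hence
  independent of it, and \<open>1 / V\<close> is integrable. So
  \<open>E (W / V) = E W * E (1 / V) = 0\<close>, and only the regression coefficient
  \<open>c\<close> is left.\<close>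

lemma ratio_expectation:
  assumes U: "U \<in> H" and V: "V \<in> H" and q: "(LINT \<omega>|M. (cmod (V \<omega>))\<^sup>2) = 1"
  shows "integrable M (\<lambda>\<omega>. U \<omega> / V \<omega>)" "(LINT \<omega>|M. U \<omega> / V \<omega>) = cov U V"
proof -
  define c where "c = cov U V"
  define W where "W \<omega> = U \<omega> - c * V \<omega>" for \<omega>
  have cV: "(\<lambda>\<omega>. c * V \<omega>) \<in> H" by (rule scale_mem[OF V])
  have W: "W \<in> H" unfolding W_def by (rule diff_mem[OF U cV])
  have "cov W V = 0"
    unfolding W_def cov_lincomb(2)[OF U cV V] cov_lincomb(3)[OF V V V] cov_self q by (simp add: c_def)
  then have "indep_var borel W borel V" by (rule indep_singles[OF W V])
  then have ind: "indep_var borel ((\<lambda>z. z) \<circ> W) borel ((\<lambda>z. 1 / z) \<circ> V)"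
    by (rule indep_var_compose) auto
  have i: "integrable M W" "integrable M (\<lambda>\<omega>. 1 / V \<omega>)"
    using mem_integrable[OF W] inverse_integrable[OF V] q by auto
  have iWV: "integrable M (\<lambda>\<omega>. W \<omega> * (1 / V \<omega>))" and mean0: "(LINT \<omega>|M. W \<omega> * (1 / V \<omega>)) = 0"
    using indep_var_integrable[OF ind] indep_var_lebesgue_integral[OF ind] i mem_mean[OF W]
    by (auto simp: comp_def)
  have ae: "AE \<omega> in M. W \<omega> * (1 / V \<omega>) + c = U \<omega> / V \<omega>"
    using circular_gaussian_AE_neq_0[OF mem_circular[OF V]] q
    by (auto elim!: eventually_mono simp: W_def field_simps)
  note [measurable] = mem_measurable[OF U] mem_measurable[OF V] mem_measurable[OF W]
  have "integrable M (\<lambda>\<omega>. W \<omega> * (1 / V \<omega>) + c)" using iWV by simp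
  then show "integrable M (\<lambda>\<omega>. U \<omega> / V \<omega>)"
    by (rule integrable_cong_AE_imp) (use ae in \<open>auto elim: eventually_mono\<close>)
  have "(LINT \<omega>|M. U \<omega> / V \<omega>) = (LINT \<omega>|M. W \<omega> * (1 / V \<omega>) + c)"
    by (rule integral_cong_AE) (use ae in \<open>auto elim: eventually_mono\<close>)
  also have "\<dots> = c" using mean0 iWV by (simp add: prob_space)
  finally show "(LINT \<omega>|M. U \<omega> / V \<omega>) = cov U V" by (simp add: c_def)
qed

end

section \<open>Interpolation inequalities and inverse moments of products\<close>

lemma product_powr_bound:
  fixes a b d1 d2 :: real
  assumes "0 \<le> a" "0 \<le> b" "0 < d1" "0 < d2" "d1 \<le> a + b" "d2 \<le> a + b"
  shows "(a * b) powr (-5/4) \<le>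
    2 powr (3/4) * (a powr (-7/4) * d1 powr (-3/4) + b powr (-7/4) * d2 powr (-3/4))"
proof -
  \<comment> \<open>The larger value satisfies both \<open>b \<ge> d / 2\<close> and
    \<open>b \<ge> a\<close>. The first bound takes 3/4 of its exponent 5/4, the second the
    remaining 1/2, which raises the exponent of \<open>a\<close> to 7/4, still below 2.\<close>
  have main: "(a * b) powr (-5/4) \<le> 2 powr (3/4) * (a powr (-7/4) * d powr (-3/4))"
    if ab: "0 < a" "a \<le> b" and d: "0 < d" "d \<le> a + b" for a b d :: real
  proof -
    have "b powr (-5/4) = b powr (-3/4) * b powr (-1/2)"
      by (simp add: powr_add[symmetric])
    also have "\<dots> \<le> (d / 2) powr (-3/4) * a powr (-1/2)"
      using ab d by (intro mult_mono powr_mono2') auto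
    also have "(d / 2) powr (-3/4) = 2 powr (3/4) * d powr (-3/4)"
      using d by (simp add: powr_divide powr_minus field_simps)
    finally have "a powr (-5/4) * b powr (-5/4) \<le> a powr (-5/4) * (2 powr (3/4) * d powr (-3/4) * a powr (-1/2))"
      by (intro mult_left_mono) auto
    also have "\<dots> = 2 powr (3/4) * ((a powr (-5/4) * a powr (-1/2)) * d powr (-3/4))"
      by simp
    also have "a powr (-5/4) * a powr (-1/2) = a powr (-7/4)"
      by (simp add: powr_add[symmetric])
    finally show ?thesis using ab by (simp add: powr_mult)
  qed
  show ?thesis
  proof (cases "a = 0 \<or> b = 0")
    case True
    then show ?thesis by auto
  next
    case False
    then have pos: "a > 0" "b > 0" using assms by auto
    show ?thesis
    proof (cases "a \<le> b")
      case True
      from main[OF pos(1) True assms(3,5)] show ?thesis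
        by (rule order_trans) (simp add: distrib_left)
    next
      case False
      then have "b \<le> a" by simp
      have "(a * b) powr (-5/4) \<le> 2 powr (3/4) * (b powr (-7/4) * d2 powr (-3/4))"
        using main[OF pos(2) \<open>b \<le> a\<close> assms(4)] assms(6) by (simp only: add.commute[of a b] mult.commute[of a b])
      then show ?thesis
        by (rule order_trans) (simp add: distrib_left)
    qed
  qed
qed

text \<open>Young's inequality for the conjugate exponents 5 and 5/4, with its constants relaxed to
  1. The cases are which of \<open>x ^ 4\<close> and \<open>y\<close> is larger.\<close>

lemma mult_le_power5_powr:
  fixes x y :: real
  assumes "0 \<le> x" "0 \<le> y"
  shows "x * y \<le> x ^ 5 + y powr (5/4)"
proof (cases "y \<le> x ^ 4")
  case True
  then have "x * y \<le> x * x ^ 4" using assms by (intro mult_left_mono) auto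
  also have "\<dots> = x ^ 5" by (simp add: power_numeral_reduce)
  finally show ?thesis by (simp add: add_increasing2)
next
  case False
  then have y: "y > 0" using assms by (smt (verit) zero_le_power)
  have "x = (x ^ 4) powr (1/4)"
  proof (cases "x = 0")
    case False
    then have "(x ^ 4) powr (1/4) = (x powr 4) powr (1/4)" using assms by simp
    also have "\<dots> = x powr (4 * (1/4))" by (rule powr_powr)
    finally show ?thesis using False assms by simp
  qed simp
  also have "\<dots> \<le> y powr (1/4)" using False assms by (intro powr_mono2) auto
  finally have "x * y \<le> y powr (1/4) * y powr 1" using y by (intro mult_mono) auto
  also have "\<dots> = y powr (5/4)" by (simp only: powr_add[symmetric]) simp
  finally show ?thesis using assms by (simp add: add_increasing)
qed

definition inverse_moment :: "real \<Rightarrow> real" where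
  "inverse_moment p = (LINT z|std_complex_gaussian. cmod z powr (- p))"

definition inverse_product_const :: real where
  "inverse_product_const = 2 powr (3/4) * (2 * (inverse_moment (7/4) * inverse_moment (3/4)))"

context gaussian_space
begin

lemma cov_residual:
  assumes "X \<in> H" "Y \<in> H" "Z \<in> H"
  shows "(\<lambda>\<omega>. X \<omega> - c * Y \<omega>) \<in> H"
    "cov (\<lambda>\<omega>. X \<omega> - c * Y \<omega>) Z = cov X Z - c * cov Y Z"
    "cov Z (\<lambda>\<omega>. X \<omega> - c * Y \<omega>) = cov Z X - cnj c * cov Z Y"
  using assms scale_mem[OF assms(2), of c] diff_mem cov_lincomb(2)[of X "\<lambda>\<omega>. c * Y \<omega>" Z]
    cov_lincomb(5)[of X "\<lambda>\<omega>. c * Y \<omega>" Z] cov_lincomb(3)[of Y Y Z c] cov_lincomb(6)[of Y Y Z c] by auto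

text \<open>One Gram-Schmidt step: the residual \<open>Y - \<kappa> * X\<close> has second moment
  \<open>1 - |\<kappa>|^2 = s^2\<close>, whence the factor \<open>1 / s\<close>.\<close>

lemma normalized_residual:
  fixes \<kappa> :: complex and s :: real
  assumes X: "X \<in> H" and Y: "Y \<in> H" and X1: "(LINT \<omega>|M. (cmod (X \<omega>))\<^sup>2) = 1"
    and Y1: "(LINT \<omega>|M. (cmod (Y \<omega>))\<^sup>2) = 1" and \<kappa>: "cov Y X = \<kappa>"
    and s: "s > 0" "(cmod \<kappa>)\<^sup>2 + s\<^sup>2 = 1"
    and \<eta>_def: "\<eta> = (\<lambda>\<omega>. of_real (1 / s) * (Y \<omega> - \<kappa> * X \<omega>))"
  shows "\<eta> \<in> H" "cov \<eta> X = 0" "(LINT \<omega>|M. (cmod (\<eta> \<omega>))\<^sup>2) = 1"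
    "\<And>\<omega>. Y \<omega> = \<kappa> * X \<omega> + of_real s * \<eta> \<omega>"
    "\<And>Z. Z \<in> H \<Longrightarrow> cov Z \<eta> = of_real (1 / s) * (cov Z Y - cnj \<kappa> * cov Z X)"
proof -
  define D where "D \<omega> = Y \<omega> - \<kappa> * X \<omega>" for \<omega>
  have \<eta>_D: "\<eta> = (\<lambda>\<omega>. of_real (1 / s) * D \<omega>)" by (simp add: \<eta>_def D_def)
  have D: "D \<in> H" unfolding D_def by (rule cov_residual(1)[OF Y X X])
  show \<eta>: "\<eta> \<in> H" unfolding \<eta>_D by (rule scale_mem[OF D])
  have DX: "cov D X = 0"
    unfolding D_def cov_residual(2)[OF Y X X] \<kappa> cov_self X1 by simp
  show "cov \<eta> X = 0" unfolding \<eta>_D cov_lincomb(3)[OF D D X] DX by simp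
  have XY: "cov X Y = cnj \<kappa>" using cov_cnj[of X Y] \<kappa> by simp
  have "cov D D = cov D Y - cnj \<kappa> * cov D X"
    using cov_residual(3)[OF Y X D, of \<kappa>] by (simp add: D_def)
  also have "cov D Y = cov Y Y - \<kappa> * cov X Y"
    using cov_residual(2)[OF Y X Y, of \<kappa>] by (simp add: D_def)
  finally have "cov D D = 1 - \<kappa> * cnj \<kappa>"
    unfolding DX XY cov_self Y1 by simp
  also have "\<dots> = of_real (s\<^sup>2)"
    unfolding complex_norm_square[symmetric] using s(2) by (metis add_diff_cancel_left' of_real_1 of_real_diff)
  finally have D2: "(LINT \<omega>|M. (cmod (D \<omega>))\<^sup>2) = s\<^sup>2" unfolding cov_self of_real_eq_iff .
  have "(LINT \<omega>|M. (cmod (\<eta> \<omega>))\<^sup>2) = (LINT \<omega>|M. (1 / s)\<^sup>2 * (cmod (D \<omega>))\<^sup>2)"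
    using s by (simp add: \<eta>_D norm_mult norm_divide power_divide)
  also have "\<dots> = (1 / s)\<^sup>2 * s\<^sup>2" by (simp only: integral_mult_right_zero D2)
  also have "\<dots> = 1" using s by (simp add: power_divide)
  finally show "(LINT \<omega>|M. (cmod (\<eta> \<omega>))\<^sup>2) = 1" .
  show "Y \<omega> = \<kappa> * X \<omega> + of_real s * \<eta> \<omega>" for \<omega>
    using s by (simp add: \<eta>_def)
  show "cov Z \<eta> = of_real (1 / s) * (cov Z Y - cnj \<kappa> * cov Z X)" if Z: "Z \<in> H" for Z
    unfolding \<eta>_D cov_lincomb(6)[OF D D Z] using cov_residual(3)[OF Y X Z, of \<kappa>] by (simp add: D_def)
qed

lemma inverse_powr_product:
  assumes X: "X \<in> H" and Y: "Y \<in> H" and XY: "cov X Y = 0"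
    and X1: "(LINT \<omega>|M. (cmod (X \<omega>))\<^sup>2) = 1" and Y1: "(LINT \<omega>|M. (cmod (Y \<omega>))\<^sup>2) = 1"
    and p: "0 \<le> p" "p < 2" and q: "0 \<le> q" "q < 2" and s: "s > 0"
  shows "integrable M (\<lambda>\<omega>. cmod (X \<omega>) powr (- p) * (s * cmod (Y \<omega>)) powr (- q))"
    "(LINT \<omega>|M. cmod (X \<omega>) powr (- p) * (s * cmod (Y \<omega>)) powr (- q)) =
      s powr (- q) * (inverse_moment p * inverse_moment q)"
proof -
  have ind: "indep_var borel ((\<lambda>z. cmod z powr (- p)) \<circ> X) borel ((\<lambda>z. cmod z powr (- q)) \<circ> Y)"
    by (rule indep_var_compose[OF indep_singles[OF X Y XY]]) auto
  have i: "integrable M (\<lambda>\<omega>. cmod (X \<omega>) powr (- p))" "integrable M (\<lambda>\<omega>. cmod (Y \<omega>) powr (- q))"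
    using circular_gaussian_powr(1)[OF mem_circular[OF X] p] circular_gaussian_powr(1)[OF mem_circular[OF Y] q] by auto
  have eq: "cmod (X \<omega>) powr (- p) * (s * cmod (Y \<omega>)) powr (- q) =
      s powr (- q) * (cmod (X \<omega>) powr (- p) * cmod (Y \<omega>) powr (- q))" for \<omega>
    using s by (simp add: powr_mult)
  show "integrable M (\<lambda>\<omega>. cmod (X \<omega>) powr (- p) * (s * cmod (Y \<omega>)) powr (- q))"
    unfolding eq using indep_var_integrable[OF ind] i by (intro integrable_mult_right) (simp add: comp_def)
  have "(LINT \<omega>|M. cmod (X \<omega>) powr (- p) * cmod (Y \<omega>) powr (- q)) = inverse_moment p * inverse_moment q"
    using indep_var_lebesgue_integral[OF ind] i circular_gaussian_powr(2)[OF mem_circular[OF X] p]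
      circular_gaussian_powr(2)[OF mem_circular[OF Y] q] X1 Y1 by (simp add: comp_def inverse_moment_def)
  then show "(LINT \<omega>|M. cmod (X \<omega>) powr (- p) * (s * cmod (Y \<omega>)) powr (- q)) =
      s powr (- q) * (inverse_moment p * inverse_moment q)"
    unfolding eq by (simp only: integral_mult_right_zero)
qed

text \<open>Interpolation: \<open>s * cmod \<eta> \<le> cmod X + cmod Y\<close> for both normalized residuals \<open>\<eta>\<close>, and each
  residual is independent of the variable it is taken against.\<close>

lemma inverse_product_bound:
  assumes X: "X \<in> H" and Y: "Y \<in> H" and X1: "(LINT \<omega>|M. (cmod (X \<omega>))\<^sup>2) = 1"
    and Y1: "(LINT \<omega>|M. (cmod (Y \<omega>))\<^sup>2) = 1" and s: "s > 0" "(cmod (cov X Y))\<^sup>2 + s\<^sup>2 = 1"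
  shows "integrable M (\<lambda>\<omega>. (cmod (X \<omega>) * cmod (Y \<omega>)) powr (-5/4))"
    "(LINT \<omega>|M. (cmod (X \<omega>) * cmod (Y \<omega>)) powr (-5/4)) \<le> inverse_product_const * s powr (-3/4)"
proof -
  note [measurable] = mem_measurable[OF X] mem_measurable[OF Y]
  have cYX: "cov Y X = cnj (cov X Y)" by (rule cov_cnj)
  have s': "(cmod (cov Y X))\<^sup>2 + s\<^sup>2 = 1" using s(2) unfolding cYX by simp
  define \<eta>1 where "\<eta>1 = (\<lambda>\<omega>. of_real (1 / s) * (Y \<omega> - cov Y X * X \<omega>))"
  define \<eta>2 where "\<eta>2 = (\<lambda>\<omega>. of_real (1 / s) * (X \<omega> - cov X Y * Y \<omega>))"
  note r1 = normalized_residual[OF X Y X1 Y1 refl s(1) s' \<eta>1_def]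
  note r2 = normalized_residual[OF Y X Y1 X1 refl s \<eta>2_def]
  have cov1: "cov X \<eta>1 = 0" by (rule trans[OF cov_cnj]) (simp only: r1(2) complex_cnj_zero)
  have cov2: "cov Y \<eta>2 = 0" by (rule trans[OF cov_cnj]) (simp only: r2(2) complex_cnj_zero)
  have le1: "cmod (cov X Y) \<le> 1" "cmod (cov Y X) \<le> 1"
    using s s' by (smt (verit) power2_le_imp_le zero_le_power2 one_power2)+
  have d: "s * cmod (\<eta>1 \<omega>) \<le> cmod (X \<omega>) + cmod (Y \<omega>)" "s * cmod (\<eta>2 \<omega>) \<le> cmod (X \<omega>) + cmod (Y \<omega>)" for \<omega>
  proof -
    have "s * cmod (\<eta>1 \<omega>) = cmod (Y \<omega> - cov Y X * X \<omega>)" using s by (simp add: \<eta>1_def norm_mult norm_divide)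
    also have "\<dots> \<le> cmod (Y \<omega>) + cmod (cov Y X) * cmod (X \<omega>)"
      using norm_triangle_ineq4[of "Y \<omega>" "cov Y X * X \<omega>"] by (simp add: norm_mult)
    also have "\<dots> \<le> cmod (X \<omega>) + cmod (Y \<omega>)" using le1 by (simp add: mult_left_le_one_le)
    finally show "s * cmod (\<eta>1 \<omega>) \<le> cmod (X \<omega>) + cmod (Y \<omega>)" .
    have "s * cmod (\<eta>2 \<omega>) = cmod (X \<omega> - cov X Y * Y \<omega>)" using s by (simp add: \<eta>2_def norm_mult norm_divide)
    also have "\<dots> \<le> cmod (X \<omega>) + cmod (cov X Y) * cmod (Y \<omega>)"
      using norm_triangle_ineq4[of "X \<omega>" "cov X Y * Y \<omega>"] by (simp add: norm_mult)
    also have "\<dots> \<le> cmod (X \<omega>) + cmod (Y \<omega>)" using le1 by (simp add: mult_left_le_one_le)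
    finally show "s * cmod (\<eta>2 \<omega>) \<le> cmod (X \<omega>) + cmod (Y \<omega>)" .
  qed
  let ?g = "\<lambda>\<omega>. 2 powr (3/4) * (cmod (X \<omega>) powr (-(7/4)) * (s * cmod (\<eta>1 \<omega>)) powr (-(3/4)) +
      cmod (Y \<omega>) powr (-(7/4)) * (s * cmod (\<eta>2 \<omega>)) powr (-(3/4)))"
  \<comment> \<open>The residuals have second moment 1 and are therefore almost surely non-zero, as
    the interpolation inequality requires of its lower bounds.\<close>
  have ae: "AE \<omega> in M. (cmod (X \<omega>) * cmod (Y \<omega>)) powr (-5/4) \<le> ?g \<omega>"
    using circular_gaussian_AE_neq_0[OF mem_circular[OF r1(1)]] circular_gaussian_AE_neq_0[OF mem_circular[OF r2(1)]]
    unfolding r1(3) r2(3) using s(1)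
    by (auto elim!: eventually_elim2 intro!: product_powr_bound[unfolded minus_divide_left[symmetric]] d)
  note p1 = inverse_powr_product[OF X r1(1) cov1 X1 r1(3), of "7/4" "3/4" s]
  note p2 = inverse_powr_product[OF Y r2(1) cov2 Y1 r2(3), of "7/4" "3/4" s]
  have ig: "integrable M ?g"
    using p1(1) p2(1) s by (intro integrable_mult_right Bochner_Integration.integrable_add) auto
  show int: "integrable M (\<lambda>\<omega>. (cmod (X \<omega>) * cmod (Y \<omega>)) powr (-5/4))"
    by (rule Bochner_Integration.integrable_bound[OF ig]) (use ae in \<open>auto elim!: eventually_mono\<close>)
  have "(LINT \<omega>|M. (cmod (X \<omega>) * cmod (Y \<omega>)) powr (-5/4)) \<le> integral\<^sup>L M ?g"
    by (rule integral_mono_AE[OF int ig ae])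
  also have "\<dots> = 2 powr (3/4) * (s powr (-(3/4)) * (inverse_moment (7/4) * inverse_moment (3/4)) +
      s powr (-(3/4)) * (inverse_moment (7/4) * inverse_moment (3/4)))"
    using p1 p2 s by (simp only: integral_mult_right_zero) simp
  also have "\<dots> = inverse_product_const * s powr (-3/4)"
    by (simp add: inverse_product_const_def)
  finally show "(LINT \<omega>|M. (cmod (X \<omega>) * cmod (Y \<omega>)) powr (-5/4)) \<le> inverse_product_const * s powr (-3/4)" .
qed

text \<open>The numerators have moments of every order, the denominators only few inverse ones.
  Young's inequality therefore puts the large exponent 5 on the numerators, followed by
  \<open>(u * v) ^ 5 \<le> u ^ 10 + v ^ 10\<close>, and leaves to the inverse product the exponent
  5/4 at which it is already bounded.\<close>

lemma double_ratio_bound: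
  assumes X: "X \<in> H" and Y: "Y \<in> H" and X1: "(LINT \<omega>|M. (cmod (X \<omega>))\<^sup>2) = 1"
    and Y1: "(LINT \<omega>|M. (cmod (Y \<omega>))\<^sup>2) = 1" and s: "s > 0" "(cmod (cov X Y))\<^sup>2 + s\<^sup>2 = 1"
    and U: "U \<in> H" and V: "V \<in> H"
  shows "integrable M (\<lambda>\<omega>. cmod (U \<omega>) * cmod (V \<omega>) / (cmod (X \<omega>) * cmod (Y \<omega>)))"
    "(LINT \<omega>|M. cmod (U \<omega>) * cmod (V \<omega>) / (cmod (X \<omega>) * cmod (Y \<omega>))) \<le>
      (LINT \<omega>|M. cmod (U \<omega>) ^ 10) + (LINT \<omega>|M. cmod (V \<omega>) ^ 10) + inverse_product_const * s powr (-3/4)"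
    "integrable M (\<lambda>\<omega>. 1 / (cmod (X \<omega>) * cmod (Y \<omega>)))"
proof -
  note [measurable] = mem_measurable[OF X] mem_measurable[OF Y] mem_measurable[OF U] mem_measurable[OF V]
  note b = inverse_product_bound[OF X Y X1 Y1 s]
  let ?g = "\<lambda>\<omega>. cmod (U \<omega>) ^ 10 + cmod (V \<omega>) ^ 10 + (cmod (X \<omega>) * cmod (Y \<omega>)) powr (-5/4)"
  have inv: "(1 / a) powr (5/4) = a powr (-5/4)" if "a \<ge> 0" for a :: real
    using that by (simp add: powr_divide powr_minus_divide)
  have pw: "u * v / (x * y) \<le> u ^ 10 + v ^ 10 + (x * y) powr (-5/4)"
    if nn: "0 \<le> u" "0 \<le> v" "0 \<le> x" "0 \<le> y" for u v x y :: real
  proof -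
    have "(u * v) * (1 / (x * y)) \<le> (u * v) ^ 5 + (1 / (x * y)) powr (5/4)"
      using nn by (intro mult_le_power5_powr) auto
    moreover have "(1 / (x * y)) powr (5/4) = (x * y) powr (-5/4)" by (rule inv) (use nn in auto)
    moreover have "(u * v) ^ 5 \<le> u ^ 10 + v ^ 10"
    proof -
      have "(u * v) ^ 5 = u ^ 5 * v ^ 5" by (rule power_mult_distrib)
      also have "\<dots> \<le> (u ^ 5)\<^sup>2 + (v ^ 5)\<^sup>2"
        using sum_squares_bound[of "u ^ 5" "v ^ 5"]
          mult_nonneg_nonneg[OF zero_le_power[OF nn(1), of 5] zero_le_power[OF nn(2), of 5]] by linarith
      finally show ?thesis by (simp add: power_mult[symmetric])
    qed
    ultimately show ?thesis by simp
  qed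
  have ig: "integrable M ?g"
    using mem_power_integrable[OF U, of 5] mem_power_integrable[OF V, of 5] b(1) by simp
  show int: "integrable M (\<lambda>\<omega>. cmod (U \<omega>) * cmod (V \<omega>) / (cmod (X \<omega>) * cmod (Y \<omega>)))"
  proof (rule Bochner_Integration.integrable_bound[OF ig _ AE_I2])
    fix \<omega>
    have "norm (cmod (U \<omega>) * cmod (V \<omega>) / (cmod (X \<omega>) * cmod (Y \<omega>))) =
        cmod (U \<omega>) * cmod (V \<omega>) / (cmod (X \<omega>) * cmod (Y \<omega>))"
      unfolding real_norm_def by (intro abs_of_nonneg divide_nonneg_nonneg mult_nonneg_nonneg) auto
    also have "\<dots> \<le> ?g \<omega>" by (rule pw) auto
    also have "\<dots> \<le> norm (?g \<omega>)" by simp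
    finally show "norm (cmod (U \<omega>) * cmod (V \<omega>) / (cmod (X \<omega>) * cmod (Y \<omega>))) \<le> norm (?g \<omega>)" .
  qed measurable
  have "(LINT \<omega>|M. cmod (U \<omega>) * cmod (V \<omega>) / (cmod (X \<omega>) * cmod (Y \<omega>))) \<le> integral\<^sup>L M ?g"
    by (rule integral_mono[OF int ig]) (rule pw; simp)
  also have "\<dots> = (LINT \<omega>|M. cmod (U \<omega>) ^ 10) + (LINT \<omega>|M. cmod (V \<omega>) ^ 10) +
      (LINT \<omega>|M. (cmod (X \<omega>) * cmod (Y \<omega>)) powr (-5/4))"
    using mem_power_integrable[OF U, of 5] mem_power_integrable[OF V, of 5] b(1) by simp
  finally show "(LINT \<omega>|M. cmod (U \<omega>) * cmod (V \<omega>) / (cmod (X \<omega>) * cmod (Y \<omega>))) \<le>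
      (LINT \<omega>|M. cmod (U \<omega>) ^ 10) + (LINT \<omega>|M. cmod (V \<omega>) ^ 10) + inverse_product_const * s powr (-3/4)"
    using b(2) by simp
  have ig1: "integrable M (\<lambda>\<omega>. 1 + (cmod (X \<omega>) * cmod (Y \<omega>)) powr (-5/4))" using b(1) by simp
  show "integrable M (\<lambda>\<omega>. 1 / (cmod (X \<omega>) * cmod (Y \<omega>)))"
  proof (rule Bochner_Integration.integrable_bound[OF ig1 _ AE_I2])
    fix \<omega>
    have "1 * (1 / (cmod (X \<omega>) * cmod (Y \<omega>))) \<le> 1 ^ 5 + (1 / (cmod (X \<omega>) * cmod (Y \<omega>))) powr (5/4)"
      by (rule mult_le_power5_powr) auto
    then show "norm (1 / (cmod (X \<omega>) * cmod (Y \<omega>))) \<le> norm (1 + (cmod (X \<omega>) * cmod (Y \<omega>)) powr (-5/4))"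
      by (subst (asm) inv) auto
  qed measurable
qed


section \<open>The covariance of two imaginary ratios\<close>

lemma Im_mult_Im: "Im a * Im b = Re (a * cnj b - a * b) / 2"
  by (simp add: algebra_simps)

text \<open>Conditionally on \<open>f1\<close>, \<open>f2\<close> the variables \<open>u1\<close>, \<open>u2\<close> are affine in \<open>f1\<close>, \<open>\<eta>\<close> plus
  independent noise \<open>h1\<close>, \<open>h2\<close>, where \<open>\<eta>\<close> is the normalized residual of \<open>f2\<close> given \<open>f1\<close>. Division by zero
  makes the formula correct for \<open>\<kappa> = 0\<close> too.\<close>

lemma Im_ratio_covariance:
  assumes f: "f1 \<in> H" "f2 \<in> H" and u: "u1 \<in> H" "u2 \<in> H"
    and f1: "(LINT \<omega>|M. (cmod (f1 \<omega>))\<^sup>2) = 1" and f2: "(LINT \<omega>|M. (cmod (f2 \<omega>))\<^sup>2) = 1"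
    and \<kappa>: "cov f1 f2 = \<kappa>" and s: "s > 0" "(cmod \<kappa>)\<^sup>2 + s\<^sup>2 = 1"
    and u1f1: "cov u1 f1 = 0" and u2f2: "cov u2 f2 = 0"
    and u1f2: "cov u1 f2 = \<beta>" and u2f1: "cov u2 f1 = - cnj \<beta>" and u1u2: "cov u1 u2 = \<gamma>"
  shows "integrable M (\<lambda>\<omega>. Im (u1 \<omega> / f1 \<omega>) * Im (u2 \<omega> / f2 \<omega>))"
    "(LINT \<omega>|M. Im (u1 \<omega> / f1 \<omega>) * Im (u2 \<omega> / f2 \<omega>)) =
      Re ((\<beta> / \<kappa>)\<^sup>2 * of_real (ln (1 / s\<^sup>2) - (cmod \<kappa>)\<^sup>2 / s\<^sup>2) + \<gamma> / \<kappa> * of_real (ln (1 / s\<^sup>2))) / 2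
      + (cmod \<beta>)\<^sup>2 / (2 * s\<^sup>2)"
proof -
  define L where "L = complex_of_real (ln (1 / s\<^sup>2))"
  define S where "S = complex_of_real s"
  have S0: "S \<noteq> 0" using s by (simp add: S_def)
  have cnjS: "cnj S = S" by (simp add: S_def)
  have nS: "\<kappa> * cnj \<kappa> + S\<^sup>2 = 1"
    unfolding complex_norm_square[symmetric] S_def using s(2) by (metis of_real_1 of_real_add of_real_power)
  have f2f1: "cov f2 f1 = cnj \<kappa>" using cov_cnj[of f2 f1] \<kappa> by simp
  have s': "(cmod (cnj \<kappa>))\<^sup>2 + s\<^sup>2 = 1" using s by simp
  define \<eta> where "\<eta> = (\<lambda>\<omega>. of_real (1 / s) * (f2 \<omega> - cnj \<kappa> * f1 \<omega>))"
  note r = normalized_residual[OF f f1 f2 f2f1 s(1) s' \<eta>_def]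
  note \<eta> = r(1)
  have f2_eq: "f2 \<omega> = cnj \<kappa> * f1 \<omega> + S * \<eta> \<omega>" for \<omega> using r(4) by (simp add: S_def)
  have c\<eta>: "cov Z \<eta> = (cov Z f2 - \<kappa> * cov Z f1) / S" if "Z \<in> H" for Z
    using r(5)[OF that] by (simp add: S_def)
  have \<eta>f1: "cov \<eta> f1 = 0" and \<eta>\<eta>: "cov \<eta> \<eta> = 1" using r(2) by (simp_all only: cov_self r(3) of_real_1)
  have f1\<eta>: "cov f1 \<eta> = 0" by (rule trans[OF cov_cnj]) (simp only: \<eta>f1 complex_cnj_zero)
  have \<eta>f2: "cov \<eta> f2 = S"
  proof -
    have "cov f2 \<eta> = (1 - \<kappa> * cnj \<kappa>) / S" unfolding c\<eta>[OF f(2)] f2f1 cov_self f2 by simp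
    also have "\<dots> = S" using nS S0 by (simp add: field_simps power2_eq_square)
    finally show ?thesis using cov_cnj[of \<eta> f2] cnjS by simp
  qed
  \<comment> \<open>Regression coefficients: of \<open>u1\<close> on \<eta>, of \<open>u2\<close> on
    \<open>f1\<close>, and of \<open>u2\<close> on \<eta>. There is none of \<open>u1\<close> on
    \<open>f1\<close> because these are uncorrelated.\<close>
  define b p q where "b = \<beta> / S" and "p = - cnj \<beta>" and "q = \<kappa> * cnj \<beta> / S"
  have u1\<eta>: "cov u1 \<eta> = b" unfolding c\<eta>[OF u(1)] u1f1 u1f2 b_def by simp
  have u2\<eta>: "cov u2 \<eta> = q" unfolding c\<eta>[OF u(2)] u2f1 u2f2 q_def by simp
  have \<eta>u2: "cov \<eta> u2 = cnj q" using cov_cnj[of \<eta> u2] u2\<eta> by simp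
  define h1 where "h1 = (\<lambda>\<omega>. u1 \<omega> - b * \<eta> \<omega>)"
  define k2 where "k2 = (\<lambda>\<omega>. u2 \<omega> - p * f1 \<omega>)"
  define h2 where "h2 = (\<lambda>\<omega>. k2 \<omega> - q * \<eta> \<omega>)"
  have h1: "h1 \<in> H" unfolding h1_def by (rule cov_residual(1)[OF u(1) \<eta> \<eta>])
  have k2: "k2 \<in> H" unfolding k2_def by (rule cov_residual(1)[OF u(2) f(1) \<eta>])
  have h2: "h2 \<in> H" unfolding h2_def by (rule cov_residual(1)[OF k2 \<eta> \<eta>])
  have h1c: "cov h1 Z = cov u1 Z - b * cov \<eta> Z" if "Z \<in> H" for Z
    unfolding h1_def by (rule cov_residual(2)[OF u(1) \<eta> that])
  have h2c: "cov h2 Z = cov u2 Z - p * cov f1 Z - q * cov \<eta> Z" if "Z \<in> H" for Z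
    unfolding h2_def cov_residual(2)[OF k2 \<eta> that] unfolding k2_def cov_residual(2)[OF u(2) f(1) that] ..
  have z: "cov h1 f1 = 0" "cov h1 \<eta> = 0" "cov h2 f1 = 0" "cov h2 \<eta> = 0"
    unfolding h1c[OF f(1)] h1c[OF \<eta>] h2c[OF f(1)] h2c[OF \<eta>]
    by (simp_all only: u1f1 \<eta>f1 u1\<eta> \<eta>\<eta> u2f1 cov_self f1 u2\<eta> f1\<eta> p_def of_real_1) simp_all
  have z': "cov f1 h1 = 0" "cov f1 h2 = 0" "cov \<eta> h1 = 0" "cov \<eta> h2 = 0"
    using z cov_cnj[of f1 h1] cov_cnj[of f1 h2] cov_cnj[of \<eta> h1] cov_cnj[of \<eta> h2] by (metis complex_cnj_zero)+
  have h1h2: "cov h1 h2 = \<gamma> - b * cnj q"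
  proof -
    have "cov h1 h2 = cov h1 k2 - cnj q * cov h1 \<eta>" unfolding h2_def by (rule cov_residual(3)[OF k2 \<eta> h1])
    also have "cov h1 k2 = cov h1 u2 - cnj p * cov h1 f1" unfolding k2_def by (rule cov_residual(3)[OF u(2) f(1) h1])
    finally show ?thesis unfolding h1c[OF u(2)] z u1u2 \<eta>u2 by simp
  qed
  note meas [measurable] = mem_measurable[OF f(1)] mem_measurable[OF f(2)] mem_measurable[OF \<eta>]
    mem_measurable[OF h1] mem_measurable[OF h2] mem_measurable[OF u(1)] mem_measurable[OF u(2)]
  have s\<kappa>: "(cmod (cov f1 f2))\<^sup>2 + s\<^sup>2 = 1" using s \<kappa> by simp
  note drb = double_ratio_bound[OF f f1 f2 s(1) s\<kappa>]
  have int: "integrable M (\<lambda>\<omega>. X \<omega> * Y \<omega> / (f1 \<omega> * f2 \<omega>))"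
    "integrable M (\<lambda>\<omega>. X \<omega> * cnj (Y \<omega>) / (f1 \<omega> * cnj (f2 \<omega>)))" if XY: "X \<in> H" "Y \<in> H" for X Y
  proof -
    note [measurable] = mem_measurable[OF XY(1)] mem_measurable[OF XY(2)]
    show "integrable M (\<lambda>\<omega>. X \<omega> * Y \<omega> / (f1 \<omega> * f2 \<omega>))"
      "integrable M (\<lambda>\<omega>. X \<omega> * cnj (Y \<omega>) / (f1 \<omega> * cnj (f2 \<omega>)))"
      by (rule Bochner_Integration.integrable_bound[OF drb(1)[OF XY]]; simp add: norm_mult norm_divide)+
  qed
  have inv: "integrable M (\<lambda>\<omega>. 1 / (f1 \<omega> * f2 \<omega>))" "integrable M (\<lambda>\<omega>. 1 / (f1 \<omega> * cnj (f2 \<omega>)))"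
    "integrable M (\<lambda>\<omega>. 1 / (cnj (f1 \<omega>) * f2 \<omega>))"
    by (rule Bochner_Integration.integrable_bound[OF drb(3)[OF u]]; simp add: norm_mult norm_divide)+
  have f2_m: "(\<lambda>(x, y). cnj \<kappa> * x + S * y) \<in> borel_measurable (borel \<Otimes>\<^sub>M borel)" by measurable
  \<comment> \<open>\<open>f2\<close> is a function of \<open>f1\<close> and \<eta>, so the pair of
    noises is independent of every denominator.\<close>
  have noise: "(LINT \<omega>|M. \<phi> (h1 \<omega>, h2 \<omega>) * \<psi> (f1 \<omega>, \<eta> \<omega>)) = (LINT \<omega>|M. \<phi> (h1 \<omega>, h2 \<omega>)) * (LINT \<omega>|M. \<psi> (f1 \<omega>, \<eta> \<omega>))"
    if m: "\<phi> \<in> borel_measurable (borel \<Otimes>\<^sub>M borel)" "\<psi> \<in> borel_measurable (borel \<Otimes>\<^sub>M borel)"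
      and i: "integrable M (\<lambda>\<omega>. \<phi> (h1 \<omega>, h2 \<omega>))" "integrable M (\<lambda>\<omega>. \<psi> (f1 \<omega>, \<eta> \<omega>))"
    for \<phi> \<psi> :: "complex \<times> complex \<Rightarrow> complex"
  proof -
    have "indep_var borel (\<phi> \<circ> (\<lambda>\<omega>. (h1 \<omega>, h2 \<omega>))) borel (\<psi> \<circ> (\<lambda>\<omega>. (f1 \<omega>, \<eta> \<omega>)))"
      using m by (intro indep_var_compose[OF indep_pairs[OF h1 h2 f(1) \<eta> z]]) (simp_all add: borel_prod)
    from indep_var_lebesgue_integral[OF this] i show ?thesis by (simp add: comp_def)
  qed
  have law: "distr M borel f1 = std_complex_gaussian" "distr M borel \<eta> = std_complex_gaussian"
    using mem_circular[OF f(1)] mem_circular[OF \<eta>] f1 r(3)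
    by (simp_all add: circular_gaussian_def distr_id2)
  have pair_law: "std_complex_gaussian \<Otimes>\<^sub>M std_complex_gaussian = distr M (borel \<Otimes>\<^sub>M borel) (\<lambda>\<omega>. (f1 \<omega>, \<eta> \<omega>))"
    using indep_singles[OF f(1) \<eta> f1\<eta>] unfolding indep_var_distribution_eq law by blast
  have pair_int: "integrable (std_complex_gaussian \<Otimes>\<^sub>M std_complex_gaussian) \<psi>"
      and pair_eq: "(LINT x|(std_complex_gaussian \<Otimes>\<^sub>M std_complex_gaussian). \<psi> x) = (LINT \<omega>|M. \<psi> (f1 \<omega>, \<eta> \<omega>))"
    if "\<psi> \<in> borel_measurable (borel \<Otimes>\<^sub>M borel)" "integrable M (\<lambda>\<omega>. \<psi> (f1 \<omega>, \<eta> \<omega>))"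
    for \<psi> :: "complex \<times> complex \<Rightarrow> complex"
    unfolding pair_law using that by (simp_all add: integrable_distr_eq integral_distr)
  \<comment> \<open>The integral over two Gaussians carries the conjugate on the first variable and
    applies with \<open>k = cnj \<kappa>\<close>; conjugating its value gives the one needed
    here.\<close>
  have I1: "(LINT \<omega>|M. 1 / (f1 \<omega> * cnj (f2 \<omega>))) = L / \<kappa>"
  proof -
    let ?\<psi> = "\<lambda>(w, z). 1 / (cnj w * (cnj \<kappa> * w + of_real s * z)) :: complex"
    have m: "?\<psi> \<in> borel_measurable (borel \<Otimes>\<^sub>M borel)" by measurable
    have eq: "?\<psi> (f1 \<omega>, \<eta> \<omega>) = 1 / (cnj (f1 \<omega>) * f2 \<omega>)" for \<omega> by (simp add: f2_eq S_def)
    have i: "integrable M (\<lambda>\<omega>. ?\<psi> (f1 \<omega>, \<eta> \<omega>))" unfolding eq by (rule inv(3))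
    have "(LINT \<omega>|M. 1 / (cnj (f1 \<omega>) * f2 \<omega>)) = L / cnj \<kappa>"
      using integral_two_gaussians_inverse[OF s' s(1) pair_int[OF m i]] pair_eq[OF m i]
      unfolding eq L_def by simp
    then have "cnj (LINT \<omega>|M. 1 / (cnj (f1 \<omega>) * f2 \<omega>)) = L / \<kappa>" by (simp add: L_def)
    then show ?thesis by (simp flip: Bochner_Integration.integral_cnj)
  qed
  have I2: "(LINT \<omega>|M. \<eta> \<omega> * cnj (f1 \<omega>) / (f1 \<omega> * cnj (f2 \<omega>))) = - (S / \<kappa>\<^sup>2) * (L - \<kappa> * cnj \<kappa>)"
  proof -
    let ?\<psi> = "\<lambda>(w, z). cnj z * w / (cnj w * (cnj \<kappa> * w + of_real s * z)) :: complex"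
    have m: "?\<psi> \<in> borel_measurable (borel \<Otimes>\<^sub>M borel)" by measurable
    have eq: "?\<psi> (f1 \<omega>, \<eta> \<omega>) = cnj (\<eta> \<omega> * cnj (f1 \<omega>) / (f1 \<omega> * cnj (f2 \<omega>)))" for \<omega> by (simp add: f2_eq S_def)
    have i: "integrable M (\<lambda>\<omega>. ?\<psi> (f1 \<omega>, \<eta> \<omega>))" unfolding eq using int(2)[OF \<eta> f(1)] by (subst complex_integrable_cnj)
    have "cnj (LINT \<omega>|M. \<eta> \<omega> * cnj (f1 \<omega>) / (f1 \<omega> * cnj (f2 \<omega>))) = - (of_real s / (cnj \<kappa>)\<^sup>2) * of_real (ln (1 / s\<^sup>2) - (cmod \<kappa>)\<^sup>2)"
      using integral_two_gaussians_cnj_ratio[OF s' s(1) pair_int[OF m i]] pair_eq[OF m i]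
      unfolding eq Bochner_Integration.integral_cnj by simp
    then have "cnj (cnj (LINT \<omega>|M. \<eta> \<omega> * cnj (f1 \<omega>) / (f1 \<omega> * cnj (f2 \<omega>)))) =
        cnj (- (of_real s / (cnj \<kappa>)\<^sup>2) * of_real (ln (1 / s\<^sup>2) - (cmod \<kappa>)\<^sup>2))" by (rule arg_cong)
    then show ?thesis unfolding complex_norm_square[symmetric] S_def L_def
      by (simp only: complex_cnj_cnj complex_cnj_mult complex_cnj_minus complex_cnj_divide complex_cnj_complex_of_real
        complex_cnj_power complex_cnj_diff of_real_diff)
  qed
  have nz: "AE \<omega> in M. f1 \<omega> \<noteq> 0 \<and> f2 \<omega> \<noteq> 0"
    using circular_gaussian_AE_neq_0[OF mem_circular[OF f(1)]] circular_gaussian_AE_neq_0[OF mem_circular[OF f(2)]]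
    unfolding f1 f2 by auto
  have \<eta>_f1: "(LINT \<omega>|M. \<eta> \<omega> / f1 \<omega>) = 0" "integrable M (\<lambda>\<omega>. \<eta> \<omega> / f1 \<omega>)"
    using ratio_expectation[OF \<eta> f(1) f1] \<eta>f1 by auto
  have \<eta>_f2: "(LINT \<omega>|M. \<eta> \<omega> / f2 \<omega>) = S" "integrable M (\<lambda>\<omega>. \<eta> \<omega> / f2 \<omega>)"
    using ratio_expectation[OF \<eta> f(2) f2] \<eta>f2 by auto
  \<comment> \<open>Replacing \<open>cnj \<eta>\<close> in the numerator by
    \<open>(cnj f2 - \<kappa> * cnj f1) / S\<close> cancels a denominator and leaves
    \<open>E (\<eta> / f1) = 0\<close> and the integral of \<open>I2\<close>.\<close>
  have I3: "(LINT \<omega>|M. \<eta> \<omega> * cnj (\<eta> \<omega>) / (f1 \<omega> * cnj (f2 \<omega>))) = - (\<kappa> / S) * (LINT \<omega>|M. \<eta> \<omega> * cnj (f1 \<omega>) / (f1 \<omega> * cnj (f2 \<omega>)))"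
  proof -
    have "(LINT \<omega>|M. \<eta> \<omega> * cnj (\<eta> \<omega>) / (f1 \<omega> * cnj (f2 \<omega>))) =
        (LINT \<omega>|M. (1 / S) * (\<eta> \<omega> / f1 \<omega>) - (\<kappa> / S) * (\<eta> \<omega> * cnj (f1 \<omega>) / (f1 \<omega> * cnj (f2 \<omega>))))"
    proof (rule integral_cong_AE)
      show "AE \<omega> in M. \<eta> \<omega> * cnj (\<eta> \<omega>) / (f1 \<omega> * cnj (f2 \<omega>)) =
        (1 / S) * (\<eta> \<omega> / f1 \<omega>) - (\<kappa> / S) * (\<eta> \<omega> * cnj (f1 \<omega>) / (f1 \<omega> * cnj (f2 \<omega>)))"
        using nz
      proof eventually_elim
        fix \<omega> assume "f1 \<omega> \<noteq> 0 \<and> f2 \<omega> \<noteq> 0"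
        moreover have "cnj (f2 \<omega>) = \<kappa> * cnj (f1 \<omega>) + S * cnj (\<eta> \<omega>)" unfolding f2_eq by (simp add: cnjS)
        moreover have "cnj (f2 \<omega>) \<noteq> 0" using calculation(1) by simp
        ultimately show "\<eta> \<omega> * cnj (\<eta> \<omega>) / (f1 \<omega> * cnj (f2 \<omega>)) =
          (1 / S) * (\<eta> \<omega> / f1 \<omega>) - (\<kappa> / S) * (\<eta> \<omega> * cnj (f1 \<omega>) / (f1 \<omega> * cnj (f2 \<omega>)))"
          using S0 by (simp add: divide_simps del: complex_cnj_add complex_cnj_mult) (simp add: algebra_simps)
      qed
    qed measurable
    also have "\<dots> = (1 / S) * 0 - (\<kappa> / S) * (LINT \<omega>|M. \<eta> \<omega> * cnj (f1 \<omega>) / (f1 \<omega> * cnj (f2 \<omega>)))"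
      using Bochner_Integration.integral_diff[OF integrable_mult_right[OF \<eta>_f1(2), of "1 / S"]
          integrable_mult_right[OF int(2)[OF \<eta> f(1)], of "\<kappa> / S"]]
      by (simp only: integral_mult_right_zero \<eta>_f1(1))
    finally show ?thesis by simp
  qed
  \<comment> \<open>The same substitution without conjugates; now \<open>ratio_expectation\<close>
    evaluates both resulting means.\<close>
  have I4: "(LINT \<omega>|M. \<eta> \<omega> * \<eta> \<omega> / (f1 \<omega> * f2 \<omega>)) = - cnj \<kappa>"
  proof -
    have "(LINT \<omega>|M. \<eta> \<omega> * \<eta> \<omega> / (f1 \<omega> * f2 \<omega>)) =
        (LINT \<omega>|M. (1 / S) * (\<eta> \<omega> / f1 \<omega>) - (cnj \<kappa> / S) * (\<eta> \<omega> / f2 \<omega>))"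
    proof (rule integral_cong_AE)
      show "AE \<omega> in M. \<eta> \<omega> * \<eta> \<omega> / (f1 \<omega> * f2 \<omega>) = (1 / S) * (\<eta> \<omega> / f1 \<omega>) - (cnj \<kappa> / S) * (\<eta> \<omega> / f2 \<omega>)"
        using nz
      proof eventually_elim
        fix \<omega> assume "f1 \<omega> \<noteq> 0 \<and> f2 \<omega> \<noteq> 0"
        moreover note f2_eq[of \<omega>]
        ultimately show "\<eta> \<omega> * \<eta> \<omega> / (f1 \<omega> * f2 \<omega>) = (1 / S) * (\<eta> \<omega> / f1 \<omega>) - (cnj \<kappa> / S) * (\<eta> \<omega> / f2 \<omega>)"
          using S0 by (simp add: divide_simps) (simp add: algebra_simps)
      qed
    qed measurable
    also have "\<dots> = (1 / S) * 0 - (cnj \<kappa> / S) * S"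
      using Bochner_Integration.integral_diff[OF integrable_mult_right[OF \<eta>_f1(2), of "1 / S"]
          integrable_mult_right[OF \<eta>_f2(2), of "cnj \<kappa> / S"]]
      by (simp only: integral_mult_right_zero \<eta>_f1(1) \<eta>_f2(1))
    finally show ?thesis using S0 by simp
  qed
  have N1: "(LINT \<omega>|M. h1 \<omega> * h2 \<omega> / (f1 \<omega> * f2 \<omega>)) = 0"
    using noise[of "\<lambda>(x, y). x * y" "\<lambda>(x, y). 1 / (x * (cnj \<kappa> * x + S * y))"] mem_mult_integrable(1)[OF h1 h2] inv(1) mem_mult_mean[OF h1 h2]
    by (simp add: f2_eq[symmetric])
  have N2: "(LINT \<omega>|M. h1 \<omega> * cnj (h2 \<omega>) / (f1 \<omega> * cnj (f2 \<omega>))) = cov h1 h2 * (LINT \<omega>|M. 1 / (f1 \<omega> * cnj (f2 \<omega>)))"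
    using noise[of "\<lambda>(x, y). x * cnj y" "\<lambda>(x, y). 1 / (x * cnj (cnj \<kappa> * x + S * y))"] mem_mult_integrable(2)[OF h1 h2] inv(2)
    by (simp add: f2_eq[symmetric] del: complex_cnj_add complex_cnj_mult)
  \<comment> \<open>A single numerator is dominated through \<open>x \<le> x * x + 1\<close> by the
    cases of two equal numerators and of none.\<close>
  have unit_int: "integrable M (\<lambda>\<omega>. X \<omega> / (f1 \<omega> * f2 \<omega>))" "integrable M (\<lambda>\<omega>. X \<omega> / (f1 \<omega> * cnj (f2 \<omega>)))"
    "integrable M (\<lambda>\<omega>. cnj (X \<omega>) / (f1 \<omega> * cnj (f2 \<omega>)))" if X: "X \<in> H" for X
  proof -
    note [measurable] = mem_measurable[OF X]
    have i: "integrable M (\<lambda>\<omega>. cmod (X \<omega>) * cmod (X \<omega>) / (cmod (f1 \<omega>) * cmod (f2 \<omega>)) + 1 / (cmod (f1 \<omega>) * cmod (f2 \<omega>)))"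
      using drb(1)[OF X X] drb(3)[OF X X] by (rule Bochner_Integration.integrable_add)
    have le: "x / d \<le> x * x / d + 1 / d" if "0 \<le> d" for x d :: real
    proof -
      have "x \<le> x * x + 1" using zero_le_power2[of "x - 1"] zero_le_power2[of x] unfolding power2_eq_square by (simp add: algebra_simps; linarith)
      then have "x / d \<le> (x * x + 1) / d" using that by (rule divide_right_mono)
      then show ?thesis by (simp add: add_divide_distrib)
    qed
    show "integrable M (\<lambda>\<omega>. X \<omega> / (f1 \<omega> * f2 \<omega>))" "integrable M (\<lambda>\<omega>. X \<omega> / (f1 \<omega> * cnj (f2 \<omega>)))"
      "integrable M (\<lambda>\<omega>. cnj (X \<omega>) / (f1 \<omega> * cnj (f2 \<omega>)))"
      by (rule Bochner_Integration.integrable_bound[OF i]; simp add: norm_mult norm_divide; intro AE_I2 le mult_nonneg_nonneg norm_ge_zero)+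
  qed
  \<comment> \<open>Mixed terms contain exactly one noise factor, which has mean zero and is
    independent of the rest.\<close>
  have N3: "(LINT \<omega>|M. X \<omega> * Y \<omega> / (f1 \<omega> * f2 \<omega>)) = 0" "(LINT \<omega>|M. X \<omega> * cnj (Y \<omega>) / (f1 \<omega> * cnj (f2 \<omega>))) = 0"
    if "(X = h1 \<or> X = h2) \<and> (Y = f1 \<or> Y = \<eta>) \<or> (X = f1 \<or> X = \<eta>) \<and> (Y = h1 \<or> Y = h2)" for X Y
  proof -
    have g1: "(LINT \<omega>|M. Z \<omega> * (Y \<omega> / (f1 \<omega> * f2 \<omega>))) = 0"
      "(LINT \<omega>|M. Z \<omega> * (cnj (Y \<omega>) / (f1 \<omega> * cnj (f2 \<omega>)))) = 0"
      "(LINT \<omega>|M. cnj (Z \<omega>) * (Y \<omega> / (f1 \<omega> * cnj (f2 \<omega>)))) = 0"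
      if ZY: "Z = h1 \<or> Z = h2" "Y = f1 \<or> Y = \<eta>" for Z Y
    proof -
      have "fst \<in> borel_measurable (borel \<Otimes>\<^sub>M borel :: (complex \<times> complex) measure)"
        "snd \<in> borel_measurable (borel \<Otimes>\<^sub>M borel :: (complex \<times> complex) measure)" by measurable
      then obtain \<phi> \<psi> :: "complex \<times> complex \<Rightarrow> complex"
        where [measurable]: "\<phi> \<in> borel_measurable (borel \<Otimes>\<^sub>M borel)" "\<psi> \<in> borel_measurable (borel \<Otimes>\<^sub>M borel)"
          and \<phi>: "\<And>\<omega>. \<phi> (h1 \<omega>, h2 \<omega>) = Z \<omega>" and \<psi>: "\<And>\<omega>. \<psi> (f1 \<omega>, \<eta> \<omega>) = Y \<omega>"
        using ZY by (metis fst_conv snd_conv)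
      have Z: "Z \<in> H" and Y: "Y \<in> H" using ZY h1 h2 f(1) \<eta> by auto
      have iZ: "integrable M Z" "integrable M (\<lambda>\<omega>. cnj (Z \<omega>))" "(LINT \<omega>|M. cnj (Z \<omega>)) = 0"
        using mem_integrable[OF Z] mem_mean[OF Z] by (simp_all add: complex_integrable_cnj)
      have m: "(\<lambda>p. \<psi> p / (fst p * (cnj \<kappa> * fst p + S * snd p))) \<in> borel_measurable (borel \<Otimes>\<^sub>M borel)"
        "(\<lambda>p. \<psi> p / (fst p * cnj (cnj \<kappa> * fst p + S * snd p))) \<in> borel_measurable (borel \<Otimes>\<^sub>M borel)"
        "(\<lambda>p. cnj (\<psi> p) / (fst p * cnj (cnj \<kappa> * fst p + S * snd p))) \<in> borel_measurable (borel \<Otimes>\<^sub>M borel)"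
        "(\<lambda>p. cnj (\<phi> p)) \<in> borel_measurable (borel \<Otimes>\<^sub>M borel)"
        "\<phi> \<in> borel_measurable (borel \<Otimes>\<^sub>M borel)"
        by measurable
      note u = unit_int[OF Y]
      show "(LINT \<omega>|M. Z \<omega> * (Y \<omega> / (f1 \<omega> * f2 \<omega>))) = 0"
        using noise[OF m(5) m(1), unfolded fst_conv snd_conv \<phi> \<psi> f2_eq[symmetric], OF iZ(1) u(1)] mem_mean[OF Z]
        by simp
      show "(LINT \<omega>|M. Z \<omega> * (cnj (Y \<omega>) / (f1 \<omega> * cnj (f2 \<omega>)))) = 0"
        using noise[OF m(5) m(3), unfolded fst_conv snd_conv \<phi> \<psi> f2_eq[symmetric], OF iZ(1) u(3)] mem_mean[OF Z]
        by simp
      show "(LINT \<omega>|M. cnj (Z \<omega>) * (Y \<omega> / (f1 \<omega> * cnj (f2 \<omega>)))) = 0"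
        using noise[OF m(4) m(2), unfolded fst_conv snd_conv \<phi> \<psi> f2_eq[symmetric], OF iZ(2) u(2)] iZ(3)
        by simp
    qed
    show "(LINT \<omega>|M. X \<omega> * Y \<omega> / (f1 \<omega> * f2 \<omega>)) = 0" "(LINT \<omega>|M. X \<omega> * cnj (Y \<omega>) / (f1 \<omega> * cnj (f2 \<omega>))) = 0"
      using that g1[of X Y] g1[of Y X] by (auto simp: mult.commute)
  qed
  have u1_eq: "u1 \<omega> = b * \<eta> \<omega> + h1 \<omega>" and u2_eq: "u2 \<omega> = p * f1 \<omega> + q * \<eta> \<omega> + h2 \<omega>" for \<omega>
    by (simp_all add: h1_def h2_def k2_def)
  have plain: "(LINT \<omega>|M. u1 \<omega> * u2 \<omega> / (f1 \<omega> * f2 \<omega>)) = b * p * S - b * q * cnj \<kappa>"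
  proof -
    have f1f1: "AE \<omega> in M. \<eta> \<omega> * f1 \<omega> / (f1 \<omega> * f2 \<omega>) = \<eta> \<omega> / f2 \<omega>" using nz by eventually_elim simp
    have e1: "(LINT \<omega>|M. \<eta> \<omega> * f1 \<omega> / (f1 \<omega> * f2 \<omega>)) = S"
      unfolding \<eta>_f2(1)[symmetric] by (rule integral_cong_AE) (use f1f1 in auto)
    have "u1 \<omega> * u2 \<omega> / (f1 \<omega> * f2 \<omega>) = (b * p) * (\<eta> \<omega> * f1 \<omega> / (f1 \<omega> * f2 \<omega>)) + (b * q) * (\<eta> \<omega> * \<eta> \<omega> / (f1 \<omega> * f2 \<omega>))
        + b * (\<eta> \<omega> * h2 \<omega> / (f1 \<omega> * f2 \<omega>)) + p * (h1 \<omega> * f1 \<omega> / (f1 \<omega> * f2 \<omega>)) + q * (h1 \<omega> * \<eta> \<omega> / (f1 \<omega> * f2 \<omega>))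
        + h1 \<omega> * h2 \<omega> / (f1 \<omega> * f2 \<omega>)" for \<omega>
      unfolding u1_eq[of \<omega>] u2_eq[of \<omega>] by (simp only: distrib_left distrib_right add_divide_distrib times_divide_eq_right mult_ac add_ac)
    then have "(LINT \<omega>|M. u1 \<omega> * u2 \<omega> / (f1 \<omega> * f2 \<omega>)) =
        (b * p) * (LINT \<omega>|M. \<eta> \<omega> * f1 \<omega> / (f1 \<omega> * f2 \<omega>)) + (b * q) * (LINT \<omega>|M. \<eta> \<omega> * \<eta> \<omega> / (f1 \<omega> * f2 \<omega>))
        + b * (LINT \<omega>|M. \<eta> \<omega> * h2 \<omega> / (f1 \<omega> * f2 \<omega>)) + p * (LINT \<omega>|M. h1 \<omega> * f1 \<omega> / (f1 \<omega> * f2 \<omega>))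
        + q * (LINT \<omega>|M. h1 \<omega> * \<eta> \<omega> / (f1 \<omega> * f2 \<omega>)) + (LINT \<omega>|M. h1 \<omega> * h2 \<omega> / (f1 \<omega> * f2 \<omega>))"
      by (simp only:)
        (subst Bochner_Integration.integral_add integral_mult_right_zero,
          (intro Bochner_Integration.integrable_add integrable_mult_right int(1) f \<eta> h1 h2)+ | simp only: integral_mult_right_zero)+
    moreover have "(LINT \<omega>|M. \<eta> \<omega> * h2 \<omega> / (f1 \<omega> * f2 \<omega>)) = 0" "(LINT \<omega>|M. h1 \<omega> * f1 \<omega> / (f1 \<omega> * f2 \<omega>)) = 0"
      "(LINT \<omega>|M. h1 \<omega> * \<eta> \<omega> / (f1 \<omega> * f2 \<omega>)) = 0"
      by (rule N3(1); blast)+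
    ultimately show ?thesis unfolding e1 I4 N1 by (simp only:) simp
  qed
  have sesq: "(LINT \<omega>|M. u1 \<omega> * cnj (u2 \<omega>) / (f1 \<omega> * cnj (f2 \<omega>))) =
      b * cnj p * (- (S / \<kappa>\<^sup>2) * (L - \<kappa> * cnj \<kappa>)) + b * cnj q * (- (\<kappa> / S) * (- (S / \<kappa>\<^sup>2) * (L - \<kappa> * cnj \<kappa>)))
      + (\<gamma> - b * cnj q) * (L / \<kappa>)"
  proof -
    have "u1 \<omega> * cnj (u2 \<omega>) / (f1 \<omega> * cnj (f2 \<omega>)) = (b * cnj p) * (\<eta> \<omega> * cnj (f1 \<omega>) / (f1 \<omega> * cnj (f2 \<omega>)))
        + (b * cnj q) * (\<eta> \<omega> * cnj (\<eta> \<omega>) / (f1 \<omega> * cnj (f2 \<omega>)))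
        + b * (\<eta> \<omega> * cnj (h2 \<omega>) / (f1 \<omega> * cnj (f2 \<omega>))) + cnj p * (h1 \<omega> * cnj (f1 \<omega>) / (f1 \<omega> * cnj (f2 \<omega>)))
        + cnj q * (h1 \<omega> * cnj (\<eta> \<omega>) / (f1 \<omega> * cnj (f2 \<omega>)))
        + h1 \<omega> * cnj (h2 \<omega>) / (f1 \<omega> * cnj (f2 \<omega>))" for \<omega>
      unfolding u1_eq[of \<omega>] u2_eq[of \<omega>] complex_cnj_add complex_cnj_mult
      by (simp only: distrib_left distrib_right add_divide_distrib times_divide_eq_right mult_ac add_ac)
    then have "(LINT \<omega>|M. u1 \<omega> * cnj (u2 \<omega>) / (f1 \<omega> * cnj (f2 \<omega>))) =
        (b * cnj p) * (LINT \<omega>|M. \<eta> \<omega> * cnj (f1 \<omega>) / (f1 \<omega> * cnj (f2 \<omega>)))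
        + (b * cnj q) * (LINT \<omega>|M. \<eta> \<omega> * cnj (\<eta> \<omega>) / (f1 \<omega> * cnj (f2 \<omega>)))
        + b * (LINT \<omega>|M. \<eta> \<omega> * cnj (h2 \<omega>) / (f1 \<omega> * cnj (f2 \<omega>)))
        + cnj p * (LINT \<omega>|M. h1 \<omega> * cnj (f1 \<omega>) / (f1 \<omega> * cnj (f2 \<omega>)))
        + cnj q * (LINT \<omega>|M. h1 \<omega> * cnj (\<eta> \<omega>) / (f1 \<omega> * cnj (f2 \<omega>)))
        + (LINT \<omega>|M. h1 \<omega> * cnj (h2 \<omega>) / (f1 \<omega> * cnj (f2 \<omega>)))"
      by (simp only:)
        (subst Bochner_Integration.integral_add integral_mult_right_zero,
          (intro Bochner_Integration.integrable_add integrable_mult_right int(2) f \<eta> h1 h2)+ | simp only: integral_mult_right_zero)+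
    moreover have "(LINT \<omega>|M. \<eta> \<omega> * cnj (h2 \<omega>) / (f1 \<omega> * cnj (f2 \<omega>))) = 0"
      "(LINT \<omega>|M. h1 \<omega> * cnj (f1 \<omega>) / (f1 \<omega> * cnj (f2 \<omega>))) = 0"
      "(LINT \<omega>|M. h1 \<omega> * cnj (\<eta> \<omega>) / (f1 \<omega> * cnj (f2 \<omega>))) = 0"
      by (rule N3(2); blast)+
    ultimately show ?thesis
      unfolding I3 I2 N2 h1h2 I1 by (simp only:) simp
  qed
  \<comment> \<open>A product of imaginary parts combines one sesquilinear and one bilinear ratio;
    hence the parallel computations \<open>sesq\<close> and \<open>plain\<close>.\<close>
  have prod: "Im (u1 \<omega> / f1 \<omega>) * Im (u2 \<omega> / f2 \<omega>) =
      Re (u1 \<omega> * cnj (u2 \<omega>) / (f1 \<omega> * cnj (f2 \<omega>)) - u1 \<omega> * u2 \<omega> / (f1 \<omega> * f2 \<omega>)) / 2" for \<omega>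
    unfolding Im_mult_Im by simp
  have idiff: "integrable M (\<lambda>\<omega>. u1 \<omega> * cnj (u2 \<omega>) / (f1 \<omega> * cnj (f2 \<omega>)) - u1 \<omega> * u2 \<omega> / (f1 \<omega> * f2 \<omega>))"
    by (intro Bochner_Integration.integrable_diff int u)
  show "integrable M (\<lambda>\<omega>. Im (u1 \<omega> / f1 \<omega>) * Im (u2 \<omega> / f2 \<omega>))"
    unfolding prod using idiff by (intro integrable_divide integrable_Re)
  have "(LINT \<omega>|M. Im (u1 \<omega> / f1 \<omega>) * Im (u2 \<omega> / f2 \<omega>)) =
      Re ((LINT \<omega>|M. u1 \<omega> * cnj (u2 \<omega>) / (f1 \<omega> * cnj (f2 \<omega>))) - (LINT \<omega>|M. u1 \<omega> * u2 \<omega> / (f1 \<omega> * f2 \<omega>))) / 2"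
    unfolding prod integral_divide_zero integral_Re[OF idiff]
    by (subst Bochner_Integration.integral_diff) (intro int u refl)+
  also have "(LINT \<omega>|M. u1 \<omega> * u2 \<omega> / (f1 \<omega> * f2 \<omega>)) = - (of_real ((cmod \<beta>)\<^sup>2) / S\<^sup>2)"
  proof -
    have "b * p * S - b * q * cnj \<kappa> = - (\<beta> * cnj \<beta> * (S\<^sup>2 + \<kappa> * cnj \<kappa>) / S\<^sup>2)"
      using S0 by (simp add: b_def p_def q_def field_simps power2_eq_square)
    then show ?thesis unfolding plain complex_norm_square using nS by (simp add: add.commute)
  qed
  also have "(LINT \<omega>|M. u1 \<omega> * cnj (u2 \<omega>) / (f1 \<omega> * cnj (f2 \<omega>))) =
      (\<beta> / \<kappa>)\<^sup>2 * (L - \<kappa> * cnj \<kappa> / S\<^sup>2) + \<gamma> / \<kappa> * L"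
  proof (cases "\<kappa> = 0")
    case True
    then show ?thesis unfolding sesq by simp
  next
    case False
    have q': "cnj q = cnj \<kappa> * \<beta> / S" "cnj p = - \<beta>" by (simp_all add: q_def p_def cnjS)
    \<comment> \<open>Writing \<open>cnj \<kappa>\<close> as \<open>n / \<kappa>\<close> with
      \<open>n = 1 - S^2\<close> removes the conjugate and leaves an identity between rational
      expressions.\<close>
    define n where "n = \<kappa> * cnj \<kappa>"
    have cn: "cnj \<kappa> = n / \<kappa>" using False by (simp add: n_def)
    have n: "n = 1 - S\<^sup>2" using nS unfolding n_def[symmetric] by (simp add: algebra_simps)
    show ?thesis unfolding sesq q' b_def n_def[symmetric] unfolding cn
      using S0 False unfolding n by (simp add: divide_simps) (simp add: algebra_simps power2_eq_square)
  qed
  also have "\<kappa> * cnj \<kappa> / S\<^sup>2 = of_real ((cmod \<kappa>)\<^sup>2 / s\<^sup>2)"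
    unfolding complex_norm_square[symmetric] S_def by simp
  also have "- (complex_of_real ((cmod \<beta>)\<^sup>2) / S\<^sup>2) = - of_real ((cmod \<beta>)\<^sup>2 / s\<^sup>2)"
    unfolding S_def by simp
  finally show "(LINT \<omega>|M. Im (u1 \<omega> / f1 \<omega>) * Im (u2 \<omega> / f2 \<omega>)) =
      Re ((\<beta> / \<kappa>)\<^sup>2 * of_real (ln (1 / s\<^sup>2) - (cmod \<kappa>)\<^sup>2 / s\<^sup>2) + \<gamma> / \<kappa> * of_real (ln (1 / s\<^sup>2))) / 2
      + (cmod \<beta>)\<^sup>2 / (2 * s\<^sup>2)"
    unfolding L_def by (simp add: add_divide_distrib)
qed

end

section \<open>The covariance kernel as a Fourier transform\<close>

lemma has_vector_derivative_iff_quotient: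
  fixes g :: "real \<Rightarrow> 'a::real_normed_vector"
  shows "(g has_vector_derivative d) (at x) \<longleftrightarrow> ((\<lambda>h. (g (x + h) - g x) /\<^sub>R h) \<longlongrightarrow> d) (at 0)"
proof -
  have eq: "norm (g (x + h) - g x - h *\<^sub>R d) / norm h = norm ((g (x + h) - g x) /\<^sub>R h - d)" if "h \<noteq> 0" for h
  proof -
    have "(g (x + h) - g x) /\<^sub>R h - d = (g (x + h) - g x - h *\<^sub>R d) /\<^sub>R h"
      using that by (simp add: scaleR_diff_right)
    then show ?thesis by (simp add: divide_inverse mult.commute)
  qed
  have "(g has_vector_derivative d) (at x) \<longleftrightarrow>
      ((\<lambda>h. norm (g (x + h) - g x - h *\<^sub>R d) / norm h) \<longlongrightarrow> 0) (at 0)"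
    unfolding has_vector_derivative_def has_derivative_at using bounded_linear_scaleR_left by blast
  also have "\<dots> \<longleftrightarrow> ((\<lambda>h. norm ((g (x + h) - g x) /\<^sub>R h - d)) \<longlongrightarrow> 0) (at 0)"
  proof (rule filterlim_cong[OF refl refl])
    show "eventually (\<lambda>h. norm (g (x + h) - g x - h *\<^sub>R d) / norm h = norm ((g (x + h) - g x) /\<^sub>R h - d)) (at 0)"
      unfolding eventually_at_filter by (rule always_eventually) (use eq in blast)
  qed
  also have "\<dots> \<longleftrightarrow> ((\<lambda>h. (g (x + h) - g x) /\<^sub>R h) \<longlongrightarrow> d) (at 0)"
    unfolding tendsto_norm_zero_iff by (subst Lim_null) simp
  finally show ?thesis .
qed

lemma ball_in_borel [measurable]: "ball (x :: 'a::metric_space) e \<in> sets borel"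
  by simp

lemma nn_integral_abs_powr_finite:
  fixes x0 \<delta> :: real
  shows "(\<integral>\<^sup>+ x. ennreal (\<bar>x - x0\<bar> powr (-3/4)) * indicator (ball x0 \<delta>) x \<partial>lborel) < \<infinity>"
proof (cases "\<delta> > 0")
  case d: True
  let ?g = "\<lambda>y. ennreal (indicator {0..\<delta>} y * y powr (-3/4))"
  have fin: "(\<integral>\<^sup>+ y. ?g y \<partial>lborel) < \<infinity>"
  proof -
    have "((\<lambda>y. y powr (-3/4)) has_integral (\<delta> powr (-3/4 + 1) / (-3/4 + 1))) {0..\<delta>}"
      using d by (intro has_integral_powr_from_0) auto
    then have "((\<lambda>y. if y \<in> {0..\<delta>} then y powr (-3/4) else 0) has_integral (\<delta> powr (-3/4 + 1) / (-3/4 + 1))) UNIV"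
      by (subst has_integral_restrict_UNIV)
    then have "((\<lambda>y. indicator {0..\<delta>} y * y powr (-3/4)) has_integral (\<delta> powr (-3/4 + 1) / (-3/4 + 1))) UNIV"
      by (rule has_integral_eq[rotated]) (auto simp: indicator_def)
    then have "(\<integral>\<^sup>+ y. ?g y \<partial>lborel) = ennreal (\<delta> powr (-3/4 + 1) / (-3/4 + 1))"
      by (intro nn_integral_has_integral_lborel) auto
    then show ?thesis by simp
  qed
  have "(\<integral>\<^sup>+ x. ennreal (\<bar>x - x0\<bar> powr (-3/4)) * indicator (ball x0 \<delta>) x \<partial>lborel) \<le>
      (\<integral>\<^sup>+ x. ?g (x - x0) + ?g (x0 - x) \<partial>lborel)"
  proof (intro nn_integral_mono)
    fix x
    show "ennreal (\<bar>x - x0\<bar> powr (-3/4)) * indicator (ball x0 \<delta>) x \<le> ?g (x - x0) + ?g (x0 - x)"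
      by (cases "x0 \<le> x") (auto simp: indicator_def dist_real_def)
  qed
  also have "\<dots> = (\<integral>\<^sup>+ x. ?g (x - x0) \<partial>lborel) + (\<integral>\<^sup>+ x. ?g (x0 - x) \<partial>lborel)"
    by (intro nn_integral_add) auto
  also have "(\<integral>\<^sup>+ x. ?g (x - x0) \<partial>lborel) = (\<integral>\<^sup>+ y. ?g y \<partial>lborel)"
    using nn_integral_real_affine[of "\<lambda>x. ?g (x - x0)" 1 x0] by simp
  also have "(\<integral>\<^sup>+ x. ?g (x0 - x) \<partial>lborel) = (\<integral>\<^sup>+ y. ?g y \<partial>lborel)"
    using nn_integral_real_affine[of "\<lambda>x. ?g (x0 - x)" "-1" x0] by simp
  also have "(\<integral>\<^sup>+ y. ?g y \<partial>lborel) + (\<integral>\<^sup>+ y. ?g y \<partial>lborel) < \<infinity>"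
    using fin by (simp only: ennreal_add_less_top infinity_ennreal_def)
  finally show ?thesis .
qed (simp add: ball_empty)

text \<open>\<open>moment\<close> has the form that the sum over dyadic scales produces in
  \<open>log_sum_bound\<close>; \<open>spectral_moment\<close> supplies it from the logarithmic
  moment condition.\<close>

locale spectral = real_distribution \<rho> for \<rho> :: "real measure" +
  fixes r :: "real \<Rightarrow> complex"
  assumes r_eq: "r t = (LINT l|\<rho>. iexp (- (t * l)))"
    and moment: "integrable \<rho> (\<lambda>l. l\<^sup>2 * (1 + ln (1 + \<bar>l\<bar>)))"
    and nondegenerate: "\<not> degenerate \<rho>"
begin

lemma square_integrable: "integrable \<rho> (\<lambda>l. l\<^sup>2)"
proof (rule Bochner_Integration.integrable_bound[OF moment])
  have "l\<^sup>2 \<le> l\<^sup>2 * (1 + ln (1 + \<bar>l\<bar>))" for l :: real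
    by (simp add: mult_le_cancel_left1)
  then show "AE l in \<rho>. norm (l\<^sup>2) \<le> norm (l\<^sup>2 * (1 + ln (1 + \<bar>l\<bar>)))"
    by (auto intro!: AE_I2 simp: abs_mult)
qed simp

lemma abs_integrable: "integrable \<rho> (\<lambda>l. l)"
proof (rule Bochner_Integration.integrable_bound)
  show "integrable \<rho> (\<lambda>l. 1 + l\<^sup>2)" using square_integrable by simp
  have "\<bar>l\<bar> \<le> 1 + l\<^sup>2" for l :: real
    using zero_le_power2[of "\<bar>l\<bar> - 1"] abs_ge_zero[of l] unfolding power2_diff by (simp del: abs_ge_zero)
  then show "AE l in \<rho>. norm l \<le> norm (1 + l\<^sup>2)" by simp
qed simp

definition r1 :: "real \<Rightarrow> complex" where
  "r1 t = (LINT l|\<rho>. - (\<i> * of_real l) * iexp (- (t * l)))"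

definition r2 :: "real \<Rightarrow> complex" where
  "r2 t = (LINT l|\<rho>. - of_real (l\<^sup>2) * iexp (- (t * l)))"

lemma norm_iexp_diff: "cmod (iexp a - 1) \<le> \<bar>a\<bar>"
  using iexp_approx1[of a 0] by simp

lemma difference_quotient_bound: "cmod ((iexp (- (h * l)) - 1) / of_real h) \<le> \<bar>l\<bar>"
proof (cases "h = 0")
  case False
  have "cmod (iexp (- (h * l)) - 1) \<le> \<bar>l\<bar> * \<bar>h\<bar>"
    using norm_iexp_diff[of "- (h * l)"] by (simp add: abs_mult mult.commute)
  with False show ?thesis
    by (simp add: norm_divide pos_divide_le_eq)
qed simp

lemma difference_quotient_tendsto:
  assumes "h \<longlonglongrightarrow> 0" "\<And>n. h n \<noteq> 0"
  shows "(\<lambda>n. (iexp (- (h n * l)) - 1) / of_real (h n)) \<longlonglongrightarrow> - (\<i> * of_real l)"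
proof -
  have "((\<lambda>x. - (x * l)) has_vector_derivative - l) (at 0)"
    by (auto intro!: derivative_eq_intros simp: has_real_derivative_iff_has_vector_derivative[symmetric])
  from vector_diff_chain_at[OF this has_vector_derivative_iexp]
  have "((\<lambda>x. iexp (- (x * l))) has_vector_derivative - (\<i> * of_real l)) (at 0)"
    by (simp add: comp_def scaleR_conv_of_real mult.commute)
  then have "((\<lambda>y. (iexp (- (y * l)) - 1) /\<^sub>R y) \<longlongrightarrow> - (\<i> * of_real l)) (at 0)"
    unfolding has_vector_derivative_iff_quotient by simp
  moreover have "filterlim h (at 0) sequentially"
    using assms by (intro filterlim_atI) auto
  ultimately have "(\<lambda>n. (iexp (- (h n * l)) - 1) /\<^sub>R h n) \<longlonglongrightarrow> - (\<i> * of_real l)"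
    by (rule filterlim_compose)
  then show ?thesis by (simp add: scaleR_conv_of_real divide_inverse mult.commute)
qed

text \<open>The difference quotients of the character are bounded by \<open>|l|\<close>, so the
  integrable \<open>l * w l\<close> dominates and the limit passes under the integral. The weight 1
  gives the first derivative of \<open>r\<close>, the weight \<open>- \<i> * l\<close> the
  second.\<close>

lemma fourier_has_vector_derivative:
  fixes w :: "real \<Rightarrow> complex"
  assumes [measurable]: "w \<in> borel_measurable borel" and w: "integrable \<rho> w" and lw: "integrable \<rho> (\<lambda>l. of_real l * w l)"
  shows "((\<lambda>t. LINT l|\<rho>. w l * iexp (- (t * l))) has_vector_derivative
    (LINT l|\<rho>. - (\<i> * of_real l) * w l * iexp (- (t * l)))) (at t)"
proof -
  have wi: "integrable \<rho> (\<lambda>l. w l * iexp (- (t * l)))" for t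
    by (rule Bochner_Integration.integrable_bound[OF w]) (auto simp: norm_mult)
  have "(\<lambda>n. ((LINT l|\<rho>. w l * iexp (- ((t + h n) * l))) - (LINT l|\<rho>. w l * iexp (- (t * l)))) /\<^sub>R h n)
      \<longlonglongrightarrow> (LINT l|\<rho>. - (\<i> * of_real l) * w l * iexp (- (t * l)))"
    if h: "h \<longlonglongrightarrow> 0" "\<And>n. h n \<noteq> 0" for h
  proof -
    have eq: "((LINT l|\<rho>. w l * iexp (- ((t + h n) * l))) - (LINT l|\<rho>. w l * iexp (- (t * l)))) /\<^sub>R h n =
        (LINT l|\<rho>. (w l * iexp (- (t * l))) * ((iexp (- (h n * l)) - 1) / of_real (h n)))" for n
    proof -
      have "(w l * iexp (- (t * l))) * ((iexp (- (h n * l)) - 1) / of_real (h n)) =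
          inverse (h n) *\<^sub>R (w l * iexp (- ((t + h n) * l)) - w l * iexp (- (t * l)))" for l
      proof -
        have "iexp (- ((t + h n) * l)) = iexp (- (t * l)) * iexp (- (h n * l))"
          by (simp add: mult_exp_exp algebra_simps)
        then show ?thesis by (simp only: scaleR_conv_of_real divide_inverse of_real_inverse) (simp add: algebra_simps)
      qed
      then show ?thesis
        by (simp only: integral_scaleR_right Bochner_Integration.integral_diff[OF wi wi])
    qed
    have "(\<lambda>n. LINT l|\<rho>. (w l * iexp (- (t * l))) * ((iexp (- (h n * l)) - 1) / of_real (h n)))
      \<longlonglongrightarrow> (LINT l|\<rho>. (w l * iexp (- (t * l))) * (- (\<i> * of_real l)))"
    proof (rule integral_dominated_convergence[where w="\<lambda>l. norm (of_real l * w l)"])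
      show "AE l in \<rho>. (\<lambda>n. (w l * iexp (- (t * l))) * ((iexp (- (h n * l)) - 1) / of_real (h n)))
          \<longlonglongrightarrow> (w l * iexp (- (t * l))) * (- (\<i> * of_real l))"
        by (intro AE_I2 tendsto_mult tendsto_const difference_quotient_tendsto h)
      show "AE l in \<rho>. norm ((w l * iexp (- (t * l))) * ((iexp (- (h n * l)) - 1) / of_real (h n))) \<le> norm (of_real l * w l)" for n
      proof (intro AE_I2)
        fix l
        have n1: "cmod (iexp (- (t * l))) = 1" by simp
        show "norm ((w l * iexp (- (t * l))) * ((iexp (- (h n * l)) - 1) / of_real (h n))) \<le> norm (of_real l * w l)"
          using mult_left_mono[OF difference_quotient_bound[of "h n" l] norm_ge_zero[of "w l"]]
          unfolding norm_mult n1 norm_of_real by (simp only: mult_1_right mult.commute[of "\<bar>l\<bar>"])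
      qed
    qed (use lw in \<open>auto intro: integrable_norm\<close>)
    then show ?thesis unfolding eq by (simp add: mult_ac)
  qed
  then have "((\<lambda>y. ((LINT l|\<rho>. w l * iexp (- ((t + y) * l))) - (LINT l|\<rho>. w l * iexp (- (t * l)))) /\<^sub>R y)
      \<longlongrightarrow> (LINT l|\<rho>. - (\<i> * of_real l) * w l * iexp (- (t * l)))) (at 0)"
    by (auto simp: tendsto_at_iff_sequentially comp_def)
  then show ?thesis unfolding has_vector_derivative_iff_quotient .
qed

lemma r_deriv: "(r has_vector_derivative r1 t) (at t)"
proof -
  have "r = (\<lambda>t. LINT l|\<rho>. 1 * iexp (- (t * l)))" using r_eq by auto
  moreover have "integrable \<rho> (\<lambda>l. complex_of_real l * 1)" using abs_integrable by simp
  ultimately show ?thesis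
    using fourier_has_vector_derivative[of "\<lambda>_. 1" t] by (simp add: r1_def)
qed

lemma r1_deriv: "(r1 has_vector_derivative r2 t) (at t)"
proof -
  have "integrable \<rho> (\<lambda>l. - (\<i> * complex_of_real l))"
    using abs_integrable by simp
  moreover have "integrable \<rho> (\<lambda>l. of_real l * - (\<i> * complex_of_real l))"
  proof -
    have "integrable \<rho> (\<lambda>l. - \<i> * complex_of_real (l\<^sup>2))"
      by (intro integrable_mult_right integrable_of_real square_integrable)
    then show ?thesis by (simp add: power2_eq_square mult_ac)
  qed
  ultimately have "((\<lambda>t. LINT l|\<rho>. - (\<i> * of_real l) * iexp (- (t * l))) has_vector_derivative
      (LINT l|\<rho>. - (\<i> * of_real l) * - (\<i> * of_real l) * iexp (- (t * l)))) (at t)"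
    by (intro fourier_has_vector_derivative) auto
  moreover have "- (\<i> * complex_of_real l) * - (\<i> * of_real l) = - of_real (l\<^sup>2)" for l
    by (simp add: power2_eq_square algebra_simps)
  ultimately show ?thesis by (simp only: r1_def[abs_def] r2_def)
qed

lemma continuous_r: "continuous_on UNIV r"
  using r_deriv has_vector_derivative_continuous continuous_at_imp_continuous_on by blast

lemma continuous_r1: "continuous_on UNIV r1"
  using r1_deriv has_vector_derivative_continuous continuous_at_imp_continuous_on by blast

lemma continuous_r2: "continuous_on UNIV r2"
proof (intro continuous_at_imp_continuous_on ballI continuous_at_sequentiallyI)
  fix t and u :: "nat \<Rightarrow> real" assume u: "u \<longlonglongrightarrow> t"
  show "(\<lambda>n. r2 (u n)) \<longlonglongrightarrow> r2 t"
    unfolding r2_def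
  proof (rule integral_dominated_convergence[where w="\<lambda>l. l\<^sup>2"])
    show "AE l in \<rho>. (\<lambda>n. - of_real (l\<^sup>2) * iexp (- (u n * l))) \<longlonglongrightarrow> - of_real (l\<^sup>2) * iexp (- (t * l))"
      by (intro AE_I2 tendsto_intros u)
  qed (use square_integrable in \<open>auto simp: norm_mult norm_power\<close>)
qed

lemma r_0: "r 0 = 1"
  by (simp add: r_eq prob_space del: space_eq_univ)

lemma iexp_cnj: "cnj (iexp x) = iexp (- x)"
  by (simp add: exp_cnj)

lemma r_minus: "r (- t) = cnj (r t)"
proof -
  have "cnj (iexp (- (t * l))) = iexp (- (- t * l))" for l
    by (simp add: iexp_cnj del: of_real_mult of_real_minus)
  then show ?thesis unfolding r_eq Bochner_Integration.integral_cnj[symmetric] by (simp only:)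
qed

lemma r1_minus: "r1 (- t) = - cnj (r1 t)"
proof -
  have "cnj (r1 t) = (LINT l|\<rho>. - (- (\<i> * of_real l) * iexp (- (- t * l))))"
  proof -
    have "cnj (- (\<i> * of_real l) * iexp (- (t * l))) = - (- (\<i> * of_real l) * iexp (- (- t * l)))" for l
      by (simp add: iexp_cnj del: of_real_mult of_real_minus)
    then show ?thesis unfolding r1_def Bochner_Integration.integral_cnj[symmetric] by (simp only:)
  qed
  also have "\<dots> = - r1 (- t)"
    unfolding r1_def by (rule integral_minus)
  finally show ?thesis by simp
qed

lemma r1_0: "r1 0 = - \<i> * of_real (LINT l|\<rho>. l)"
proof -
  have "r1 0 = (LINT l|\<rho>. - \<i> * of_real l)" by (simp add: r1_def)
  then show ?thesis by (simp only: integral_mult_right_zero integral_complex_of_real)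
qed

lemma r2_0: "r2 0 = - of_real (LINT l|\<rho>. l\<^sup>2)"
proof -
  have "r2 0 = (LINT l|\<rho>. - of_real (l\<^sup>2))" by (simp add: r2_def)
  then show ?thesis by (simp only: integral_minus integral_complex_of_real)
qed

section \<open>The distance of |r| from 1 and its zeros\<close>

lemma norm_r_le: "cmod (r t) \<le> 1"
proof -
  have "cmod (r t) \<le> (LINT l|\<rho>. cmod (iexp (- (t * l))))"
    unfolding r_eq by (rule integral_norm_bound)
  then show ?thesis by (simp add: prob_space del: space_eq_univ)
qed

text \<open>Zero variance would put all mass at the mean, which is degeneracy.\<close>

lemma variance_pos: "(LINT l|\<rho>. l\<^sup>2) - (LINT l|\<rho>. l)\<^sup>2 > 0"
proof -
  define m where "m = (LINT l|\<rho>. l)"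
  have i: "integrable \<rho> (\<lambda>l. (l - m)\<^sup>2)"
    using square_integrable abs_integrable by (simp add: power2_diff)
  have eq: "(LINT l|\<rho>. (l - m)\<^sup>2) = (LINT l|\<rho>. l\<^sup>2) - m\<^sup>2"
  proof -
    have "(LINT l|\<rho>. (l - m)\<^sup>2) = (LINT l|\<rho>. l\<^sup>2 + m\<^sup>2 - 2 * m * l)"
      by (simp add: power2_diff algebra_simps)
    also have "\<dots> = (LINT l|\<rho>. l\<^sup>2) + m\<^sup>2 - 2 * m * m"
      using square_integrable abs_integrable by (simp add: m_def prob_space del: space_eq_univ)
    finally show ?thesis by (simp add: power2_eq_square)
  qed
  have "(LINT l|\<rho>. (l - m)\<^sup>2) \<noteq> 0"
  proof
    assume "(LINT l|\<rho>. (l - m)\<^sup>2) = 0"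
    then have "AE l in \<rho>. (l - m)\<^sup>2 = 0"
      using integral_nonneg_eq_0_iff_AE[OF i] by simp
    then have ae: "AE l in \<rho>. l = m" by simp
    have "\<rho> = return borel m"
    proof (rule measure_eqI)
      fix A assume A: "A \<in> sets \<rho>"
      have "emeasure \<rho> A = (\<integral>\<^sup>+ l. indicator A l \<partial>\<rho>)" using A by simp
      also have "\<dots> = (\<integral>\<^sup>+ l. indicator A m \<partial>\<rho>)"
        by (rule nn_integral_cong_AE) (use ae in \<open>auto elim!: eventually_mono\<close>)
      also have "\<dots> = indicator A m" using emeasure_space_1 by simp
      finally show "emeasure \<rho> A = emeasure (return borel m) A" using A by simp
    qed simp
    then show False using nondegenerate unfolding degenerate_def by blast
  qed
  moreover have "(LINT l|\<rho>. (l - m)\<^sup>2) \<ge> 0" by simp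
  ultimately show ?thesis using eq unfolding m_def[symmetric] by linarith
qed

text \<open>Standard deviation of the residual of one value of the process after regression on
  another at lag \<open>x\<close>; it instantiates the \<open>s\<close> of the Gaussian
  computations.\<close>

definition defect :: "real \<Rightarrow> real" where
  "defect x = sqrt (1 - (cmod (r x))\<^sup>2)"

lemma defect_square: "(defect x)\<^sup>2 = 1 - (cmod (r x))\<^sup>2"
  using norm_r_le[of x] by (simp add: defect_def power_le_one)

lemma defect_pos_iff: "defect x > 0 \<longleftrightarrow> cmod (r x) < 1"
  using norm_r_le[of x] by (simp add: defect_def power_less_one_iff)

lemma continuous_defect: "continuous_on UNIV defect"
  unfolding defect_def by (intro continuous_intros continuous_r)

text \<open>At 0 the function \<open>|r|^2\<close> has value 1, derivative 0 and second derivative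
  \<open>- 2 * V\<close>, where \<open>V > 0\<close> is the variance of \<rho>. Giving up half of
  the quadratic coefficient leaves \<open>1 - |r x|^2 \<ge> V / 2 * x^2\<close> on a whole
  neighbourhood.\<close>

lemma defect_linear_bound: "\<exists>c>0. \<exists>\<delta>>0. \<forall>x. \<bar>x\<bar> < \<delta> \<longrightarrow> c * \<bar>x\<bar> \<le> defect x"
proof -
  define V where "V = (LINT l|\<rho>. l\<^sup>2) - (LINT l|\<rho>. l)\<^sup>2"
  have V: "V > 0" using variance_pos by (simp add: V_def)
  have dRe: "((\<lambda>x. Re (r x)) has_real_derivative Re (r1 x)) (at x)"
    and dIm: "((\<lambda>x. Im (r x)) has_real_derivative Im (r1 x)) (at x)"
    and dRe1: "((\<lambda>x. Re (r1 x)) has_real_derivative Re (r2 x)) (at x)"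
    and dIm1: "((\<lambda>x. Im (r1 x)) has_real_derivative Im (r2 x)) (at x)" for x
    unfolding has_real_derivative_iff_has_vector_derivative
    by (intro bounded_linear.has_vector_derivative[OF bounded_linear_Re] bounded_linear.has_vector_derivative[OF bounded_linear_Im] r_deriv r1_deriv)+
  define \<phi>1 where "\<phi>1 x = 2 * Re (r x) * Re (r1 x) + 2 * Im (r x) * Im (r1 x)" for x
  have square_deriv: "((\<lambda>x. (u x)\<^sup>2 + (v x)\<^sup>2) has_real_derivative (2 * u x * u1 + 2 * v x * v1)) (at x)"
    if "(u has_real_derivative u1) (at x)" "(v has_real_derivative v1) (at x)" for u v :: "real \<Rightarrow> real" and u1 v1 x
    using that by (auto intro!: derivative_eq_intros)
  have d\<phi>: "((\<lambda>x. (cmod (r x))\<^sup>2) has_real_derivative \<phi>1 x) (at x)" for x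
    unfolding cmod_power2 \<phi>1_def by (rule square_deriv[OF dRe dIm])
  have prod_deriv: "((\<lambda>x. 2 * u x * u1 x + 2 * v x * v1 x) has_real_derivative
      (2 * u1 x * u1 x + 2 * u x * u2 + 2 * v1 x * v1 x + 2 * v x * v2)) (at x)"
    if "(u has_real_derivative u1 x) (at x)" "(v has_real_derivative v1 x) (at x)"
      "(u1 has_real_derivative u2) (at x)" "(v1 has_real_derivative v2) (at x)" for u v u1 v1 :: "real \<Rightarrow> real" and u2 v2 x
    using that by (auto intro!: derivative_eq_intros)
  have "(\<phi>1 has_real_derivative (2 * Re (r1 0) * Re (r1 0) + 2 * Re (r 0) * Re (r2 0) + 2 * Im (r1 0) * Im (r1 0) + 2 * Im (r 0) * Im (r2 0))) (at 0)"
    unfolding \<phi>1_def[abs_def] by (rule prod_deriv[OF dRe dIm dRe1 dIm1])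
  moreover have "2 * Re (r1 0) * Re (r1 0) + 2 * Re (r 0) * Re (r2 0) + 2 * Im (r1 0) * Im (r1 0) + 2 * Im (r 0) * Im (r2 0) = - 2 * V"
    unfolding r_0 r1_0 r2_0 V_def by (simp add: power2_eq_square)
  ultimately have "(\<phi>1 has_real_derivative (- 2 * V)) (at 0)" by (simp only:)
  moreover have "\<phi>1 0 = 0" by (simp add: \<phi>1_def r_0 r1_0)
  ultimately have "((\<lambda>h. \<phi>1 h / h) \<longlongrightarrow> - 2 * V) (at 0)"
    by (simp add: DERIV_def)
  then have "eventually (\<lambda>h. \<phi>1 h / h < - V) (at 0)"
    using V by (intro order_tendstoD) auto
  then obtain \<delta> where \<delta>: "\<delta> > 0" "\<And>h. h \<noteq> 0 \<Longrightarrow> \<bar>h\<bar> < \<delta> \<Longrightarrow> \<phi>1 h / h < - V"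
    unfolding eventually_at by (auto simp: dist_real_def)
  \<comment> \<open>The second derivative enters only at 0, through the bound on
    \<open>\<phi>1 h / h\<close>. It makes \<open>|r|^2 + V / 2 * x^2\<close> non-increasing to the
    right of 0; negative arguments follow later from \<open>r (- x) = cnj (r x)\<close>.\<close>
  have pos: "(cmod (r x))\<^sup>2 \<le> 1 - V / 2 * x\<^sup>2" if x: "0 \<le> x" "x < \<delta>" for x
  proof -
    have "(cmod (r x))\<^sup>2 + V / 2 * x\<^sup>2 \<le> (cmod (r 0))\<^sup>2 + V / 2 * 0\<^sup>2"
    proof (rule DERIV_nonpos_imp_nonincreasing[OF x(1)])
      fix y assume y: "0 \<le> y" "y \<le> x"
      have "((\<lambda>x. (cmod (r x))\<^sup>2 + V / 2 * x\<^sup>2) has_real_derivative (\<phi>1 y + V * y)) (at y)"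
        by (intro DERIV_add d\<phi>) (auto intro!: derivative_eq_intros)
      moreover have "\<phi>1 y + V * y \<le> 0"
      proof (cases "y = 0")
        case False
        then have "\<phi>1 y / y < - V" using \<delta>(2)[of y] x y by auto
        then have "\<phi>1 y < - V * y" using y False by (simp add: pos_divide_less_eq)
        then show ?thesis by simp
      qed (simp add: \<open>\<phi>1 0 = 0\<close>)
      ultimately show "\<exists>d. ((\<lambda>x. (cmod (r x))\<^sup>2 + V / 2 * x\<^sup>2) has_real_derivative d) (at y) \<and> d \<le> 0" by blast
    qed
    then show ?thesis by (simp add: r_0)
  qed
  have "sqrt (V / 2) * \<bar>x\<bar> \<le> defect x" if x: "\<bar>x\<bar> < \<delta>" for x
  proof -
    have "(cmod (r x))\<^sup>2 \<le> 1 - V / 2 * x\<^sup>2"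
      using pos[of x] pos[of "- x"] x r_minus[of x] by (cases "0 \<le> x") auto
    then have "V / 2 * x\<^sup>2 \<le> 1 - (cmod (r x))\<^sup>2" by simp
    then have "sqrt (V / 2 * x\<^sup>2) \<le> defect x" unfolding defect_def by (rule real_sqrt_le_mono)
    then show ?thesis by (simp only: real_sqrt_mult real_sqrt_abs)
  qed
  then show ?thesis using V \<delta>(1) by (intro exI[of _ "sqrt (V / 2)"] conjI exI[of _ \<delta>]) auto
qed

text \<open>\<open>|r x0| = 1\<close> is equality in the triangle inequality for the integral, which
  forces the character \<open>iexp (- (x0 * l))\<close> to be \<rho>-almost surely the constant
  \<open>r x0\<close>.\<close>

lemma r_translate:
  assumes "cmod (r x0) = 1"
  shows "r (x0 + x) = r x0 * r x"
proof -
  have i: "integrable \<rho> (\<lambda>l. iexp (- (t * l)))" for t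
    by (rule integrable_const_bound[where B=1]) auto
  have i1: "integrable \<rho> (\<lambda>l. cnj (r x0) * iexp (- (x0 * l)))" by (intro integrable_mult_right i)
  have i2: "integrable \<rho> (\<lambda>l. 1 - Re (cnj (r x0) * iexp (- (x0 * l))))"
    using integrable_Re[OF i1] by simp
  have nn: "0 \<le> 1 - Re (cnj (r x0) * iexp (- (x0 * l)))" for l
    using complex_Re_le_cmod[of "cnj (r x0) * iexp (- (x0 * l))"] assms by (simp add: norm_mult)
  have "(LINT l|\<rho>. Re (cnj (r x0) * iexp (- (x0 * l)))) = Re (cnj (r x0) * r x0)"
    using integral_Re[OF i1] by (simp only: integral_mult_right_zero r_eq[symmetric])
  also have "\<dots> = 1"
    using complex_norm_square[of "r x0"] assms by (simp add: mult.commute)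
  finally have "(LINT l|\<rho>. 1 - Re (cnj (r x0) * iexp (- (x0 * l)))) = 0"
    using integrable_Re[OF i1] by (simp add: prob_space del: space_eq_univ)
  then have "AE l in \<rho>. 1 - Re (cnj (r x0) * iexp (- (x0 * l))) = 0"
    using integral_nonneg_eq_0_iff_AE[OF i2] nn by simp
  then have ae: "AE l in \<rho>. iexp (- (x0 * l)) = r x0"
  proof eventually_elim
    fix l assume "1 - Re (cnj (r x0) * iexp (- (x0 * l))) = 0"
    then have Re: "Re (cnj (r x0) * iexp (- (x0 * l))) = 1" by simp
    moreover have "cmod (cnj (r x0) * iexp (- (x0 * l))) = 1" using assms by (simp add: norm_mult)
    ultimately have "cnj (r x0) * iexp (- (x0 * l)) = 1"
      by (metis cmod_eq_Re complex_eq_iff abs_one cmod_power2 one_complex.simps power_one add_cancel_right_right power2_eq_iff_nonneg power_eq_0_iff zero_neq_numeral)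
    then have "r x0 * cnj (r x0) * iexp (- (x0 * l)) = r x0" by (simp add: mult.assoc)
    then show "iexp (- (x0 * l)) = r x0" unfolding complex_norm_square[symmetric] assms by simp
  qed
  have "r (x0 + x) = (LINT l|\<rho>. iexp (- (x0 * l)) * iexp (- (x * l)))"
    unfolding r_eq by (simp add: exp_add[symmetric] algebra_simps)
  also have "\<dots> = (LINT l|\<rho>. r x0 * iexp (- (x * l)))"
    by (rule integral_cong_AE) (use ae in \<open>auto elim!: eventually_mono\<close>)
  also have "\<dots> = r x0 * r x" by (simp only: integral_mult_right_zero r_eq[symmetric])
  finally show ?thesis .
qed

text \<open>At a zero \<open>x0\<close> of the defect, \<open>r_translate\<close> carries the linear
  bound over from 0, and \<open>|x - x0|\<close> to the power -3/4 is integrable; the same bound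
  isolates the zero. Elsewhere the defect stays away from 0 by continuity.\<close>

lemma defect_powr_local:
  "\<exists>e>0. (\<forall>x\<in>ball x0 e. x \<noteq> x0 \<longrightarrow> cmod (r x) < 1) \<and>
    (\<integral>\<^sup>+ x. ennreal (defect x powr (-3/4)) * indicator (ball x0 e) x \<partial>lborel) < \<infinity>"
proof (cases "cmod (r x0) = 1")
  case True
  obtain c \<delta> where c: "c > 0" and \<delta>: "\<delta> > 0" and le: "\<And>x. \<bar>x\<bar> < \<delta> \<Longrightarrow> c * \<bar>x\<bar> \<le> defect x"
    using defect_linear_bound by blast
  have sig: "c * \<bar>x - x0\<bar> \<le> defect x" if "x \<in> ball x0 \<delta>" for x
  proof -
    have "defect x = defect (x - x0)"
      unfolding defect_def using r_translate[OF True, of "x - x0"] True by (simp add: norm_mult)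
    then show ?thesis using le[of "x - x0"] that by (simp add: dist_real_def abs_minus_commute)
  qed
  have "(\<integral>\<^sup>+ x. ennreal (defect x powr (-3/4)) * indicator (ball x0 \<delta>) x \<partial>lborel) \<le>
      (\<integral>\<^sup>+ x. ennreal (c powr (-3/4)) * (ennreal (\<bar>x - x0\<bar> powr (-3/4)) * indicator (ball x0 \<delta>) x) \<partial>lborel)"
  proof (intro nn_integral_mono)
    fix x
    have "defect x powr (-3/4) \<le> c powr (-3/4) * \<bar>x - x0\<bar> powr (-3/4)" if x: "x \<in> ball x0 \<delta>"
    proof (cases "x = x0")
      case True
      then have "defect x = 0" using \<open>cmod (r x0) = 1\<close> by (simp add: defect_def)
      then show ?thesis by simp
    next
      case False
      then have "defect x powr (-3/4) \<le> (c * \<bar>x - x0\<bar>) powr (-3/4)"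
        using sig[OF x] c by (intro powr_mono2') auto
      then show ?thesis using c by (simp add: powr_mult)
    qed
    then show "ennreal (defect x powr (-3/4)) * indicator (ball x0 \<delta>) x \<le>
        ennreal (c powr (-3/4)) * (ennreal (\<bar>x - x0\<bar> powr (-3/4)) * indicator (ball x0 \<delta>) x)"
      by (auto simp: indicator_def ennreal_mult'[symmetric] intro!: ennreal_leI)
  qed
  also have "\<dots> = ennreal (c powr (-3/4)) * (\<integral>\<^sup>+ x. ennreal (\<bar>x - x0\<bar> powr (-3/4)) * indicator (ball x0 \<delta>) x \<partial>lborel)"
    by (rule nn_integral_cmult) measurable
  also have "\<dots> < \<infinity>" using nn_integral_abs_powr_finite[of x0 \<delta>] by (simp add: ennreal_mult_less_top)
  finally have fin: "(\<integral>\<^sup>+ x. ennreal (defect x powr (-3/4)) * indicator (ball x0 \<delta>) x \<partial>lborel) < \<infinity>" .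
  have "cmod (r x) < 1" if "x \<in> ball x0 \<delta>" "x \<noteq> x0" for x
  proof -
    have "0 < c * \<bar>x - x0\<bar>" using that c by simp
    also have "\<dots> \<le> defect x" by (rule sig[OF that(1)])
    finally show ?thesis by (simp add: defect_pos_iff)
  qed
  then show ?thesis using fin \<delta> by blast
next
  case False
  then have s0: "defect x0 > 0" using norm_r_le[of x0] by (simp add: defect_pos_iff)
  have "isCont defect x0" using continuous_defect by (simp add: continuous_on_eq_continuous_at)
  then have "eventually (\<lambda>x. defect x > defect x0 / 2) (at x0)"
    unfolding isCont_def using s0 by (intro order_tendstoD) auto
  then obtain e where e: "e > 0" "\<And>x. x \<noteq> x0 \<Longrightarrow> dist x x0 < e \<Longrightarrow> defect x > defect x0 / 2"
    unfolding eventually_at by auto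
  have ge: "defect x > defect x0 / 2" if "x \<in> ball x0 e" for x
    using e(2)[of x] s0 that by (cases "x = x0") (auto simp: dist_commute)
  have "(\<integral>\<^sup>+ x. ennreal (defect x powr (-3/4)) * indicator (ball x0 e) x \<partial>lborel) \<le>
      (\<integral>\<^sup>+ x. ennreal ((defect x0 / 2) powr (-3/4)) * indicator (ball x0 e) x \<partial>lborel)"
  proof (intro nn_integral_mono)
    fix x
    have "defect x powr (-3/4) \<le> (defect x0 / 2) powr (-3/4)" if "x \<in> ball x0 e"
      using ge[OF that] s0 by (intro powr_mono2') auto
    then show "ennreal (defect x powr (-3/4)) * indicator (ball x0 e) x \<le> ennreal ((defect x0 / 2) powr (-3/4)) * indicator (ball x0 e) x"
      by (auto simp: indicator_def intro!: ennreal_leI)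
  qed
  also have "\<dots> = ennreal ((defect x0 / 2) powr (-3/4)) * emeasure lborel (ball x0 e)"
    by (simp add: nn_integral_cmult_indicator)
  also have "\<dots> < \<infinity>" using emeasure_bounded_finite[OF bounded_ball, of x0 e] by (simp add: ennreal_mult_less_top)
  finally have "(\<integral>\<^sup>+ x. ennreal (defect x powr (-3/4)) * indicator (ball x0 e) x \<partial>lborel) < \<infinity>" .
  moreover have "cmod (r x) < 1" if "x \<in> ball x0 e" for x
    using ge[OF that] s0 defect_pos_iff[of x] by auto
  ultimately show ?thesis using e(1) by blast
qed

text \<open>A finite subcover by the balls of \<open>defect_powr_local\<close>, each of which
  contains at most its centre as a point with \<open>|r| = 1\<close>.\<close>

lemma defect_powr_compact:
  assumes "compact S"
  shows "(\<integral>\<^sup>+ x. ennreal (defect x powr (-3/4)) * indicator S x \<partial>lborel) < \<infinity>"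
    "finite {x \<in> S. cmod (r x) = 1}"
proof -
  have "\<forall>x0. \<exists>e>0. (\<forall>x\<in>ball x0 e. x \<noteq> x0 \<longrightarrow> cmod (r x) < 1) \<and>
    (\<integral>\<^sup>+ x. ennreal (defect x powr (-3/4)) * indicator (ball x0 e) x \<partial>lborel) < \<infinity>"
    using defect_powr_local by blast
  then obtain e where e: "\<And>x0. e x0 > 0" "\<And>x0 x. x \<in> ball x0 (e x0) \<Longrightarrow> x \<noteq> x0 \<Longrightarrow> cmod (r x) < 1"
      "\<And>x0. (\<integral>\<^sup>+ x. ennreal (defect x powr (-3/4)) * indicator (ball x0 (e x0)) x \<partial>lborel) < \<infinity>"
    by metis
  have "S \<subseteq> (\<Union>x0\<in>S. ball x0 (e x0))" using e(1) by auto
  from compactE_image[OF assms _ this] obtain C where C: "C \<subseteq> S" "finite C" "S \<subseteq> (\<Union>x0\<in>C. ball x0 (e x0))"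
    by auto
  have [measurable]: "defect \<in> borel_measurable borel"
    by (intro borel_measurable_continuous_onI continuous_defect)
  have "(\<integral>\<^sup>+ x. ennreal (defect x powr (-3/4)) * indicator S x \<partial>lborel) \<le>
      (\<integral>\<^sup>+ x. (\<Sum>x0\<in>C. ennreal (defect x powr (-3/4)) * indicator (ball x0 (e x0)) x) \<partial>lborel)"
  proof (intro nn_integral_mono)
    fix x
    show "ennreal (defect x powr (-3/4)) * indicator S x \<le> (\<Sum>x0\<in>C. ennreal (defect x powr (-3/4)) * indicator (ball x0 (e x0)) x)"
    proof (cases "x \<in> S")
      case True
      then obtain x0 where x0: "x0 \<in> C" "x \<in> ball x0 (e x0)" using C by blast
      then have "ennreal (defect x powr (-3/4)) * indicator S x = ennreal (defect x powr (-3/4)) * indicator (ball x0 (e x0)) x"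
        using True by simp
      also have "\<dots> \<le> (\<Sum>x0\<in>C. ennreal (defect x powr (-3/4)) * indicator (ball x0 (e x0)) x)"
        using C(2) x0(1) by (intro member_le_sum) auto
      finally show ?thesis .
    qed simp
  qed
  also have "\<dots> = (\<Sum>x0\<in>C. \<integral>\<^sup>+ x. ennreal (defect x powr (-3/4)) * indicator (ball x0 (e x0)) x \<partial>lborel)"
    by (intro nn_integral_sum) auto
  also have "\<dots> < \<infinity>" using e(3) C(2) by (simp add: less_top)
  finally show "(\<integral>\<^sup>+ x. ennreal (defect x powr (-3/4)) * indicator S x \<partial>lborel) < \<infinity>" .
  have "{x \<in> S. cmod (r x) = 1} \<subseteq> C" using C(3) e(2) by fastforce
  then show "finite {x \<in> S. cmod (r x) = 1}" using C(2) finite_subset by blast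
qed

lemma AE_norm_r_less: "AE x in lborel. cmod (r x) < 1"
proof -
  have "{x. cmod (r x) = 1} = (\<Union>n::nat. {x \<in> {- real n..real n}. cmod (r x) = 1})"
  proof safe
    fix x assume "cmod (r x) = 1"
    moreover obtain n :: nat where "\<bar>x\<bar> \<le> real n" using real_arch_simple by blast
    ultimately show "x \<in> (\<Union>n::nat. {x \<in> {- real n..real n}. cmod (r x) = 1})" by (auto simp: abs_le_iff intro!: exI[of _ n])
  qed
  moreover have "countable (\<Union>n::nat. {x \<in> {- real n..real n}. cmod (r x) = 1})"
    by (rule countable_UN[OF _ countable_finite[OF defect_powr_compact(2)[OF compact_Icc]]]) simp
  ultimately have "countable {x. cmod (r x) = 1}" by simp
  then have "{x. cmod (r x) = 1} \<in> null_sets lborel" by (rule countable_imp_null_set_lborel)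
  then have "AE x in lborel. x \<notin> {x. cmod (r x) = 1}" by (rule AE_not_in)
  then show ?thesis by eventually_elim (use norm_r_le in \<open>auto simp: less_le\<close>)
qed

section \<open>Dyadic scales and the logarithmic moment\<close>

lemma log_sum_bound:
  fixes l :: real
  shows "summable (\<lambda>n. min 4 ((1/4) ^ n * l\<^sup>2))" "(\<Sum>n. min 4 ((1/4) ^ n * l\<^sup>2)) \<le> 6 * (1 + ln (1 + \<bar>l\<bar>))"
proof -
  show sm: "summable (\<lambda>n. min 4 ((1/4) ^ n * l\<^sup>2))"
    by (rule summable_comparison_test'[where g="\<lambda>n. (1/4) ^ n * l\<^sup>2" and N=0])
      (auto intro!: summable_mult2 summable_geometric)
  \<comment> \<open>\<open>N\<close> is \<open>log 2 (1 + |l|)\<close> rounded up. Before it each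
    term is at most the cap 4; from it on a geometric series dominates because
    \<open>l^2 \<le> 4 ^ N\<close>.\<close>
  define N where "N = nat \<lceil>log 2 (1 + \<bar>l\<bar>)\<rceil>"
  have log0: "log 2 (1 + \<bar>l\<bar>) \<ge> 0" by simp
  have N1: "real N \<le> log 2 (1 + \<bar>l\<bar>) + 1" and N2: "log 2 (1 + \<bar>l\<bar>) \<le> real N"
    using log0 unfolding N_def by linarith+
  have "1 + \<bar>l\<bar> = 2 powr (log 2 (1 + \<bar>l\<bar>))" by simp
  also have "\<dots> \<le> 2 powr real N" using N2 by (intro powr_mono) auto
  finally have "\<bar>l\<bar> \<le> 2 ^ N" by (simp add: powr_realpow)
  then have l2: "l\<^sup>2 \<le> (2 ^ N)\<^sup>2" by (simp add: abs_le_square_iff[symmetric])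
  define g where "g n = (if n < N then 4 else (1/4) ^ (n - N) :: real)" for n
  have le: "min 4 ((1/4) ^ n * l\<^sup>2) \<le> g n" for n
  proof (cases "n < N")
    case False
    then have "(1/4::real) ^ n = (1/4) ^ (n - N) * (1/4) ^ N" by (simp add: power_add[symmetric])
    moreover have "(1/4::real) ^ N * l\<^sup>2 \<le> (1/4) ^ N * (2 ^ N)\<^sup>2" using l2 by (intro mult_left_mono) auto
    moreover have "(1/4::real) ^ N * (2 ^ N)\<^sup>2 = 1"
      by (simp add: power2_eq_square power_mult_distrib[symmetric] power_one_over field_simps)
    ultimately have "(1/4) ^ n * l\<^sup>2 \<le> (1/4) ^ (n - N) * 1"
      by (simp only: mult.assoc) (intro mult_left_mono, auto)
    then show ?thesis using False by (simp add: g_def min.coboundedI2)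
  qed (simp add: g_def)
  have gN: "(\<lambda>n. g (n + N)) sums (4/3)"
    using geometric_sums[of "1/4::real"] by (simp add: g_def)
  then have g: "summable g" using summable_iff_shift sums_summable by blast
  have "(\<Sum>n. min 4 ((1/4) ^ n * l\<^sup>2)) \<le> suminf g" by (intro suminf_le le sm g)
  also have "\<dots> = 4/3 + (\<Sum>i<N. g i)"
    using suminf_split_initial_segment[OF g, of N] gN by (simp add: sums_iff)
  also have "\<dots> = 4/3 + 4 * real N" by (simp add: g_def)
  also have "\<dots> \<le> 16/3 + 4 * (ln (1 + \<bar>l\<bar>) / ln 2)" using N1 by (simp add: log_def)
  \<comment> \<open>\<open>1 / ln 2 \<le> 3/2\<close> turns the coefficient 4 into the constant 6 of
    the bound.\<close>
  also have "ln (1 + \<bar>l\<bar>) / ln 2 \<le> ln (1 + \<bar>l\<bar>) * (3/2)"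
  proof -
    have "1 / ln 2 \<le> (3/2 :: real)" using ln2_ge_two_thirds by (simp add: field_simps)
    then show ?thesis using mult_left_mono[of "1 / ln 2" "3/2" "ln (1 + \<bar>l\<bar>)"] by simp
  qed
  finally show "(\<Sum>n. min 4 ((1/4) ^ n * l\<^sup>2)) \<le> 6 * (1 + ln (1 + \<bar>l\<bar>))" by simp
qed

text \<open>Majorant, in spectral form, of the mean square increment of the derivative over lags up
  to \<open>(1/2) ^ n\<close>: the squared modulus of \<open>iexp a - 1\<close> is at most 4 and at
  most \<open>a^2\<close>.\<close>

definition increment_bound :: "nat \<Rightarrow> ennreal" where
  "increment_bound n = (\<integral>\<^sup>+ l. ennreal (l\<^sup>2 * min 4 ((1/4) ^ n * l\<^sup>2)) \<partial>\<rho>)"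

lemma increment_bound_summable: "(\<Sum>n. increment_bound n) < \<infinity>"
proof -
  have "(\<Sum>n. increment_bound n) = (\<integral>\<^sup>+ l. (\<Sum>n. ennreal (l\<^sup>2 * min 4 ((1/4) ^ n * l\<^sup>2))) \<partial>\<rho>)"
    unfolding increment_bound_def by (rule nn_integral_suminf[symmetric]) simp
  also have "\<dots> \<le> (\<integral>\<^sup>+ l. ennreal (6 * (l\<^sup>2 * (1 + ln (1 + \<bar>l\<bar>)))) \<partial>\<rho>)"
  proof (intro nn_integral_mono)
    fix l :: real
    have "(\<Sum>n. l\<^sup>2 * min 4 ((1/4) ^ n * l\<^sup>2)) = l\<^sup>2 * (\<Sum>n. min 4 ((1/4) ^ n * l\<^sup>2))"
      by (intro suminf_mult log_sum_bound)
    also have "\<dots> \<le> l\<^sup>2 * (6 * (1 + ln (1 + \<bar>l\<bar>)))"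
      by (intro mult_left_mono log_sum_bound) auto
    finally have le: "(\<Sum>n. l\<^sup>2 * min 4 ((1/4) ^ n * l\<^sup>2)) \<le> 6 * (l\<^sup>2 * (1 + ln (1 + \<bar>l\<bar>)))"
      by (simp only: mult.left_commute)
    have "(\<Sum>n. ennreal (l\<^sup>2 * min 4 ((1/4) ^ n * l\<^sup>2))) = ennreal (\<Sum>n. l\<^sup>2 * min 4 ((1/4) ^ n * l\<^sup>2))"
      by (intro suminf_ennreal2 summable_mult log_sum_bound) auto
    with le show "(\<Sum>n. ennreal (l\<^sup>2 * min 4 ((1/4) ^ n * l\<^sup>2))) \<le> ennreal (6 * (l\<^sup>2 * (1 + ln (1 + \<bar>l\<bar>))))"
      by (simp only: ennreal_leI)
  qed
  also have "\<dots> < \<infinity>"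
    using integrable_mult_right[OF moment, of 6] by (subst nn_integral_eq_integral) auto
  finally show ?thesis .
qed

lemma increment_bound:
  assumes "\<bar>s\<bar> \<le> (1/2) ^ n"
  shows "(\<integral>\<^sup>+ l. ennreal (l\<^sup>2 * (cmod (iexp (- (s * l)) - 1))\<^sup>2) \<partial>\<rho>) \<le> increment_bound n"
  unfolding increment_bound_def
proof (intro nn_integral_mono ennreal_leI mult_left_mono)
  fix l
  have "cmod (iexp (- (s * l)) - 1) \<le> 2" using norm_triangle_ineq4[of "iexp (- (s * l))" 1] by simp
  then have "(cmod (iexp (- (s * l)) - 1))\<^sup>2 \<le> 2\<^sup>2" by (intro power_mono) auto
  moreover have "(cmod (iexp (- (s * l)) - 1))\<^sup>2 \<le> (1/4) ^ n * l\<^sup>2"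
  proof -
    have "cmod (iexp (- (s * l)) - 1) \<le> (1/2) ^ n * \<bar>l\<bar>"
      using norm_iexp_diff[of "- (s * l)"] mult_right_mono[OF assms abs_ge_zero[of l]] by (simp add: abs_mult)
    then have "(cmod (iexp (- (s * l)) - 1))\<^sup>2 \<le> ((1/2) ^ n * \<bar>l\<bar>)\<^sup>2" by (intro power_mono) auto
    also have "\<dots> = (1/4) ^ n * l\<^sup>2"
      by (simp add: power_mult_distrib power2_eq_square power_one_over power_mult_distrib[symmetric])
    finally show ?thesis .
  qed
  ultimately show "(cmod (iexp (- (s * l)) - 1))\<^sup>2 \<le> min 4 ((1/4) ^ n * l\<^sup>2)" by simp
qed simp

end

section \<open>Square-mean limits\<close>

lemma null_sequence_comparison:
  fixes a b :: "nat \<Rightarrow> real"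
  assumes "\<And>k. 0 \<le> a k" "\<And>k. a k \<le> b k" "b \<longlonglongrightarrow> 0"
  shows "a \<longlonglongrightarrow> 0"
  by (rule tendsto_sandwich[of "\<lambda>_. 0" a sequentially b]) (use assms in auto)

lemma cmod_add_square_le: "(cmod (a + b))\<^sup>2 \<le> 2 * (cmod a)\<^sup>2 + 2 * (cmod b)\<^sup>2"
proof -
  have "(cmod (a + b))\<^sup>2 \<le> (cmod a + cmod b)\<^sup>2" by (intro power_mono norm_triangle_ineq) simp
  also have "\<dots> \<le> 2 * (cmod a)\<^sup>2 + 2 * (cmod b)\<^sup>2"
    using sum_squares_bound[of "cmod a" "cmod b"] by (simp add: power2_sum)
  finally show ?thesis .
qed

lemma square_integrable_add:
  fixes X Y :: "'a \<Rightarrow> complex"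
  assumes [measurable]: "X \<in> borel_measurable M" "Y \<in> borel_measurable M"
    and i: "integrable M (\<lambda>\<omega>. (cmod (X \<omega>))\<^sup>2)" "integrable M (\<lambda>\<omega>. (cmod (Y \<omega>))\<^sup>2)"
  shows "integrable M (\<lambda>\<omega>. (cmod (X \<omega> + Y \<omega>))\<^sup>2)"
    "(LINT \<omega>|M. (cmod (X \<omega> + Y \<omega>))\<^sup>2) \<le> 2 * (LINT \<omega>|M. (cmod (X \<omega>))\<^sup>2) + 2 * (LINT \<omega>|M. (cmod (Y \<omega>))\<^sup>2)"
proof -
  have i2: "integrable M (\<lambda>\<omega>. 2 * (cmod (X \<omega>))\<^sup>2 + 2 * (cmod (Y \<omega>))\<^sup>2)" using i by simp
  show int: "integrable M (\<lambda>\<omega>. (cmod (X \<omega> + Y \<omega>))\<^sup>2)"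
  proof (rule Bochner_Integration.integrable_bound[OF i2])
    show "AE \<omega> in M. norm ((cmod (X \<omega> + Y \<omega>))\<^sup>2) \<le> norm (2 * (cmod (X \<omega>))\<^sup>2 + 2 * (cmod (Y \<omega>))\<^sup>2)"
    proof (rule AE_I2)
      fix \<omega>
      show "norm ((cmod (X \<omega> + Y \<omega>))\<^sup>2) \<le> norm (2 * (cmod (X \<omega>))\<^sup>2 + 2 * (cmod (Y \<omega>))\<^sup>2)"
        using cmod_add_square_le[of "X \<omega>" "Y \<omega>"] by simp
    qed
  qed measurable
  have "(LINT \<omega>|M. (cmod (X \<omega> + Y \<omega>))\<^sup>2) \<le> (LINT \<omega>|M. 2 * (cmod (X \<omega>))\<^sup>2 + 2 * (cmod (Y \<omega>))\<^sup>2)"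
    by (rule integral_mono[OF int i2]) (rule cmod_add_square_le)
  then show "(LINT \<omega>|M. (cmod (X \<omega> + Y \<omega>))\<^sup>2) \<le> 2 * (LINT \<omega>|M. (cmod (X \<omega>))\<^sup>2) + 2 * (LINT \<omega>|M. (cmod (Y \<omega>))\<^sup>2)"
    using i by simp
qed

text \<open>Squared moduli are compared by a weighted inequality with a free parameter
  \<open>t\<close>. Taking it slightly above the square root of the mean square error makes both of
  its terms vanish in the limit.\<close>

lemma square_mean_tendsto:
  fixes Z :: "'a \<Rightarrow> complex" and Zk :: "nat \<Rightarrow> 'a \<Rightarrow> complex"
  assumes [measurable]: "\<And>k. Zk k \<in> borel_measurable M" "Z \<in> borel_measurable M"
    and ik: "\<And>k. integrable M (\<lambda>\<omega>. (cmod (Zk k \<omega>))\<^sup>2)"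
    and id: "\<And>k. integrable M (\<lambda>\<omega>. (cmod (Zk k \<omega> - Z \<omega>))\<^sup>2)"
    and lim: "(\<lambda>k. LINT \<omega>|M. (cmod (Zk k \<omega> - Z \<omega>))\<^sup>2) \<longlonglongrightarrow> 0"
  shows "integrable M (\<lambda>\<omega>. (cmod (Z \<omega>))\<^sup>2)"
    "(\<lambda>k. LINT \<omega>|M. (cmod (Zk k \<omega>))\<^sup>2) \<longlonglongrightarrow> (LINT \<omega>|M. (cmod (Z \<omega>))\<^sup>2)"
proof -
  have "integrable M (\<lambda>\<omega>. (cmod (Zk 0 \<omega> + - (Zk 0 \<omega> - Z \<omega>)))\<^sup>2)"
    using id[of 0] by (intro square_integrable_add ik) (auto simp: norm_minus_commute)
  then show iZ: "integrable M (\<lambda>\<omega>. (cmod (Z \<omega>))\<^sup>2)" by simp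
  define D where "D k = (LINT \<omega>|M. (cmod (Zk k \<omega> - Z \<omega>))\<^sup>2)" for k
  define C where "C = (LINT \<omega>|M. (cmod (Z \<omega>))\<^sup>2)"
  \<comment> \<open>The summand \<open>1 / real (Suc k)\<close> keeps the parameter positive when
    \<open>D k\<close> is 0, and \<open>D k \<le> (e k)^2\<close> gives
    \<open>D k / e k \<le> e k\<close>.\<close>
  define e where "e k = sqrt (D k + 1 / real (Suc k))" for k
  have D0: "D k \<ge> 0" for k by (simp add: D_def)
  have e_pos: "e k > 0" for k using D0[of k] by (simp add: e_def add_nonneg_pos)
  have e_lim: "e \<longlonglongrightarrow> 0"
  proof -
    have "(\<lambda>k. sqrt (D k + 1 / real (Suc k))) \<longlonglongrightarrow> sqrt (0 + 0)"
      using lim LIMSEQ_inverse_real_of_nat unfolding D_def inverse_eq_divide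
      by (intro tendsto_real_sqrt tendsto_add) auto
    then show ?thesis by (simp add: e_def[abs_def])
  qed
  have pw: "\<bar>(cmod b)\<^sup>2 - (cmod a)\<^sup>2\<bar> \<le> (1 + 1 / t) * (cmod (b - a))\<^sup>2 + t * (cmod a)\<^sup>2" if t: "t > 0" for a b :: complex and t
  proof -
    define d where "d = cmod (b - a)"
    have tri: "cmod b \<le> cmod a + d" "cmod a \<le> cmod b + d" "0 \<le> d"
      unfolding d_def by norm+
    have "\<bar>(cmod b)\<^sup>2 - (cmod a)\<^sup>2\<bar> = \<bar>cmod b - cmod a\<bar> * (cmod b + cmod a)"
      unfolding square_diff_square_factored power2_eq_square abs_mult by simp
    also have "\<dots> \<le> d * (2 * cmod a + d)"
      using tri by (intro mult_mono) auto
    also have "\<dots> = d\<^sup>2 + 2 * (cmod a * d)" by (simp add: power2_eq_square algebra_simps)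
    also have "2 * (cmod a * d) \<le> t * (cmod a)\<^sup>2 + (1 / t) * d\<^sup>2"
    proof -
      have "0 \<le> (sqrt t * cmod a - d / sqrt t)\<^sup>2" by simp
      also have "\<dots> = t * (cmod a)\<^sup>2 - 2 * (cmod a * d) + (1 / t) * d\<^sup>2"
        using t by (simp add: power2_diff power_mult_distrib power_divide)
      finally show ?thesis by simp
    qed
    finally show ?thesis by (simp add: d_def distrib_right)
  qed
  have bound: "\<bar>(LINT \<omega>|M. (cmod (Zk k \<omega>))\<^sup>2) - C\<bar> \<le> D k + e k * (1 + C)" for k
  proof -
    have "\<bar>(LINT \<omega>|M. (cmod (Zk k \<omega>))\<^sup>2) - C\<bar> = \<bar>LINT \<omega>|M. (cmod (Zk k \<omega>))\<^sup>2 - (cmod (Z \<omega>))\<^sup>2\<bar>"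
      using ik iZ by (simp add: C_def)
    also have "\<dots> \<le> (LINT \<omega>|M. \<bar>(cmod (Zk k \<omega>))\<^sup>2 - (cmod (Z \<omega>))\<^sup>2\<bar>)"
      by (rule integral_abs_bound)
    also have "\<dots> \<le> (LINT \<omega>|M. (1 + 1 / e k) * (cmod (Zk k \<omega> - Z \<omega>))\<^sup>2 + e k * (cmod (Z \<omega>))\<^sup>2)"
      using ik iZ id by (intro integral_mono pw e_pos) auto
    also have "\<dots> = (1 + 1 / e k) * D k + e k * C"
      using iZ id by (simp add: D_def C_def)
    also have "D k / e k \<le> e k"
    proof -
      have "D k \<le> (e k)\<^sup>2" using D0[of k] by (simp add: e_def)
      then show ?thesis using e_pos[of k] by (simp add: pos_divide_le_eq power2_eq_square)
    qed
    then have "(1 + 1 / e k) * D k + e k * C \<le> D k + e k * (1 + C)"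
      by (simp add: algebra_simps)
    finally show ?thesis .
  qed
  have b0: "(\<lambda>k. D k + e k * (1 + C)) \<longlonglongrightarrow> 0 + 0 * (1 + C)"
    using lim unfolding D_def[symmetric] by (intro tendsto_intros e_lim)
  have "(\<lambda>k. (LINT \<omega>|M. (cmod (Zk k \<omega>))\<^sup>2) - C) \<longlonglongrightarrow> 0"
  proof (rule Lim_null_comparison[rotated])
    show "eventually (\<lambda>k. norm ((LINT \<omega>|M. (cmod (Zk k \<omega>))\<^sup>2) - C) \<le> D k + e k * (1 + C)) sequentially"
      unfolding real_norm_def by (rule always_eventually) (rule allI, rule bound)
  qed (use b0 in simp)
  then show "(\<lambda>k. LINT \<omega>|M. (cmod (Zk k \<omega>))\<^sup>2) \<longlonglongrightarrow> (LINT \<omega>|M. (cmod (Z \<omega>))\<^sup>2)"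
    unfolding C_def by (rule LIM_zero_cancel)
qed

lemma (in prob_space) mean_le_sqrt_square_mean:
  fixes X :: "'a \<Rightarrow> complex"
  assumes [measurable]: "X \<in> borel_measurable M" and i: "integrable M (\<lambda>\<omega>. (cmod (X \<omega>))\<^sup>2)"
  shows "integrable M (\<lambda>\<omega>. cmod (X \<omega>))" "(LINT \<omega>|M. cmod (X \<omega>)) \<le> sqrt (LINT \<omega>|M. (cmod (X \<omega>))\<^sup>2)"
proof -
  have le: "cmod z \<le> 1 + (cmod z)\<^sup>2" for z
    using zero_le_power2[of "cmod z - 1"] norm_ge_zero[of z] unfolding power2_diff by (simp del: norm_ge_zero)
  show i1: "integrable M (\<lambda>\<omega>. cmod (X \<omega>))"
  proof (rule Bochner_Integration.integrable_bound)
    show "integrable M (\<lambda>\<omega>. 1 + (cmod (X \<omega>))\<^sup>2)" using i by simp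
    show "AE \<omega> in M. norm (cmod (X \<omega>)) \<le> norm (1 + (cmod (X \<omega>))\<^sup>2)"
    proof (rule AE_I2)
      fix \<omega>
      show "norm (cmod (X \<omega>)) \<le> norm (1 + (cmod (X \<omega>))\<^sup>2)" using le[of "X \<omega>"] by simp
    qed
  qed measurable
  have "0 \<le> variance (\<lambda>\<omega>. cmod (X \<omega>))" by (rule variance_positive)
  also have "\<dots> = (LINT \<omega>|M. (cmod (X \<omega>))\<^sup>2) - (LINT \<omega>|M. cmod (X \<omega>))\<^sup>2"
    by (rule variance_eq[OF i1 i])
  finally show "(LINT \<omega>|M. cmod (X \<omega>)) \<le> sqrt (LINT \<omega>|M. (cmod (X \<omega>))\<^sup>2)"
    by (intro real_le_rsqrt) simp
qed

text \<open>\<open>iexp\<close> is 1-Lipschitz, so characteristic functions converge along mean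
  square limits, and the Gaussian form passes to the limit together with the second moments.\<close>

lemma circular_gaussian_limit:
  fixes Zk :: "nat \<Rightarrow> 'a \<Rightarrow> complex"
  assumes M: "prob_space M" and g: "\<And>k. \<exists>q. circular_gaussian M (Zk k) q"
    and [measurable]: "Z \<in> borel_measurable M"
    and id: "\<And>k. integrable M (\<lambda>\<omega>. (cmod (Zk k \<omega> - Z \<omega>))\<^sup>2)"
    and lim: "(\<lambda>k. LINT \<omega>|M. (cmod (Zk k \<omega> - Z \<omega>))\<^sup>2) \<longlonglongrightarrow> 0"
  shows "circular_gaussian M Z (LINT \<omega>|M. (cmod (Z \<omega>))\<^sup>2)"
proof (rule circular_gaussianI[OF M])
  interpret prob_space M by fact
  have m [measurable]: "Zk k \<in> borel_measurable M" for k using g circular_gaussian_measurable by blast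
  have ik: "integrable M (\<lambda>\<omega>. (cmod (Zk k \<omega>))\<^sup>2)" for k
    using g[of k] circular_gaussian_power(1)[of M "Zk k" _ 1] by auto
  have gk: "circular_gaussian M (Zk k) (LINT \<omega>|M. (cmod (Zk k \<omega>))\<^sup>2)" for k
    using g[of k] circular_gaussian_power(2)[of M "Zk k" _ 1] by auto
  note q = square_mean_tendsto(2)[OF m \<open>Z \<in> borel_measurable M\<close> ik id lim]
  fix \<xi>
  have "(\<lambda>k. LINT \<omega>|M. iexp (\<xi> \<bullet> Zk k \<omega>)) \<longlonglongrightarrow> (LINT \<omega>|M. iexp (\<xi> \<bullet> Z \<omega>))"
  proof (rule LIM_zero_cancel, rule Lim_null_comparison)
    show "(\<lambda>k. cmod \<xi> * sqrt (LINT \<omega>|M. (cmod (Zk k \<omega> - Z \<omega>))\<^sup>2)) \<longlonglongrightarrow> 0"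
      using tendsto_mult_left[OF tendsto_real_sqrt[OF lim], of "cmod \<xi>"] by simp
    have ie: "integrable M (\<lambda>\<omega>. iexp (\<xi> \<bullet> X \<omega>))" if "X \<in> borel_measurable M" for X
      using that by (intro integrable_const_bound[where B=1]) auto
    have "cmod ((LINT \<omega>|M. iexp (\<xi> \<bullet> Zk k \<omega>)) - (LINT \<omega>|M. iexp (\<xi> \<bullet> Z \<omega>))) \<le>
        cmod \<xi> * sqrt (LINT \<omega>|M. (cmod (Zk k \<omega> - Z \<omega>))\<^sup>2)" for k
    proof -
      have pw: "cmod (iexp (\<xi> \<bullet> a) - iexp (\<xi> \<bullet> b)) \<le> cmod \<xi> * cmod (a - b)" for a b
      proof -
        have "iexp (\<xi> \<bullet> a) - iexp (\<xi> \<bullet> b) = iexp (\<xi> \<bullet> b) * (iexp (\<xi> \<bullet> a - \<xi> \<bullet> b) - 1)"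
          by (simp add: right_diff_distrib mult_exp_exp algebra_simps)
        then have "cmod (iexp (\<xi> \<bullet> a) - iexp (\<xi> \<bullet> b)) = cmod (iexp (\<xi> \<bullet> a - \<xi> \<bullet> b) - 1)"
          by (simp only: norm_mult) simp
        also have "\<dots> \<le> \<bar>\<xi> \<bullet> a - \<xi> \<bullet> b\<bar>" using iexp_approx1[of "\<xi> \<bullet> a - \<xi> \<bullet> b" 0] by simp
        also have "\<dots> \<le> cmod \<xi> * cmod (a - b)"
          unfolding inner_diff_right[symmetric] by (rule Cauchy_Schwarz_ineq2)
        finally show ?thesis .
      qed
      note sm = mean_le_sqrt_square_mean[OF _ id[of k]]
      have "cmod ((LINT \<omega>|M. iexp (\<xi> \<bullet> Zk k \<omega>)) - (LINT \<omega>|M. iexp (\<xi> \<bullet> Z \<omega>))) =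
          cmod (LINT \<omega>|M. iexp (\<xi> \<bullet> Zk k \<omega>) - iexp (\<xi> \<bullet> Z \<omega>))"
        using Bochner_Integration.integral_diff[OF ie[OF m[of k]] ie[OF \<open>Z \<in> borel_measurable M\<close>]] by simp
      also have "\<dots> \<le> (LINT \<omega>|M. cmod (iexp (\<xi> \<bullet> Zk k \<omega>) - iexp (\<xi> \<bullet> Z \<omega>)))"
        by (rule integral_norm_bound)
      also have "\<dots> \<le> (LINT \<omega>|M. cmod \<xi> * cmod (Zk k \<omega> - Z \<omega>))"
        using sm(1) by (intro integral_mono pw integrable_norm Bochner_Integration.integrable_diff ie m) auto
      also have "\<dots> = cmod \<xi> * (LINT \<omega>|M. cmod (Zk k \<omega> - Z \<omega>))" by simp
      also have "\<dots> \<le> cmod \<xi> * sqrt (LINT \<omega>|M. (cmod (Zk k \<omega> - Z \<omega>))\<^sup>2)"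
        by (intro mult_left_mono sm(2)) auto
      finally show ?thesis .
    qed
    then show "eventually (\<lambda>k. norm ((LINT \<omega>|M. iexp (\<xi> \<bullet> Zk k \<omega>)) - (LINT \<omega>|M. iexp (\<xi> \<bullet> Z \<omega>))) \<le>
        cmod \<xi> * sqrt (LINT \<omega>|M. (cmod (Zk k \<omega> - Z \<omega>))\<^sup>2)) sequentially"
      by (intro always_eventually) simp
  qed
  moreover have "(\<lambda>k. LINT \<omega>|M. iexp (\<xi> \<bullet> Zk k \<omega>)) \<longlonglongrightarrow> of_real (exp (- (LINT \<omega>|M. (cmod (Z \<omega>))\<^sup>2) * (cmod \<xi>)\<^sup>2 / 4))"
    unfolding circular_gaussian_char[OF gk] by (intro tendsto_intros q) simp
  ultimately show "(LINT \<omega>|M. iexp (\<xi> \<bullet> Z \<omega>)) = exp (- (LINT \<omega>|M. (cmod (Z \<omega>))\<^sup>2) * (cmod \<xi>)\<^sup>2 / 4)"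
    by (rule LIMSEQ_unique)
qed auto

section \<open>Processes with continuous paths\<close>

text \<open>Freezing time on a grid of mesh \<open>1 / (n + 1)\<close> leaves countably many
  measurable pieces, and continuity of the paths gives convergence.\<close>

lemma measurable_continuous_process:
  fixes f :: "real \<Rightarrow> 'a \<Rightarrow> complex"
  assumes [measurable]: "\<And>t. f t \<in> borel_measurable M" and cont: "\<And>\<omega>. continuous_on UNIV (\<lambda>t. f t \<omega>)"
  shows "(\<lambda>p. f (fst p) (snd p)) \<in> borel_measurable (borel \<Otimes>\<^sub>M M)"
proof (rule borel_measurable_LIMSEQ_metric)
  fix n :: nat
  have "(\<lambda>p. f (real_of_int i / real (Suc n)) (snd p)) \<in> borel_measurable (borel \<Otimes>\<^sub>M M)" for i :: int
    by measurable
  moreover have "(\<lambda>p. \<lfloor>real (Suc n) * fst p\<rfloor>) \<in> borel \<Otimes>\<^sub>M M \<rightarrow>\<^sub>M count_space UNIV"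
    by measurable
  ultimately show "(\<lambda>p. f (real_of_int \<lfloor>real (Suc n) * fst p\<rfloor> / real (Suc n)) (snd p)) \<in> borel_measurable (borel \<Otimes>\<^sub>M M)"
    by (rule measurable_compose_countable)
next
  fix p :: "real \<times> 'a"
  have "(\<lambda>n. real_of_int \<lfloor>real (Suc n) * fst p\<rfloor> / real (Suc n)) \<longlonglongrightarrow> fst p"
  proof (rule LIM_zero_cancel, rule Lim_null_comparison)
    show "(\<lambda>n. inverse (real (Suc n))) \<longlonglongrightarrow> 0" by (rule LIMSEQ_inverse_real_of_nat)
    have "\<bar>real_of_int \<lfloor>real (Suc n) * fst p\<rfloor> / real (Suc n) - fst p\<bar> \<le> inverse (real (Suc n))" for n
    proof -
      have "real_of_int \<lfloor>real (Suc n) * fst p\<rfloor> / real (Suc n) - fst p =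
          (real_of_int \<lfloor>real (Suc n) * fst p\<rfloor> - real (Suc n) * fst p) / real (Suc n)"
        by (simp add: diff_divide_distrib)
      moreover have "\<bar>real_of_int \<lfloor>real (Suc n) * fst p\<rfloor> - real (Suc n) * fst p\<bar> \<le> 1" by linarith
      ultimately show ?thesis by (simp add: abs_divide inverse_eq_divide divide_right_mono)
    qed
    then show "eventually (\<lambda>n. norm (real_of_int \<lfloor>real (Suc n) * fst p\<rfloor> / real (Suc n) - fst p) \<le> inverse (real (Suc n))) sequentially"
      by (intro always_eventually) simp
  qed
  then show "(\<lambda>n. f (real_of_int \<lfloor>real (Suc n) * fst p\<rfloor> / real (Suc n)) (snd p)) \<longlonglongrightarrow> f (fst p) (snd p)"
    using cont[of "snd p"] by (intro continuous_on_tendsto_compose[of UNIV "\<lambda>t. f t (snd p)"]) auto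
qed

text \<open>Differentiability is tested along rational increments; where a path is not differentiable,
  \<open>vector_derivative\<close> is the constant \<open>SOME d. False\<close>.\<close>

lemma measurable_vector_derivative_process:
  fixes f :: "real \<Rightarrow> 'a \<Rightarrow> complex"
  assumes fm: "\<And>t. f t \<in> borel_measurable M" and cont: "\<And>\<omega>. continuous_on UNIV (\<lambda>t. f t \<omega>)"
  shows "(\<lambda>p. vector_derivative (\<lambda>t. f t (snd p)) (at (fst p))) \<in> borel_measurable (borel \<Otimes>\<^sub>M M)"
proof -
  have joint [measurable]: "(\<lambda>p. f (fst p) (snd p)) \<in> borel_measurable (borel \<Otimes>\<^sub>M M)"
    by (rule measurable_continuous_process[OF fm cont])
  define q where "q h p = (f (fst p + h) (snd p) - f (fst p) (snd p)) /\<^sub>R h" for h and p :: "real \<times> 'a"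
  have q_m [measurable]: "q h \<in> borel_measurable (borel \<Otimes>\<^sub>M M)" for h
  proof -
    have "(\<lambda>p. (fst p + h, snd p)) \<in> (borel \<Otimes>\<^sub>M M) \<rightarrow>\<^sub>M (borel \<Otimes>\<^sub>M M)" by measurable
    from measurable_compose[OF this joint]
    have [measurable]: "(\<lambda>p. f (fst p + h) (snd p)) \<in> borel_measurable (borel \<Otimes>\<^sub>M M)" by simp
    show ?thesis unfolding q_def by measurable
  qed
  define L where "L p = lim (\<lambda>n. q (1 / real (Suc n)) p)" for p
  have L_m [measurable]: "L \<in> borel_measurable (borel \<Otimes>\<^sub>M M)"
    unfolding L_def by measurable
  \<comment> \<open>All quantifiers range over countable sets, which keeps \<open>D\<close>
    measurable.\<close>
  define D where "D p \<longleftrightarrow> (\<forall>k::nat. \<exists>m::nat. \<forall>u::rat. 0 < \<bar>real_of_rat u\<bar> \<and> \<bar>real_of_rat u\<bar> < 1 / real (Suc m) \<longrightarrow>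
      cmod (q (real_of_rat u) p - L p) \<le> 1 / real (Suc k))" for p
  have D_m [measurable]: "Measurable.pred (borel \<Otimes>\<^sub>M M) D"
    unfolding D_def by measurable
  define c where "c = (SOME d :: complex. False)"
  have lim_L: "L p = d" if d: "((\<lambda>h. q h p) \<longlongrightarrow> d) (at 0)" for p d
  proof -
    have "filterlim (\<lambda>n. 1 / real (Suc n)) (at 0) sequentially"
      using LIMSEQ_inverse_real_of_nat unfolding inverse_eq_divide by (intro filterlim_atI) auto
    from filterlim_compose[OF d this] show ?thesis unfolding L_def by (rule limI)
  qed
  have D_iff: "D p \<longleftrightarrow> (\<exists>d. ((\<lambda>h. q h p) \<longlongrightarrow> d) (at 0))" for p
  proof
    assume "\<exists>d. ((\<lambda>h. q h p) \<longlongrightarrow> d) (at 0)"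
    then have lim: "((\<lambda>h. q h p) \<longlongrightarrow> L p) (at 0)" using lim_L by blast
    show "D p"
      unfolding D_def
    proof
      fix k :: nat
      have "eventually (\<lambda>h. dist (q h p) (L p) < 1 / real (Suc k)) (at 0)"
        using lim by (rule tendstoD) simp
      then obtain \<delta> where \<delta>: "\<delta> > 0" "\<And>h. h \<noteq> 0 \<Longrightarrow> \<bar>h\<bar> < \<delta> \<Longrightarrow> dist (q h p) (L p) < 1 / real (Suc k)"
        unfolding eventually_at by (auto simp: dist_real_def)
      obtain m where m: "inverse (real (Suc m)) < \<delta>" using reals_Archimedean[OF \<delta>(1)] by blast
      have "cmod (q (real_of_rat u) p - L p) \<le> 1 / real (Suc k)"
        if "0 < \<bar>real_of_rat u\<bar> \<and> \<bar>real_of_rat u\<bar> < 1 / real (Suc m)" for u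
        using \<delta>(2)[of "real_of_rat u"] that m by (auto simp: dist_norm inverse_eq_divide)
      then show "\<exists>m. \<forall>u. 0 < \<bar>real_of_rat u\<bar> \<and> \<bar>real_of_rat u\<bar> < 1 / real (Suc m) \<longrightarrow>
          cmod (q (real_of_rat u) p - L p) \<le> 1 / real (Suc k)" by blast
    qed
  next
    assume D: "D p"
    have qc: "isCont (\<lambda>h. cmod (q h p - L p)) h" if "h \<noteq> 0" for h
    proof -
      have "continuous_on UNIV (\<lambda>h. f (fst p + h) (snd p))"
        by (rule continuous_on_compose2[OF cont]) (auto intro!: continuous_intros)
      then have "isCont (\<lambda>h. f (fst p + h) (snd p)) h" by (simp add: continuous_on_eq_continuous_at)
      then show ?thesis unfolding q_def using that by (intro continuous_intros) auto
    qed
    have "((\<lambda>h. q h p) \<longlongrightarrow> L p) (at 0)"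
    proof (rule tendstoI)
      fix e :: real assume "e > 0"
      then obtain k where k: "inverse (real (Suc k)) < e" using reals_Archimedean by blast
      obtain m where m: "\<And>u. 0 < \<bar>real_of_rat u\<bar> \<Longrightarrow> \<bar>real_of_rat u\<bar> < 1 / real (Suc m) \<Longrightarrow>
          cmod (q (real_of_rat u) p - L p) \<le> 1 / real (Suc k)"
        using D unfolding D_def by blast
      \<comment> \<open>For \<open>h \<noteq> 0\<close> the quotient is continuous in
        \<open>h\<close>, so a violated estimate would persist at some nearby rational
        increment.\<close>
      have "cmod (q h p - L p) \<le> 1 / real (Suc k)" if h: "h \<noteq> 0" "\<bar>h\<bar> < 1 / real (Suc m)" for h
      proof (rule ccontr)
        assume "\<not> cmod (q h p - L p) \<le> 1 / real (Suc k)"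
        then have "eventually (\<lambda>x. cmod (q x p - L p) > 1 / real (Suc k)) (at h)"
          using qc[OF h(1)] unfolding isCont_def by (intro order_tendstoD) auto
        moreover have "eventually (\<lambda>x. x \<noteq> 0 \<and> \<bar>x\<bar> < 1 / real (Suc m)) (at h)"
        proof -
          have "open {x. x \<noteq> 0 \<and> \<bar>x\<bar> < 1 / real (Suc m)}"
            by (intro open_Collect_conj open_Collect_neq open_Collect_less continuous_intros)
          then show ?thesis using h eventually_at_topological by blast
        qed
        ultimately have "eventually (\<lambda>x. cmod (q x p - L p) > 1 / real (Suc k) \<and> x \<noteq> 0 \<and> \<bar>x\<bar> < 1 / real (Suc m)) (at h)"
          by eventually_elim simp
        then obtain \<delta> where \<delta>: "\<delta> > 0" "\<And>x. x \<noteq> h \<Longrightarrow> \<bar>x - h\<bar> < \<delta> \<Longrightarrow> cmod (q x p - L p) > 1 / real (Suc k) \<and> x \<noteq> 0 \<and> \<bar>x\<bar> < 1 / real (Suc m)"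
          unfolding eventually_at by (auto simp: dist_real_def)
        obtain u :: rat where "h < real_of_rat u" "real_of_rat u < h + \<delta>"
          using of_rat_dense[of h "h + \<delta>"] \<delta>(1) by auto
        then have "cmod (q (real_of_rat u) p - L p) > 1 / real (Suc k) \<and> real_of_rat u \<noteq> 0 \<and> \<bar>real_of_rat u\<bar> < 1 / real (Suc m)"
          using \<delta>(2)[of "real_of_rat u"] by auto
        then show False using m[of u] by auto
      qed
      then have "dist (q h p) (L p) < e" if "h \<noteq> 0" "\<bar>h\<bar> < 1 / real (Suc m)" for h
        using that k by (force simp: dist_norm inverse_eq_divide)
      then show "eventually (\<lambda>h. dist (q h p) (L p) < e) (at 0)"
        unfolding eventually_at by (intro exI[of _ "1 / real (Suc m)"]) (auto simp: dist_real_def)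
    qed
    then show "\<exists>d. ((\<lambda>h. q h p) \<longlongrightarrow> d) (at 0)" by blast
  qed
  have hvd: "((\<lambda>t. f t (snd p)) has_vector_derivative d) (at (fst p)) \<longleftrightarrow> ((\<lambda>h. q h p) \<longlongrightarrow> d) (at 0)" for p d
    unfolding has_vector_derivative_iff_quotient q_def ..
  have "vector_derivative (\<lambda>t. f t (snd p)) (at (fst p)) = (if D p then L p else c)" for p
  proof (cases "D p")
    case True
    then obtain d where d: "((\<lambda>h. q h p) \<longlongrightarrow> d) (at 0)" using D_iff by blast
    then have "((\<lambda>t. f t (snd p)) has_vector_derivative d) (at (fst p))" by (simp add: hvd)
    then have "vector_derivative (\<lambda>t. f t (snd p)) (at (fst p)) = d" by (rule vector_derivative_at)
    then show ?thesis using True lim_L[OF d] by simp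
  next
    case False
    then have "\<not> ((\<lambda>t. f t (snd p)) has_vector_derivative d) (at (fst p))" for d
      using D_iff hvd by blast
    then show ?thesis using False by (simp add: vector_derivative_def c_def)
  qed
  then show ?thesis by simp
qed

section \<open>The Gaussian space of a stationary process\<close>

text \<open>Paths are continuous at every \<omega>, not only almost surely, so that paths and their
  derivatives are jointly measurable without exceptions. The given process is brought to this form
  by changing it on a null set.\<close>

locale stationary_gaussian = prob_space M + S: spectral \<rho> r
  for M :: "'a measure" and \<rho> :: "real measure" and r :: "real \<Rightarrow> complex" +
  fixes f :: "real \<Rightarrow> 'a \<Rightarrow> complex"
  assumes f_measurable [measurable]: "f t \<in> borel_measurable M"
    and f_continuous: "continuous_on UNIV (\<lambda>t. f t \<omega>)"
    and f_gaussian: "finite A \<Longrightarrow> \<exists>q. circular_gaussian M (\<lambda>\<omega>. \<Sum>t\<in>A. c t * f t \<omega>) q"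
    and f_cov: "(LINT \<omega>|M. f s \<omega> * cnj (f t \<omega>)) = r (s - t)"
begin

text \<open>\<open>rep Z \<phi>\<close>: the spectral isometry \<open>f t \<mapsto> (\<lambda>l. iexp (- (t * l)))\<close> into \<open>L\<^sup>2 \<rho>\<close> maps the finite
  combination \<open>Z\<close> to \<open>\<phi>\<close>; \<open>rep_limit\<close> is the closure of this graph.\<close>

inductive rep :: "('a \<Rightarrow> complex) \<Rightarrow> (real \<Rightarrow> complex) \<Rightarrow> bool" where
  base: "rep (f t) (\<lambda>l. iexp (- (t * l)))"
| add: "rep X \<phi> \<Longrightarrow> rep Y \<psi> \<Longrightarrow> rep (\<lambda>\<omega>. X \<omega> + Y \<omega>) (\<lambda>l. \<phi> l + \<psi> l)"
| scale: "rep X \<phi> \<Longrightarrow> rep (\<lambda>\<omega>. c * X \<omega>) (\<lambda>l. c * \<phi> l)"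

lemma rep_combination:
  assumes "rep Z \<phi>"
  shows "\<exists>A c. finite A \<and> Z = (\<lambda>\<omega>. \<Sum>t\<in>A. c t * f t \<omega>)"
  using assms
proof induction
  case (base t)
  show ?case by (intro exI[of _ "{t}"] exI[of _ "\<lambda>_. 1"]) simp
next
  case (add X \<phi> Y \<psi>)
  then obtain A c B d where A: "finite A" "X = (\<lambda>\<omega>. \<Sum>t\<in>A. c t * f t \<omega>)" and B: "finite B" "Y = (\<lambda>\<omega>. \<Sum>t\<in>B. d t * f t \<omega>)"
    by blast
  define e where "e t = (if t \<in> A then c t else 0) + (if t \<in> B then d t else 0)" for t
  have "X \<omega> + Y \<omega> = (\<Sum>t\<in>A \<union> B. e t * f t \<omega>)" for \<omega>
  proof -
    have "X \<omega> = (\<Sum>t\<in>A \<union> B. (if t \<in> A then c t else 0) * f t \<omega>)"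
      unfolding A(2) using A(1) B(1) by (intro sum.mono_neutral_cong_left) auto
    moreover have "Y \<omega> = (\<Sum>t\<in>A \<union> B. (if t \<in> B then d t else 0) * f t \<omega>)"
      unfolding B(2) using A(1) B(1) by (intro sum.mono_neutral_cong_left) auto
    ultimately show ?thesis by (simp only: e_def distrib_right sum.distrib)
  qed
  then show ?case using A(1) B(1) by (intro exI[of _ "A \<union> B"] exI[of _ e]) auto
next
  case (scale X \<phi> c)
  then obtain A d where A: "finite A" "X = (\<lambda>\<omega>. \<Sum>t\<in>A. d t * f t \<omega>)" by blast
  then show ?case
    by (intro exI[of _ A] exI[of _ "\<lambda>t. c * d t"]) (simp add: sum_distrib_left mult.assoc)
qed

lemma rep_gaussian: "rep Z \<phi> \<Longrightarrow> \<exists>q. circular_gaussian M Z q"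
  using rep_combination[of Z \<phi>] f_gaussian by blast

lemma rep_measurable:
  assumes "rep Z \<phi>"
  shows "Z \<in> borel_measurable M" "\<phi> \<in> borel_measurable borel" "\<phi> \<in> borel_measurable \<rho>"
proof -
  show "Z \<in> borel_measurable M" using rep_gaussian[OF assms] circular_gaussian_measurable by blast
  show "\<phi> \<in> borel_measurable borel" using assms by induction auto
  then show "\<phi> \<in> borel_measurable \<rho>" by simp
qed

lemma rep_square_integrable:
  assumes "rep Z \<phi>"
  shows "integrable M (\<lambda>\<omega>. (cmod (Z \<omega>))\<^sup>2)"
  using rep_gaussian[OF assms] circular_gaussian_power(1)[of M Z _ 1] by auto

lemma rep_bounded: "rep Z \<phi> \<Longrightarrow> \<exists>B. \<forall>l. cmod (\<phi> l) \<le> B"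
proof (induction rule: rep.induct)
  case (base t)
  show ?case by (intro exI[of _ 1]) simp
next
  case (add X \<phi> Y \<psi>)
  then obtain B C where "\<And>l. cmod (\<phi> l) \<le> B" "\<And>l. cmod (\<psi> l) \<le> C" by blast
  then have "cmod (\<phi> l + \<psi> l) \<le> B + C" for l by (meson add_mono norm_triangle_ineq order_trans)
  then show ?case by blast
next
  case (scale X \<phi> c)
  then obtain B where "\<And>l. cmod (\<phi> l) \<le> B" by blast
  then have "cmod (c * \<phi> l) \<le> cmod c * B" for l by (simp add: norm_mult mult_left_mono)
  then show ?case by blast
qed

lemma rep_mult_integrable:
  assumes "rep Z \<phi>" "rep Y \<psi>"
  shows "integrable M (\<lambda>\<omega>. Z \<omega> * cnj (Y \<omega>))" "integrable \<rho> (\<lambda>l. \<phi> l * cnj (\<psi> l))"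
proof -
  note [measurable] = rep_measurable[OF assms(1)] rep_measurable[OF assms(2)]
  have i: "integrable M (\<lambda>\<omega>. (cmod (Z \<omega>))\<^sup>2 + (cmod (Y \<omega>))\<^sup>2)"
    using assms by (intro Bochner_Integration.integrable_add rep_square_integrable)
  have le: "cmod a * cmod b \<le> (cmod a)\<^sup>2 + (cmod b)\<^sup>2" for a b
    using sum_squares_bound[of "cmod a" "cmod b"] mult_nonneg_nonneg[OF norm_ge_zero norm_ge_zero, of a b]
    by linarith
  show "integrable M (\<lambda>\<omega>. Z \<omega> * cnj (Y \<omega>))"
    by (rule Bochner_Integration.integrable_bound[OF i]) (auto simp: norm_mult intro!: le)
  obtain B C where "\<And>l. cmod (\<phi> l) \<le> B" "\<And>l. cmod (\<psi> l) \<le> C"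
    using assms[THEN rep_bounded] by blast
  then have "cmod (\<phi> l * cnj (\<psi> l)) \<le> B * C" for l
    unfolding norm_mult complex_mod_cnj by (intro mult_mono) (auto intro: order_trans[OF norm_ge_zero])
  then show "integrable \<rho> (\<lambda>l. \<phi> l * cnj (\<psi> l))"
    by (intro S.integrable_const_bound[where B="B * C"]) auto
qed

lemma rep_cov_base:
  assumes "rep Z \<phi>"
  shows "(LINT \<omega>|M. Z \<omega> * cnj (f t \<omega>)) = (LINT l|\<rho>. \<phi> l * cnj (iexp (- (t * l))))"
  using assms
proof induction
  case (base s)
  have "iexp (- (s * l)) * cnj (iexp (- (t * l))) = iexp (- ((s - t) * l))" for l
    unfolding S.iexp_cnj mult_exp_exp by (simp add: algebra_simps)
  then show ?case unfolding f_cov S.r_eq by simp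
next
  case (add X \<phi> Y \<psi>)
  note i = rep_mult_integrable[OF add(1) base[of t]] rep_mult_integrable[OF add(2) base[of t]]
  show ?case unfolding distrib_right
    using Bochner_Integration.integral_add[OF i(1,3)] Bochner_Integration.integral_add[OF i(2,4)] add(3,4) by (simp only:)
next
  case (scale X \<phi> c)
  then show ?case unfolding mult.assoc by (simp only: integral_mult_right_zero)
qed

lemma rep_cov:
  assumes "rep Y \<psi>" "rep Z \<phi>"
  shows "(LINT \<omega>|M. Z \<omega> * cnj (Y \<omega>)) = (LINT l|\<rho>. \<phi> l * cnj (\<psi> l))"
  using assms(1)
proof induction
  case (base t)
  show ?case by (rule rep_cov_base[OF assms(2)])
next
  case (add X1 \<phi>1 X2 \<phi>2)
  note i = rep_mult_integrable[OF assms(2) add(1)] rep_mult_integrable[OF assms(2) add(2)]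
  show ?case unfolding complex_cnj_add distrib_left
    using Bochner_Integration.integral_add[OF i(1,3)] Bochner_Integration.integral_add[OF i(2,4)] add(3,4) by (simp only:)
next
  case (scale X1 \<phi>1 c)
  then show ?case unfolding complex_cnj_mult mult.left_commute[of _ "cnj c"] by (simp only: integral_mult_right_zero)
qed

lemma rep_square:
  assumes "rep Z \<phi>"
  shows "(LINT \<omega>|M. (cmod (Z \<omega>))\<^sup>2) = (LINT l|\<rho>. (cmod (\<phi> l))\<^sup>2)"
proof -
  have "complex_of_real (LINT \<omega>|M. (cmod (Z \<omega>))\<^sup>2) = of_real (LINT l|\<rho>. (cmod (\<phi> l))\<^sup>2)"
    using rep_cov[OF assms assms] unfolding complex_norm_square[symmetric] integral_complex_of_real .
  then show ?thesis by (simp only: of_real_eq_iff)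
qed

section \<open>Closure of the spectral isometry under mean square limits\<close>

definition rep_limit :: "('a \<Rightarrow> complex) \<Rightarrow> (real \<Rightarrow> complex) \<Rightarrow> bool" where
  "rep_limit Z \<phi> \<longleftrightarrow> Z \<in> borel_measurable M \<and> \<phi> \<in> borel_measurable borel \<and>
    (\<exists>Zk \<phi>k. (\<forall>k. rep (Zk k) (\<phi>k k)) \<and>
      (\<forall>k. integrable M (\<lambda>\<omega>. (cmod (Zk k \<omega> - Z \<omega>))\<^sup>2)) \<and> (\<forall>k. integrable \<rho> (\<lambda>l. (cmod (\<phi>k k l - \<phi> l))\<^sup>2)) \<and>
      (\<lambda>k. LINT \<omega>|M. (cmod (Zk k \<omega> - Z \<omega>))\<^sup>2) \<longlonglongrightarrow> 0 \<and> (\<lambda>k. LINT l|\<rho>. (cmod (\<phi>k k l - \<phi> l))\<^sup>2) \<longlonglongrightarrow> 0)"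

lemma rep_imp_rep_limit: "rep Z \<phi> \<Longrightarrow> rep_limit Z \<phi>"
  unfolding rep_limit_def using rep_measurable
  by (intro conjI exI[of _ "\<lambda>_. Z"] exI[of _ "\<lambda>_. \<phi>"]) auto

lemma rep_limit_measurable:
  assumes "rep_limit Z \<phi>"
  shows "Z \<in> borel_measurable M" "\<phi> \<in> borel_measurable borel" "\<phi> \<in> borel_measurable \<rho>"
  using assms by (auto simp: rep_limit_def)

lemma rep_limit_scale:
  assumes "rep_limit Z \<phi>"
  shows "rep_limit (\<lambda>\<omega>. c * Z \<omega>) (\<lambda>l. c * \<phi> l)"
proof -
  note [measurable] = rep_limit_measurable[OF assms]
  obtain Zk \<phi>k where r: "\<And>k. rep (Zk k) (\<phi>k k)"
    and i: "\<And>k. integrable M (\<lambda>\<omega>. (cmod (Zk k \<omega> - Z \<omega>))\<^sup>2)" "\<And>k. integrable \<rho> (\<lambda>l. (cmod (\<phi>k k l - \<phi> l))\<^sup>2)"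
    and l: "(\<lambda>k. LINT \<omega>|M. (cmod (Zk k \<omega> - Z \<omega>))\<^sup>2) \<longlonglongrightarrow> 0" "(\<lambda>k. LINT l|\<rho>. (cmod (\<phi>k k l - \<phi> l))\<^sup>2) \<longlonglongrightarrow> 0"
    using assms unfolding rep_limit_def by blast
  have eq: "(cmod (c * a - c * b))\<^sup>2 = (cmod c)\<^sup>2 * (cmod (a - b))\<^sup>2" for a b
    by (simp add: right_diff_distrib[symmetric] norm_mult power_mult_distrib)
  have "(\<lambda>k. (cmod c)\<^sup>2 * (LINT \<omega>|M. (cmod (Zk k \<omega> - Z \<omega>))\<^sup>2)) \<longlonglongrightarrow> 0"
    "(\<lambda>k. (cmod c)\<^sup>2 * (LINT l|\<rho>. (cmod (\<phi>k k l - \<phi> l))\<^sup>2)) \<longlonglongrightarrow> 0"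
    using tendsto_mult_left[OF l(1), of "(cmod c)\<^sup>2"] tendsto_mult_left[OF l(2), of "(cmod c)\<^sup>2"] by simp_all
  then show ?thesis
    unfolding rep_limit_def
    by (intro conjI exI[of _ "\<lambda>k \<omega>. c * Zk k \<omega>"] exI[of _ "\<lambda>k l. c * \<phi>k k l"] allI)
      (auto simp: eq intro: rep.scale r intro!: integrable_mult_right i)
qed

lemma rep_limit_add:
  assumes "rep_limit X \<phi>" "rep_limit Y \<psi>"
  shows "rep_limit (\<lambda>\<omega>. X \<omega> + Y \<omega>) (\<lambda>l. \<phi> l + \<psi> l)"
proof -
  note m [measurable] = rep_limit_measurable[OF assms(1)] rep_limit_measurable[OF assms(2)]
  obtain Xk \<phi>k where r: "\<And>k. rep (Xk k) (\<phi>k k)"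
    and i: "\<And>k. integrable M (\<lambda>\<omega>. (cmod (Xk k \<omega> - X \<omega>))\<^sup>2)" "\<And>k. integrable \<rho> (\<lambda>l. (cmod (\<phi>k k l - \<phi> l))\<^sup>2)"
    and l: "(\<lambda>k. LINT \<omega>|M. (cmod (Xk k \<omega> - X \<omega>))\<^sup>2) \<longlonglongrightarrow> 0" "(\<lambda>k. LINT l|\<rho>. (cmod (\<phi>k k l - \<phi> l))\<^sup>2) \<longlonglongrightarrow> 0"
    using assms(1) unfolding rep_limit_def by blast
  obtain Yk \<psi>k where r': "\<And>k. rep (Yk k) (\<psi>k k)"
    and i': "\<And>k. integrable M (\<lambda>\<omega>. (cmod (Yk k \<omega> - Y \<omega>))\<^sup>2)" "\<And>k. integrable \<rho> (\<lambda>l. (cmod (\<psi>k k l - \<psi> l))\<^sup>2)"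
    and l': "(\<lambda>k. LINT \<omega>|M. (cmod (Yk k \<omega> - Y \<omega>))\<^sup>2) \<longlonglongrightarrow> 0" "(\<lambda>k. LINT l|\<rho>. (cmod (\<psi>k k l - \<psi> l))\<^sup>2) \<longlonglongrightarrow> 0"
    using assms(2) unfolding rep_limit_def by blast
  note mk [measurable] = rep_measurable[OF r] rep_measurable[OF r']
  have eq: "(Xk k \<omega> + Yk k \<omega>) - (X \<omega> + Y \<omega>) = (Xk k \<omega> - X \<omega>) + (Yk k \<omega> - Y \<omega>)"
    "(\<phi>k k l + \<psi>k k l) - (\<phi> l + \<psi> l) = (\<phi>k k l - \<phi> l) + (\<psi>k k l - \<psi> l)" for k \<omega> l by simp_all
  have a: "integrable M (\<lambda>\<omega>. (cmod ((Xk k \<omega> - X \<omega>) + (Yk k \<omega> - Y \<omega>)))\<^sup>2)"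
    "(LINT \<omega>|M. (cmod ((Xk k \<omega> - X \<omega>) + (Yk k \<omega> - Y \<omega>)))\<^sup>2) \<le>
      2 * (LINT \<omega>|M. (cmod (Xk k \<omega> - X \<omega>))\<^sup>2) + 2 * (LINT \<omega>|M. (cmod (Yk k \<omega> - Y \<omega>))\<^sup>2)" for k
    using i(1)[of k] i'(1)[of k] by (intro square_integrable_add; simp)+
  have b: "integrable \<rho> (\<lambda>l. (cmod ((\<phi>k k l - \<phi> l) + (\<psi>k k l - \<psi> l)))\<^sup>2)"
    "(LINT l|\<rho>. (cmod ((\<phi>k k l - \<phi> l) + (\<psi>k k l - \<psi> l)))\<^sup>2) \<le>
      2 * (LINT l|\<rho>. (cmod (\<phi>k k l - \<phi> l))\<^sup>2) + 2 * (LINT l|\<rho>. (cmod (\<psi>k k l - \<psi> l))\<^sup>2)" for k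
    using i(2)[of k] i'(2)[of k] by (intro square_integrable_add; simp)+
  have "(\<lambda>k. 2 * (LINT \<omega>|M. (cmod (Xk k \<omega> - X \<omega>))\<^sup>2) + 2 * (LINT \<omega>|M. (cmod (Yk k \<omega> - Y \<omega>))\<^sup>2)) \<longlonglongrightarrow> 2 * 0 + 2 * 0"
    by (intro tendsto_intros l l')
  then have c: "(\<lambda>k. LINT \<omega>|M. (cmod ((Xk k \<omega> - X \<omega>) + (Yk k \<omega> - Y \<omega>)))\<^sup>2) \<longlonglongrightarrow> 0"
    by (intro null_sequence_comparison[OF _ a(2)]) simp_all
  have "(\<lambda>k. 2 * (LINT l|\<rho>. (cmod (\<phi>k k l - \<phi> l))\<^sup>2) + 2 * (LINT l|\<rho>. (cmod (\<psi>k k l - \<psi> l))\<^sup>2)) \<longlonglongrightarrow> 2 * 0 + 2 * 0"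
    by (intro tendsto_intros l l')
  then have d: "(\<lambda>k. LINT l|\<rho>. (cmod ((\<phi>k k l - \<phi> l) + (\<psi>k k l - \<psi> l)))\<^sup>2) \<longlonglongrightarrow> 0"
    by (intro null_sequence_comparison[OF _ b(2)]) simp_all
  show ?thesis
    unfolding rep_limit_def
  proof (intro conjI exI[of _ "\<lambda>k \<omega>. Xk k \<omega> + Yk k \<omega>"] exI[of _ "\<lambda>k l. \<phi>k k l + \<psi>k k l"] allI)
    show "rep (\<lambda>\<omega>. Xk k \<omega> + Yk k \<omega>) (\<lambda>l. \<phi>k k l + \<psi>k k l)" for k by (rule rep.add[OF r r'])
  qed (use m in \<open>simp_all only: eq a b c d borel_measurable_add\<close>)
qed

lemma rep_limit_square:
  assumes "rep_limit Z \<phi>"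
  shows "circular_gaussian M Z (LINT \<omega>|M. (cmod (Z \<omega>))\<^sup>2)"
    "(LINT \<omega>|M. (cmod (Z \<omega>))\<^sup>2) = (LINT l|\<rho>. (cmod (\<phi> l))\<^sup>2)"
    "integrable M (\<lambda>\<omega>. (cmod (Z \<omega>))\<^sup>2)" "integrable \<rho> (\<lambda>l. (cmod (\<phi> l))\<^sup>2)"
proof -
  note m = rep_limit_measurable[OF assms]
  obtain Zk \<phi>k where r: "\<And>k. rep (Zk k) (\<phi>k k)"
    and i: "\<And>k. integrable M (\<lambda>\<omega>. (cmod (Zk k \<omega> - Z \<omega>))\<^sup>2)" "\<And>k. integrable \<rho> (\<lambda>l. (cmod (\<phi>k k l - \<phi> l))\<^sup>2)"
    and l: "(\<lambda>k. LINT \<omega>|M. (cmod (Zk k \<omega> - Z \<omega>))\<^sup>2) \<longlonglongrightarrow> 0" "(\<lambda>k. LINT l|\<rho>. (cmod (\<phi>k k l - \<phi> l))\<^sup>2) \<longlonglongrightarrow> 0"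
    using assms unfolding rep_limit_def by blast
  have i\<phi>: "integrable \<rho> (\<lambda>l. (cmod (\<phi>k k l))\<^sup>2)" for k
  proof -
    have "integrable \<rho> (\<lambda>l. cmod (\<phi>k k l * cnj (\<phi>k k l)))"
      using rep_mult_integrable(2)[OF r r] by (rule integrable_norm)
    then show ?thesis by (simp add: norm_mult power2_eq_square)
  qed
  note q1 = square_mean_tendsto[OF rep_measurable(1)[OF r] m(1) rep_square_integrable[OF r] i(1) l(1)]
  note q2 = square_mean_tendsto[OF rep_measurable(3)[OF r] m(3) i\<phi> i(2) l(2)]
  show "integrable M (\<lambda>\<omega>. (cmod (Z \<omega>))\<^sup>2)" "integrable \<rho> (\<lambda>l. (cmod (\<phi> l))\<^sup>2)" by (rule q1 q2)+
  show "(LINT \<omega>|M. (cmod (Z \<omega>))\<^sup>2) = (LINT l|\<rho>. (cmod (\<phi> l))\<^sup>2)"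
    using q1(2) q2(2) unfolding rep_square[OF r] by (rule LIMSEQ_unique)
  show "circular_gaussian M Z (LINT \<omega>|M. (cmod (Z \<omega>))\<^sup>2)"
    by (rule circular_gaussian_limit[OF prob_space_axioms rep_gaussian[OF r] m(1) i(1) l(1)])
qed

definition H :: "('a \<Rightarrow> complex) set" where
  "H = {Z. \<exists>\<phi>. rep_limit Z \<phi>}"

sublocale gaussian_space M H
proof
  fix Z assume "Z \<in> H"
  then show "\<exists>q. circular_gaussian M Z q" using rep_limit_square(1) by (auto simp: H_def)
next
  fix X Y assume "X \<in> H" "Y \<in> H"
  then show "(\<lambda>\<omega>. X \<omega> + Y \<omega>) \<in> H" unfolding H_def using rep_limit_add by blast
next
  fix X c assume "X \<in> H"
  then show "(\<lambda>\<omega>. c * X \<omega>) \<in> H" unfolding H_def using rep_limit_scale by blast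
qed

text \<open>The isometry preserves norms by \<open>rep_limit_square\<close>; polarization over the
  fourth roots of unity recovers the inner product from them.\<close>

lemma rep_limit_cov:
  assumes X: "rep_limit X \<phi>" and Y: "rep_limit Y \<psi>"
  shows "cov X Y = (LINT l|\<rho>. \<phi> l * cnj (\<psi> l))"
proof -
  have pol: "a * cnj b = of_real ((cmod (a + 1 * b))\<^sup>2 / 4) - of_real ((cmod (a + (-1) * b))\<^sup>2 / 4)
      + \<i> * of_real ((cmod (a + \<i> * b))\<^sup>2 / 4) - \<i> * of_real ((cmod (a + (- \<i>) * b))\<^sup>2 / 4)" for a b :: complex
    unfolding cmod_power2 by (simp add: complex_eq_iff power2_eq_square field_simps)
  define A where "A c = (LINT \<omega>|M. (cmod (X \<omega> + c * Y \<omega>))\<^sup>2 / 4)" for c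
  define B where "B c = (LINT l|\<rho>. (cmod (\<phi> l + c * \<psi> l))\<^sup>2 / 4)" for c
  have r: "rep_limit (\<lambda>\<omega>. X \<omega> + c * Y \<omega>) (\<lambda>l. \<phi> l + c * \<psi> l)" for c
    by (intro rep_limit_add rep_limit_scale X Y)
  have AB: "A c = B c" for c
    using rep_limit_square(2)[OF r[of c]] by (simp add: A_def B_def)
  have iA: "integrable M (\<lambda>\<omega>. complex_of_real ((cmod (X \<omega> + c * Y \<omega>))\<^sup>2 / 4))" for c
    by (intro integrable_of_real integrable_divide rep_limit_square(3)[OF r])
  have iB: "integrable \<rho> (\<lambda>l. complex_of_real ((cmod (\<phi> l + c * \<psi> l))\<^sup>2 / 4))" for c
    by (intro integrable_of_real integrable_divide rep_limit_square(4)[OF r])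
  have "cov X Y = of_real (A 1) - of_real (A (-1)) + \<i> * of_real (A \<i>) - \<i> * of_real (A (- \<i>))"
    unfolding pol[of "X _" "Y _"] A_def
    by (simp only: Bochner_Integration.integral_add Bochner_Integration.integral_diff Bochner_Integration.integrable_add
      Bochner_Integration.integrable_diff integrable_mult_right iA integral_mult_right_zero integral_complex_of_real)
  also have "\<dots> = (LINT l|\<rho>. \<phi> l * cnj (\<psi> l))"
    unfolding pol[of "\<phi> _" "\<psi> _"] AB B_def
    by (simp only: Bochner_Integration.integral_add Bochner_Integration.integral_diff Bochner_Integration.integrable_add
      Bochner_Integration.integrable_diff integrable_mult_right iB integral_mult_right_zero integral_complex_of_real)
  finally show ?thesis .
qed

end

section \<open>The derivative process\<close>

lemma ennreal_suminf_tendsto_0: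
  fixes u :: "nat \<Rightarrow> ennreal"
  assumes "(\<Sum>k. u k) \<noteq> \<infinity>"
  shows "u \<longlonglongrightarrow> 0"
proof -
  have fin: "u k \<noteq> \<infinity>" for k
  proof
    assume "u k = \<infinity>"
    then have "(\<Sum>k. u k) = \<infinity>" using sum_le_suminf[of u "{k}"] by (auto simp: top_unique)
    then show False using assms by simp
  qed
  have eq: "ennreal (enn2real (u k)) = u k" for k using fin[of k] by (simp add: less_top)
  have "summable (\<lambda>k. enn2real (u k))"
    by (rule summable_suminf_not_top) (use assms in \<open>simp_all add: eq\<close>)
  then have "(\<lambda>k. ennreal (enn2real (u k))) \<longlonglongrightarrow> ennreal 0"
    by (intro tendsto_ennrealI summable_LIMSEQ_zero)
  then show ?thesis unfolding eq by simp
qed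

text \<open>Takes the part of Borel-Cantelli: a finite sum of means makes the random series finite,
  and in particular its terms tend to 0.\<close>

lemma AE_suminf_finite:
  fixes u :: "nat \<Rightarrow> 'a \<Rightarrow> ennreal"
  assumes [measurable]: "\<And>k. u k \<in> borel_measurable M"
    and le: "\<And>k. (\<integral>\<^sup>+ x. u k x \<partial>M) \<le> a k" and a: "(\<Sum>k. a k) < \<infinity>"
  shows "AE x in M. (\<Sum>k. u k x) \<noteq> \<infinity>"
proof (rule nn_integral_noteq_infinite)
  have "(\<integral>\<^sup>+ x. (\<Sum>k. u k x) \<partial>M) = (\<Sum>k. \<integral>\<^sup>+ x. u k x \<partial>M)"
    by (rule nn_integral_suminf) simp
  also have "\<dots> \<le> (\<Sum>k. a k)" using le by (intro suminf_le) auto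
  also note a
  finally show "(\<integral>\<^sup>+ x. (\<Sum>k. u k x) \<partial>M) \<noteq> \<infinity>" by (rule less_imp_neq)
qed simp

text \<open>Serves to pass from mean squares to means; the free parameter \<open>t\<close> replaces
  the optimization in Cauchy-Schwarz.\<close>

lemma le_add_weighted_square:
  fixes x t :: real
  assumes "t > 0"
  shows "x \<le> t + x\<^sup>2 / t"
proof -
  have "0 \<le> (x - t)\<^sup>2 + x\<^sup>2 + t\<^sup>2" by simp
  then have "x * t \<le> t * t + x\<^sup>2" by (simp add: power2_eq_square algebra_simps)
  then have "x * t / t \<le> (t * t + x\<^sup>2) / t" using assms by (intro divide_right_mono) auto
  then show ?thesis using assms by (simp add: add_divide_distrib)
qed

lemma suminf_power_quarter: "(\<Sum>k. ennreal (C * (1/2) ^ k)) < \<infinity>" if "C \<ge> 0"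
proof -
  have "summable (\<lambda>k. C * (1/2) ^ k :: real)" by (intro summable_mult summable_geometric) simp
  then show ?thesis using that by (subst suminf_ennreal2) auto
qed

lemma dyadic_scale:
  fixes h :: real
  assumes "0 < h" "h \<le> (1/2) ^ N"
  obtains n where "N \<le> n" "(1/2) ^ Suc n < h" "h \<le> (1/2) ^ n"
proof -
  have ex: "\<exists>n. (1/2::real) ^ Suc n < h"
  proof -
    obtain n where "(1/2::real) ^ n < h" using real_arch_pow_inv[OF assms(1), of "1/2"] by auto
    moreover have "(1/2::real) ^ Suc n \<le> (1/2) ^ n" by simp
    ultimately show ?thesis by (meson le_less_trans)
  qed
  define n where "n = (LEAST n. (1/2::real) ^ Suc n < h)"
  have n: "(1/2::real) ^ Suc n < h" unfolding n_def using ex by (rule LeastI_ex)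
  have N: "N \<le> n"
  proof (rule ccontr)
    assume "\<not> N \<le> n"
    then have "(1/2::real) ^ N \<le> (1/2) ^ Suc n" by (intro power_decreasing) auto
    then show False using n assms by simp
  qed
  have "h \<le> (1/2) ^ n"
  proof (cases "n = N")
    case False
    then obtain m where m: "n = Suc m" using N by (cases n) auto
    have "\<not> (1/2::real) ^ Suc m < h" using not_less_Least[of m "\<lambda>n. (1/2::real) ^ Suc n < h"] m by (simp add: n_def)
    then show ?thesis using m by simp
  qed (use assms in simp)
  then show ?thesis using that N n by blast
qed

text \<open>The integrated difference quotient of \<open>g\<close> is a difference of two difference
  quotients of an antiderivative, so continuity of \<open>g\<close> suffices.\<close>

lemma difference_quotient_increment:
  fixes g :: "real \<Rightarrow> complex"
  assumes g: "continuous_on UNIV g" and ab: "a \<le> b" and hk: "hk \<longlonglongrightarrow> 0" "\<And>k. hk k > 0"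
  shows "(\<lambda>k. LINT s:{a..b}|lborel. (g (s + hk k) - g s) / of_real (hk k)) \<longlonglongrightarrow> g b - g a"
proof -
  obtain F where F: "\<And>x. (F has_vector_derivative g x) (at x)"
  proof -
    have "\<exists>F. \<forall>x. (F has_vector_derivative g x) (at x)"
    proof (intro exI allI)
      fix x
      show "((\<lambda>y. integral {0..y} g - integral {y..0} g) has_vector_derivative g x) (at x)"
      proof -
        \<comment> \<open>One of the two integrals vanishes, according to the sign of
          \<open>y\<close>. A base point below both 0 and \<open>x\<close> turns the expression near
          \<open>x\<close> into an indefinite integral minus a constant.\<close>
        define c where "c = min x 0 - 1"
        have c: "c < x" "c < 0" by (auto simp: c_def)
        have gi: "g integrable_on {u..v}" for u v
          by (intro integrable_continuous_real continuous_on_subset[OF g]) auto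
        have eq: "integral {0..y} g - integral {y..0} g = integral {c..y} g - integral {c..0} g" if "c \<le> y" for y
        proof (cases "0 \<le> y")
          case True
          then have "integral {c..0} g + integral {0..y} g = integral {c..y} g"
            using c by (intro Henstock_Kurzweil_Integration.integral_combine gi) auto
          moreover have "integral {y..0} g = 0" using True by (cases "y = 0") auto
          ultimately show ?thesis by (simp add: algebra_simps)
        next
          case False
          then have "integral {c..y} g + integral {y..0} g = integral {c..0} g"
            using that by (intro Henstock_Kurzweil_Integration.integral_combine gi) auto
          then show ?thesis using False by (simp add: algebra_simps)
        qed
        have "((\<lambda>y. integral {c..y} g) has_vector_derivative g x) (at x within {c..x + 1})"
          using c by (intro integral_has_vector_derivative continuous_on_subset[OF g]) auto
        then have "((\<lambda>y. integral {c..y} g) has_vector_derivative g x) (at x)"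
          using c by (subst (asm) at_within_Icc_at) auto
        then have "((\<lambda>y. integral {c..y} g - integral {c..0} g) has_vector_derivative g x) (at x)"
          using has_vector_derivative_diff[OF _ has_vector_derivative_const[of "integral {c..0} g" "at x"]] by fastforce
        then show ?thesis
          by (rule has_vector_derivative_transform_within_open[where S="{c<..}"]) (use c eq in auto)
      qed
    qed
    then show ?thesis using that by blast
  qed
  have int: "(LINT s:{a..b}|lborel. (g (s + h) - g s) / of_real h) =
      (F (b + h) - F b) /\<^sub>R h - (F (a + h) - F a) /\<^sub>R h" for h
  proof -
    have "continuous_on {a..b} (\<lambda>s. (g (s + h) - g s) / of_real h)"
    proof -
      have "continuous_on {a..b} (\<lambda>s. g (s + h))"
        by (rule continuous_on_compose2[OF g]) (auto intro!: continuous_intros)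
      moreover have "continuous_on {a..b} g" by (rule continuous_on_subset[OF g]) simp
      ultimately have "continuous_on {a..b} (\<lambda>s. inverse (of_real h) * (g (s + h) - g s))"
        by (intro continuous_intros)
      then show ?thesis by (simp add: divide_inverse mult.commute)
    qed
    then have "(LINT s:{a..b}|lborel. (g (s + h) - g s) / of_real h) = integral {a..b} (\<lambda>s. (g (s + h) - g s) / of_real h)"
      by (intro set_borel_integral_eq_integral(2) borel_integrable_atLeastAtMost')
    also have "((\<lambda>s. (g (s + h) - g s) / of_real h) has_integral
        (F (b + h) - F b) /\<^sub>R h - (F (a + h) - F a) /\<^sub>R h) {a..b}"
    proof (rule fundamental_theorem_of_calculus[OF ab])
      fix x
      have "((\<lambda>s. s + h) has_vector_derivative 1) (at x)"
        by (auto intro!: derivative_eq_intros simp: has_real_derivative_iff_has_vector_derivative[symmetric])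
      from vector_diff_chain_at[OF this F]
      have "((\<lambda>s. F (s + h)) has_vector_derivative g (x + h)) (at x)" by (simp add: comp_def)
      from has_vector_derivative_diff[OF this F]
      have "((\<lambda>s. F (s + h) - F s) has_vector_derivative (g (x + h) - g x)) (at x)" .
      then have "((\<lambda>s. (F (s + h) - F s) /\<^sub>R h) has_vector_derivative (g (x + h) - g x) /\<^sub>R h) (at x)"
        by (rule bounded_linear.has_vector_derivative[OF bounded_linear_scaleR_right])
      moreover have "(g (x + h) - g x) /\<^sub>R h = (g (x + h) - g x) / of_real h"
        by (simp only: scaleR_conv_of_real divide_inverse of_real_inverse mult.commute)
      ultimately show "((\<lambda>s. (F (s + h) - F s) /\<^sub>R h) has_vector_derivative (g (x + h) - g x) / of_real h) (at x within {a..b})"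
        by (simp only: has_vector_derivative_at_within)
    qed
    then have "integral {a..b} (\<lambda>s. (g (s + h) - g s) / of_real h) = (F (b + h) - F b) /\<^sub>R h - (F (a + h) - F a) /\<^sub>R h"
      by (rule integral_unique)
    finally show ?thesis .
  qed
  have hk0: "filterlim hk (at 0) sequentially"
  proof (rule filterlim_atI[OF hk(1)])
    show "eventually (\<lambda>k. hk k \<noteq> 0) sequentially"
      by (rule always_eventually) (metis hk(2) less_irrefl)
  qed
  have "(\<lambda>k. (F (x + hk k) - F x) /\<^sub>R hk k) \<longlonglongrightarrow> g x" for x
  proof -
    have "((\<lambda>h. (F (x + h) - F x) /\<^sub>R h) \<longlongrightarrow> g x) (at 0)"
      using F[of x] unfolding has_vector_derivative_iff_quotient .
    from filterlim_compose[OF this hk0] show ?thesis .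
  qed
  then show ?thesis unfolding int by (intro tendsto_diff)
qed

text \<open>The \<open>L\<^sup>1\<close> limit makes \<open>g\<close> an indefinite integral of \<open>D\<close>, and Cauchy-Schwarz bounds the error of its
  difference quotients at \<open>t\<close> by the dyadic mean square oscillation of \<open>D\<close>.\<close>

lemma derivative_from_averages:
  fixes g D :: "real \<Rightarrow> complex"
  assumes g: "continuous_on UNIV g" and [measurable]: "D \<in> borel_measurable borel"
    and hk: "hk \<longlonglongrightarrow> 0" "\<And>k. hk k > 0"
    and A: "(\<lambda>k. \<integral>\<^sup>+ s. ennreal (cmod ((g (s + hk k) - g s) / of_real (hk k) - D s)) * indicator {t - 1..t + 1} s \<partial>lborel) \<longlonglongrightarrow> 0"
    and B: "(\<lambda>n. ennreal (2 ^ n) * (\<integral>\<^sup>+ s. ennreal ((cmod (D s - D t))\<^sup>2) * indicator {t - (1/2) ^ n..t + (1/2) ^ n} s \<partial>lborel)) \<longlonglongrightarrow> 0"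
  shows "(g has_vector_derivative D t) (at t)"
proof -
  define osc_int where "osc_int e = (\<integral>\<^sup>+ s. ennreal (cmod (D s - D t)) * indicator {t - e..t + e} s \<partial>lborel)" for e
  have gm [measurable]: "g \<in> borel_measurable borel" using g by (rule borel_measurable_continuous_onI)
  have interval: "ennreal (cmod (g b - g a - of_real (b - a) * D t)) \<le> osc_int e"
    if ab: "a \<le> b" "t - e \<le> a" "b \<le> t + e" "e \<le> 1" for a b e
  proof -
    let ?q = "\<lambda>k s. (g (s + hk k) - g s) / of_real (hk k)"
    have contq: "continuous_on {a..b} (?q k)" for k
    proof -
      have "continuous_on {a..b} (\<lambda>s. g (s + hk k))"
        by (rule continuous_on_compose2[OF g]) (auto intro!: continuous_intros)
      moreover have "continuous_on {a..b} g" by (rule continuous_on_subset[OF g]) simp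
      ultimately show ?thesis using hk(2)[of k] by (intro continuous_intros) auto
    qed
    have iq: "set_integrable lborel {a..b} (?q k)" for k by (rule borel_integrable_atLeastAtMost'[OF contq])
    have ic: "set_integrable lborel {a..b} (\<lambda>s. D t)" by (rule borel_integrable_atLeastAtMost') simp
    have le: "ennreal (cmod ((LINT s:{a..b}|lborel. ?q k s) - of_real (b - a) * D t)) \<le>
        (\<integral>\<^sup>+ s. ennreal (cmod (?q k s - D s)) * indicator {t - 1..t + 1} s \<partial>lborel) + osc_int e" for k
    proof -
      have "(LINT s:{a..b}|lborel. D t) = of_real (b - a) * D t"
        using ab(1) by (simp add: set_lebesgue_integral_def scaleR_conv_of_real)
      then have "(LINT s:{a..b}|lborel. ?q k s) - of_real (b - a) * D t = (LINT s:{a..b}|lborel. ?q k s - D t)"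
        using set_integral_diff(2)[OF iq[of k] ic] by simp
      also have "ennreal (cmod \<dots>) \<le> (\<integral>\<^sup>+ s. ennreal (norm (indicator {a..b} s *\<^sub>R (?q k s - D t))) \<partial>lborel)"
        unfolding set_lebesgue_integral_def by (rule integral_norm_bound_ennreal)
          (use set_integral_diff(1)[OF iq[of k] ic] in \<open>simp add: set_integrable_def\<close>)
      also have "\<dots> \<le> (\<integral>\<^sup>+ s. ennreal (cmod (?q k s - D s)) * indicator {t - 1..t + 1} s +
          ennreal (cmod (D s - D t)) * indicator {t - e..t + e} s \<partial>lborel)"
      proof (intro nn_integral_mono)
        fix s
        show "ennreal (norm (indicator {a..b} s *\<^sub>R (?q k s - D t))) \<le>
          ennreal (cmod (?q k s - D s)) * indicator {t - 1..t + 1} s + ennreal (cmod (D s - D t)) * indicator {t - e..t + e} s"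
        proof (cases "s \<in> {a..b}")
          case True
          then have "s \<in> {t - 1..t + 1}" "s \<in> {t - e..t + e}" using ab by auto
          moreover have "cmod (?q k s - D t) \<le> cmod (?q k s - D s) + cmod (D s - D t)"
            using norm_triangle_ineq[of "?q k s - D s" "D s - D t"] by simp
          ultimately show ?thesis using True by (simp add: ennreal_plus[symmetric] ennreal_leI del: ennreal_plus)
        qed simp
      qed
      also have "\<dots> = (\<integral>\<^sup>+ s. ennreal (cmod (?q k s - D s)) * indicator {t - 1..t + 1} s \<partial>lborel) + osc_int e"
        unfolding osc_int_def by (rule nn_integral_add) measurable
      finally show ?thesis .
    qed
    have "(\<lambda>k. ennreal (cmod ((LINT s:{a..b}|lborel. ?q k s) - of_real (b - a) * D t))) \<longlonglongrightarrow>
        ennreal (cmod (g b - g a - of_real (b - a) * D t))"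
      by (intro tendsto_ennrealI tendsto_norm tendsto_diff tendsto_const difference_quotient_increment g ab(1) hk)
    moreover have "(\<lambda>k. (\<integral>\<^sup>+ s. ennreal (cmod (?q k s - D s)) * indicator {t - 1..t + 1} s \<partial>lborel) + osc_int e) \<longlonglongrightarrow> 0 + osc_int e"
      by (intro tendsto_add A tendsto_const) 
    ultimately show ?thesis using le by (intro LIMSEQ_le[where X="\<lambda>k. ennreal (cmod ((LINT s:{a..b}|lborel. ?q k s) - of_real (b - a) * D t))"]) auto
  qed
  have osc: "eventually (\<lambda>n. osc_int ((1/2) ^ n) \<le> ennreal (c * (1/2) ^ n)) sequentially" if c: "c > 0" for c
  proof -
    \<comment> \<open>\<open>t0\<close> times the interval length \<open>2 * (1/2) ^ n\<close> is
      half of the target \<open>c * (1/2) ^ n\<close>; the threshold \<open>t0 * (c / 2)\<close>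
      imposed through \<open>B\<close> leaves the other half for the square term, which is divided
      by \<open>t0\<close>.\<close>
    define t0 where "t0 = c / 4"
    have t0: "t0 > 0" using c by (simp add: t0_def)
    have "eventually (\<lambda>n. ennreal (2 ^ n) * (\<integral>\<^sup>+ s. ennreal ((cmod (D s - D t))\<^sup>2) * indicator {t - (1/2) ^ n..t + (1/2) ^ n} s \<partial>lborel) < ennreal (t0 * (c / 2))) sequentially"
      using B c t0 by (intro order_tendstoD) auto
    then show ?thesis
    proof eventually_elim
      fix n
      let ?I = "{t - (1/2) ^ n..t + (1/2) ^ n}"
      let ?J = "\<integral>\<^sup>+ s. ennreal ((cmod (D s - D t))\<^sup>2) * indicator ?I s \<partial>lborel"
      assume J: "ennreal (2 ^ n) * ?J < ennreal (t0 * (c / 2))"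
      have one: "ennreal ((1/2) ^ n) * ennreal (2 ^ n) = 1"
        by (subst ennreal_mult'[symmetric]) (simp_all add: power_one_over)
      have eq: "ennreal ((1/2) ^ n) * (ennreal (2 ^ n) * ?J) = ?J"
        unfolding mult.assoc[symmetric] one by simp
      then have J': "?J \<le> ennreal ((1/2) ^ n) * ennreal (t0 * (c / 2))"
        using mult_left_mono[OF less_imp_le[OF J] zero_le, of "ennreal ((1/2) ^ n)"] by (simp only: eq)
      have "osc_int ((1/2) ^ n) \<le> (\<integral>\<^sup>+ s. ennreal t0 * indicator ?I s + ennreal (1 / t0) * (ennreal ((cmod (D s - D t))\<^sup>2) * indicator ?I s) \<partial>lborel)"
        unfolding osc_int_def
      proof (intro nn_integral_mono)
        fix s
        have "cmod (D s - D t) \<le> t0 + (cmod (D s - D t))\<^sup>2 / t0" by (rule le_add_weighted_square[OF t0])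
        then have "ennreal (cmod (D s - D t)) \<le> ennreal t0 + ennreal (1 / t0) * ennreal ((cmod (D s - D t))\<^sup>2)"
          using t0 by (simp add: ennreal_mult'[symmetric] ennreal_plus[symmetric] ennreal_leI del: ennreal_plus)
        then show "ennreal (cmod (D s - D t)) * indicator ?I s \<le>
            ennreal t0 * indicator ?I s + ennreal (1 / t0) * (ennreal ((cmod (D s - D t))\<^sup>2) * indicator ?I s)"
          by (simp add: indicator_def)
      qed
      also have "\<dots> = ennreal t0 * emeasure lborel ?I + ennreal (1 / t0) * ?J"
        by (subst nn_integral_add) (auto simp: nn_integral_cmult nn_integral_cmult_indicator)
      also have "\<dots> \<le> ennreal t0 * ennreal (2 * (1/2) ^ n) + ennreal (1 / t0) * (ennreal ((1/2) ^ n) * ennreal (t0 * (c / 2)))"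
        by (intro add_mono mult_left_mono J') auto
      also have "\<dots> = ennreal (c * (1/2) ^ n)"
      proof -
        have "t0 * (2 * (1/2) ^ n) + (1 / t0) * ((1/2) ^ n * (t0 * (c / 2))) = c * (1/2) ^ n"
          using c by (simp add: t0_def field_simps)
        then show ?thesis using t0 c
          by (simp add: ennreal_mult'[symmetric] ennreal_plus[symmetric] del: ennreal_plus)
      qed
      finally show "osc_int ((1/2) ^ n) \<le> ennreal (c * (1/2) ^ n)" .
    qed
  qed
  show ?thesis
    unfolding has_vector_derivative_iff_quotient
  proof (rule tendstoI)
    fix e :: real assume e: "e > 0"
    obtain N where N: "\<And>n. N \<le> n \<Longrightarrow> osc_int ((1/2) ^ n) \<le> ennreal ((e / 4) * (1/2) ^ n)"
      using osc[of "e / 4"] e unfolding eventually_sequentially by auto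
    have "dist ((g (t + h) - g t) /\<^sub>R h) (D t) < e" if h: "h \<noteq> 0" "\<bar>h\<bar> < (1/2) ^ N" for h
    proof -
      \<comment> \<open>The scale is comparable to the increment,
        \<open>(1/2) ^ n < 2 * |h|\<close>; the factor 2 lost here is why \<open>N\<close> was
        chosen for \<open>e / 4\<close>.\<close>
      obtain n where n: "N \<le> n" "(1/2) ^ Suc n < \<bar>h\<bar>" "\<bar>h\<bar> \<le> (1/2) ^ n"
        using dyadic_scale[of "\<bar>h\<bar>" N] h by auto
      have p1: "(1/2::real) ^ n \<le> 1" by (simp add: power_le_one)
      have "ennreal (cmod (g (t + h) - g t - of_real h * D t)) \<le> osc_int ((1/2) ^ n)"
      proof (cases "h > 0")
        case True
        then show ?thesis using interval[of t "t + h" "(1/2) ^ n"] n p1 by simp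
      next
        case False
        then have "ennreal (cmod (g t - g (t + h) - of_real (- h) * D t)) \<le> osc_int ((1/2) ^ n)"
          using interval[of "t + h" t "(1/2) ^ n"] n p1 by simp
        also have "cmod (g t - g (t + h) - of_real (- h) * D t) = cmod (g (t + h) - g t - of_real h * D t)"
          by (subst norm_minus_cancel[symmetric]) (simp add: algebra_simps)
        finally show ?thesis .
      qed
      also have "\<dots> \<le> ennreal ((e / 4) * (1/2) ^ n)" by (rule N[OF n(1)])
      finally have "cmod (g (t + h) - g t - of_real h * D t) \<le> (e / 4) * (1/2) ^ n"
        using e by (simp add: ennreal_le_iff)
      also have "\<dots> \<le> (e / 2) * \<bar>h\<bar>" using n(2) e by simp
      finally have le2: "cmod (g (t + h) - g t - of_real h * D t) / \<bar>h\<bar> \<le> e / 2"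
        using h by (simp add: pos_divide_le_eq)
      have eq: "(g (t + h) - g t) /\<^sub>R h - D t = (g (t + h) - g t - of_real h * D t) / of_real h"
        using h by (simp only: scaleR_conv_of_real of_real_inverse) (simp add: field_simps)
      have "dist ((g (t + h) - g t) /\<^sub>R h) (D t) = cmod (g (t + h) - g t - of_real h * D t) / \<bar>h\<bar>"
        unfolding dist_norm eq by (simp add: norm_divide)
      with le2 e show ?thesis by linarith
    qed
    then show "eventually (\<lambda>h. dist ((g (t + h) - g t) /\<^sub>R h) (D t) < e) (at 0)"
      unfolding eventually_at by (intro exI[of _ "(1/2) ^ N"]) (auto simp: dist_real_def)
  qed
qed

section \<open>Mean square and almost sure derivative\<close>

context stationary_gaussian
begin

definition diff_quot :: "real \<Rightarrow> real \<Rightarrow> 'a \<Rightarrow> complex" where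
  "diff_quot h t \<omega> = (f (t + h) \<omega> - f t \<omega>) / of_real h"

text \<open>Spectral representative of the difference quotient at time 0; as \<open>h\<close> tends
  to 0 it approaches \<open>- \<i> * l\<close>, the multiplier of differentiation.\<close>

definition symbol :: "real \<Rightarrow> real \<Rightarrow> complex" where
  "symbol h l = (iexp (- (h * l)) - 1) / of_real h"

definition symbol_error :: "real \<Rightarrow> real" where
  "symbol_error h = (LINT l|\<rho>. (cmod (symbol h l + \<i> * of_real l))\<^sup>2)"

lemma f_joint [measurable]: "(\<lambda>p. f (fst p) (snd p)) \<in> borel_measurable (borel \<Otimes>\<^sub>M M)"
  by (rule measurable_continuous_process[OF f_measurable f_continuous])

lemma diff_quot_joint [measurable]: "(\<lambda>p. diff_quot h (fst p) (snd p)) \<in> borel_measurable (borel \<Otimes>\<^sub>M M)"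
proof -
  have "(\<lambda>p. (fst p + h, snd p)) \<in> (borel \<Otimes>\<^sub>M M) \<rightarrow>\<^sub>M (borel \<Otimes>\<^sub>M M)" by measurable
  from measurable_compose[OF this f_joint]
  have [measurable]: "(\<lambda>p. f (fst p + h) (snd p)) \<in> borel_measurable (borel \<Otimes>\<^sub>M M)" by simp
  show ?thesis unfolding diff_quot_def by measurable
qed

lemma diff_quot_measurable [measurable]: "diff_quot h t \<in> borel_measurable M"
  unfolding diff_quot_def by measurable

lemma symbol_measurable [measurable]: "symbol h \<in> borel_measurable borel"
  unfolding symbol_def by measurable

lemma symbol_error_le: "(cmod (symbol h l + \<i> * of_real l))\<^sup>2 \<le> 4 * l\<^sup>2"
proof -
  have "cmod (symbol h l + \<i> * of_real l) \<le> cmod (symbol h l) + cmod (\<i> * of_real l)" by (rule norm_triangle_ineq)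
  also have "\<dots> \<le> 2 * \<bar>l\<bar>" using S.difference_quotient_bound[of h l] by (simp add: symbol_def norm_mult)
  finally have "(cmod (symbol h l + \<i> * of_real l))\<^sup>2 \<le> (2 * \<bar>l\<bar>)\<^sup>2" by (intro power_mono) auto
  then show ?thesis by (simp add: power_mult_distrib)
qed

lemma symbol_error_integrable: "integrable \<rho> (\<lambda>l. (cmod (symbol h l + \<i> * of_real l))\<^sup>2)"
proof (rule Bochner_Integration.integrable_bound)
  show "integrable \<rho> (\<lambda>l. 4 * l\<^sup>2)" using S.square_integrable by simp
  show "AE l in \<rho>. norm ((cmod (symbol h l + \<i> * of_real l))\<^sup>2) \<le> norm (4 * l\<^sup>2)"
    using symbol_error_le by (intro AE_I2) simp
qed simp

text \<open>Dominated convergence allows steps that converge as fast as desired. The rate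
  \<open>(1/4) ^ k\<close> in mean square survives the weights \<open>2 ^ k\<close> by which almost
  sure convergence is extracted.\<close>

lemma ex_step: "\<exists>h>0. h \<le> 1 / real (Suc k) \<and> symbol_error h \<le> (1/4) ^ k"
proof -
  have "(\<lambda>n. symbol_error (1 / real (Suc n))) \<longlonglongrightarrow> (LINT l|\<rho>. (0::real))"
    unfolding symbol_error_def
  proof (rule integral_dominated_convergence[where w="\<lambda>l. 4 * l\<^sup>2"])
    show "AE l in \<rho>. (\<lambda>n. (cmod (symbol (1 / real (Suc n)) l + \<i> * of_real l))\<^sup>2) \<longlonglongrightarrow> 0"
    proof (rule AE_I2)
      fix l
      have "(\<lambda>n. 1 / real (Suc n)) \<longlonglongrightarrow> 0" using LIMSEQ_inverse_real_of_nat by (simp add: inverse_eq_divide)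
      from S.difference_quotient_tendsto[OF this, of l]
      have "(\<lambda>n. symbol (1 / real (Suc n)) l) \<longlonglongrightarrow> - (\<i> * of_real l)" unfolding symbol_def by simp
      then have "(\<lambda>n. (cmod (symbol (1 / real (Suc n)) l + \<i> * of_real l))\<^sup>2) \<longlonglongrightarrow> (cmod (- (\<i> * of_real l) + \<i> * of_real l))\<^sup>2"
        by (intro tendsto_intros)
      then show "(\<lambda>n. (cmod (symbol (1 / real (Suc n)) l + \<i> * of_real l))\<^sup>2) \<longlonglongrightarrow> 0" by simp
    qed
    show "integrable \<rho> (\<lambda>l. 4 * l\<^sup>2)" using S.square_integrable by simp
    show "AE l in \<rho>. norm ((cmod (symbol (1 / real (Suc n)) l + \<i> * of_real l))\<^sup>2) \<le> 4 * l\<^sup>2" for n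
      using symbol_error_le by (intro AE_I2) simp
  qed simp_all
  then have "(\<lambda>n. symbol_error (1 / real (Suc n))) \<longlonglongrightarrow> 0" by simp
  then have "eventually (\<lambda>n. symbol_error (1 / real (Suc n)) < (1/4) ^ k) sequentially"
    by (rule order_tendstoD) simp
  then obtain N where N: "\<And>n. N \<le> n \<Longrightarrow> symbol_error (1 / real (Suc n)) < (1/4) ^ k"
    unfolding eventually_sequentially by blast
  have "1 / real (Suc (max N k)) \<le> 1 / real (Suc k)" by (intro divide_left_mono) auto
  then show ?thesis using N[of "max N k"] by (intro exI[of _ "1 / real (Suc (max N k))"]) auto
qed

definition step :: "nat \<Rightarrow> real" where
  "step k = (SOME h. h > 0 \<and> h \<le> 1 / real (Suc k) \<and> symbol_error h \<le> (1/4) ^ k)"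

lemma step: "step k > 0" "step k \<le> 1 / real (Suc k)" "symbol_error (step k) \<le> (1/4) ^ k"
  using someI_ex[OF ex_step[of k]] unfolding step_def by blast+

lemma step_tendsto: "step \<longlonglongrightarrow> 0"
proof (rule null_sequence_comparison)
  show "(\<lambda>k. 1 / real (Suc k)) \<longlonglongrightarrow> 0" using LIMSEQ_inverse_real_of_nat by (simp add: inverse_eq_divide)
qed (use step in \<open>auto intro: less_imp_le\<close>)

lemma rep_diff_quot: "rep (diff_quot h t) (\<lambda>l. iexp (- (t * l)) * symbol h l)"
proof -
  have "rep (\<lambda>\<omega>. (1 / of_real h) * (f (t + h) \<omega> + (-1) * f t \<omega>))
      (\<lambda>l. (1 / of_real h) * (iexp (- ((t + h) * l)) + (-1) * iexp (- (t * l))))"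
    by (intro rep.scale rep.add rep.base)
  moreover have "(\<lambda>\<omega>. (1 / of_real h) * (f (t + h) \<omega> + (-1) * f t \<omega>)) = diff_quot h t"
    by (simp add: diff_quot_def fun_eq_iff)
  moreover have "(1 / of_real h) * (iexp (- ((t + h) * l)) + (-1) * iexp (- (t * l))) = iexp (- (t * l)) * symbol h l" for l
  proof -
    have "iexp (- ((t + h) * l)) = iexp (- (t * l)) * iexp (- (h * l))" by (simp add: mult_exp_exp algebra_simps)
    then show ?thesis by (simp only: symbol_def) (simp add: algebra_simps diff_divide_distrib)
  qed
  ultimately show ?thesis by (simp only:)
qed

lemma diff_quot_diff_square:
  "(\<integral>\<^sup>+ \<omega>. ennreal ((cmod (diff_quot h t \<omega> - diff_quot k t \<omega>))\<^sup>2) \<partial>M) \<le> ennreal (2 * symbol_error h + 2 * symbol_error k)"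
proof -
  have r: "rep (\<lambda>\<omega>. diff_quot h t \<omega> + (-1) * diff_quot k t \<omega>)
      (\<lambda>l. iexp (- (t * l)) * symbol h l + (-1) * (iexp (- (t * l)) * symbol k l))"
    by (intro rep.add rep.scale rep_diff_quot)
  have eq: "(cmod (iexp (- (t * l)) * symbol h l + (-1) * (iexp (- (t * l)) * symbol k l)))\<^sup>2 =
      (cmod ((symbol h l + \<i> * of_real l) + - (symbol k l + \<i> * of_real l)))\<^sup>2" for l
  proof -
    have "iexp (- (t * l)) * symbol h l + (-1) * (iexp (- (t * l)) * symbol k l) =
        iexp (- (t * l)) * ((symbol h l + \<i> * of_real l) + - (symbol k l + \<i> * of_real l))"
      by (simp add: algebra_simps)
    then show ?thesis by (simp only: norm_mult) simp
  qed
  have "(\<integral>\<^sup>+ \<omega>. ennreal ((cmod (diff_quot h t \<omega> - diff_quot k t \<omega>))\<^sup>2) \<partial>M) =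
      ennreal (LINT \<omega>|M. (cmod (diff_quot h t \<omega> + (-1) * diff_quot k t \<omega>))\<^sup>2)"
    using rep_square_integrable[OF r] by (subst nn_integral_eq_integral[symmetric]) simp_all
  also have "(LINT \<omega>|M. (cmod (diff_quot h t \<omega> + (-1) * diff_quot k t \<omega>))\<^sup>2) =
      (LINT l|\<rho>. (cmod ((symbol h l + \<i> * of_real l) + - (symbol k l + \<i> * of_real l)))\<^sup>2)"
    unfolding rep_square[OF r] eq ..
  also have "\<dots> \<le> 2 * (LINT l|\<rho>. (cmod (symbol h l + \<i> * of_real l))\<^sup>2) + 2 * (LINT l|\<rho>. (cmod (- (symbol k l + \<i> * of_real l)))\<^sup>2)"
    using symbol_error_integrable[of h] symbol_error_integrable[of k]
    by (intro square_integrable_add(2)) (simp_all only: norm_minus_cancel, measurable)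
  also have "\<dots> = 2 * symbol_error h + 2 * symbol_error k"
    by (simp only: norm_minus_cancel symbol_error_def)
  finally show ?thesis by (simp only: ennreal_leI)
qed

text \<open>Where the sequence diverges \<open>lim\<close> is still some value, so \<open>G\<close>
  is total and jointly measurable; it is a genuine limit almost surely at each fixed time.\<close>

definition G :: "real \<Rightarrow> 'a \<Rightarrow> complex" where
  "G t \<omega> = lim (\<lambda>k. diff_quot (step k) t \<omega>)"

lemma G_joint [measurable]: "(\<lambda>p. G (fst p) (snd p)) \<in> borel_measurable (borel \<Otimes>\<^sub>M M)"
  unfolding G_def by measurable

lemma G_measurable [measurable]: "G t \<in> borel_measurable M"
  unfolding G_def by measurable

text \<open>The mean squares of successive differences \<open>d\<close> remain summable after
  weighting by \<open>2 ^ k\<close>, and \<open>|d| \<le> (1/2) ^ k + 2 ^ k * |d|^2\<close> then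
  makes the differences themselves absolutely summable.\<close>

lemma AE_diff_quot_tendsto: "AE \<omega> in M. (\<lambda>k. diff_quot (step k) t \<omega>) \<longlonglongrightarrow> G t \<omega>"
proof -
  let ?d = "\<lambda>k \<omega>. (cmod (diff_quot (step (Suc k)) t \<omega> - diff_quot (step k) t \<omega>))\<^sup>2"
  have "AE \<omega> in M. (\<Sum>k. ennreal (2 ^ k) * ennreal (?d k \<omega>)) \<noteq> \<infinity>"
  proof (rule AE_suminf_finite)
    fix k
    have "(\<integral>\<^sup>+ \<omega>. ennreal (2 ^ k) * ennreal (?d k \<omega>) \<partial>M) = ennreal (2 ^ k) * (\<integral>\<^sup>+ \<omega>. ennreal (?d k \<omega>) \<partial>M)"
      by (rule nn_integral_cmult) measurable
    also have "\<dots> \<le> ennreal (2 ^ k) * ennreal (2 * symbol_error (step (Suc k)) + 2 * symbol_error (step k))"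
      by (intro mult_left_mono diff_quot_diff_square) simp
    also have "\<dots> \<le> ennreal (2 ^ k) * ennreal (4 * (1/4) ^ k)"
    proof (intro mult_left_mono ennreal_leI)
      have "symbol_error (step (Suc k)) \<le> (1/4) ^ Suc k" by (rule step)
      also have "\<dots> \<le> (1/4) ^ k" by simp
      finally show "2 * symbol_error (step (Suc k)) + 2 * symbol_error (step k) \<le> 4 * (1/4) ^ k"
        using step(3)[of k] by linarith
    qed simp
    also have "\<dots> = ennreal (4 * (1/2) ^ k)"
    proof -
      have "(2::real) ^ k * (4 * (1/4) ^ k) = 4 * (2 * (1/4)) ^ k" by (simp only: power_mult_distrib mult.left_commute)
      then show ?thesis by (subst ennreal_mult'[symmetric]) simp_all
    qed
    finally show "(\<integral>\<^sup>+ \<omega>. ennreal (2 ^ k) * ennreal (?d k \<omega>) \<partial>M) \<le> ennreal (4 * (1/2) ^ k)" .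
  next
    show "(\<Sum>k. ennreal (4 * (1/2) ^ k)) < \<infinity>" by (rule suminf_power_quarter) simp
  qed measurable
  then show ?thesis
  proof eventually_elim
    fix \<omega> assume fin: "(\<Sum>k. ennreal (2 ^ k) * ennreal (?d k \<omega>)) \<noteq> \<infinity>"
    have "summable (\<lambda>k. 2 ^ k * ?d k \<omega>)"
    proof (rule summable_suminf_not_top)
      have "ennreal (2 ^ k * ?d k \<omega>) = ennreal (2 ^ k) * ennreal (?d k \<omega>)" for k by (rule ennreal_mult) auto
      then show "(\<Sum>k. ennreal (2 ^ k * ?d k \<omega>)) \<noteq> top" using fin by (simp only: infinity_ennreal_def not_False_eq_True)
    qed simp
    then have "summable (\<lambda>k. (1/2) ^ k + 2 ^ k * ?d k \<omega>)"
      by (intro summable_add summable_geometric) simp_all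
    then have "summable (\<lambda>k. cmod (diff_quot (step (Suc k)) t \<omega> - diff_quot (step k) t \<omega>))"
    proof (rule summable_comparison_test'[where N=0])
      fix k :: nat
      have "cmod (diff_quot (step (Suc k)) t \<omega> - diff_quot (step k) t \<omega>) \<le> (1/2) ^ k + ?d k \<omega> / (1/2) ^ k"
        by (rule le_add_weighted_square) simp
      then show "norm (cmod (diff_quot (step (Suc k)) t \<omega> - diff_quot (step k) t \<omega>)) \<le> (1/2) ^ k + 2 ^ k * ?d k \<omega>"
        by (simp add: power_one_over mult.commute)
    qed
    then have "summable (\<lambda>k. diff_quot (step (Suc k)) t \<omega> - diff_quot (step k) t \<omega>)" by (rule summable_norm_cancel)
    from summable_LIMSEQ[OF this]
    have "(\<lambda>n. diff_quot (step n) t \<omega> - diff_quot (step 0) t \<omega>) \<longlonglongrightarrow> (\<Sum>k. diff_quot (step (Suc k)) t \<omega> - diff_quot (step k) t \<omega>)"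
      unfolding sum_lessThan_telescope[of "\<lambda>n. diff_quot (step n) t \<omega>"] .
    from tendsto_add[OF this tendsto_const[of "diff_quot (step 0) t \<omega>"]]
    have "(\<lambda>n. diff_quot (step n) t \<omega>) \<longlonglongrightarrow> (\<Sum>k. diff_quot (step (Suc k)) t \<omega> - diff_quot (step k) t \<omega>) + diff_quot (step 0) t \<omega>"
      by simp
    then show "(\<lambda>k. diff_quot (step k) t \<omega>) \<longlonglongrightarrow> G t \<omega>" unfolding G_def by (simp add: limI)
  qed
qed

text \<open>Fatou's lemma: the bound of \<open>diff_quot_diff_square\<close>, uniform over later
  indices \<open>m \<ge> n\<close>, is inherited by the almost sure limit.\<close>

lemma diff_quot_G_square:
  "(\<integral>\<^sup>+ \<omega>. ennreal ((cmod (diff_quot (step n) t \<omega> - G t \<omega>))\<^sup>2) \<partial>M) \<le> ennreal (4 * (1/4) ^ n)"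
proof -
  let ?u = "\<lambda>m \<omega>. ennreal ((cmod (diff_quot (step n) t \<omega> - diff_quot (step m) t \<omega>))\<^sup>2)"
  have "(\<integral>\<^sup>+ \<omega>. ennreal ((cmod (diff_quot (step n) t \<omega> - G t \<omega>))\<^sup>2) \<partial>M) = (\<integral>\<^sup>+ \<omega>. liminf (\<lambda>m. ?u m \<omega>) \<partial>M)"
  proof (rule nn_integral_cong_AE)
    show "AE \<omega> in M. ennreal ((cmod (diff_quot (step n) t \<omega> - G t \<omega>))\<^sup>2) = liminf (\<lambda>m. ?u m \<omega>)"
      using AE_diff_quot_tendsto[of t]
    proof eventually_elim
      fix \<omega> assume "(\<lambda>k. diff_quot (step k) t \<omega>) \<longlonglongrightarrow> G t \<omega>"
      then have "(\<lambda>m. ?u m \<omega>) \<longlonglongrightarrow> ennreal ((cmod (diff_quot (step n) t \<omega> - G t \<omega>))\<^sup>2)"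
        by (intro tendsto_ennrealI tendsto_intros)
      from lim_imp_Liminf[OF _ this] show "ennreal ((cmod (diff_quot (step n) t \<omega> - G t \<omega>))\<^sup>2) = liminf (\<lambda>m. ?u m \<omega>)" by simp
    qed
  qed
  also have "\<dots> \<le> liminf (\<lambda>m. \<integral>\<^sup>+ \<omega>. ?u m \<omega> \<partial>M)" by (rule nn_integral_liminf) measurable
  also have "\<dots> \<le> liminf (\<lambda>m. ennreal (4 * (1/4) ^ n))"
  proof (rule Liminf_mono)
    show "eventually (\<lambda>m. (\<integral>\<^sup>+ \<omega>. ?u m \<omega> \<partial>M) \<le> ennreal (4 * (1/4) ^ n)) sequentially"
      using eventually_ge_at_top[of n]
    proof eventually_elim
      fix m assume m: "n \<le> m"
      have "symbol_error (step m) \<le> (1/4) ^ m" by (rule step)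
      also have "\<dots> \<le> (1/4) ^ n" using m by (intro power_decreasing) auto
      finally have "2 * symbol_error (step n) + 2 * symbol_error (step m) \<le> 4 * (1/4) ^ n"
        using step(3)[of n] by linarith
      then show "(\<integral>\<^sup>+ \<omega>. ?u m \<omega> \<partial>M) \<le> ennreal (4 * (1/4) ^ n)"
        by (intro order_trans[OF diff_quot_diff_square] ennreal_leI)
    qed
  qed
  also have "\<dots> = ennreal (4 * (1/4) ^ n)" by (rule Liminf_const) simp
  finally show ?thesis .
qed

lemma rep_limit_f: "rep_limit (f t) (\<lambda>l. iexp (- (t * l)))"
  by (rule rep_imp_rep_limit[OF rep.base])

text \<open>The difference quotients along \<open>step\<close> converge on both sides of the
  isometry at once: to \<open>G t\<close> in mean square, and their symbols to the multiplier of
  differentiation in the mean square of \<rho>.\<close>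

lemma rep_limit_G: "rep_limit (G t) (\<lambda>l. - (\<i> * of_real l) * iexp (- (t * l)))"
  unfolding rep_limit_def
proof (intro conjI exI[of _ "\<lambda>k. diff_quot (step k) t"] exI[of _ "\<lambda>k l. iexp (- (t * l)) * symbol (step k) l"] allI)
  have nn: "(\<integral>\<^sup>+ \<omega>. ennreal ((cmod (diff_quot (step k) t \<omega> - G t \<omega>))\<^sup>2) \<partial>M) < \<infinity>" for k
    using diff_quot_G_square[of k t] by (rule order_le_less_trans) simp
  show int: "integrable M (\<lambda>\<omega>. (cmod (diff_quot (step k) t \<omega> - G t \<omega>))\<^sup>2)" for k
    using nn[of k] by (intro integrableI_nonneg) auto
  have le: "(LINT \<omega>|M. (cmod (diff_quot (step k) t \<omega> - G t \<omega>))\<^sup>2) \<le> 4 * (1/4) ^ k" for k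
    using diff_quot_G_square[of k t] int[of k] by (subst (asm) nn_integral_eq_integral) auto
  have lim4: "(\<lambda>k. 4 * (1/4) ^ k :: real) \<longlonglongrightarrow> 0"
    using tendsto_mult_left[OF LIMSEQ_power_zero[of "1/4::real"], of 4] by simp
  show "(\<lambda>k. LINT \<omega>|M. (cmod (diff_quot (step k) t \<omega> - G t \<omega>))\<^sup>2) \<longlonglongrightarrow> 0"
    by (rule null_sequence_comparison[OF _ le lim4]) simp
  have eq: "(cmod (iexp (- (t * l)) * symbol h l - - (\<i> * of_real l) * iexp (- (t * l))))\<^sup>2 = (cmod (symbol h l + \<i> * of_real l))\<^sup>2" for l h
  proof -
    have "iexp (- (t * l)) * symbol h l - - (\<i> * of_real l) * iexp (- (t * l)) = iexp (- (t * l)) * (symbol h l + \<i> * of_real l)"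
      by (simp add: algebra_simps)
    then show ?thesis by (simp only: norm_mult) simp
  qed
  show "integrable \<rho> (\<lambda>l. (cmod (iexp (- (t * l)) * symbol (step k) l - - (\<i> * of_real l) * iexp (- (t * l))))\<^sup>2)" for k
    unfolding eq by (rule symbol_error_integrable)
  have lim1: "(\<lambda>k. (1/4) ^ k :: real) \<longlonglongrightarrow> 0" by (rule LIMSEQ_power_zero) simp
  show "(\<lambda>k. LINT l|\<rho>. (cmod (iexp (- (t * l)) * symbol (step k) l - - (\<i> * of_real l) * iexp (- (t * l))))\<^sup>2) \<longlonglongrightarrow> 0"
    unfolding eq symbol_error_def[symmetric]
    by (rule null_sequence_comparison[OF _ step(3) lim1]) (simp add: symbol_error_def)
  show "rep (diff_quot (step k) t) (\<lambda>l. iexp (- (t * l)) * symbol (step k) l)" for k by (rule rep_diff_quot)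
qed auto

lemma G_increment:
  assumes "\<bar>s\<bar> \<le> (1/2) ^ n"
  shows "(\<integral>\<^sup>+ \<omega>. ennreal ((cmod (G (t + s) \<omega> - G t \<omega>))\<^sup>2) \<partial>M) \<le> S.increment_bound n"
proof -
  have r: "rep_limit (\<lambda>\<omega>. G (t + s) \<omega> + (-1) * G t \<omega>)
      (\<lambda>l. - (\<i> * of_real l) * iexp (- ((t + s) * l)) + (-1) * (- (\<i> * of_real l) * iexp (- (t * l))))"
    by (intro rep_limit_add rep_limit_scale rep_limit_G)
  have eq: "(cmod (- (\<i> * of_real l) * iexp (- ((t + s) * l)) + (-1) * (- (\<i> * of_real l) * iexp (- (t * l)))))\<^sup>2 =
      l\<^sup>2 * (cmod (iexp (- (s * l)) - 1))\<^sup>2" for l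
  proof -
    have "iexp (- ((t + s) * l)) = iexp (- (t * l)) * iexp (- (s * l))" by (simp add: mult_exp_exp algebra_simps)
    then have "- (\<i> * of_real l) * iexp (- ((t + s) * l)) + (-1) * (- (\<i> * of_real l) * iexp (- (t * l))) =
        - \<i> * of_real l * iexp (- (t * l)) * (iexp (- (s * l)) - 1)"
      by (simp only:) (simp add: algebra_simps)
    then show ?thesis by (simp only: norm_mult) (simp add: power_mult_distrib)
  qed
  have "(\<integral>\<^sup>+ \<omega>. ennreal ((cmod (G (t + s) \<omega> - G t \<omega>))\<^sup>2) \<partial>M) =
      ennreal (LINT \<omega>|M. (cmod (G (t + s) \<omega> + (-1) * G t \<omega>))\<^sup>2)"
    using rep_limit_square(3)[OF r] by (subst nn_integral_eq_integral[symmetric]) simp_all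
  also have "\<dots> = ennreal (LINT l|\<rho>. l\<^sup>2 * (cmod (iexp (- (s * l)) - 1))\<^sup>2)"
    unfolding rep_limit_square(2)[OF r] eq ..
  also have "\<dots> = (\<integral>\<^sup>+ l. ennreal (l\<^sup>2 * (cmod (iexp (- (s * l)) - 1))\<^sup>2) \<partial>\<rho>)"
    using rep_limit_square(4)[OF r] unfolding eq by (subst nn_integral_eq_integral) simp_all
  also have "\<dots> \<le> S.increment_bound n" by (rule S.increment_bound[OF assms])
  finally show ?thesis .
qed

lemma path_measurable:
  assumes "(\<lambda>p. X (fst p) (snd p)) \<in> borel_measurable (borel \<Otimes>\<^sub>M M)" "\<omega> \<in> space M"
  shows "(\<lambda>t. X t \<omega>) \<in> borel_measurable borel"
proof -
  have "(\<lambda>t. (t, \<omega>)) \<in> borel \<rightarrow>\<^sub>M borel \<Otimes>\<^sub>M M" using assms(2) by simp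
  from measurable_compose[OF this assms(1)] show ?thesis by simp
qed

lemma measurable_inner_nn_integral:
  assumes "(\<lambda>(s, \<omega>). F s \<omega>) \<in> borel_measurable (lborel \<Otimes>\<^sub>M M)"
  shows "(\<lambda>\<omega>. \<integral>\<^sup>+ s. F s \<omega> \<partial>lborel) \<in> borel_measurable M"
proof (rule lborel.borel_measurable_nn_integral)
  show "(\<lambda>(\<omega>, s). F s \<omega>) \<in> borel_measurable (M \<Otimes>\<^sub>M lborel)"
    using assms by (subst measurable_pair_swap_iff) (simp add: split_beta')
qed

text \<open>At fixed \<open>t\<close> both limits required by
  \<open>derivative_from_averages\<close> are deduced from random series with summable means. The
  averages profit from the rate of \<open>step\<close>, the oscillations from
  \<open>increment_bound_summable\<close>.\<close>

lemma AE_has_derivative: "AE \<omega> in M. ((\<lambda>t. f t \<omega>) has_vector_derivative G t \<omega>) (at t)"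
proof -
  interpret P: pair_sigma_finite lborel M ..
  let ?I = "{t - 1..t + 1}"
  let ?J = "\<lambda>n::nat. {t - (1/2) ^ n..t + (1/2) ^ n}"
  \<comment> \<open>The weight \<open>2 ^ k\<close> lets \<open>v\<close> control the first power of
    the error up to \<open>2 * (1/2) ^ k\<close>. In \<open>w\<close> the factor
    \<open>2 ^ n\<close> compensates the interval length \<open>2 * (1/2) ^ n\<close>, so its mean
    is at most \<open>2 * S.increment_bound n\<close>.\<close>
  define v where "v k \<omega> = (\<integral>\<^sup>+ s. ennreal (2 ^ k) * (ennreal ((cmod (diff_quot (step k) s \<omega> - G s \<omega>))\<^sup>2) * indicator ?I s) \<partial>lborel)" for k \<omega>
  define w where "w n \<omega> = ennreal (2 ^ n) * (\<integral>\<^sup>+ s. ennreal ((cmod (G s \<omega> - G t \<omega>))\<^sup>2) * indicator (?J n) s \<partial>lborel)" for n \<omega>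
  have mv: "(\<lambda>(s, \<omega>). ennreal (2 ^ k) * (ennreal ((cmod (diff_quot (step k) s \<omega> - G s \<omega>))\<^sup>2) * indicator ?I s)) \<in> borel_measurable (lborel \<Otimes>\<^sub>M M)" for k
    unfolding split_beta by measurable
  have mw: "(\<lambda>(s, \<omega>). ennreal ((cmod (G s \<omega> - G t \<omega>))\<^sup>2) * indicator (?J n) s) \<in> borel_measurable (lborel \<Otimes>\<^sub>M M)" for n
    unfolding split_beta by measurable
  have v_m [measurable]: "v k \<in> borel_measurable M" for k
    unfolding v_def by (rule measurable_inner_nn_integral[OF mv])
  have w_m [measurable]: "w n \<in> borel_measurable M" for n
    unfolding w_def by (intro borel_measurable_times_ennreal borel_measurable_const measurable_inner_nn_integral[OF mw])
  have "AE \<omega> in M. (\<Sum>k. v k \<omega>) \<noteq> \<infinity>"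
  proof (rule AE_suminf_finite)
    fix k
    have "(\<integral>\<^sup>+ \<omega>. v k \<omega> \<partial>M) = (\<integral>\<^sup>+ s. \<integral>\<^sup>+ \<omega>. ennreal (2 ^ k) * (ennreal ((cmod (diff_quot (step k) s \<omega> - G s \<omega>))\<^sup>2) * indicator ?I s) \<partial>M \<partial>lborel)"
      unfolding v_def by (rule P.Fubini'[OF mv])
    also have "\<dots> = (\<integral>\<^sup>+ s. ennreal (2 ^ k) * (\<integral>\<^sup>+ \<omega>. ennreal ((cmod (diff_quot (step k) s \<omega> - G s \<omega>))\<^sup>2) \<partial>M) * indicator ?I s \<partial>lborel)"
      by (intro nn_integral_cong) (simp add: nn_integral_cmult nn_integral_multc mult.assoc)
    also have "\<dots> \<le> (\<integral>\<^sup>+ s. ennreal (2 ^ k) * ennreal (4 * (1/4) ^ k) * indicator ?I s \<partial>lborel)"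
      by (intro nn_integral_mono mult_right_mono mult_left_mono diff_quot_G_square) simp_all
    also have "\<dots> = ennreal (2 ^ k) * ennreal (4 * (1/4) ^ k) * 2"
      by (simp add: nn_integral_cmult_indicator)
    also have "\<dots> = ennreal (8 * (1/2) ^ k)"
    proof -
      have "(2::real) ^ k * (4 * (1/4) ^ k) * 2 = 8 * (2 * (1/4)) ^ k" by (simp only: power_mult_distrib)
      then have "ennreal (8 * (1/2) ^ k) = ennreal (2 ^ k * (4 * (1/4) ^ k) * 2)" by simp
      also have "\<dots> = ennreal (2 ^ k * (4 * (1/4) ^ k)) * ennreal 2" by (rule ennreal_mult'') simp
      also have "ennreal (2 ^ k * (4 * (1/4) ^ k)) = ennreal (2 ^ k) * ennreal (4 * (1/4) ^ k)" by (rule ennreal_mult'') simp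
      finally show ?thesis by (simp only: ennreal_numeral zero_le_numeral)
    qed
    finally show "(\<integral>\<^sup>+ \<omega>. v k \<omega> \<partial>M) \<le> ennreal (8 * (1/2) ^ k)" .
  next
    show "(\<Sum>k. ennreal (8 * (1/2) ^ k)) < \<infinity>" by (rule suminf_power_quarter) simp
  qed measurable
  moreover have "AE \<omega> in M. (\<Sum>n. w n \<omega>) \<noteq> \<infinity>"
  proof (rule AE_suminf_finite)
    fix n
    define X where "X = (\<integral>\<^sup>+ \<omega>. \<integral>\<^sup>+ s. ennreal ((cmod (G s \<omega> - G t \<omega>))\<^sup>2) * indicator (?J n) s \<partial>lborel \<partial>M)"
    have w_eq: "(\<integral>\<^sup>+ \<omega>. w n \<omega> \<partial>M) = ennreal (2 ^ n) * X"
      unfolding w_def X_def by (rule nn_integral_cmult[OF measurable_inner_nn_integral[OF mw]])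
    have X_eq: "X = (\<integral>\<^sup>+ s. \<integral>\<^sup>+ \<omega>. ennreal ((cmod (G s \<omega> - G t \<omega>))\<^sup>2) * indicator (?J n) s \<partial>M \<partial>lborel)"
      unfolding X_def by (rule P.Fubini'[OF mw])
    have "X \<le> (\<integral>\<^sup>+ s. S.increment_bound n * indicator (?J n) s \<partial>lborel)"
      unfolding X_eq
    proof (rule nn_integral_mono)
      fix s
      show "(\<integral>\<^sup>+ \<omega>. ennreal ((cmod (G s \<omega> - G t \<omega>))\<^sup>2) * indicator (?J n) s \<partial>M) \<le> S.increment_bound n * indicator (?J n) s"
      proof (cases "s \<in> ?J n")
        case True
        then have "\<bar>s - t\<bar> \<le> (1/2) ^ n" by (auto simp: abs_le_iff)
        from G_increment[OF this, of t] show ?thesis using True by simp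
      qed simp
    qed
    moreover have "(\<integral>\<^sup>+ s. S.increment_bound n * indicator (?J n) s \<partial>lborel) = S.increment_bound n * emeasure lborel (?J n)"
      by (rule nn_integral_cmult_indicator) simp
    moreover have "emeasure lborel (?J n) = ennreal (2 * (1/2) ^ n)" by simp
    ultimately have X_le: "X \<le> S.increment_bound n * ennreal (2 * (1/2) ^ n)" by (simp only:)
    have two: "ennreal (2 ^ n) * ennreal (2 * (1/2) ^ n) = 2"
    proof -
      have "(2::real) ^ n * (2 * (1/2) ^ n) = 2" by (simp add: power_one_over)
      moreover have "ennreal (2 ^ n * (2 * (1/2) ^ n)) = ennreal (2 ^ n) * ennreal (2 * (1/2) ^ n)"
        by (rule ennreal_mult'') simp
      ultimately show ?thesis by (simp only: ennreal_numeral zero_le_numeral)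
    qed
    have "ennreal (2 ^ n) * X \<le> ennreal (2 ^ n) * (S.increment_bound n * ennreal (2 * (1/2) ^ n))"
      by (rule mult_left_mono[OF X_le]) simp
    moreover have "ennreal (2 ^ n) * (S.increment_bound n * ennreal (2 * (1/2) ^ n)) =
        (ennreal (2 ^ n) * ennreal (2 * (1/2) ^ n)) * S.increment_bound n"
      by (simp only: mult.assoc mult.commute[of "S.increment_bound n"])
    ultimately show "(\<integral>\<^sup>+ \<omega>. w n \<omega> \<partial>M) \<le> 2 * S.increment_bound n"
      unfolding w_eq two by (simp only:)
  next
    show "(\<Sum>n. 2 * S.increment_bound n) < \<infinity>"
      using S.increment_bound_summable by (simp add: ennreal_mult_less_top)
  qed simp
  moreover have "AE \<omega> in M. \<omega> \<in> space M" by (rule AE_space)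
  ultimately show ?thesis
  proof eventually_elim
    fix \<omega> assume v: "(\<Sum>k. v k \<omega>) \<noteq> \<infinity>" and w: "(\<Sum>n. w n \<omega>) \<noteq> \<infinity>" and \<omega>: "\<omega> \<in> space M"
    note [measurable] = path_measurable[OF G_joint \<omega>] path_measurable[OF diff_quot_joint \<omega>]
    have v0: "(\<lambda>k. v k \<omega>) \<longlonglongrightarrow> 0" by (rule ennreal_suminf_tendsto_0[OF v])
    have w0: "(\<lambda>n. w n \<omega>) \<longlonglongrightarrow> 0" by (rule ennreal_suminf_tendsto_0[OF w])
    let ?u = "\<lambda>k. \<integral>\<^sup>+ s. ennreal (cmod (diff_quot (step k) s \<omega> - G s \<omega>)) * indicator ?I s \<partial>lborel"
    have ule: "?u k \<le> ennreal (2 * (1/2) ^ k) + v k \<omega>" for k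
    proof -
      have "?u k \<le> (\<integral>\<^sup>+ s. ennreal ((1/2) ^ k) * indicator ?I s + ennreal (2 ^ k) * (ennreal ((cmod (diff_quot (step k) s \<omega> - G s \<omega>))\<^sup>2) * indicator ?I s) \<partial>lborel)"
      proof (rule nn_integral_mono)
        fix s
        let ?x = "cmod (diff_quot (step k) s \<omega> - G s \<omega>)"
        have "?x \<le> (1/2) ^ k + ?x\<^sup>2 / (1/2) ^ k" by (rule le_add_weighted_square) simp
        then have "?x \<le> (1/2) ^ k + 2 ^ k * ?x\<^sup>2" by (simp add: power_one_over mult.commute)
        then have "ennreal ?x \<le> ennreal ((1/2) ^ k) + ennreal (2 ^ k) * ennreal (?x\<^sup>2)"
          by (simp add: ennreal_mult'[symmetric] ennreal_plus[symmetric] ennreal_leI del: ennreal_plus)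
        then show "ennreal ?x * indicator ?I s \<le> ennreal ((1/2) ^ k) * indicator ?I s + ennreal (2 ^ k) * (ennreal (?x\<^sup>2) * indicator ?I s)"
          by (simp add: indicator_def)
      qed
      also have "\<dots> = (\<integral>\<^sup>+ s. ennreal ((1/2) ^ k) * indicator ?I s \<partial>lborel) + v k \<omega>"
        unfolding v_def by (rule nn_integral_add) measurable
      also have "(\<integral>\<^sup>+ s. ennreal ((1/2) ^ k) * indicator ?I s \<partial>lborel) = ennreal (2 * (1/2) ^ k)"
        by (subst nn_integral_cmult_indicator) (auto simp: ennreal_mult'[symmetric] mult.commute simp flip: ennreal_numeral)
      finally show ?thesis .
    qed
    have "(\<lambda>k. ennreal (2 * (1/2) ^ k)) \<longlonglongrightarrow> ennreal (2 * 0)"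
      by (intro tendsto_ennrealI tendsto_mult tendsto_const LIMSEQ_power_zero) simp
    from tendsto_add[OF this v0]
    have "(\<lambda>k. ennreal (2 * (1/2) ^ k) + v k \<omega>) \<longlonglongrightarrow> 0" by simp
    from tendsto_sandwich[OF _ _ tendsto_const this] ule have u0: "?u \<longlonglongrightarrow> 0" by simp
    show "((\<lambda>t. f t \<omega>) has_vector_derivative G t \<omega>) (at t)"
      by (rule derivative_from_averages[where hk=step and D="\<lambda>s. G s \<omega>"])
        (use f_continuous step_tendsto step(1) u0 w0 in \<open>auto simp: diff_quot_def w_def\<close>)
  qed
qed

text \<open>The exceptional event of \<open>AE_has_derivative\<close> depends on the time. Fubini
  exchanges the quantifiers, and this is what the joint measurability of
  \<open>vector_derivative\<close> is for.\<close>

lemma AE_path_derivative: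
  "AE \<omega> in M. AE t in lborel. vector_derivative (\<lambda>t. f t \<omega>) (at t) = G t \<omega>"
proof -
  interpret P: pair_sigma_finite lborel M ..
  have m: "(\<lambda>p. vector_derivative (\<lambda>t. f t (snd p)) (at (fst p))) \<in> borel_measurable (lborel \<Otimes>\<^sub>M M)"
    using measurable_vector_derivative_process[OF f_measurable f_continuous] by simp
  have "AE t in lborel. AE \<omega> in M. vector_derivative (\<lambda>t. f t \<omega>) (at t) = G t \<omega>"
  proof (rule AE_I2)
    fix t
    show "AE \<omega> in M. vector_derivative (\<lambda>t. f t \<omega>) (at t) = G t \<omega>"
      using AE_has_derivative[of t] by eventually_elim (rule vector_derivative_at)
  qed
  moreover have "{p \<in> space (lborel \<Otimes>\<^sub>M M). vector_derivative (\<lambda>t. f t (snd p)) (at (fst p)) = G (fst p) (snd p)} \<in> sets (lborel \<Otimes>\<^sub>M M)"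
    using m by measurable
  ultimately show ?thesis
    using P.AE_commute[of "\<lambda>t \<omega>. vector_derivative (\<lambda>t. f t \<omega>) (at t) = G t \<omega>"] by simp
qed

end

section \<open>Moments of the integral of a stationary process\<close>

text \<open>Origin of the factor \<open>T - |x|\<close>: the overlap of \<open>{0..T}\<close> with
  its translate by \<open>x\<close>.\<close>

lemma integral_two_indicators:
  fixes T x :: real
  assumes "T > 0"
  shows "integrable lborel (\<lambda>s. indicator {0..T} s * indicator {0..T} (s - x) :: real)"
    "(LINT s|lborel. indicator {0..T} s * indicator {0..T} (s - x)) = indicator {-T..T} x * (T - \<bar>x\<bar>)"
proof -
  have eq: "(\<lambda>s. indicator {0..T} s * indicator {0..T} (s - x) :: real) = indicator {max 0 x..min T (T + x)}"
    by (auto simp: indicator_def fun_eq_iff)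
  show "integrable lborel (\<lambda>s. indicator {0..T} s * indicator {0..T} (s - x) :: real)"
    unfolding eq by (rule integrable_real_indicator) (simp_all add: emeasure_lborel_Icc_eq)
  have "measure lborel {max 0 x..min T (T + x)} = indicator {-T..T} x * (T - \<bar>x\<bar>)"
  proof (cases "max 0 x \<le> min T (T + x)")
    case True
    then have "measure lborel {max 0 x..min T (T + x)} = min T (T + x) - max 0 x" by (rule measure_lborel_Icc)
    moreover have "min T (T + x) - max 0 x = T - \<bar>x\<bar>" by linarith
    moreover have "x \<in> {-T..T}" using True by auto
    ultimately show ?thesis by simp
  next
    case False
    then have "x \<notin> {-T..T}" using assms by auto
    then show ?thesis using False by simp
  qed
  then show "(LINT s|lborel. indicator {0..T} s * indicator {0..T} (s - x)) = indicator {-T..T} x * (T - \<bar>x\<bar>)"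
    unfolding eq by simp
qed

text \<open>In the coordinates \<open>(x, s)\<close> with \<open>x = s - t\<close> the variable
  \<open>s\<close> enters only through the two indicators, and integrating it out leaves their
  overlap.\<close>

lemma integral_difference_kernel:
  fixes k :: "real \<Rightarrow> real"
  assumes T: "T > 0" and [measurable]: "k \<in> borel_measurable borel"
    and k: "set_integrable lborel {-T..T} k"
  shows "integrable (lborel \<Otimes>\<^sub>M lborel) (\<lambda>p. indicator {0..T} (fst p) * indicator {0..T} (snd p) * k (fst p - snd p))"
    "(LINT p|(lborel \<Otimes>\<^sub>M lborel). indicator {0..T} (fst p) * indicator {0..T} (snd p) * k (fst p - snd p)) =
      (LINT x:{-T..T}|lborel. (T - \<bar>x\<bar>) * k x)"
proof -
  let ?f = "\<lambda>p::real \<times> real. indicator {0..T} (fst p) * indicator {0..T} (snd p) * k (fst p - snd p)"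
  let ?h = "\<lambda>p::real \<times> real. indicator {0..T} (snd p) * indicator {0..T} (snd p - fst p) * k (fst p)"
  have kabs: "integrable lborel (\<lambda>x. indicator {-T..T} x * \<bar>k x\<bar>)"
    using integrable_norm[OF k[unfolded set_integrable_def]] by (simp add: abs_mult)
  have h: "integrable (lborel \<Otimes>\<^sub>M lborel) ?h"
  proof (rule lborel_pair.Fubini_integrable)
    show "?h \<in> borel_measurable (lborel \<Otimes>\<^sub>M lborel)" by measurable
    have eq: "(LINT s|lborel. norm (?h (x, s))) = indicator {-T..T} x * (T - \<bar>x\<bar>) * \<bar>k x\<bar>" for x
    proof -
      have "(LINT s|lborel. norm (?h (x, s))) = (LINT s|lborel. (indicator {0..T} s * indicator {0..T} (s - x)) * \<bar>k x\<bar>)"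
        by (simp add: abs_mult)
      also have "\<dots> = (LINT s|lborel. (indicator {0..T} s * indicator {0..T} (s - x))) * \<bar>k x\<bar>"
        by (rule integral_mult_left_zero)
      finally show ?thesis by (simp only: integral_two_indicators(2)[OF T])
    qed
    show "integrable lborel (\<lambda>x. LINT s|lborel. norm (?h (x, s)))"
      unfolding eq
    proof (rule Bochner_Integration.integrable_bound)
      show "integrable lborel (\<lambda>x. T * (indicator {-T..T} x * \<bar>k x\<bar>))" using kabs by (rule integrable_mult_right)
      have "\<bar>T - \<bar>x\<bar>\<bar> * \<bar>k x\<bar> \<le> T * \<bar>k x\<bar>" if "x \<in> {-T..T}" for x
        using that by (intro mult_right_mono) auto
      then show "AE x in lborel. norm (indicator {-T..T} x * (T - \<bar>x\<bar>) * \<bar>k x\<bar>) \<le> norm (T * (indicator {-T..T} x * \<bar>k x\<bar>))"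
        using T by (intro AE_I2) (simp add: indicator_def abs_mult)
    qed measurable
    show "AE x in lborel. integrable lborel (\<lambda>s. ?h (x, s))"
    proof (rule AE_I2)
      fix x
      show "integrable lborel (\<lambda>s. ?h (x, s))"
        using integrable_mult_left[OF integral_two_indicators(1)[OF T, of x], of "k x"] by simp
    qed
  qed
  have h': "integrable (lborel \<Otimes>\<^sub>M lborel) (\<lambda>(s, x). ?h (x, s))"
    using lborel_pair.integrable_product_swap[OF h] by simp
  have inner: "(LINT t|lborel. ?f (s, t)) = (LINT x|lborel. ?h (x, s))" for s
    using lborel_integral_real_affine[of "-1" "\<lambda>t. ?f (s, t)" s] by simp
  have inner_norm: "(LINT t|lborel. norm (?f (s, t))) = (LINT x|lborel. norm (?h (x, s)))" for s
    using lborel_integral_real_affine[of "-1" "\<lambda>t. norm (?f (s, t))" s] by simp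
  have inner_i: "integrable lborel (\<lambda>t. ?f (s, t)) \<longleftrightarrow> integrable lborel (\<lambda>x. ?h (x, s))" for s
    using lborel_integrable_real_affine_iff[of "-1" "\<lambda>t. ?f (s, t)" s] by simp
  show f: "integrable (lborel \<Otimes>\<^sub>M lborel) ?f"
  proof (rule lborel_pair.Fubini_integrable)
    show "integrable lborel (\<lambda>s. LINT t|lborel. norm (?f (s, t)))"
      unfolding inner_norm using lborel_pair.integrable_fst'[OF integrable_norm[OF h']] by simp
    show "AE s in lborel. integrable lborel (\<lambda>t. ?f (s, t))"
      unfolding inner_i using lborel_pair.AE_integrable_fst'[OF h'] by simp
  qed measurable
  have "(LINT p|(lborel \<Otimes>\<^sub>M lborel). ?f p) = (LINT s|lborel. LINT t|lborel. ?f (s, t))"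
    by (rule lborel_pair.integral_fst'[OF f, symmetric])
  also have "\<dots> = (LINT s|lborel. LINT x|lborel. ?h (x, s))" unfolding inner ..
  also have "\<dots> = (LINT x|lborel. LINT s|lborel. ?h (x, s))"
    using lborel_pair.Fubini_integral[of "\<lambda>x s. ?h (x, s)"] h by (simp add: split_beta')
  also have "\<dots> = (LINT x|lborel. indicator {-T..T} x * (T - \<bar>x\<bar>) * k x)"
  proof -
    have "(LINT s|lborel. ?h (x, s)) = indicator {-T..T} x * (T - \<bar>x\<bar>) * k x" for x
    proof -
      have "(LINT s|lborel. ?h (x, s)) = (LINT s|lborel. (indicator {0..T} s * indicator {0..T} (s - x)) * k x)" by simp
      also have "\<dots> = (LINT s|lborel. (indicator {0..T} s * indicator {0..T} (s - x))) * k x"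
        by (rule integral_mult_left_zero)
      finally show ?thesis by (simp only: integral_two_indicators(2)[OF T])
    qed
    then show ?thesis by (simp only:)
  qed
  finally show "(LINT p|(lborel \<Otimes>\<^sub>M lborel). ?f p) = (LINT x:{-T..T}|lborel. (T - \<bar>x\<bar>) * k x)"
    by (simp add: set_lebesgue_integral_def mult.assoc)
qed

text \<open>The square of the integral is a double integral, and \<open>b\<close> dominates it so
  that expectation and integration may be exchanged. \<open>P\<close> singles out the lags at which
  the covariance is known; the remaining lags are null and pull back to a null set of pairs of
  times.\<close>

lemma process_integral_moments:
  fixes Y :: "real \<Rightarrow> 'a \<Rightarrow> real" and k b :: "real \<Rightarrow> real"
  assumes "prob_space M" and T: "T > 0"
    and Ym [measurable]: "(\<lambda>p. Y (fst p) (snd p)) \<in> borel_measurable (borel \<Otimes>\<^sub>M M)"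
    and Y: "\<And>t. integrable M (Y t)" "\<And>t. (LINT \<omega>|M. Y t \<omega>) = 0" "\<And>t. (LINT \<omega>|M. \<bar>Y t \<omega>\<bar>) \<le> c"
    and P: "AE x in lborel. P x" and [measurable]: "Measurable.pred borel P"
    and YY: "\<And>s t. P (s - t) \<Longrightarrow> integrable M (\<lambda>\<omega>. Y s \<omega> * Y t \<omega>)"
      "\<And>s t. P (s - t) \<Longrightarrow> (LINT \<omega>|M. Y s \<omega> * Y t \<omega>) = k (s - t)"
      "\<And>s t. P (s - t) \<Longrightarrow> (LINT \<omega>|M. \<bar>Y s \<omega> * Y t \<omega>\<bar>) \<le> b (s - t)"
    and [measurable]: "k \<in> borel_measurable borel" "b \<in> borel_measurable borel"
    and k: "set_integrable lborel {-T..T} k" and b: "set_integrable lborel {-T..T} b"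
  defines "Z \<equiv> \<lambda>\<omega>. LINT t:{0..T}|lborel. Y t \<omega>"
  shows "AE \<omega> in M. set_integrable lborel {0..T} (\<lambda>t. Y t \<omega>)"
    "integrable M Z" "(LINT \<omega>|M. Z \<omega>) = 0"
    "integrable M (\<lambda>\<omega>. (Z \<omega>)\<^sup>2)" "(LINT \<omega>|M. (Z \<omega>)\<^sup>2) = (LINT x:{-T..T}|lborel. (T - \<bar>x\<bar>) * k x)"
proof -
  interpret prob_space M by fact
  interpret L: pair_sigma_finite lborel M ..
  interpret Q: pair_sigma_finite "lborel \<Otimes>\<^sub>M lborel :: (real \<times> real) measure" M
    unfolding lborel_prod by (intro pair_sigma_finite.intro lborel.sigma_finite_measure_axioms sigma_finite_measure_axioms)
  let ?y = "\<lambda>p. indicator {0..T} (fst p) * Y (fst p) (snd p)"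
  have y: "integrable (lborel \<Otimes>\<^sub>M M) ?y"
  proof (rule L.Fubini_integrable)
    show "?y \<in> borel_measurable (lborel \<Otimes>\<^sub>M M)" by measurable
    have eq: "(LINT \<omega>|M. norm (?y (t, \<omega>))) = indicator {0..T} t * (LINT \<omega>|M. \<bar>Y t \<omega>\<bar>)" for t
      by (simp add: abs_mult)
    show "integrable lborel (\<lambda>t. LINT \<omega>|M. norm (?y (t, \<omega>)))"
    proof (rule Bochner_Integration.integrable_bound)
      show "integrable lborel (\<lambda>t. indicator {0..T} t * c)"
        by (intro integrable_mult_left integrable_real_indicator) (simp_all add: emeasure_lborel_Icc_eq)
      show "AE t in lborel. norm (LINT \<omega>|M. norm (?y (t, \<omega>))) \<le> norm (indicator {0..T} t * c)"
      proof (rule AE_I2)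
        fix t
        have "0 \<le> (LINT \<omega>|M. \<bar>Y t \<omega>\<bar>)" by simp
        with order_trans[OF Y(3)[of t] abs_ge_self] show "norm (LINT \<omega>|M. norm (?y (t, \<omega>))) \<le> norm (indicator {0..T} t * c)"
          unfolding eq by (simp add: indicator_def)
      qed
    qed measurable
    show "AE t in lborel. integrable M (\<lambda>\<omega>. ?y (t, \<omega>))" using Y(1) by (intro AE_I2) simp
  qed
  show "AE \<omega> in M. set_integrable lborel {0..T} (\<lambda>t. Y t \<omega>)"
    using L.AE_integrable_snd[of "\<lambda>t \<omega>. ?y (t, \<omega>)"] y by (simp add: set_integrable_def split_beta')
  have Z: "Z \<omega> = (LINT t|lborel. ?y (t, \<omega>))" for \<omega> by (simp add: Z_def set_lebesgue_integral_def)
  show "integrable M Z"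
    unfolding Z using L.integrable_snd[of "\<lambda>t \<omega>. ?y (t, \<omega>)"] y by (simp add: split_beta')
  have "(LINT \<omega>|M. Z \<omega>) = (LINT t|lborel. LINT \<omega>|M. ?y (t, \<omega>))"
    unfolding Z using L.Fubini_integral[of "\<lambda>t \<omega>. ?y (t, \<omega>)"] y by (simp add: split_beta')
  then show "(LINT \<omega>|M. Z \<omega>) = 0" by (simp add: Y(2))
  let ?w = "\<lambda>p. indicator {0..T} (fst (fst p)) * indicator {0..T} (snd (fst p)) * (Y (fst (fst p)) (snd p) * Y (snd (fst p)) (snd p))"
  have "(\<lambda>p. (fst (fst p), snd p)) \<in> (borel \<Otimes>\<^sub>M borel) \<Otimes>\<^sub>M M \<rightarrow>\<^sub>M borel \<Otimes>\<^sub>M M"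
    and "(\<lambda>p. (snd (fst p), snd p)) \<in> (borel \<Otimes>\<^sub>M borel) \<Otimes>\<^sub>M M \<rightarrow>\<^sub>M borel \<Otimes>\<^sub>M M" by measurable
  from measurable_compose[OF this(1) Ym] measurable_compose[OF this(2) Ym]
  have [measurable]: "(\<lambda>p. Y (fst (fst p)) (snd p)) \<in> borel_measurable ((borel \<Otimes>\<^sub>M borel) \<Otimes>\<^sub>M M)"
    "(\<lambda>p. Y (snd (fst p)) (snd p)) \<in> borel_measurable ((borel \<Otimes>\<^sub>M borel) \<Otimes>\<^sub>M M)" by simp_all
  have P2: "AE p in lborel \<Otimes>\<^sub>M lborel. P (fst p - snd p)"
  proof (rule lborel_pair.AE_pair_measure)
    show "{p \<in> space (lborel \<Otimes>\<^sub>M lborel). P (fst p - snd p)} \<in> sets (lborel \<Otimes>\<^sub>M lborel)" by measurable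
    show "AE s in lborel. AE t in lborel. P (fst (s, t) - snd (s, t))"
    proof (rule AE_I2)
      fix s :: real
      show "AE t in lborel. P (fst (s, t) - snd (s, t))"
        using AE_borel_affine[of "-1" P s] P by simp
    qed
  qed
  have w: "integrable ((lborel \<Otimes>\<^sub>M lborel) \<Otimes>\<^sub>M M) ?w"
  proof (rule Q.Fubini_integrable)
    show "?w \<in> borel_measurable ((lborel \<Otimes>\<^sub>M lborel) \<Otimes>\<^sub>M M)" by measurable
    have eq: "(LINT \<omega>|M. norm (?w (p, \<omega>))) = indicator {0..T} (fst p) * indicator {0..T} (snd p) * (LINT \<omega>|M. \<bar>Y (fst p) \<omega> * Y (snd p) \<omega>\<bar>)" for p
      by (simp add: abs_mult)
    show "integrable (lborel \<Otimes>\<^sub>M lborel) (\<lambda>p. LINT \<omega>|M. norm (?w (p, \<omega>)))"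
    proof (rule Bochner_Integration.integrable_bound[OF integral_difference_kernel(1)[OF T _ b]])
      show "AE p in lborel \<Otimes>\<^sub>M lborel. norm (LINT \<omega>|M. norm (?w (p, \<omega>))) \<le>
          norm (indicator {0..T} (fst p) * indicator {0..T} (snd p) * b (fst p - snd p))"
        using P2
      proof eventually_elim
        fix p assume "P (fst p - snd p)"
        note order_trans[OF YY(3)[OF this] abs_ge_self]
        moreover have "0 \<le> (LINT \<omega>|M. \<bar>Y (fst p) \<omega> * Y (snd p) \<omega>\<bar>)" by simp
        ultimately show "norm (LINT \<omega>|M. norm (?w (p, \<omega>))) \<le>
          norm (indicator {0..T} (fst p) * indicator {0..T} (snd p) * b (fst p - snd p))"
          unfolding eq by (simp add: indicator_def)
      qed
    qed measurable
    show "AE p in lborel \<Otimes>\<^sub>M lborel. integrable M (\<lambda>\<omega>. ?w (p, \<omega>))"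
      using P2 by eventually_elim (use YY(1) in simp)
  qed
  have w': "integrable ((lborel \<Otimes>\<^sub>M lborel) \<Otimes>\<^sub>M M) (\<lambda>(p, \<omega>). ?w (p, \<omega>))" using w by (simp add: split_beta')
  have sq: "AE \<omega> in M. (LINT p|(lborel \<Otimes>\<^sub>M lborel). ?w (p, \<omega>)) = (Z \<omega>)\<^sup>2"
    using Q.AE_integrable_snd[OF w']
  proof eventually_elim
    fix \<omega> assume i: "integrable (lborel \<Otimes>\<^sub>M lborel) (\<lambda>p. ?w (p, \<omega>))"
    have "(LINT p|(lborel \<Otimes>\<^sub>M lborel). ?w (p, \<omega>)) = (LINT s|lborel. LINT t|lborel. ?w ((s, t), \<omega>))"
      by (rule lborel_pair.integral_fst'[OF i, symmetric])
    also have "\<dots> = (LINT s|lborel. LINT t|lborel. ?y (s, \<omega>) * ?y (t, \<omega>))"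
      by (simp add: mult_ac)
    also have "\<dots> = Z \<omega> * Z \<omega>"
      unfolding Z integral_mult_right_zero integral_mult_left_zero ..
    finally show "(LINT p|(lborel \<Otimes>\<^sub>M lborel). ?w (p, \<omega>)) = (Z \<omega>)\<^sup>2" by (simp only: power2_eq_square)
  qed
  have [measurable]: "Z \<in> borel_measurable M" using \<open>integrable M Z\<close> by simp
  have W: "integrable M (\<lambda>\<omega>. LINT p|(lborel \<Otimes>\<^sub>M lborel). ?w (p, \<omega>))"
    by (rule Q.integrable_snd[OF w'])
  have "integrable M (\<lambda>\<omega>. LINT p|(lborel \<Otimes>\<^sub>M lborel). ?w (p, \<omega>)) \<longleftrightarrow> integrable M (\<lambda>\<omega>. (Z \<omega>)\<^sup>2)"
    by (rule integrable_cong_AE[OF borel_measurable_integrable[OF W] _ sq]) simp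
  with W show "integrable M (\<lambda>\<omega>. (Z \<omega>)\<^sup>2)" by (rule iffD1[rotated])
  have "(LINT \<omega>|M. (Z \<omega>)\<^sup>2) = (LINT \<omega>|M. LINT p|(lborel \<Otimes>\<^sub>M lborel). ?w (p, \<omega>))"
  proof (rule integral_cong_AE)
    show "(\<lambda>\<omega>. LINT p|(lborel \<Otimes>\<^sub>M lborel). ?w (p, \<omega>)) \<in> borel_measurable M"
      using Q.integrable_snd[OF w'] by (rule borel_measurable_integrable)
    show "AE \<omega> in M. (Z \<omega>)\<^sup>2 = (LINT p|(lborel \<Otimes>\<^sub>M lborel). ?w (p, \<omega>))"
      using sq by eventually_elim simp
  qed simp
  also have "\<dots> = (LINT p|(lborel \<Otimes>\<^sub>M lborel). LINT \<omega>|M. ?w (p, \<omega>))"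
    by (rule Q.Fubini_integral[OF w'])
  also have "\<dots> = (LINT p|(lborel \<Otimes>\<^sub>M lborel). indicator {0..T} (fst p) * indicator {0..T} (snd p) * k (fst p - snd p))"
  proof (rule integral_cong_AE)
    show "AE p in lborel \<Otimes>\<^sub>M lborel. (LINT \<omega>|M. ?w (p, \<omega>)) = indicator {0..T} (fst p) * indicator {0..T} (snd p) * k (fst p - snd p)"
      using P2 by eventually_elim (simp add: YY(2))
    show "(\<lambda>p. LINT \<omega>|M. ?w (p, \<omega>)) \<in> borel_measurable (lborel \<Otimes>\<^sub>M lborel)"
      using Q.integrable_fst'[OF w] by (rule borel_measurable_integrable)
  qed measurable
  also have "\<dots> = (LINT x:{-T..T}|lborel. (T - \<bar>x\<bar>) * k x)"
    by (rule integral_difference_kernel(2)[OF T _ k]) simp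
  finally show "(LINT \<omega>|M. (Z \<omega>)\<^sup>2) = (LINT x:{-T..T}|lborel. (T - \<bar>x\<bar>) * k x)" .
qed

section \<open>The covariance of the logarithmic derivative\<close>

context spectral
begin

lemma vector_derivative_r [simp]: "vector_derivative r (at t) = r1 t"
  by (rule vector_derivative_at[OF r_deriv])

lemma log_derivative_r: "log_derivative r t = r1 t / r t"
  by (simp add: log_derivative_def)

lemma vector_derivative_log_derivative_r:
  assumes "r t \<noteq> 0"
  shows "vector_derivative (log_derivative r) (at t) = r2 t / r t - (r1 t / r t)\<^sup>2"
proof (rule vector_derivative_at)
  have "(inverse has_field_derivative - (inverse (r t) ^ Suc (Suc 0))) (at (r t))"
    by (rule DERIV_inverse[OF assms])
  from field_vector_diff_chain_at[OF r_deriv this]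
  have "((\<lambda>t. inverse (r t)) has_vector_derivative r1 t * - (inverse (r t) ^ Suc (Suc 0))) (at t)"
    by (simp only: comp_def)
  from has_vector_derivative_mult[OF r1_deriv this]
  have "((\<lambda>t. r1 t * inverse (r t)) has_vector_derivative
      r1 t * (r1 t * - (inverse (r t) ^ Suc (Suc 0))) + r2 t * inverse (r t)) (at t)" .
  moreover have "(\<lambda>t. r1 t * inverse (r t)) = log_derivative r"
    by (simp add: fun_eq_iff log_derivative_r divide_inverse)
  moreover have "r1 t * (r1 t * - (inverse (r t) ^ Suc (Suc 0))) + r2 t * inverse (r t) =
      r2 t / r t - (r1 t / r t)\<^sup>2"
    by (simp add: divide_inverse power2_eq_square algebra_simps)
  ultimately show "(log_derivative r has_vector_derivative r2 t / r t - (r1 t / r t)\<^sup>2) (at t)"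
    by (simp only:)
qed

lemma winding_kernel_explicit:
  "winding_kernel r x = (if cmod (r x) = 0 \<or> cmod (r x) = 1 then 1 / 2 * (cmod (r1 x))\<^sup>2
    else (cmod (r x))\<^sup>2 / (1 - (cmod (r x))\<^sup>2) * (Im (r1 x / r x - r1 0))\<^sup>2
      - 1 / 2 * ln (1 / (1 - (cmod (r x))\<^sup>2)) * Re (r2 x / r x - (r1 x / r x)\<^sup>2))"
  by (simp only: winding_kernel_def Let_def vector_derivative_r log_derivative_r r_0 div_by_1 if_cancel)
    (auto simp: vector_derivative_log_derivative_r)

lemma r_measurable [measurable]: "r \<in> borel_measurable borel" "r1 \<in> borel_measurable borel" "r2 \<in> borel_measurable borel"
  "defect \<in> borel_measurable borel"
  by (intro borel_measurable_continuous_onI continuous_r continuous_r1 continuous_r2 continuous_defect)+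

lemma winding_kernel_measurable [measurable]: "winding_kernel r \<in> borel_measurable borel"
  unfolding winding_kernel_explicit[abs_def] by measurable

text \<open>Let \<open>D = \<beta> / r x\<close> be the difference of the logarithmic derivatives at
  \<open>x\<close> and 0, and \<open>R'\<close> the derivative of the logarithmic derivative at
  \<open>x\<close>. Then \<open>\<gamma> / r x = - R' - D^2\<close>, so the terms in
  \<open>D^2\<close> that carry the logarithm cancel, and
  \<open>|D|^2 - Re (D^2) = 2 * (Im D)^2\<close> yields the kernel. At \<open>r x = 0\<close> the
  divisions by zero leave \<open>|\<beta>|^2 / 2\<close>, the first branch.\<close>

lemma winding_kernel_eq:
  assumes x: "cmod (r x) < 1" and \<beta>: "\<beta> = r1 x - r1 0 * r x"
    and \<gamma>: "\<gamma> = - r2 x + 2 * r1 0 * r1 x - (r1 0)\<^sup>2 * r x"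
  shows "winding_kernel r x =
    Re ((\<beta> / r x)\<^sup>2 * of_real (ln (1 / (defect x)\<^sup>2) - (cmod (r x))\<^sup>2 / (defect x)\<^sup>2) + \<gamma> / r x * of_real (ln (1 / (defect x)\<^sup>2))) / 2
      + (cmod \<beta>)\<^sup>2 / (2 * (defect x)\<^sup>2)"
proof (cases "r x = 0")
  case True
  then show ?thesis by (simp add: winding_kernel_explicit \<beta> defect_square)
next
  case False
  define D where "D = r1 x / r x - r1 0"
  define R' where "R' = r2 x / r x - (r1 x / r x)\<^sup>2"
  define L where "L = ln (1 / (defect x)\<^sup>2)"
  define c where "c = (cmod (r x))\<^sup>2 / (defect x)\<^sup>2"
  have D: "\<beta> / r x = D" using False by (simp add: \<beta> D_def field_simps)
  have "\<gamma> / r x = - (r2 x / r x) + 2 * r1 0 * (r1 x / r x) - (r1 0)\<^sup>2"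
    using False by (simp add: \<gamma> diff_divide_distrib add_divide_distrib)
  also have "\<dots> = - R' - D\<^sup>2"
    by (simp add: R'_def D_def power2_eq_square algebra_simps)
  finally have \<gamma>': "\<gamma> / r x = - R' - D\<^sup>2" .
  have "cmod \<beta> = cmod (r x) * cmod D" using False by (simp add: D[symmetric] norm_divide)
  then have \<beta>': "(cmod \<beta>)\<^sup>2 / (2 * (defect x)\<^sup>2) = c * (cmod D)\<^sup>2 / 2"
    by (simp add: c_def power_mult_distrib)
  have "Re (D\<^sup>2 * of_real (L - c) + (- R' - D\<^sup>2) * of_real L) / 2 + c * (cmod D)\<^sup>2 / 2 =
      c * (Im D)\<^sup>2 - 1 / 2 * L * Re R'"
    unfolding cmod_power2 by (simp add: Re_power2) (simp add: field_simps)
  moreover have "winding_kernel r x = c * (Im D)\<^sup>2 - 1 / 2 * L * Re R'"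
    using x False by (simp add: winding_kernel_explicit c_def D_def L_def R'_def defect_square)
  ultimately show ?thesis unfolding D \<gamma>' \<beta>' L_def[symmetric] c_def[symmetric] by (simp only:)
qed

lemma set_integrable_defect_powr:
  assumes S: "compact S"
  shows "set_integrable lborel S (\<lambda>x. b + c * defect x powr (-3/4))"
proof -
  have S' [measurable]: "S \<in> sets borel" using S by (simp add: borel_compact)
  have "integrable lborel (\<lambda>x. indicator S x * defect x powr (-3/4))"
  proof (rule integrableI_nonneg)
    have "(\<integral>\<^sup>+ x. ennreal (indicator S x * defect x powr (-3/4)) \<partial>lborel) =
        (\<integral>\<^sup>+ x. ennreal (defect x powr (-3/4)) * indicator S x \<partial>lborel)"
      by (intro nn_integral_cong) (simp add: indicator_def)
    then show "(\<integral>\<^sup>+ x. ennreal (indicator S x * defect x powr (-3/4)) \<partial>lborel) < \<infinity>"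
      using defect_powr_compact(1)[OF S] by simp
  qed simp_all
  then have "set_integrable lborel S (\<lambda>x. defect x powr (-3/4))" by (simp add: set_integrable_def)
  moreover have "set_integrable lborel S (\<lambda>x. b)"
    unfolding set_integrable_def using emeasure_compact_finite[OF S] by simp
  ultimately show ?thesis by (intro set_integral_add set_integrable_mult_right)
qed

end

text \<open>A bound of Young type: numerators have all moments, and 7/4 stays below the critical
  inverse power 2. The split is at \<open>a = y powr (-3/4)\<close>, where \<open>a / y\<close>
  equals \<open>y powr (-7/4)\<close>; beyond it \<open>1 / y \<le> a ^ 3\<close> if
  \<open>y < 1\<close>, and the case \<open>y \<ge> 1\<close> is elementary.\<close>

lemma divide_le_power4_powr:
  fixes a y :: real
  assumes "a \<ge> 0" "y \<ge> 0"
  shows "a / y \<le> 1 + a ^ 4 + y powr (-7/4)"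
proof (cases "y = 0")
  case False
  with assms have y: "y > 0" by simp
  show ?thesis
  proof (cases "a \<le> y powr (-3/4)")
    case True
    have "a / y \<le> y powr (-3/4) * y powr (-1)"
      using mult_right_mono[OF True, of "1 / y"] y by (simp add: powr_minus_divide)
    also have "\<dots> = y powr (-7/4)" by (simp only: powr_add[symmetric]) simp
    finally show ?thesis using assms by (simp add: add_increasing)
  next
    case le: False
    show ?thesis
    proof (cases "y \<ge> 1")
      case True
      have "a / y \<le> a" using True assms by (simp add: pos_divide_le_eq mult_le_cancel_left1)
      also have "a \<le> 1 + a ^ 4"
      proof (cases "a \<le> 1")
        case False
        then have "a ^ 1 \<le> a ^ 4" by (intro power_increasing) auto
        then show ?thesis by simp
      qed (use assms in \<open>simp add: add_increasing2\<close>)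
      finally show ?thesis by (simp add: add_increasing2)
    next
      case y1: False
      have y34: "1 \<le> y powr (-3/4)" using powr_mono2'[of "-3/4" y 1] y y1 by simp
      then have a: "a \<ge> 1" using le by simp
      have "1 / y = (y powr (-3/4)) powr (4/3)" using y by (simp only: powr_powr) (simp add: powr_minus_divide)
      also have "\<dots> \<le> a powr (4/3)" using le by (intro powr_mono2) auto
      also have "\<dots> \<le> a powr 3" using a by (intro powr_mono) auto
      also have "\<dots> = a ^ 3" using a by simp
      finally have "a * (1 / y) \<le> a * a ^ 3" using assms by (intro mult_left_mono) auto
      then have "a / y \<le> a ^ 4" by (simp add: power_numeral_reduce)
      then show ?thesis by (simp add: add_increasing add_increasing2)
    qed
  qed
qed (use assms in simp)

section \<open>Covariances of process, derivative and residual; the kernel as a covariance\<close>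

context stationary_gaussian
begin

lemma f_mem: "f t \<in> H" and G_mem: "G t \<in> H"
  using rep_limit_f rep_limit_G by (auto simp: H_def)

lemma cov_G_f: "cov (G s) (f t) = S.r1 (s - t)"
proof -
  have "- (\<i> * of_real l) * iexp (- (s * l)) * cnj (iexp (- (t * l))) = - (\<i> * of_real l) * iexp (- ((s - t) * l))" for l
    unfolding S.iexp_cnj mult.assoc mult_exp_exp by (simp add: algebra_simps)
  then show ?thesis unfolding rep_limit_cov[OF rep_limit_G rep_limit_f] S.r1_def by (simp only:)
qed

lemma cov_f_G: "cov (f s) (G t) = - S.r1 (s - t)"
proof -
  have "cov (f s) (G t) = cnj (S.r1 (- (s - t)))" using cov_cnj[of "f s" "G t"] by (simp add: cov_G_f)
  then show ?thesis unfolding S.r1_minus by simp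
qed

lemma cov_G_G: "cov (G s) (G t) = - S.r2 (s - t)"
proof -
  have "- (\<i> * of_real l) * iexp (- (s * l)) * cnj (- (\<i> * of_real l) * iexp (- (t * l))) =
      - (- of_real (l\<^sup>2) * iexp (- ((s - t) * l)))" for l
  proof -
    have "iexp (- (s * l)) * cnj (iexp (- (t * l))) = iexp (- ((s - t) * l))"
      unfolding S.iexp_cnj mult_exp_exp by (simp add: algebra_simps)
    moreover have "- (\<i> * of_real l) * a * cnj (- (\<i> * of_real l) * b) = of_real (l\<^sup>2) * (a * cnj b)" for a b
      by (simp add: complex_eq_iff power2_eq_square algebra_simps)
    ultimately show ?thesis by simp
  qed
  then show ?thesis unfolding rep_limit_cov[OF rep_limit_G rep_limit_G] S.r2_def
    by (simp only: Bochner_Integration.integral_minus)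
qed

lemma f_variance: "(LINT \<omega>|M. (cmod (f t \<omega>))\<^sup>2) = 1"
  using cov_self[of "f t"] by (simp add: f_cov S.r_0)

lemma cnj_r1_0: "cnj (S.r1 0) = - S.r1 0"
  using S.r1_minus[of 0] by (metis minus_minus minus_zero)

definition u :: "real \<Rightarrow> 'a \<Rightarrow> complex" where
  "u t \<omega> = G t \<omega> - S.r1 0 * f t \<omega>"

lemma u_eq: "u t = (\<lambda>\<omega>. G t \<omega> - S.r1 0 * f t \<omega>)"
  by (simp add: u_def fun_eq_iff)

lemma u_mem: "u t \<in> H"
  unfolding u_eq by (rule cov_residual(1)[OF G_mem f_mem f_mem])

lemma cov_u_f: "cov (u s) (f t) = S.r1 (s - t) - S.r1 0 * r (s - t)"
  unfolding u_eq cov_residual(2)[OF G_mem f_mem f_mem] cov_G_f f_cov ..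

lemma cov_u_G: "cov (u s) (G t) = - S.r2 (s - t) + S.r1 0 * S.r1 (s - t)"
  unfolding u_eq cov_residual(2)[OF G_mem f_mem G_mem] cov_f_G cov_G_G by simp

lemma cov_u_u: "cov (u s) (u t) = - S.r2 (s - t) + 2 * S.r1 0 * S.r1 (s - t) - (S.r1 0)\<^sup>2 * r (s - t)"
proof -
  have "cov (u s) (u t) = cov (u s) (G t) - cnj (S.r1 0) * cov (u s) (f t)"
    unfolding u_eq[of t] by (rule cov_residual(3)[OF G_mem f_mem u_mem])
  then show ?thesis unfolding cov_u_G cov_u_f cnj_r1_0 by (simp add: algebra_simps power2_eq_square)
qed

definition u_variance :: real where
  "u_variance = Re (- S.r2 0 + (S.r1 0)\<^sup>2)"

lemma u_variance: "(LINT \<omega>|M. (cmod (u t \<omega>))\<^sup>2) = u_variance"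
proof -
  have "complex_of_real (LINT \<omega>|M. (cmod (u t \<omega>))\<^sup>2) = - S.r2 0 + (S.r1 0)\<^sup>2"
    using cov_self[of "u t"] unfolding cov_u_u by (simp add: S.r_0 power2_eq_square)
  then show ?thesis unfolding u_variance_def by (metis Re_complex_of_real)
qed

lemma u_moment: "integrable M (\<lambda>\<omega>. cmod (u t \<omega>) ^ (2 * n))" "(LINT \<omega>|M. cmod (u t \<omega>) ^ (2 * n)) = u_variance ^ n * fact n"
  using circular_gaussian_power[OF mem_circular[OF u_mem]] unfolding u_variance by auto

definition Y :: "real \<Rightarrow> 'a \<Rightarrow> real" where
  "Y t \<omega> = Im (u t \<omega> / f t \<omega>)"

lemma u_joint [measurable]: "(\<lambda>p. u (fst p) (snd p)) \<in> borel_measurable (borel \<Otimes>\<^sub>M M)"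
  unfolding u_def by measurable

lemma Y_joint [measurable]: "(\<lambda>p. Y (fst p) (snd p)) \<in> borel_measurable (borel \<Otimes>\<^sub>M M)"
  unfolding Y_def by measurable

lemma Y_mean: "integrable M (Y t)" "(LINT \<omega>|M. Y t \<omega>) = 0"
proof -
  note i = ratio_expectation[OF u_mem[of t] f_mem[of t] f_variance]
  have "Y t = (\<lambda>\<omega>. Im (u t \<omega> / f t \<omega>))" by (simp add: Y_def fun_eq_iff)
  then show "integrable M (Y t)" using i(1) by (simp only: integrable_Im)
  have "(LINT \<omega>|M. Y t \<omega>) = Im (LINT \<omega>|M. u t \<omega> / f t \<omega>)" unfolding Y_def by (rule integral_Im[OF i(1)])
  then show "(LINT \<omega>|M. Y t \<omega>) = 0" unfolding i(2) cov_u_f by (simp add: S.r_0)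
qed

text \<open>The bound does not depend on \<open>t\<close>, as the exchange of expectation with
  integration over \<open>{0..T}\<close> requires.\<close>

lemma Y_abs_mean: "(LINT \<omega>|M. \<bar>Y t \<omega>\<bar>) \<le> 1 + u_variance ^ 2 * fact 2 + inverse_moment (7/4)"
proof -
  have c: "circular_gaussian M (f t) 1" using mem_circular[OF f_mem] unfolding f_variance .
  have i1: "integrable M (\<lambda>\<omega>. cmod (u t \<omega>) ^ 4)" "(LINT \<omega>|M. cmod (u t \<omega>) ^ 4) = u_variance ^ 2 * fact 2"
    using u_moment[of t 2] by simp_all
  have i2: "integrable M (\<lambda>\<omega>. cmod (f t \<omega>) powr (-7/4))" "(LINT \<omega>|M. cmod (f t \<omega>) powr (-7/4)) = inverse_moment (7/4)"
    using circular_gaussian_powr[OF c, of "7/4"] by (simp_all add: inverse_moment_def)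
  have "(LINT \<omega>|M. \<bar>Y t \<omega>\<bar>) \<le> (LINT \<omega>|M. 1 + cmod (u t \<omega>) ^ 4 + cmod (f t \<omega>) powr (-7/4))"
  proof (rule integral_mono)
    show "integrable M (\<lambda>\<omega>. \<bar>Y t \<omega>\<bar>)" using Y_mean(1) by simp
    show "integrable M (\<lambda>\<omega>. 1 + cmod (u t \<omega>) ^ 4 + cmod (f t \<omega>) powr (-7/4))" using i1 i2 by simp
    fix \<omega>
    have "\<bar>Y t \<omega>\<bar> \<le> cmod (u t \<omega>) / cmod (f t \<omega>)"
      unfolding Y_def norm_divide[symmetric] by (rule abs_Im_le_cmod)
    also have "\<dots> \<le> 1 + cmod (u t \<omega>) ^ 4 + cmod (f t \<omega>) powr (-7/4)" by (rule divide_le_power4_powr) simp_all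
    finally show "\<bar>Y t \<omega>\<bar> \<le> 1 + cmod (u t \<omega>) ^ 4 + cmod (f t \<omega>) powr (-7/4)" .
  qed
  also have "\<dots> = 1 + u_variance ^ 2 * fact 2 + inverse_moment (7/4)"
    using i1 i2 by (simp add: prob_space)
  finally show ?thesis .
qed

definition product_bound :: "real \<Rightarrow> real" where
  "product_bound x = 2 * (u_variance ^ 5 * fact 5) + inverse_product_const * S.defect x powr (-3/4)"

lemma Y_product:
  assumes "cmod (r (s - t)) < 1"
  shows "integrable M (\<lambda>\<omega>. Y s \<omega> * Y t \<omega>)" "(LINT \<omega>|M. Y s \<omega> * Y t \<omega>) = winding_kernel r (s - t)"
    "(LINT \<omega>|M. \<bar>Y s \<omega> * Y t \<omega>\<bar>) \<le> product_bound (s - t)"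
proof -
  have d: "S.defect (s - t) > 0" "(cmod (r (s - t)))\<^sup>2 + (S.defect (s - t))\<^sup>2 = 1"
    using assms by (simp_all add: S.defect_pos_iff S.defect_square)
  have d': "(cmod (cov (f s) (f t)))\<^sup>2 + (S.defect (s - t))\<^sup>2 = 1" unfolding f_cov by (rule d(2))
  define \<beta> where "\<beta> = S.r1 (s - t) - S.r1 0 * r (s - t)"
  define \<gamma> where "\<gamma> = - S.r2 (s - t) + 2 * S.r1 0 * S.r1 (s - t) - (S.r1 0)\<^sup>2 * r (s - t)"
  have uf: "cov (u a) (f a) = 0" for a unfolding cov_u_f by (simp add: S.r_0)
  have \<beta>1: "cov (u s) (f t) = \<beta>" unfolding cov_u_f \<beta>_def ..
  \<comment> \<open>Hermitian symmetry: \<open>r (- x) = cnj (r x)\<close>,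
    \<open>S.r1 (- x) = - cnj (S.r1 x)\<close>, and \<open>S.r1 0\<close> is purely
    imaginary.\<close>
  have "t - s = - (s - t)" by simp
  then have \<beta>2: "cov (u t) (f s) = - cnj \<beta>"
    unfolding cov_u_f \<beta>_def by (simp only: S.r_minus S.r1_minus complex_cnj_diff complex_cnj_mult cnj_r1_0) simp
  have \<gamma>: "cov (u s) (u t) = \<gamma>" unfolding cov_u_u \<gamma>_def ..
  note c = Im_ratio_covariance[OF f_mem f_mem u_mem u_mem f_variance f_variance f_cov d uf uf \<beta>1 \<beta>2 \<gamma>]
  note b = double_ratio_bound[OF f_mem f_mem f_variance f_variance d(1) d' u_mem[of s] u_mem[of t]]
  show i: "integrable M (\<lambda>\<omega>. Y s \<omega> * Y t \<omega>)" unfolding Y_def by (rule c(1))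
  show "(LINT \<omega>|M. Y s \<omega> * Y t \<omega>) = winding_kernel r (s - t)"
    unfolding Y_def c(2) by (rule S.winding_kernel_eq[OF assms \<beta>_def \<gamma>_def, symmetric])
  have m: "(LINT \<omega>|M. cmod (u a \<omega>) ^ 10) = u_variance ^ 5 * fact 5" for a
    using u_moment(2)[of a 5] by simp
  have "(LINT \<omega>|M. \<bar>Y s \<omega> * Y t \<omega>\<bar>) \<le> (LINT \<omega>|M. cmod (u s \<omega>) * cmod (u t \<omega>) / (cmod (f s \<omega>) * cmod (f t \<omega>)))"
  proof (rule integral_mono[OF _ b(1)])
    show "integrable M (\<lambda>\<omega>. \<bar>Y s \<omega> * Y t \<omega>\<bar>)" using i by simp
    fix \<omega>
    have "\<bar>Y s \<omega>\<bar> * \<bar>Y t \<omega>\<bar> \<le> cmod (u s \<omega> / f s \<omega>) * cmod (u t \<omega> / f t \<omega>)"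
      unfolding Y_def by (intro mult_mono abs_Im_le_cmod) simp_all
    then show "\<bar>Y s \<omega> * Y t \<omega>\<bar> \<le> cmod (u s \<omega>) * cmod (u t \<omega>) / (cmod (f s \<omega>) * cmod (f t \<omega>))"
      by (simp add: abs_mult norm_divide)
  qed
  also note b(2)
  finally show "(LINT \<omega>|M. \<bar>Y s \<omega> * Y t \<omega>\<bar>) \<le> product_bound (s - t)"
    unfolding m product_bound_def by linarith
qed

lemma product_bound_measurable [measurable]: "product_bound \<in> borel_measurable borel"
  unfolding product_bound_def by measurable

lemma product_bound_integrable: "compact K \<Longrightarrow> set_integrable lborel K product_bound"
  unfolding product_bound_def by (rule S.set_integrable_defect_powr)

text \<open>At almost every lag the kernel is the covariance of \<open>Y x\<close> and
  \<open>Y 0\<close>, hence dominated by \<open>E |Y x * Y 0|\<close>; its singular formula is never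
  estimated directly.\<close>

lemma winding_kernel_integrable:
  assumes "compact K"
  shows "set_integrable lborel K (winding_kernel r)"
proof (rule set_integrable_bound[OF product_bound_integrable[OF assms]])
  have [measurable]: "K \<in> sets borel" using assms by (simp add: borel_compact)
  show "set_borel_measurable lborel K (winding_kernel r)"
    unfolding set_borel_measurable_def by measurable
  show "AE x in lborel. x \<in> K \<longrightarrow> norm (winding_kernel r x) \<le> norm (product_bound x)"
    using S.AE_norm_r_less
  proof eventually_elim
    fix x assume "cmod (r x) < 1"
    then have x: "cmod (r (x - 0)) < 1" by simp
    have "\<bar>winding_kernel r x\<bar> \<le> (LINT \<omega>|M. \<bar>Y x \<omega> * Y 0 \<omega>\<bar>)"
      using integral_norm_bound[of M "\<lambda>\<omega>. Y x \<omega> * Y 0 \<omega>"] Y_product(2)[OF x] by simp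
    also have "\<dots> \<le> product_bound x" using Y_product(3)[OF x] by simp
    finally show "x \<in> K \<longrightarrow> norm (winding_kernel r x) \<le> norm (product_bound x)" by simp
  qed
qed

lemma Y_integral_moments:
  assumes "T > 0"
  defines "Z \<equiv> \<lambda>\<omega>. LINT t:{0..T}|lborel. Y t \<omega>"
  shows "AE \<omega> in M. set_integrable lborel {0..T} (\<lambda>t. Y t \<omega>)"
    "integrable M Z" "(LINT \<omega>|M. Z \<omega>) = 0"
    "integrable M (\<lambda>\<omega>. (Z \<omega>)\<^sup>2)" "(LINT \<omega>|M. (Z \<omega>)\<^sup>2) = (LINT x:{-T..T}|lborel. (T - \<bar>x\<bar>) * winding_kernel r x)"
proof -
  have P: "Measurable.pred borel (\<lambda>x. cmod (r x) < 1)" by measurable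
  note m = process_integral_moments[where Y=Y and P="\<lambda>x. cmod (r x) < 1" and k="winding_kernel r" and b=product_bound,
      OF prob_space_axioms assms(1) Y_joint Y_mean Y_abs_mean S.AE_norm_r_less P Y_product
      S.winding_kernel_measurable product_bound_measurable winding_kernel_integrable[OF compact_Icc]
      product_bound_integrable[OF compact_Icc]]
  show "AE \<omega> in M. set_integrable lborel {0..T} (\<lambda>t. Y t \<omega>)" by (rule m(1))
  show "integrable M Z" unfolding Z_def by (rule m(2))
  show "(LINT \<omega>|M. Z \<omega>) = 0" unfolding Z_def by (rule m(3))
  show "integrable M (\<lambda>\<omega>. (Z \<omega>)\<^sup>2)" unfolding Z_def by (rule m(4))
  show "(LINT \<omega>|M. (Z \<omega>)\<^sup>2) = (LINT x:{-T..T}|lborel. (T - \<bar>x\<bar>) * winding_kernel r x)"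
    unfolding Z_def by (rule m(5))
qed

end

section \<open>The winding\<close>

text \<open>The winding is known to agree with a measurable function only almost surely. In the
  completion this is enough for measurability, and the integrals are unchanged.\<close>

lemma (in prob_space) AE_completion_integral:
  fixes f g :: "'a \<Rightarrow> real"
  assumes g: "g \<in> borel_measurable M" and ae: "AE \<omega> in M. f \<omega> = g \<omega>"
  shows "f \<in> borel_measurable (completion M)"
    "integrable (completion M) f \<longleftrightarrow> integrable M g" "integral\<^sup>L (completion M) f = integral\<^sup>L M g"
proof -
  have gc: "g \<in> borel_measurable (completion M)" by (rule measurable_completion[OF g])
  have aec: "AE \<omega> in completion M. f \<omega> = g \<omega>" by (rule AE_completion[OF ae])
  show f: "f \<in> borel_measurable (completion M)"
  proof (rule measurableI)
    fix A :: "real set" assume "A \<in> sets borel"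
    then have "g -` A \<inter> space (completion M) \<in> sets (completion M)" using gc by (rule measurable_sets[rotated])
    then show "f -` A \<inter> space (completion M) \<in> sets (completion M)"
    proof (rule completion.in_sets_AE[rotated])
      show "AE \<omega> in completion M. \<omega> \<in> g -` A \<inter> space (completion M) \<longleftrightarrow> \<omega> \<in> f -` A \<inter> space (completion M)"
        using aec by eventually_elim simp
    qed simp
  qed simp
  have "integrable (completion M) f \<longleftrightarrow> integrable (completion M) g"
    by (rule integrable_cong_AE[OF f gc aec])
  then show "integrable (completion M) f \<longleftrightarrow> integrable M g" by (simp only: integrable_completion[OF g])
  have "integral\<^sup>L (completion M) f = integral\<^sup>L (completion M) g"
    by (rule integral_cong_AE[OF f gc aec])
  then show "integral\<^sup>L (completion M) f = integral\<^sup>L M g" by (simp only: integral_completion[OF g])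
qed

context stationary_gaussian
begin

lemma AE_f_neq_0: "AE \<omega> in M. AE t in lborel. f t \<omega> \<noteq> 0"
proof -
  interpret P: pair_sigma_finite lborel M ..
  have "AE t in lborel. AE \<omega> in M. f t \<omega> \<noteq> 0"
  proof (rule AE_I2)
    fix t
    have "circular_gaussian M (f t) 1" using mem_circular[OF f_mem[of t]] unfolding f_variance .
    then show "AE \<omega> in M. f t \<omega> \<noteq> 0" by (rule circular_gaussian_AE_neq_0) simp
  qed
  moreover have "{p \<in> space (lborel \<Otimes>\<^sub>M M). f (fst p) (snd p) \<noteq> 0} \<in> sets (lborel \<Otimes>\<^sub>M M)" by measurable
  ultimately show ?thesis using P.AE_commute[of "\<lambda>t \<omega>. f t \<omega> \<noteq> 0"] by simp
qed

text \<open>For almost every path, the times at which the derivative differs from \<open>G\<close>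
  or the path vanishes form a null set and do not affect the integral; elsewhere
  \<open>L - cnj L = 2 * \<i> * Im L\<close> with \<open>Im L = Im (S.r1 0) + Y\<close>.\<close>

lemma AE_winding:
  assumes T: "T > 0"
  shows "AE \<omega> in M. winding f T \<omega> = T * Im (S.r1 0) + (LINT t:{0..T}|lborel. Y t \<omega>)"
  using AE_path_derivative AE_f_neq_0 Y_integral_moments(1)[OF T] AE_space
proof eventually_elim
  fix \<omega>
  assume d: "AE t in lborel. vector_derivative (\<lambda>t. f t \<omega>) (at t) = G t \<omega>"
    and f: "AE t in lborel. f t \<omega> \<noteq> 0" and i: "set_integrable lborel {0..T} (\<lambda>t. Y t \<omega>)" and \<omega>: "\<omega> \<in> space M"
  let ?L = "log_derivative (\<lambda>t. f t \<omega>)" and ?a = "Im (S.r1 0)"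
  note [measurable] = path_measurable[OF f_joint \<omega>]
    path_measurable[where X="\<lambda>t \<omega>. vector_derivative (\<lambda>t. f t \<omega>) (at t)", OF measurable_vector_derivative_process[OF f_measurable f_continuous] \<omega>]
    path_measurable[OF Y_joint \<omega>]
  have c: "set_integrable lborel {0..T} (\<lambda>t. ?a)"
    unfolding set_integrable_def real_scaleR_def
    by (intro integrable_mult_left integrable_real_indicator) (simp_all add: emeasure_lborel_Icc_eq)
  have "(LINT t:{0..T}|lborel. ?L t - cnj (?L t)) = (LINT t|lborel. of_real (indicator {0..T} t * (?a + Y t \<omega>)) * (2 * \<i>))"
    unfolding set_lebesgue_integral_def
  proof (rule integral_cong_AE)
    show "(\<lambda>t. indicat_real {0..T} t *\<^sub>R (?L t - cnj (?L t))) \<in> borel_measurable lborel"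
      unfolding log_derivative_def by measurable
    show "AE t in lborel. indicat_real {0..T} t *\<^sub>R (?L t - cnj (?L t)) = of_real (indicator {0..T} t * (?a + Y t \<omega>)) * (2 * \<i>)"
      using d f
    proof eventually_elim
      fix t assume v: "vector_derivative (\<lambda>t. f t \<omega>) (at t) = G t \<omega>" and f0: "f t \<omega> \<noteq> 0"
      have "u t \<omega> / f t \<omega> = G t \<omega> / f t \<omega> - S.r1 0" using f0 by (simp add: u_def diff_divide_distrib)
      then have "Im (?L t) = ?a + Y t \<omega>" by (simp add: log_derivative_def v Y_def)
      then have "?L t - cnj (?L t) = of_real (?a + Y t \<omega>) * (2 * \<i>)" by (simp add: complex_diff_cnj)
      then show "indicat_real {0..T} t *\<^sub>R (?L t - cnj (?L t)) = of_real (indicator {0..T} t * (?a + Y t \<omega>)) * (2 * \<i>)"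
        by (simp add: scaleR_conv_of_real)
    qed
  qed measurable
  also have "\<dots> = of_real (LINT t|lborel. indicator {0..T} t * (?a + Y t \<omega>)) * (2 * \<i>)"
    by (simp only: integral_mult_left_zero integral_complex_of_real)
  finally have "winding f T \<omega> = (LINT t:{0..T}|lborel. ?a + Y t \<omega>)"
    by (simp add: winding_def Let_def set_lebesgue_integral_def)
  also have "\<dots> = (LINT t:{0..T}|lborel. ?a) + (LINT t:{0..T}|lborel. Y t \<omega>)" by (rule set_integral_add(2)[OF c i])
  also have "(LINT t:{0..T}|lborel. ?a) = T * ?a" using T by (simp add: set_lebesgue_integral_def)
  finally show "winding f T \<omega> = T * ?a + (LINT t:{0..T}|lborel. Y t \<omega>)" .
qed

text \<open>\<open>W\<close> is any function almost surely equal to the winding, so that the result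
  also covers the winding of the original process, of which the process here is a modification on a
  null set.\<close>

lemma winding_moments:
  assumes T: "T > 0" and ae: "AE \<omega> in M. W \<omega> = winding f T \<omega>"
  shows "integrable (completion M) W" "integral\<^sup>L (completion M) W = T * Im (S.r1 0)"
    "integrable (completion M) (\<lambda>\<omega>. (W \<omega>)\<^sup>2)"
    "(LINT \<omega>|completion M. (W \<omega> - T * Im (S.r1 0))\<^sup>2) = T * (LINT x:{-T..T}|lborel. (1 - \<bar>x\<bar> / T) * winding_kernel r x)"
proof -
  define Z where "Z \<omega> = (LINT t:{0..T}|lborel. Y t \<omega>)" for \<omega>
  define m where "m = T * Im (S.r1 0)"
  have Z: "integrable M Z" "(LINT \<omega>|M. Z \<omega>) = 0" "integrable M (\<lambda>\<omega>. (Z \<omega>)\<^sup>2)"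
    "(LINT \<omega>|M. (Z \<omega>)\<^sup>2) = (LINT x:{-T..T}|lborel. (T - \<bar>x\<bar>) * winding_kernel r x)"
    unfolding Z_def by (fact Y_integral_moments[OF T])+
  have [measurable]: "Z \<in> borel_measurable M" by (rule borel_measurable_integrable[OF Z(1)])
  have W: "AE \<omega> in M. W \<omega> = m + Z \<omega>"
    using ae AE_winding[OF T] unfolding Z_def m_def by eventually_elim simp
  have sq: "AE \<omega> in M. (W \<omega>)\<^sup>2 = m\<^sup>2 + 2 * m * Z \<omega> + (Z \<omega>)\<^sup>2" and ctr: "AE \<omega> in M. (W \<omega> - m)\<^sup>2 = (Z \<omega>)\<^sup>2"
    using W by (eventually_elim, simp add: power2_sum)+
  have m1: "(\<lambda>\<omega>. m + Z \<omega>) \<in> borel_measurable M" and m2: "(\<lambda>\<omega>. m\<^sup>2 + 2 * m * Z \<omega> + (Z \<omega>)\<^sup>2) \<in> borel_measurable M"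
    and m3: "(\<lambda>\<omega>. (Z \<omega>)\<^sup>2) \<in> borel_measurable M" by measurable
  show "integrable (completion M) W"
    unfolding AE_completion_integral(2)[OF m1 W] using Z(1) by simp
  have "integral\<^sup>L (completion M) W = m"
    unfolding AE_completion_integral(3)[OF m1 W] using Z(1,2) by (simp add: prob_space)
  then show "integral\<^sup>L (completion M) W = T * Im (S.r1 0)" unfolding m_def .
  show "integrable (completion M) (\<lambda>\<omega>. (W \<omega>)\<^sup>2)"
    unfolding AE_completion_integral(2)[OF m2 sq] using Z(1,3) by simp
  have "(T - \<bar>x\<bar>) * winding_kernel r x = T * ((1 - \<bar>x\<bar> / T) * winding_kernel r x)" for x
    using T by (simp add: field_simps)
  then have "(LINT \<omega>|M. (Z \<omega>)\<^sup>2) = T * (LINT x:{-T..T}|lborel. (1 - \<bar>x\<bar> / T) * winding_kernel r x)"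
    unfolding Z(4) by (simp only: set_integral_mult_right)
  then have "(LINT \<omega>|completion M. (W \<omega> - m)\<^sup>2) = T * (LINT x:{-T..T}|lborel. (1 - \<bar>x\<bar> / T) * winding_kernel r x)"
    unfolding AE_completion_integral(3)[OF m3 ctr] .
  then show "(LINT \<omega>|completion M. (W \<omega> - T * Im (S.r1 0))\<^sup>2) = T * (LINT x:{-T..T}|lborel. (1 - \<bar>x\<bar> / T) * winding_kernel r x)"
    unfolding m_def .
qed

end

section \<open>Complex Gaussian vectors\<close>

lemma circular_gaussian_cong_AE:
  assumes X: "circular_gaussian M X q" and Y: "Y \<in> borel_measurable M" and ae: "AE \<omega> in M. X \<omega> = Y \<omega>"
  shows "circular_gaussian M Y q"
  using X Y distr_cong_AE[OF refl refl ae, of borel] by (auto simp: circular_gaussian_def)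

lemma circular_gaussian_std_combination:
  fixes m :: nat
  shows "circular_gaussian (\<Pi>\<^sub>M j\<in>{..<m}. std_complex_gaussian) (\<lambda>v. \<Sum>j<m. e j * v j) (\<Sum>j<m. (cmod (e j))\<^sup>2)"
proof (rule circular_gaussianI)
  interpret P: product_sigma_finite "\<lambda>j::nat. std_complex_gaussian" ..
  show "prob_space (\<Pi>\<^sub>M j\<in>{..<m}. std_complex_gaussian)"
    by (rule prob_space_PiM) (rule prob_space_std_complex_gaussian)
  have [measurable]: "(\<lambda>v. v j) \<in> borel_measurable (\<Pi>\<^sub>M j\<in>{..<m}. std_complex_gaussian)" if "j < m" for j
    using measurable_component_singleton[of j "{..<m}" "\<lambda>_. std_complex_gaussian"] that
    by (simp cong: measurable_cong_sets)
  show "(\<lambda>v. \<Sum>j<m. e j * v j) \<in> borel_measurable (\<Pi>\<^sub>M j\<in>{..<m}. std_complex_gaussian)"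
    by (intro borel_measurable_sum borel_measurable_times borel_measurable_const) simp
  show "0 \<le> (\<Sum>j<m. (cmod (e j))\<^sup>2)" by (intro sum_nonneg) simp
  fix \<xi> :: complex
  have "iexp (\<xi> \<bullet> (\<Sum>j<m. e j * v j)) = (\<Prod>j<m. iexp ((cnj (e j) * \<xi>) \<bullet> v j))" for v :: "nat \<Rightarrow> complex"
    by (simp add: inner_sum_right inner_mult_complex sum_distrib_left exp_sum)
  moreover have "integrable std_complex_gaussian (\<lambda>z. iexp ((cnj (e j) * \<xi>) \<bullet> z))" for j
  proof (rule std_complex_gaussian.integrable_const_bound[where B=1])
    show "(\<lambda>z. iexp ((cnj (e j) * \<xi>) \<bullet> z)) \<in> borel_measurable std_complex_gaussian"
      unfolding measurable_cong_sets[OF sets_std_complex_gaussian refl]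
      by (intro borel_measurable_continuous_onI continuous_intros)
  qed simp
  ultimately have "(LINT v|(\<Pi>\<^sub>M j\<in>{..<m}. std_complex_gaussian). iexp (\<xi> \<bullet> (\<Sum>j<m. e j * v j))) =
      (\<Prod>j<m. LINT z|std_complex_gaussian. iexp ((cnj (e j) * \<xi>) \<bullet> z))"
    using P.product_integral_prod[of "{..<m}" "\<lambda>j z. iexp ((cnj (e j) * \<xi>) \<bullet> z)"] by (simp only: finite_lessThan)
  also have "\<dots> = of_real (\<Prod>j<m. exp (- (cmod (cnj (e j) * \<xi>))\<^sup>2 / 4))"
    by (simp only: char_std_complex_gaussian of_real_prod)
  also have "(\<Prod>j<m. exp (- (cmod (cnj (e j) * \<xi>))\<^sup>2 / 4)) = exp (\<Sum>j<m. - (cmod (cnj (e j) * \<xi>))\<^sup>2 / 4)"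
    by (rule exp_sum[symmetric]) simp
  also have "(\<Sum>j<m. - (cmod (cnj (e j) * \<xi>))\<^sup>2 / 4) = - (\<Sum>j<m. (cmod (e j))\<^sup>2) * (cmod \<xi>)\<^sup>2 / 4"
    by (simp add: norm_mult power_mult_distrib sum_distrib_right sum_divide_distrib sum_negf)
  finally show "(LINT v|(\<Pi>\<^sub>M j\<in>{..<m}. std_complex_gaussian). iexp (\<xi> \<bullet> (\<Sum>j<m. e j * v j))) =
      exp (- (\<Sum>j<m. (cmod (e j))\<^sup>2) * (cmod \<xi>)\<^sup>2 / 4)" .
qed

lemma distr_joint_law:
  assumes [measurable]: "\<And>i. i < n \<Longrightarrow> X i \<in> borel_measurable M"
    and [measurable]: "h \<in> borel_measurable (\<Pi>\<^sub>M i\<in>{..<n}. borel)"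
  shows "distr (joint_law M n X) borel h = distr M borel (\<lambda>\<omega>. h (\<lambda>i\<in>{..<n}. X i \<omega>))"
proof -
  have [measurable]: "(\<lambda>\<omega>. \<lambda>i\<in>{..<n}. X i \<omega>) \<in> M \<rightarrow>\<^sub>M (\<Pi>\<^sub>M i\<in>{..<n}. borel)"
    by (rule measurable_restrict) simp
  show ?thesis unfolding joint_law_def by (subst distr_distr) (simp_all add: comp_def)
qed

text \<open>A linear functional of \<open>A v\<close> is again a combination of the independent
  standard components, with coefficients \<open>\<Sum>i<n. d i * A i j\<close>.\<close>

lemma complex_gaussian_vector_combination:
  assumes X: "complex_gaussian_vector M n X"
  shows "\<exists>q. circular_gaussian M (\<lambda>\<omega>. \<Sum>i<n. d i * X i \<omega>) q"
proof -
  have Xm [measurable]: "\<And>i. i < n \<Longrightarrow> X i \<in> borel_measurable M"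
    and "\<exists>m A. joint_law M n X =
      joint_law (\<Pi>\<^sub>M j\<in>{..<m::nat}. std_complex_gaussian) n (\<lambda>i v. \<Sum>j<m. A i j * v j)"
    using X unfolding complex_gaussian_vector_def by auto
  then obtain m A where law: "joint_law M n X =
      joint_law (\<Pi>\<^sub>M j\<in>{..<m::nat}. std_complex_gaussian) n (\<lambda>i v. \<Sum>j<m. A i j * v j)"
    by (elim exE)
  let ?h = "\<lambda>x::nat \<Rightarrow> complex. \<Sum>i<n. d i * x i"
  let ?e = "\<lambda>j. \<Sum>i<n. d i * A i j"
  have h: "?h \<in> borel_measurable (\<Pi>\<^sub>M i\<in>{..<n}. borel)"
    by (intro borel_measurable_sum borel_measurable_times borel_measurable_const measurable_component_singleton) simp
  have "distr M borel (\<lambda>\<omega>. ?h (\<lambda>i\<in>{..<n}. X i \<omega>)) = distr (joint_law M n X) borel ?h"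
    by (rule distr_joint_law[OF Xm h, symmetric])
  also have "\<dots> = distr (\<Pi>\<^sub>M j\<in>{..<m}. std_complex_gaussian) borel (\<lambda>v. ?h (\<lambda>i\<in>{..<n}. \<Sum>j<m. A i j * v j))"
    unfolding law
    by (rule distr_joint_law[OF circular_gaussian_measurable[OF circular_gaussian_std_combination] h])
  also have "(\<lambda>v. ?h (\<lambda>i\<in>{..<n}. \<Sum>j<m. A i j * v j)) = (\<lambda>v::nat \<Rightarrow> complex. \<Sum>j<m. ?e j * v j)"
  proof
    fix v :: "nat \<Rightarrow> complex"
    have "?h (\<lambda>i\<in>{..<n}. \<Sum>j<m. A i j * v j) = (\<Sum>i<n. \<Sum>j<m. d i * A i j * v j)"
      by (simp add: sum_distrib_left mult.assoc)
    also have "\<dots> = (\<Sum>j<m. \<Sum>i<n. d i * A i j * v j)" by (rule sum.swap)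
    finally show "?h (\<lambda>i\<in>{..<n}. \<Sum>j<m. A i j * v j) = (\<Sum>j<m. ?e j * v j)" by (simp add: sum_distrib_right)
  qed
  finally have "distr M borel (\<lambda>\<omega>. \<Sum>i<n. d i * X i \<omega>) =
      distr (\<Pi>\<^sub>M j\<in>{..<m}. std_complex_gaussian) borel (\<lambda>v. \<Sum>j<m. ?e j * v j)" by simp
  moreover note circular_gaussian_std_combination[where m=m and e="?e"]
  moreover have "(\<lambda>\<omega>. \<Sum>i<n. d i * X i \<omega>) \<in> borel_measurable M"
    by (intro borel_measurable_sum borel_measurable_times borel_measurable_const) simp
  ultimately show ?thesis unfolding circular_gaussian_def by auto
qed

lemma complex_gaussian_process_combination:
  assumes f: "complex_gaussian_process M f" and A: "finite A"
  shows "\<exists>q. circular_gaussian M (\<lambda>\<omega>. \<Sum>t\<in>A. c t * f t \<omega>) q"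
proof -
  obtain h where h: "bij_betw h {0..<card A} A" using ex_bij_betw_nat_finite[OF A] by blast
  have "(\<lambda>\<omega>. \<Sum>t\<in>A. c t * f t \<omega>) = (\<lambda>\<omega>. \<Sum>i<card A. c (h i) * f (h i) \<omega>)"
    using h by (auto simp: fun_eq_iff sum.reindex_bij_betw[OF h, symmetric] atLeast0LessThan)
  then show ?thesis
    using complex_gaussian_vector_combination[of M "card A" "\<lambda>i. f (h i)" "\<lambda>i. c (h i)"] f
    by (simp add: complex_gaussian_process_def)
qed

lemma complex_gaussian_process_measurable:
  "complex_gaussian_process M f \<Longrightarrow> f t \<in> borel_measurable M"
  unfolding complex_gaussian_process_def complex_gaussian_vector_def by (metis lessI)

lemma stationary_covariance:
  assumes f [measurable]: "\<And>t. f t \<in> borel_measurable M" and st: "stationary_process M f"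
  shows "(LINT \<omega>|M. f s \<omega> * cnj (f t \<omega>)) = covariance_kernel M f (s - t)"
proof -
  let ?t = "\<lambda>i::nat. if i = 0 then s - t else 0"
  let ?h = "\<lambda>x::nat \<Rightarrow> complex. x 0 * cnj (x 1)"
  have h: "?h \<in> borel_measurable (\<Pi>\<^sub>M i\<in>{..<2::nat}. borel)"
    by (intro borel_measurable_times borel_measurable_cnj measurable_component_singleton) simp_all
  \<comment> \<open>The two-point law at the times \<open>s - t\<close> and 0, shifted by
    \<open>t\<close>.\<close>
  have "joint_law M 2 (\<lambda>i. f (?t i + t)) = joint_law M 2 (\<lambda>i. f (?t i))"
    by (rule st[unfolded stationary_process_def, rule_format, of 2 ?t t])
  then have "distr M borel (\<lambda>\<omega>. ?h (\<lambda>i\<in>{..<2}. f (?t i + t) \<omega>)) = distr M borel (\<lambda>\<omega>. ?h (\<lambda>i\<in>{..<2}. f (?t i) \<omega>))"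
    using distr_joint_law[OF f h] by metis
  then have "distr M borel (\<lambda>\<omega>. f s \<omega> * cnj (f t \<omega>)) = distr M borel (\<lambda>\<omega>. f (s - t) \<omega> * cnj (f 0 \<omega>))" by simp
  then have "(LINT z|distr M borel (\<lambda>\<omega>. f s \<omega> * cnj (f t \<omega>)). z) = (LINT z|distr M borel (\<lambda>\<omega>. f (s - t) \<omega> * cnj (f 0 \<omega>)). z)"
    by (simp only:)
  then show ?thesis unfolding covariance_kernel_def by (simp add: integral_distr)
qed

text \<open>Where \<open>ln (1 + |l|) \<ge> 1\<close> its power \<open>1 + \<alpha>\<close>
  dominates both summands. Otherwise \<open>1 + |l|\<close> is at most the base of the natural
  logarithm, so \<open>|l| \<le> 2\<close>, and the product is at most
  \<open>4 * 2 = 8\<close>.\<close>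

lemma spectral_moment:
  assumes \<rho>: "real_distribution \<rho>" and \<alpha>: "\<alpha> > 0"
    and i: "integrable \<rho> (\<lambda>l. l\<^sup>2 * ln (1 + \<bar>l\<bar>) powr (1 + \<alpha>))"
  shows "integrable \<rho> (\<lambda>l. l\<^sup>2 * (1 + ln (1 + \<bar>l\<bar>)))"
proof -
  interpret real_distribution \<rho> by fact
  have le: "l\<^sup>2 * (1 + ln (1 + \<bar>l\<bar>)) \<le> 8 + 2 * (l\<^sup>2 * ln (1 + \<bar>l\<bar>) powr (1 + \<alpha>))" for l :: real
  proof (cases "ln (1 + \<bar>l\<bar>) \<ge> 1")
    case True
    have "ln (1 + \<bar>l\<bar>) powr 1 \<le> ln (1 + \<bar>l\<bar>) powr (1 + \<alpha>)" using True \<alpha> by (intro powr_mono) auto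
    then have "ln (1 + \<bar>l\<bar>) \<le> ln (1 + \<bar>l\<bar>) powr (1 + \<alpha>)" using True by simp
    with True have "1 + ln (1 + \<bar>l\<bar>) \<le> 2 * ln (1 + \<bar>l\<bar>) powr (1 + \<alpha>)" by linarith
    then have "l\<^sup>2 * (1 + ln (1 + \<bar>l\<bar>)) \<le> l\<^sup>2 * (2 * ln (1 + \<bar>l\<bar>) powr (1 + \<alpha>))" by (rule mult_left_mono) simp
    then show ?thesis by simp
  next
    case False
    then have "1 + \<bar>l\<bar> \<le> exp 1" by (metis abs_ge_zero add_pos_nonneg exp_le_cancel_iff exp_ln less_eq_real_def linorder_not_less zero_less_one)
    then have l: "\<bar>l\<bar> \<le> 2" using exp_le by linarith
    have "\<bar>l\<bar>\<^sup>2 \<le> 2\<^sup>2" using l by (intro power_mono) auto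
    then have "l\<^sup>2 \<le> 4" by simp
    moreover have "1 + ln (1 + \<bar>l\<bar>) \<le> 2" using False by simp
    ultimately have "l\<^sup>2 * (1 + ln (1 + \<bar>l\<bar>)) \<le> 4 * 2" by (intro mult_mono) auto
    moreover have "0 \<le> l\<^sup>2 * ln (1 + \<bar>l\<bar>) powr (1 + \<alpha>)" by simp
    ultimately show ?thesis by linarith
  qed
  show ?thesis
  proof (rule Bochner_Integration.integrable_bound)
    show "integrable \<rho> (\<lambda>l. 8 + 2 * (l\<^sup>2 * ln (1 + \<bar>l\<bar>) powr (1 + \<alpha>)))" using i by simp
    show "AE l in \<rho>. norm (l\<^sup>2 * (1 + ln (1 + \<bar>l\<bar>))) \<le> norm (8 + 2 * (l\<^sup>2 * ln (1 + \<bar>l\<bar>) powr (1 + \<alpha>)))"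
    proof (rule AE_I2)
      fix l :: real
      have "0 \<le> l\<^sup>2 * (1 + ln (1 + \<bar>l\<bar>))" by simp
      with le[of l] show "norm (l\<^sup>2 * (1 + ln (1 + \<bar>l\<bar>))) \<le> norm (8 + 2 * (l\<^sup>2 * ln (1 + \<bar>l\<bar>) powr (1 + \<alpha>)))"
        unfolding real_norm_def by linarith
    qed
  qed measurable
qed

theorem theorem1:
  fixes M :: "'a measure" and f :: "real \<Rightarrow> 'a \<Rightarrow> complex"
    and r :: "real \<Rightarrow> complex" and \<rho> :: "real measure" and \<alpha> T :: real
  assumes "prob_space M"
    and "complex_gaussian_process M f"
    and "stationary_process M f"
    and "AE \<omega> in M. continuous_on UNIV (\<lambda>t. f t \<omega>)"
    and "r = covariance_kernel M f"
    and "continuous_on UNIV r"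
    and "r 0 = 1"
    and "spectral_measure r \<rho>"
    and "\<not> degenerate \<rho>"
    and "\<alpha> > 0"
    and "integrable \<rho> (\<lambda>l. l\<^sup>2 * ln (1 + \<bar>l\<bar>) powr (1 + \<alpha>))"
    and "T > 0"
  shows "(integrable (completion M) (winding f T) \<and>
          prob_space.expectation (completion M) (winding f T) = T * Im (vector_derivative r (at 0))) \<and>
         ((\<forall>S. compact S \<longrightarrow> set_integrable lborel S (winding_kernel r)) \<and>
          integrable (completion M) (\<lambda>\<omega>. (winding f T \<omega>)\<^sup>2) \<and>
          prob_space.variance (completion M) (winding f T) =
            T * (LINT x:{-T..T}|lborel. (1 - \<bar>x\<bar> / T) * winding_kernel r x))"
proof -
  interpret prob_space M by fact
  have fm [measurable]: "f t \<in> borel_measurable M" for t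
    by (rule complex_gaussian_process_measurable[OF assms(2)])
  obtain N where N: "{\<omega> \<in> space M. \<not> continuous_on UNIV (\<lambda>t. f t \<omega>)} \<subseteq> N" "emeasure M N = 0" and Ns [measurable]: "N \<in> sets M"
    using AE_E[OF assms(4)] by blast
  \<comment> \<open>Setting the process to 0 on \<open>N\<close> and off the space makes every path
    continuous, while finite combinations and covariances change only on a null set.\<close>
  define f' where "f' t \<omega> = (if \<omega> \<in> space M - N then f t \<omega> else 0)" for t \<omega>
  have ae: "AE \<omega> in M. \<omega> \<in> space M - N"
    using N(2) Ns AE_space[of M] AE_not_in[of N M] by (auto simp: null_sets_def)
  have f'm [measurable]: "f' t \<in> borel_measurable M" for t
    unfolding f'_def by measurable
  have \<rho>: "real_distribution \<rho>" and r_eq: "r t = (LINT l|\<rho>. exp (- (\<i> * of_real t * of_real l)))" for t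
    using assms(8) by (auto simp: spectral_measure_def)
  interpret S: spectral \<rho> r
  proof (intro spectral.intro \<rho> spectral_axioms.intro)
    fix t
    show "r t = (LINT l|\<rho>. iexp (- (t * l)))" unfolding r_eq by (simp add: mult.assoc)
  qed (use spectral_moment[OF \<rho>] assms in auto)
  interpret F: stationary_gaussian M \<rho> r f'
  proof (intro stationary_gaussian.intro prob_space_axioms S.spectral_axioms stationary_gaussian_axioms.intro f'm)
    fix \<omega>
    show "continuous_on UNIV (\<lambda>t. f' t \<omega>)"
    proof (cases "\<omega> \<in> space M - N")
      case True
      then show ?thesis using N(1) by (auto simp: f'_def)
    qed (auto simp: f'_def)
  next
    fix A :: "real set" and c assume A: "finite A"
    obtain q where "circular_gaussian M (\<lambda>\<omega>. \<Sum>t\<in>A. c t * f t \<omega>) q"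
      using complex_gaussian_process_combination[OF assms(2) A] by blast
    then have "circular_gaussian M (\<lambda>\<omega>. \<Sum>t\<in>A. c t * f' t \<omega>) q"
    proof (rule circular_gaussian_cong_AE)
      show "AE \<omega> in M. (\<Sum>t\<in>A. c t * f t \<omega>) = (\<Sum>t\<in>A. c t * f' t \<omega>)"
        using ae by eventually_elim (simp add: f'_def)
    qed measurable
    then show "\<exists>q. circular_gaussian M (\<lambda>\<omega>. \<Sum>t\<in>A. c t * f' t \<omega>) q" by blast
  next
    fix s t
    have "(LINT \<omega>|M. f' s \<omega> * cnj (f' t \<omega>)) = (LINT \<omega>|M. f s \<omega> * cnj (f t \<omega>))"
    proof (rule integral_cong_AE)
      show "AE \<omega> in M. f' s \<omega> * cnj (f' t \<omega>) = f s \<omega> * cnj (f t \<omega>)"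
        using ae by eventually_elim (simp add: f'_def)
    qed measurable
    then show "(LINT \<omega>|M. f' s \<omega> * cnj (f' t \<omega>)) = r (s - t)"
      unfolding assms(5) stationary_covariance[OF fm assms(3)] .
  qed
  \<comment> \<open>The value of \<open>winding\<close> at \<omega> reads only the path of \<omega>,
    so it is unchanged off \<open>N\<close>.\<close>
  have "AE \<omega> in M. winding f T \<omega> = winding f' T \<omega>"
    using ae by eventually_elim (simp add: winding_def f'_def)
  note W = F.winding_moments[OF assms(12) this]
  show ?thesis
    unfolding W(2) S.vector_derivative_r using W F.winding_kernel_integrable by simp
qed

end
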